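(* Let $(H,\mathcal R)$ be a quasitriangular Hopf algebra with twist $\mathcal F\in H\otimes H$, let $A$ be a left $H$-module algebra and $V,W$ quasi-commutative left $H$-module $A$-bimodules. Let further $(\Omega^\bullet,\wedge,\mathrm d)$ be a graded quasi-commutative left $H$-covariant differential calculus over $A$ with $\Omega=\Omega^1$, $\nabla_V\in\mathrm{Con}_A(V)$ and $\nabla_W\in\mathrm{Con}_A(W)$. Then, as maps $V_\star\otimes_{A_\star}W_\star\to(V\otimes_AW\otimes_A\Omega)_\star$, $$\varphi_{V,W,\Omega}\circ\bigl(\widetilde D_{\mathcal F}(\nabla_V)\oplus_{\mathcal R^{\mathcal F}}\widetilde D_{\mathcal F}(\nabla_W)\bigr)=D_{\mathcal F}(\nabla_V\oplus_{\mathcal R}\nabla_W)\circ\varphi_{V,W}.$$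
   Context: $\mathbb K$ is a commutative ring with unit; modules, algebras (associative, unital) and unadorned tensor products are over $\mathbb K$. For a Hopf algebra $H$ with coproduct $\Delta$, counit $\varepsilon$, antipode $S$, write $\Delta(\xi)=\xi_1\otimes\xi_2$ (sum understood). A quasitriangular Hopf algebra $(H,\mathcal R)$ is a Hopf algebra with an invertible $\mathcal R=R^\alpha\otimes R_\alpha\in H\otimes H$ satisfying $\xi_2\otimes\xi_1=\mathcal R\,\Delta(\xi)\,\mathcal R^{-1}$, $(\Delta\otimes\mathrm{id})\mathcal R=\mathcal R_{13}\mathcal R_{23}$, $(\mathrm{id}\otimes\Delta)\mathcal R=\mathcal R_{13}\mathcal R_{12}$; write $\mathcal R^{-1}=\bar R^\alpha\otimes\bar R_\alpha$. A left $H$-module algebra is an algebra $A$ with left $H$-action satisfying $\xi\triangleright(ab)=(\xi_1\triangleright a)(\xi_2\triangleright b)$, $\xi\triangleright1=\varepsilon(\xi)1$. A left $H$-module $A$-bimodule is an $A$-bimodule $V$ with left $H$-action satisfying $\xi\triangleright(a\cdot v)=(\xi_1\triangleright a)\cdot(\xi_2\triangleright v)$, $\xi\triangleright(v\cdot a)=(\xi_1\triangleright v)\cdot(\xi_2\triangleright a)$; it is quasi-commutative if $v\cdot a=(\bar R^\alpha\triangleright a)\cdot(\bar R_\alpha\triangleright v)$ for all $a\in A$, $v\in V$. Tensor products (over $\mathbb K$ or $A$) carry the $H$-action $\xi\triangleright(v\otimes w)=(\xi_1\triangleright v)\otimes(\xi_2\triangleright w)$. A differential calculus over $A$ is a graded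 algebra $(\Omega^\bullet=\bigoplus_{n\ge0}\Omega^n,\wedge)$ with $\Omega^0=A$ and $\mathbb K$-linear maps $\mathrm d:\Omega^n\to\Omega^{n+1}$ with $\mathrm d\circ\mathrm d=0$ and $\mathrm d(\theta\wedge\theta')=(\mathrm d\theta)\wedge\theta'+(-1)^{\deg\theta}\theta\wedge\mathrm d\theta'$, such that every $\theta\in\Omega:=\Omega^1$ is of the form $\sum_ia_i\,\mathrm db_i$ with $a_i,b_i\in A$. It is left $H$-covariant if $A$ and $\Omega^\bullet$ are left $H$-module algebras, the $H$-action preserves degree, and $\xi\triangleright\mathrm d\theta=\mathrm d(\xi\triangleright\theta)$. It is graded quasi-commutative if $\theta\wedge\theta'=(-1)^{\deg\theta\deg\theta'}(\bar R^\alpha\triangleright\theta')\wedge(\bar R_\alpha\triangleright\theta)$ for all homogeneous $\theta,\theta'\in\Omega^\bullet$ (including degree $0$). A (right) connection on $V$ is a $\mathbb K$-linear map $\nabla:V\to V\otimes_A\Omega$ with $\nabla(v\cdot a)=(\nabla v)\cdot a+v\otimes_A\mathrm da$; $\mathrm{Con}_A(V)$ is the set of these. For linear maps between left $H$-modules, $\xi\blacktriangleright P:=\xi_1\triangleright\circ P\circ S(\xi_2)\triangleright$. The sum of connections $\nabla_V\oplus_{\mathcal R}\nabla_W\in\mathrm{Con}_A(V\otimes_AW)$ is the (well defined) map $$(\nabla_V\oplus_{\mathcal R}\nabla_W)(v\otimes_Aw)=\tau^{-1}_{\mathcal R\,23}\bigl(\nabla_V(v)\otimes_Aw\bigr)+(\bar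 R^\alpha\triangleright v)\otimes_A(\bar R_\alpha\blacktriangleright\nabla_W)(w),$$ where $\tau^{-1}_{\mathcal R\,23}:V\otimes_A\Omega\otimes_AW\to V\otimes_AW\otimes_A\Omega$, $v\otimes_A\theta\otimes_Aw\mapsto v\otimes_A(R_\alpha\triangleright w)\otimes_A(R^\alpha\triangleright\theta)$. A twist of $H$ is an invertible $\mathcal F\in H\otimes H$ with $(\mathcal F\otimes 1)(\Delta\otimes\mathrm{id})\mathcal F=(1\otimes\mathcal F)(\mathrm{id}\otimes\Delta)\mathcal F$ and $(\varepsilon\otimes\mathrm{id})\mathcal F=1=(\mathrm{id}\otimes\varepsilon)\mathcal F$. Write $\mathcal F=f^\alpha\otimes f_\alpha$, $\mathcal F^{-1}=\bar f^\alpha\otimes\bar f_\alpha$. $H^{\mathcal F}$ is the Hopf algebra with the same algebra structure and counit as $H$, coproduct $\Delta^{\mathcal F}(\xi)=\mathcal F\Delta(\xi)\mathcal F^{-1}=\xi_{1_{\mathcal F}}\otimes\xi_{2_{\mathcal F}}$, antipode $S^{\mathcal F}(\xi)=\chi S(\xi)\chi^{-1}$, $\chi=f^\alpha S(f_\alpha)$; it is quasitriangular with $\mathcal R^{\mathcal F}=\mathcal F_{21}\mathcal R\mathcal F^{-1}$. $A_\star$ is the left $H^{\mathcal F}$-module algebra equal to $A$ as an $H$-module with product $a\star b=(\bar f^\alpha\triangleright a)(\bar f_\alpha\triangleright b)$; $V_\star$ is the left $H^{\mathcal F}$-module $A_\star$-bimodule equal to $V$ as an $H$-module with $a\star v=(\bar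 f^\alpha\triangleright a)\cdot(\bar f_\alpha\triangleright v)$, $v\star a=(\bar f^\alpha\triangleright v)\cdot(\bar f_\alpha\triangleright a)$; $(\Omega^\bullet_\star,\wedge_\star,\mathrm d)$, $\theta\wedge_\star\theta'=(\bar f^\alpha\triangleright\theta)\wedge(\bar f_\alpha\triangleright\theta')$, is a left $H^{\mathcal F}$-covariant calculus over $A_\star$. Tensor products over $A_\star$ carry the $H^{\mathcal F}$-action through $\Delta^{\mathcal F}$. The isomorphism $\varphi_{V,W}:V_\star\otimes_{A_\star}W_\star\to(V\otimes_AW)_\star$ is $v\otimes_{A_\star}w\mapsto(\bar f^\alpha\triangleright v)\otimes_A(\bar f_\alpha\triangleright w)$, and $\varphi_{V,W,\Omega}:=\varphi_{V\otimes_AW,\Omega}\circ(\varphi_{V,W}\otimes\mathrm{id}_{\Omega_\star}):V_\star\otimes_{A_\star}W_\star\otimes_{A_\star}\Omega_\star\to(V\otimes_AW\otimes_A\Omega)_\star$. For a linear map $P$ between left $H$-modules, $D_{\mathcal F}(P):=(\bar f^\alpha\blacktriangleright P)\circ\bar f_\alpha\triangleright$, regarded as a map between the corresponding $\star$-modules. For $\nabla\in\mathrm{Con}_A(V)$, $\widetilde D_{\mathcal F}(\nabla):=\varphi_{V,\Omega}^{-1}\circ D_{\mathcal F}(\nabla)\in\mathrm{Con}_{A_\star}(V_\star)$ (connections with respect to $\Omega_\star$). The symbol $\oplus_{\mathcal R^{\mathcal F}}$ is the sum of connections for the data $(H^{\mathcal F},\mathcal R^{\mathcal F},A_\star,V_\star,W_\star,\Omega_\star)$,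 which are again quasi-commutative, i.e. with $\mathcal R^{\mathcal F}$ in place of $\mathcal R$ and with $\xi\blacktriangleright_{\mathcal F}P:=\xi_{1_{\mathcal F}}\triangleright\circ P\circ S^{\mathcal F}(\xi_{2_{\mathcal F}})\triangleright$ in place of $\blacktriangleright$. *)

theory Defs
  imports "HOL-Algebra.Module" "HOL-Algebra.Free_Abelian_Groups"
begin

section \<open>Records\<close>

text \<open>
  All structures extend the record \<open>module\<close> of \<open>HOL-Algebra\<close>.  That record contains the
  multiplicative fields of a ring; they carry information for algebras and for the Hopf algebra,
  and are meaningless for modules and bimodules.
\<close>

type_synonym ('v, 'w) tens = "('v \<times> 'w \<Rightarrow>\<^sub>0 int) set"

record ('k, 'h) hopf = "('k, 'h) module" +
  comult :: "'h \<Rightarrow> ('h, 'h) tens"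
  counit :: "'h \<Rightarrow> 'k"
  antipode :: "'h \<Rightarrow> 'h"

record ('k, 'v, 'h) hmod = "('k, 'v) module" +
  hact :: "'h \<Rightarrow> 'v \<Rightarrow> 'v"

record ('k, 'v, 'h, 'a) hbimod = "('k, 'v, 'h) hmod" +
  lact :: "'a \<Rightarrow> 'v \<Rightarrow> 'v"
  ract :: "'v \<Rightarrow> 'a \<Rightarrow> 'v"

record ('k, 'e, 'h) calc = "('k, 'e, 'h) hmod" +
  gr :: "nat \<Rightarrow> 'e set"
  diff :: "'e \<Rightarrow> 'e"

section \<open>Linear maps and algebras\<close>

definition klinear ::
    "('k, 'r) ring_scheme \<Rightarrow> ('k, 'v, 'm) module_scheme \<Rightarrow> ('k, 'w, 'n) module_scheme
      \<Rightarrow> ('v \<Rightarrow> 'w) \<Rightarrow> bool" where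
  "klinear K M N f \<longleftrightarrow>
     f \<in> carrier M \<rightarrow> carrier N \<and>
     (\<forall>x\<in>carrier M. \<forall>y\<in>carrier M. f (x \<oplus>\<^bsub>M\<^esub> y) = f x \<oplus>\<^bsub>N\<^esub> f y) \<and>
     (\<forall>k\<in>carrier K. \<forall>x\<in>carrier M. f (k \<odot>\<^bsub>M\<^esub> x) = k \<odot>\<^bsub>N\<^esub> f x)"

definition kbilinear ::
    "('k, 'r) ring_scheme \<Rightarrow> ('k, 'u, 'l) module_scheme \<Rightarrow> ('k, 'v, 'm) module_scheme
      \<Rightarrow> ('k, 'w, 'n) module_scheme \<Rightarrow> ('u \<Rightarrow> 'v \<Rightarrow> 'w) \<Rightarrow> bool" where
  "kbilinear K L M N b \<longleftrightarrow>
     (\<forall>x\<in>carrier L. klinear K M N (b x)) \<and>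
     (\<forall>y\<in>carrier M. klinear K L N (\<lambda>x. b x y))"

text \<open>The locale \<open>algebra\<close> of \<open>HOL-Algebra\<close> is restricted to commutative algebras.\<close>

definition assoc_algebra :: "('k, 'r) ring_scheme \<Rightarrow> ('k, 'a, 'm) module_scheme \<Rightarrow> bool" where
  "assoc_algebra K A \<longleftrightarrow> module K A \<and> ring A \<and> kbilinear K A A A (\<lambda>a b. a \<otimes>\<^bsub>A\<^esub> b)"

section \<open>Tensor products\<close>

text \<open>
  \<open>V \<otimes>\<^sub>S W\<close> is the free abelian group on \<open>V \<times> W\<close> modulo biadditivity and the balancing relations
  \<open>(v s, w) = (v, s w)\<close>; its elements are cosets.  The set \<open>S\<close> and the two actions are
  parameters, so that tensor products over \<open>K\<close> and over \<open>A\<close> are both instances.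
\<close>

definition tensor_rels ::
    "'s set \<Rightarrow> ('v \<Rightarrow> 's \<Rightarrow> 'v) \<Rightarrow> ('s \<Rightarrow> 'w \<Rightarrow> 'w) \<Rightarrow> ('v, 'm) ring_scheme
      \<Rightarrow> ('w, 'n) ring_scheme \<Rightarrow> ('v \<times> 'w \<Rightarrow>\<^sub>0 int) set" where
  "tensor_rels S r l V W =
     {frag_of (v \<oplus>\<^bsub>V\<^esub> v', w) - frag_of (v, w) - frag_of (v', w) | v v' w.
        v \<in> carrier V \<and> v' \<in> carrier V \<and> w \<in> carrier W}
   \<union> {frag_of (v, w \<oplus>\<^bsub>W\<^esub> w') - frag_of (v, w) - frag_of (v, w') | v w w'.
        v \<in> carrier V \<and> w \<in> carrier W \<and> w' \<in> carrier W}
   \<union> {frag_of (r v s, w) - frag_of (v, l s w) | v s w.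
        v \<in> carrier V \<and> s \<in> S \<and> w \<in> carrier W}"

definition tensor_group ::
    "'s set \<Rightarrow> ('v \<Rightarrow> 's \<Rightarrow> 'v) \<Rightarrow> ('s \<Rightarrow> 'w \<Rightarrow> 'w) \<Rightarrow> ('v, 'm) ring_scheme
      \<Rightarrow> ('w, 'n) ring_scheme \<Rightarrow> ('v, 'w) tens ring" where
  "tensor_group S r l V W =
     (let G = free_Abelian_group (carrier V \<times> carrier W);
          Q = G Mod generate G (tensor_rels S r l V W)
      in \<lparr>carrier = carrier Q, monoid.mult = undefined, monoid.one = undefined,
          ring.zero = \<one>\<^bsub>Q\<^esub>, ring.add = monoid.mult Q\<rparr>)"

text \<open>
  \<open>v \<boxtimes>\<^bsub>T\<^esub> w\<close> is the class of \<open>(v, w)\<close> in the tensor product \<open>T\<close>; the subgroup of relations is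
  recovered as the zero element of \<open>T\<close>.
\<close>

definition ptens :: "(('v, 'w) tens, 'm) ring_scheme \<Rightarrow> 'v \<Rightarrow> 'w \<Rightarrow> ('v, 'w) tens"
    (infixl \<open>\<boxtimes>\<index>\<close> 75) where
  "v \<boxtimes>\<^bsub>T\<^esub> w = \<zero>\<^bsub>T\<^esub> #>\<^bsub>free_Abelian_group UNIV\<^esub> frag_of (v, w)"

text \<open>
  \<open>tlift Z f X\<close> is the sum of the \<open>f (v, w)\<close> in \<open>Z\<close> if \<open>X\<close> is a sum of pure tensors \<open>v \<otimes> w\<close>, that is,
  the value at \<open>X\<close> of the additive map induced by \<open>f\<close>.  It is computed on some representative of
  the coset \<open>X\<close>, and does not depend on the representative if \<open>f\<close> is a balanced biadditive map
  into the abelian group \<open>Z\<close>.  With \<open>X\<close> equal to \<open>\<Delta>(\<xi>)\<close>, \<open>\<R>\<close> or \<open>\<F>\<close> it renders the Sweedler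
  type sums over \<open>\<xi>\<^sub>1 \<otimes> \<xi>\<^sub>2\<close>, \<open>R\<^sup>\<alpha> \<otimes> R\<^sub>\<alpha>\<close> and \<open>f\<^sup>\<alpha> \<otimes> f\<^sub>\<alpha>\<close>.  In nested uses the inner sum is
  always the one that is balanced when the variables of the outer sum are fixed.
\<close>

definition tlift :: "('z, 'm) ring_scheme \<Rightarrow> ('v \<times> 'w \<Rightarrow> 'z) \<Rightarrow> ('v, 'w) tens \<Rightarrow> 'z" where
  "tlift Z f X =
     (let c = (SOME c. c \<in> X)
      in \<Oplus>\<^bsub>Z\<^esub>p\<in>Poly_Mapping.keys c. [Poly_Mapping.lookup c p] \<cdot>\<^bsub>Z\<^esub> f p)"

definition tmap ::
    "(('v', 'w') tens, 'm) ring_scheme \<Rightarrow> ('v \<Rightarrow> 'v') \<Rightarrow> ('w \<Rightarrow> 'w')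
      \<Rightarrow> ('v, 'w) tens \<Rightarrow> ('v', 'w') tens" where
  "tmap T f g = tlift T (\<lambda>(v, w). f v \<boxtimes>\<^bsub>T\<^esub> g w)"

text \<open>The canonical map \<open>X \<otimes> (Y \<otimes> Z) \<rightarrow> (X \<otimes> Y) \<otimes> Z\<close>, where \<open>XY = X \<otimes> Y\<close> and \<open>T = (X \<otimes> Y) \<otimes> Z\<close>.\<close>

definition tassoc ::
    "((('x, 'y) tens, 'z) tens, 'm) ring_scheme \<Rightarrow> (('x, 'y) tens, 'n) ring_scheme
      \<Rightarrow> ('x, ('y, 'z) tens) tens \<Rightarrow> (('x, 'y) tens, 'z) tens" where
  "tassoc T XY = tlift T (\<lambda>(x, q). tlift T (\<lambda>(y, z). (x \<boxtimes>\<^bsub>XY\<^esub> y) \<boxtimes>\<^bsub>T\<^esub> z) q)"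

definition talg ::
    "('k, 'r) ring_scheme \<Rightarrow> ('k, 'a, 'm) module_scheme \<Rightarrow> ('k, 'b, 'n) module_scheme
      \<Rightarrow> ('k, ('a, 'b) tens) module" where
  "talg K A B =
     (let T = tensor_group (carrier K) (\<lambda>a k. k \<odot>\<^bsub>A\<^esub> a) (\<lambda>k b. k \<odot>\<^bsub>B\<^esub> b) A B
      in \<lparr>carrier = carrier T,
          monoid.mult = (\<lambda>X Y. tlift T (\<lambda>(a, b).
             tlift T (\<lambda>(a', b'). (a \<otimes>\<^bsub>A\<^esub> a') \<boxtimes>\<^bsub>T\<^esub> (b \<otimes>\<^bsub>B\<^esub> b')) Y) X),
          monoid.one = \<one>\<^bsub>A\<^esub> \<boxtimes>\<^bsub>T\<^esub> \<one>\<^bsub>B\<^esub>,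
          ring.zero = \<zero>\<^bsub>T\<^esub>, ring.add = (\<lambda>X Y. X \<oplus>\<^bsub>T\<^esub> Y),
          smult = (\<lambda>k. tmap T (\<lambda>a. k \<odot>\<^bsub>A\<^esub> a) id)\<rparr>)"

text \<open>
  The bimodule \<open>V \<otimes>\<^sub>A W\<close>.  The bimodules below are unital and \<open>K\<close>-bilinear over the \<open>K\<close>-algebra \<open>A\<close>,
  so balancing over \<open>A\<close> implies balancing over \<open>K\<close>.
\<close>

definition btensor ::
    "('k, 'h) hopf \<Rightarrow> ('k, 'a, 'h) hmod \<Rightarrow> ('k, 'v, 'h, 'a) hbimod \<Rightarrow> ('k, 'w, 'h, 'a) hbimod
      \<Rightarrow> ('k, ('v, 'w) tens, 'h, 'a) hbimod" where
  "btensor H A V W =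
     (let T = tensor_group (carrier A) (ract V) (lact W) V W
      in \<lparr>carrier = carrier T, monoid.mult = undefined, monoid.one = undefined,
          ring.zero = \<zero>\<^bsub>T\<^esub>, ring.add = (\<lambda>X Y. X \<oplus>\<^bsub>T\<^esub> Y),
          smult = (\<lambda>k. tmap T (\<lambda>v. k \<odot>\<^bsub>V\<^esub> v) id),
          hact = (\<lambda>\<xi>. tlift T (\<lambda>(v, w).
             tlift T (\<lambda>(x, y). hact V x v \<boxtimes>\<^bsub>T\<^esub> hact W y w) (comult H \<xi>))),
          lact = (\<lambda>a. tmap T (lact V a) id),
          ract = (\<lambda>X a. tmap T id (\<lambda>w. ract W w a) X)\<rparr>)"

section \<open>Quasitriangular Hopf algebras and twists\<close>

abbreviation HH :: "('k, 'r) ring_scheme \<Rightarrow> ('k, 'h) hopf \<Rightarrow> ('k, ('h, 'h) tens) module" where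
  "HH K H \<equiv> talg K H H"

abbreviation HHH ::
    "('k, 'r) ring_scheme \<Rightarrow> ('k, 'h) hopf \<Rightarrow> ('k, (('h, 'h) tens, 'h) tens) module" where
  "HHH K H \<equiv> talg K (HH K H) H"

abbreviation H_HH ::
    "('k, 'r) ring_scheme \<Rightarrow> ('k, 'h) hopf \<Rightarrow> ('k, ('h, ('h, 'h) tens) tens) module" where
  "H_HH K H \<equiv> talg K H (HH K H)"

definition comult_id ::
    "('k, 'r) ring_scheme \<Rightarrow> ('k, 'h) hopf \<Rightarrow> ('h, 'h) tens \<Rightarrow> (('h, 'h) tens, 'h) tens" where
  "comult_id K H = tmap (HHH K H) (comult H) id"

definition id_comult ::
    "('k, 'r) ring_scheme \<Rightarrow> ('k, 'h) hopf \<Rightarrow> ('h, 'h) tens \<Rightarrow> (('h, 'h) tens, 'h) tens" where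
  "id_comult K H X = tassoc (HHH K H) (HH K H) (tmap (H_HH K H) id (comult H) X)"

definition leg12 ::
    "('k, 'r) ring_scheme \<Rightarrow> ('k, 'h) hopf \<Rightarrow> ('h, 'h) tens \<Rightarrow> (('h, 'h) tens, 'h) tens" where
  "leg12 K H X = X \<boxtimes>\<^bsub>HHH K H\<^esub> \<one>\<^bsub>H\<^esub>"

definition leg23 ::
    "('k, 'r) ring_scheme \<Rightarrow> ('k, 'h) hopf \<Rightarrow> ('h, 'h) tens \<Rightarrow> (('h, 'h) tens, 'h) tens" where
  "leg23 K H X = tassoc (HHH K H) (HH K H) (\<one>\<^bsub>H\<^esub> \<boxtimes>\<^bsub>H_HH K H\<^esub> X)"

definition leg13 ::
    "('k, 'r) ring_scheme \<Rightarrow> ('k, 'h) hopf \<Rightarrow> ('h, 'h) tens \<Rightarrow> (('h, 'h) tens, 'h) tens" where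
  "leg13 K H = tmap (HHH K H) (\<lambda>x. x \<boxtimes>\<^bsub>HH K H\<^esub> \<one>\<^bsub>H\<^esub>) id"

definition flip ::
    "('k, 'r) ring_scheme \<Rightarrow> ('k, 'h) hopf \<Rightarrow> ('h, 'h) tens \<Rightarrow> ('h, 'h) tens" where
  "flip K H = tlift (HH K H) (\<lambda>(x, y). y \<boxtimes>\<^bsub>HH K H\<^esub> x)"

definition hopf_algebra :: "('k, 'r) ring_scheme \<Rightarrow> ('k, 'h) hopf \<Rightarrow> bool" where
  "hopf_algebra K H \<longleftrightarrow>
     assoc_algebra K H \<and>
     comult H \<in> ring_hom H (HH K H) \<and> klinear K H (HH K H) (comult H) \<and>
     counit H \<in> ring_hom H K \<and>
     (\<forall>k\<in>carrier K. \<forall>\<xi>\<in>carrier H. counit H (k \<odot>\<^bsub>H\<^esub> \<xi>) = k \<otimes>\<^bsub>K\<^esub> counit H \<xi>) \<and>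
     klinear K H H (antipode H) \<and>
     (\<forall>\<xi>\<in>carrier H. comult_id K H (comult H \<xi>) = id_comult K H (comult H \<xi>)) \<and>
     (\<forall>\<xi>\<in>carrier H. tlift H (\<lambda>(x, y). counit H x \<odot>\<^bsub>H\<^esub> y) (comult H \<xi>) = \<xi>) \<and>
     (\<forall>\<xi>\<in>carrier H. tlift H (\<lambda>(x, y). counit H y \<odot>\<^bsub>H\<^esub> x) (comult H \<xi>) = \<xi>) \<and>
     (\<forall>\<xi>\<in>carrier H. tlift H (\<lambda>(x, y). antipode H x \<otimes>\<^bsub>H\<^esub> y) (comult H \<xi>)
        = counit H \<xi> \<odot>\<^bsub>H\<^esub> \<one>\<^bsub>H\<^esub>) \<and>
     (\<forall>\<xi>\<in>carrier H. tlift H (\<lambda>(x, y). x \<otimes>\<^bsub>H\<^esub> antipode H y) (comult H \<xi>)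
        = counit H \<xi> \<odot>\<^bsub>H\<^esub> \<one>\<^bsub>H\<^esub>)"

definition quasitriangular ::
    "('k, 'r) ring_scheme \<Rightarrow> ('k, 'h) hopf \<Rightarrow> ('h, 'h) tens \<Rightarrow> bool" where
  "quasitriangular K H R \<longleftrightarrow>
     hopf_algebra K H \<and>
     R \<in> Units (HH K H) \<and>
     (\<forall>\<xi>\<in>carrier H. flip K H (comult H \<xi>)
        = R \<otimes>\<^bsub>HH K H\<^esub> comult H \<xi> \<otimes>\<^bsub>HH K H\<^esub> inv\<^bsub>HH K H\<^esub> R) \<and>
     comult_id K H R = leg13 K H R \<otimes>\<^bsub>HHH K H\<^esub> leg23 K H R \<and>
     id_comult K H R = leg13 K H R \<otimes>\<^bsub>HHH K H\<^esub> leg12 K H R"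

definition twist :: "('k, 'r) ring_scheme \<Rightarrow> ('k, 'h) hopf \<Rightarrow> ('h, 'h) tens \<Rightarrow> bool" where
  "twist K H F \<longleftrightarrow>
     F \<in> Units (HH K H) \<and>
     leg12 K H F \<otimes>\<^bsub>HHH K H\<^esub> comult_id K H F = leg23 K H F \<otimes>\<^bsub>HHH K H\<^esub> id_comult K H F \<and>
     tlift H (\<lambda>(x, y). counit H x \<odot>\<^bsub>H\<^esub> y) F = \<one>\<^bsub>H\<^esub> \<and>
     tlift H (\<lambda>(x, y). counit H y \<odot>\<^bsub>H\<^esub> x) F = \<one>\<^bsub>H\<^esub>"

section \<open>Module algebras, bimodules, calculi, connections\<close>

definition left_H_module ::
    "('k, 'r) ring_scheme \<Rightarrow> ('k, 'h) hopf \<Rightarrow> ('k, 'v, 'h, 'm) hmod_scheme \<Rightarrow> bool" where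
  "left_H_module K H V \<longleftrightarrow>
     module K V \<and> kbilinear K H V V (hact V) \<and>
     (\<forall>\<xi>\<in>carrier H. \<forall>\<eta>\<in>carrier H. \<forall>v\<in>carrier V.
        hact V (\<xi> \<otimes>\<^bsub>H\<^esub> \<eta>) v = hact V \<xi> (hact V \<eta> v)) \<and>
     (\<forall>v\<in>carrier V. hact V \<one>\<^bsub>H\<^esub> v = v)"

definition H_module_algebra ::
    "('k, 'r) ring_scheme \<Rightarrow> ('k, 'h) hopf \<Rightarrow> ('k, 'a, 'h, 'm) hmod_scheme \<Rightarrow> bool" where
  "H_module_algebra K H A \<longleftrightarrow>
     assoc_algebra K A \<and> left_H_module K H A \<and>
     (\<forall>\<xi>\<in>carrier H. \<forall>a\<in>carrier A. \<forall>b\<in>carrier A.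
        hact A \<xi> (a \<otimes>\<^bsub>A\<^esub> b)
          = tlift A (\<lambda>(x, y). hact A x a \<otimes>\<^bsub>A\<^esub> hact A y b) (comult H \<xi>)) \<and>
     (\<forall>\<xi>\<in>carrier H. hact A \<xi> \<one>\<^bsub>A\<^esub> = counit H \<xi> \<odot>\<^bsub>A\<^esub> \<one>\<^bsub>A\<^esub>)"

definition H_module_bimodule ::
    "('k, 'r) ring_scheme \<Rightarrow> ('k, 'h) hopf \<Rightarrow> ('k, 'a, 'h) hmod \<Rightarrow> ('k, 'v, 'h, 'a) hbimod
      \<Rightarrow> bool" where
  "H_module_bimodule K H A V \<longleftrightarrow>
     left_H_module K H V \<and>
     kbilinear K A V V (lact V) \<and> kbilinear K V A V (ract V) \<and>
     (\<forall>v\<in>carrier V. lact V \<one>\<^bsub>A\<^esub> v = v \<and> ract V v \<one>\<^bsub>A\<^esub> = v) \<and>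
     (\<forall>a\<in>carrier A. \<forall>b\<in>carrier A. \<forall>v\<in>carrier V.
        lact V (a \<otimes>\<^bsub>A\<^esub> b) v = lact V a (lact V b v) \<and>
        ract V v (a \<otimes>\<^bsub>A\<^esub> b) = ract V (ract V v a) b \<and>
        ract V (lact V a v) b = lact V a (ract V v b)) \<and>
     (\<forall>\<xi>\<in>carrier H. \<forall>a\<in>carrier A. \<forall>v\<in>carrier V.
        hact V \<xi> (lact V a v)
          = tlift V (\<lambda>(x, y). lact V (hact A x a) (hact V y v)) (comult H \<xi>) \<and>
        hact V \<xi> (ract V v a)
          = tlift V (\<lambda>(x, y). ract V (hact V x v) (hact A y a)) (comult H \<xi>))"

definition quasi_commutative ::
    "('k, 'r) ring_scheme \<Rightarrow> ('k, 'h) hopf \<Rightarrow> ('h, 'h) tens \<Rightarrow> ('k, 'a, 'h) hmod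
      \<Rightarrow> ('k, 'v, 'h, 'a) hbimod \<Rightarrow> bool" where
  "quasi_commutative K H R A V \<longleftrightarrow>
     (\<forall>a\<in>carrier A. \<forall>v\<in>carrier V.
        ract V v a = tlift V (\<lambda>(x, y). lact V (hact A x a) (hact V y v)) (inv\<^bsub>HH K H\<^esub> R))"

definition graded_algebra :: "('k, 'r) ring_scheme \<Rightarrow> ('k, 'e, 'h) calc \<Rightarrow> bool" where
  "graded_algebra K E \<longleftrightarrow>
     assoc_algebra K E \<and>
     (\<forall>n. submodule (gr E n) K E) \<and>
     (\<forall>\<theta>\<in>carrier E. \<exists>!c. (\<forall>n. c n \<in> gr E n) \<and> finite {n. c n \<noteq> \<zero>\<^bsub>E\<^esub>} \<and>
        \<theta> = (\<Oplus>\<^bsub>E\<^esub>n\<in>{n. c n \<noteq> \<zero>\<^bsub>E\<^esub>}. c n)) \<and>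
     \<one>\<^bsub>E\<^esub> \<in> gr E 0 \<and>
     (\<forall>m n. \<forall>\<theta>\<in>gr E m. \<forall>\<theta>'\<in>gr E n. \<theta> \<otimes>\<^bsub>E\<^esub> \<theta>' \<in> gr E (m + n))"

text \<open>The equation \<open>\<Omega>\<^sup>0 = A\<close> is literal, so \<open>A\<close> and \<open>\<Omega>\<^sup>\<bullet>\<close> have the same type of elements.\<close>

definition is_degree_zero ::
    "('k, 'r) ring_scheme \<Rightarrow> ('k, 'e, 'h) hmod \<Rightarrow> ('k, 'e, 'h) calc \<Rightarrow> bool" where
  "is_degree_zero K A E \<longleftrightarrow>
     carrier A = gr E 0 \<and> \<one>\<^bsub>A\<^esub> = \<one>\<^bsub>E\<^esub> \<and> \<zero>\<^bsub>A\<^esub> = \<zero>\<^bsub>E\<^esub> \<and>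
     (\<forall>a\<in>carrier A. \<forall>b\<in>carrier A.
        a \<otimes>\<^bsub>A\<^esub> b = a \<otimes>\<^bsub>E\<^esub> b \<and> a \<oplus>\<^bsub>A\<^esub> b = a \<oplus>\<^bsub>E\<^esub> b) \<and>
     (\<forall>k\<in>carrier K. \<forall>a\<in>carrier A. k \<odot>\<^bsub>A\<^esub> a = k \<odot>\<^bsub>E\<^esub> a)"

definition sign :: "('k, 'r) ring_scheme \<Rightarrow> nat \<Rightarrow> 'k" where
  "sign K n = (\<ominus>\<^bsub>K\<^esub> \<one>\<^bsub>K\<^esub>) [^]\<^bsub>K\<^esub> n"

text \<open>
  \<open>\<Omega>\<^sup>\<bullet>\<close> is the internal direct sum of the \<open>\<Omega>\<^sup>n = gr E n\<close> in \<open>E\<close>, with wedge product the product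
  of \<open>E\<close>; the maps \<open>d : \<Omega>\<^sup>n \<rightarrow> \<Omega>\<^sup>n\<^sup>+\<^sup>1\<close> are combined into one linear map of degree one.
\<close>

definition differential_calculus ::
    "('k, 'r) ring_scheme \<Rightarrow> ('k, 'e, 'h) hmod \<Rightarrow> ('k, 'e, 'h) calc \<Rightarrow> bool" where
  "differential_calculus K A E \<longleftrightarrow>
     graded_algebra K E \<and> is_degree_zero K A E \<and>
     klinear K E E (diff E) \<and>
     (\<forall>n. \<forall>\<theta>\<in>gr E n. diff E \<theta> \<in> gr E (Suc n)) \<and>
     (\<forall>\<theta>\<in>carrier E. diff E (diff E \<theta>) = \<zero>\<^bsub>E\<^esub>) \<and>
     (\<forall>n. \<forall>\<theta>\<in>gr E n. \<forall>\<theta>'\<in>carrier E.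
        diff E (\<theta> \<otimes>\<^bsub>E\<^esub> \<theta>')
          = (diff E \<theta> \<otimes>\<^bsub>E\<^esub> \<theta>') \<oplus>\<^bsub>E\<^esub> (sign K n \<odot>\<^bsub>E\<^esub> (\<theta> \<otimes>\<^bsub>E\<^esub> diff E \<theta>'))) \<and>
     (\<forall>\<theta>\<in>gr E 1. \<exists>(m::nat) a b. (\<forall>i<m. a i \<in> carrier A \<and> b i \<in> carrier A) \<and>
        \<theta> = (\<Oplus>\<^bsub>E\<^esub>i\<in>{..<m}. a i \<otimes>\<^bsub>E\<^esub> diff E (b i)))"

definition H_covariant ::
    "('k, 'r) ring_scheme \<Rightarrow> ('k, 'h) hopf \<Rightarrow> ('k, 'e, 'h) hmod \<Rightarrow> ('k, 'e, 'h) calc \<Rightarrow> bool"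
    where
  "H_covariant K H A E \<longleftrightarrow>
     H_module_algebra K H A \<and> H_module_algebra K H E \<and>
     (\<forall>\<xi>\<in>carrier H. \<forall>a\<in>carrier A. hact A \<xi> a = hact E \<xi> a) \<and>
     (\<forall>\<xi>\<in>carrier H. \<forall>n. \<forall>\<theta>\<in>gr E n. hact E \<xi> \<theta> \<in> gr E n) \<and>
     (\<forall>\<xi>\<in>carrier H. \<forall>\<theta>\<in>carrier E. hact E \<xi> (diff E \<theta>) = diff E (hact E \<xi> \<theta>))"

definition graded_quasi_commutative ::
    "('k, 'r) ring_scheme \<Rightarrow> ('k, 'h) hopf \<Rightarrow> ('h, 'h) tens \<Rightarrow> ('k, 'e, 'h) calc \<Rightarrow> bool" where
  "graded_quasi_commutative K H R E \<longleftrightarrow>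
     (\<forall>m n. \<forall>\<theta>\<in>gr E m. \<forall>\<theta>'\<in>gr E n.
        \<theta> \<otimes>\<^bsub>E\<^esub> \<theta>' = sign K (m * n) \<odot>\<^bsub>E\<^esub>
          tlift E (\<lambda>(x, y). hact E x \<theta>' \<otimes>\<^bsub>E\<^esub> hact E y \<theta>) (inv\<^bsub>HH K H\<^esub> R))"

definition one_forms :: "('k, 'e, 'h) calc \<Rightarrow> ('k, 'e, 'h, 'e) hbimod" where
  "one_forms E =
     \<lparr>carrier = gr E 1, monoid.mult = undefined, monoid.one = undefined,
      ring.zero = \<zero>\<^bsub>E\<^esub>, ring.add = (\<lambda>x y. x \<oplus>\<^bsub>E\<^esub> y), smult = (\<lambda>k x. k \<odot>\<^bsub>E\<^esub> x),
      hact = hact E, lact = (\<lambda>a \<theta>. a \<otimes>\<^bsub>E\<^esub> \<theta>), ract = (\<lambda>\<theta> a. \<theta> \<otimes>\<^bsub>E\<^esub> a)\<rparr>"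

definition Con ::
    "('k, 'r) ring_scheme \<Rightarrow> ('k, 'h) hopf \<Rightarrow> ('k, 'e, 'h) hmod \<Rightarrow> ('k, 'e, 'h) calc
      \<Rightarrow> ('k, 'v, 'h, 'e) hbimod \<Rightarrow> ('v \<Rightarrow> ('v, 'e) tens) set" where
  "Con K H A E V =
     (let T = btensor H A V (one_forms E)
      in {D. klinear K V T D \<and>
             (\<forall>v\<in>carrier V. \<forall>a\<in>carrier A.
                D (ract V v a) = ract T (D v) a \<oplus>\<^bsub>T\<^esub> (v \<boxtimes>\<^bsub>T\<^esub> diff E a))})"

section \<open>The sum of connections\<close>

text \<open>The adjoint action \<open>\<xi>\<^sub>1\<triangleright> \<circ> P \<circ> S(\<xi>\<^sub>2)\<triangleright>\<close> on maps \<open>P : M \<rightarrow> N\<close>.\<close>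

definition adj_act ::
    "('k, 'h) hopf \<Rightarrow> ('k, 'm, 'h, 'x) hmod_scheme \<Rightarrow> ('k, 'n, 'h, 'y) hmod_scheme
      \<Rightarrow> 'h \<Rightarrow> ('m \<Rightarrow> 'n) \<Rightarrow> 'm \<Rightarrow> 'n" where
  "adj_act H M N \<xi> P u =
     tlift N (\<lambda>(x, y). hact N x (P (hact M (antipode H y) u))) (comult H \<xi>)"

text \<open>
  \<open>tau23_inv\<close> maps \<open>(V \<otimes> \<Omega>) \<otimes> W\<close> to \<open>(V \<otimes> W) \<otimes> \<Omega>\<close>; the argument \<open>Om\<close> is the bimodule \<open>\<Omega>\<close>.
\<close>

definition tau23_inv ::
    "('k, 'h) hopf \<Rightarrow> ('h, 'h) tens \<Rightarrow> ('k, 'a, 'h) hmod \<Rightarrow> ('k, 'v, 'h, 'a) hbimod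
      \<Rightarrow> ('k, 'w, 'h, 'a) hbimod \<Rightarrow> ('k, 'o, 'h, 'a) hbimod
      \<Rightarrow> (('v, 'o) tens, 'w) tens \<Rightarrow> (('v, 'w) tens, 'o) tens" where
  "tau23_inv H R A V W Om =
     (let VW = btensor H A V W; T = btensor H A VW Om
      in tlift T (\<lambda>(q, w). tlift T (\<lambda>(v, \<theta>).
           tlift T (\<lambda>(x, y). (v \<boxtimes>\<^bsub>VW\<^esub> hact W y w) \<boxtimes>\<^bsub>T\<^esub> hact Om x \<theta>) R) q))"

definition con_sum ::
    "('k, 'r) ring_scheme \<Rightarrow> ('k, 'h) hopf \<Rightarrow> ('h, 'h) tens \<Rightarrow> ('k, 'a, 'h) hmod
      \<Rightarrow> ('k, 'v, 'h, 'a) hbimod \<Rightarrow> ('k, 'w, 'h, 'a) hbimod \<Rightarrow> ('k, 'o, 'h, 'a) hbimod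
      \<Rightarrow> ('v \<Rightarrow> ('v, 'o) tens) \<Rightarrow> ('w \<Rightarrow> ('w, 'o) tens)
      \<Rightarrow> ('v, 'w) tens \<Rightarrow> (('v, 'w) tens, 'o) tens" where
  "con_sum K H R A V W Om DV DW =
     (let VW = btensor H A V W; VW_Om = btensor H A VW Om;
          VOm_W = btensor H A (btensor H A V Om) W;
          WOm = btensor H A W Om; V_WOm = btensor H A V WOm
      in tlift VW_Om (\<lambda>(v, w).
           tau23_inv H R A V W Om (DV v \<boxtimes>\<^bsub>VOm_W\<^esub> w) \<oplus>\<^bsub>VW_Om\<^esub>
           tassoc VW_Om VW
             (tlift V_WOm (\<lambda>(x, y). hact V x v \<boxtimes>\<^bsub>V_WOm\<^esub> adj_act H W WOm y DW w)
                (inv\<^bsub>HH K H\<^esub> R))))"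

section \<open>Twist deformation\<close>

definition twist_hopf ::
    "('k, 'r) ring_scheme \<Rightarrow> ('k, 'h) hopf \<Rightarrow> ('h, 'h) tens \<Rightarrow> ('k, 'h) hopf" where
  "twist_hopf K H F =
     (let \<chi> = tlift H (\<lambda>(x, y). x \<otimes>\<^bsub>H\<^esub> antipode H y) F
      in H\<lparr>comult := (\<lambda>\<xi>. F \<otimes>\<^bsub>HH K H\<^esub> comult H \<xi> \<otimes>\<^bsub>HH K H\<^esub> inv\<^bsub>HH K H\<^esub> F),
           antipode := (\<lambda>\<xi>. \<chi> \<otimes>\<^bsub>H\<^esub> antipode H \<xi> \<otimes>\<^bsub>H\<^esub> inv\<^bsub>H\<^esub> \<chi>)\<rparr>)"

definition twist_R ::
    "('k, 'r) ring_scheme \<Rightarrow> ('k, 'h) hopf \<Rightarrow> ('h, 'h) tens \<Rightarrow> ('h, 'h) tens \<Rightarrow> ('h, 'h) tens"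
    where
  "twist_R K H F R = flip K H F \<otimes>\<^bsub>HH K H\<^esub> R \<otimes>\<^bsub>HH K H\<^esub> inv\<^bsub>HH K H\<^esub> F"

text \<open>Applied to \<open>A\<close> this is \<open>A\<^sub>\<star>\<close>, applied to \<open>\<Omega>\<^sup>\<bullet>\<close> it is \<open>\<Omega>\<^sup>\<bullet>\<^sub>\<star>\<close> with the same grading and differential.\<close>

definition twist_alg ::
    "('k, 'r) ring_scheme \<Rightarrow> ('k, 'h) hopf \<Rightarrow> ('h, 'h) tens
      \<Rightarrow> ('k, 'a, 'h, 'm) hmod_scheme \<Rightarrow> ('k, 'a, 'h, 'm) hmod_scheme" where
  "twist_alg K H F A =
     A\<lparr>monoid.mult := (\<lambda>a b.
        tlift A (\<lambda>(x, y). hact A x a \<otimes>\<^bsub>A\<^esub> hact A y b) (inv\<^bsub>HH K H\<^esub> F))\<rparr>"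

definition twist_bimod ::
    "('k, 'r) ring_scheme \<Rightarrow> ('k, 'h) hopf \<Rightarrow> ('h, 'h) tens \<Rightarrow> ('k, 'a, 'h) hmod
      \<Rightarrow> ('k, 'v, 'h, 'a) hbimod \<Rightarrow> ('k, 'v, 'h, 'a) hbimod" where
  "twist_bimod K H F A V =
     V\<lparr>lact := (\<lambda>a v. tlift V (\<lambda>(x, y). lact V (hact A x a) (hact V y v)) (inv\<^bsub>HH K H\<^esub> F)),
       ract := (\<lambda>v a. tlift V (\<lambda>(x, y). ract V (hact V x v) (hact A y a)) (inv\<^bsub>HH K H\<^esub> F))\<rparr>"

definition phi ::
    "('k, 'r) ring_scheme \<Rightarrow> ('k, 'h) hopf \<Rightarrow> ('h, 'h) tens \<Rightarrow> ('k, 'a, 'h) hmod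
      \<Rightarrow> ('k, 'v, 'h, 'a) hbimod \<Rightarrow> ('k, 'w, 'h, 'a) hbimod \<Rightarrow> ('v, 'w) tens \<Rightarrow> ('v, 'w) tens" where
  "phi K H F A V W =
     (let T = btensor H A V W
      in tlift T (\<lambda>(v, w).
           tlift T (\<lambda>(x, y). hact V x v \<boxtimes>\<^bsub>T\<^esub> hact W y w) (inv\<^bsub>HH K H\<^esub> F)))"

text \<open>
  \<open>Om\<close> is \<open>\<Omega>\<close> and \<open>Oms\<close> is \<open>\<Omega>\<^sub>\<star>\<close>; \<open>phi\<close> itself depends on the untwisted bimodules only.
\<close>

definition phi3 ::
    "('k, 'r) ring_scheme \<Rightarrow> ('k, 'h) hopf \<Rightarrow> ('h, 'h) tens \<Rightarrow> ('k, 'a, 'h) hmod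
      \<Rightarrow> ('k, 'v, 'h, 'a) hbimod \<Rightarrow> ('k, 'w, 'h, 'a) hbimod
      \<Rightarrow> ('k, 'o, 'h, 'a) hbimod \<Rightarrow> ('k, 'o, 'h, 'a) hbimod
      \<Rightarrow> (('v, 'w) tens, 'o) tens \<Rightarrow> (('v, 'w) tens, 'o) tens" where
  "phi3 K H F A V W Om Oms =
     (let VW = btensor H A V W;
          T = btensor (twist_hopf K H F) (twist_alg K H F A) (twist_bimod K H F A VW) Oms
      in phi K H F A VW Om \<circ> tmap T (phi K H F A V W) id)"

definition DF ::
    "('k, 'r) ring_scheme \<Rightarrow> ('k, 'h) hopf \<Rightarrow> ('h, 'h) tens \<Rightarrow> ('k, 'm, 'h, 'x) hmod_scheme
      \<Rightarrow> ('k, 'n, 'h, 'y) hmod_scheme \<Rightarrow> ('m \<Rightarrow> 'n) \<Rightarrow> 'm \<Rightarrow> 'n" where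
  "DF K H F M N P u =
     tlift N (\<lambda>(x, y). adj_act H M N x P (hact M y u)) (inv\<^bsub>HH K H\<^esub> F)"

definition DF_con ::
    "('k, 'r) ring_scheme \<Rightarrow> ('k, 'h) hopf \<Rightarrow> ('h, 'h) tens \<Rightarrow> ('k, 'e, 'h) hmod
      \<Rightarrow> ('k, 'e, 'h) calc \<Rightarrow> ('k, 'v, 'h, 'e) hbimod
      \<Rightarrow> ('v \<Rightarrow> ('v, 'e) tens) \<Rightarrow> 'v \<Rightarrow> ('v, 'e) tens" where
  "DF_con K H F A E V D =
     (let T = btensor H A V (one_forms E);
          Ts = btensor (twist_hopf K H F) (twist_alg K H F A) (twist_bimod K H F A V)
                 (one_forms (twist_alg K H F E))
      in inv_into (carrier Ts) (phi K H F A V (one_forms E)) \<circ> DF K H F V T D)"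

end

theory Submission
  imports Defs
begin

text \<open>
  Write \<open>\<phi>\<close> for the comparison maps and \<open>v \<otimes>\<^sub>\<star> w\<close> for \<open>\<phi> (v \<otimes> w)\<close>. Since \<open>\<phi> \<circ> \<phi>\<^sup>-\<^sup>1 \<circ> D\<^sub>F = D\<^sub>F\<close>, and since \<open>\<phi>\<close> carries
  the twisted braiding and associativity maps to the untwisted ones, the left hand side at \<open>v \<otimes> w\<close> is
  \<open>\<tau>\<^sup>-\<^sup>1(D\<^sub>F(\<nabla>\<^sub>V) v \<otimes>\<^sub>\<star> w) + x v \<otimes>\<^sub>\<star> D\<^sub>F(y \<cdot> \<nabla>\<^sub>W) w\<close>, summed over the inverse \<open>x \<otimes> y\<close> of \<open>R\<^sup>F\<close>, where \<open>\<cdot>\<close> is the adjoint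
  action of \<open>H\<close> itself because \<open>D\<^sub>F\<close> intertwines the two adjoint actions. Applying \<open>\<xi>\<close> to the sum of connections gives
  \<open>\<tau>\<^sup>-\<^sup>1((\<xi> \<cdot> \<nabla>\<^sub>V) v \<otimes> w) + x v \<otimes> ((y \<xi>) \<cdot> \<nabla>\<^sub>W) w\<close> over the inverse of \<open>R\<close>; inserted in \<open>D\<^sub>F\<close> and evaluated at
  \<open>v \<otimes>\<^sub>\<star> w\<close> it becomes the same expression by the cocycle identity for \<open>F\<^sup>-\<^sup>1\<close> and \<open>R\<^sup>F = F\<^sub>2\<^sub>1 R F\<^sup>-\<^sup>1\<close>.

  The twisted side is always pushed through the additive maps \<open>\<phi>\<close> term by term, on an arbitrary representative. Hence the
  twisted operations need not be shown to be well defined, and \<open>\<phi>\<close> need only be surjective.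
\<close>

section \<open>Evaluation of integer formal sums in an abelian group\<close>

section \<open>Formal sums\<close>

text \<open>Elements of tensor products are cosets of formal sums, and \<open>tlift\<close>
  evaluates a representative chosen arbitrarily. Rewriting the tensor under a Sweedler sum therefore
  obliges the summand to be bilinear over K, or balanced over A. Exchanging two sums, or applying an
  additive map to a sum, carries no such obligation, because the representatives stay fixed. This
  asymmetry decides which side of the equation needs well-definedness: only the untwisted one, and
  there quasi-commutativity of W and \<Omega> enters. Surjectivity of \<phi> is enough because the
  deformed connection is defined by \<open>inv_into\<close>, which is a right inverse on the range.
  D_F intertwines the two adjoint actions because D_F(P) can be rewritten as a sum over F itself,
  with the inverse of \<chi> in the argument of P. The twisted action then reduces to \<Delta>^F F =
  F \<Delta>, and \<chi> cancels. The rewriting needs the cocycle identity solved for (\<Delta>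
  \<otimes> id) F^-1; the same form supplies the left factor F in the inverse F R^-1 F_21^-1 of
  R^F.\<close>

definition frag_sum :: "('z, 'm) ring_scheme \<Rightarrow> ('p \<Rightarrow> 'z) \<Rightarrow> ('p \<Rightarrow>\<^sub>0 int) \<Rightarrow> 'z" where
  "frag_sum Z f c = (\<Oplus>\<^bsub>Z\<^esub>p\<in>Poly_Mapping.keys c. [Poly_Mapping.lookup c p] \<cdot>\<^bsub>Z\<^esub> f p)"

context abelian_group
begin

text \<open>Cancellation can make the support of \<open>c + d\<close> smaller than the union of the
  two supports. Coefficients off the support are 0, so all three sums can be taken over one common
  index set.\<close>

lemma frag_sum_superset:
  assumes "finite U" "Poly_Mapping.keys c \<subseteq> U" "f \<in> U \<rightarrow> carrier G"
  shows "frag_sum G f c = (\<Oplus>p\<in>U. [Poly_Mapping.lookup c p] \<cdot> f p)"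
  unfolding frag_sum_def
  by (rule add.finprod_mono_neutral_cong_left)
    (use assms int_pow_0[of "add_monoid G"] in \<open>auto simp: Pi_iff in_keys_iff add_pow_def[of G "0::int"] add.int_pow_closed\<close>)

lemma frag_sum_closed:
  assumes "f \<in> Poly_Mapping.keys c \<rightarrow> carrier G"
  shows "frag_sum G f c \<in> carrier G"
  unfolding frag_sum_def using assms by (auto intro!: finsum_closed add.int_pow_closed)

lemma frag_sum_add:
  assumes "f \<in> P \<rightarrow> carrier G" "Poly_Mapping.keys c \<subseteq> P" "Poly_Mapping.keys d \<subseteq> P"
  shows "frag_sum G f (c + d) = frag_sum G f c \<oplus> frag_sum G f d"
proof -
  let ?U = "Poly_Mapping.keys c \<union> Poly_Mapping.keys d"
  have f: "f \<in> ?U \<rightarrow> carrier G" using assms by auto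
  have "frag_sum G f (c + d) = (\<Oplus>p\<in>?U. [Poly_Mapping.lookup (c + d) p] \<cdot> f p)"
    by (rule frag_sum_superset) (use f keys_add[of c d] in auto)
  also have "\<dots> = (\<Oplus>p\<in>?U. [Poly_Mapping.lookup c p] \<cdot> f p \<oplus> [Poly_Mapping.lookup d p] \<cdot> f p)"
    by (rule finsum_cong') (use f in \<open>auto simp: lookup_add add.int_pow_mult Pi_iff add.int_pow_closed\<close>)
  also have "\<dots> = (\<Oplus>p\<in>?U. [Poly_Mapping.lookup c p] \<cdot> f p) \<oplus> (\<Oplus>p\<in>?U. [Poly_Mapping.lookup d p] \<cdot> f p)"
    by (rule finsum_addf) (use f in \<open>auto simp: Pi_iff add.int_pow_closed\<close>)
  also have "\<dots> = frag_sum G f c \<oplus> frag_sum G f d"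
    using frag_sum_superset[of ?U c f] frag_sum_superset[of ?U d f] f by simp
  finally show ?thesis .
qed

lemma frag_sum_0: "frag_sum G f 0 = \<zero>"
  by (simp add: frag_sum_def)

lemma frag_sum_uminus:
  assumes "f \<in> P \<rightarrow> carrier G" "Poly_Mapping.keys c \<subseteq> P"
  shows "frag_sum G f (- c) = \<ominus> frag_sum G f c"
proof -
  have "frag_sum G f (- c) \<oplus> frag_sum G f c = \<zero>"
    using frag_sum_add[OF assms(1), of "- c" c] assms(2) by (simp add: frag_sum_0)
  then show ?thesis
    using assms by (intro minus_equality[symmetric]) (auto intro!: frag_sum_closed)
qed

lemma frag_sum_diff:
  assumes "f \<in> P \<rightarrow> carrier G" "Poly_Mapping.keys c \<subseteq> P" "Poly_Mapping.keys d \<subseteq> P"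
  shows "frag_sum G f (c - d) = frag_sum G f c \<ominus> frag_sum G f d"
  using frag_sum_add[OF assms(1), of c "- d"] frag_sum_uminus[OF assms(1), of d] assms
  by (simp add: a_minus_def)

lemma frag_sum_of: "f p \<in> carrier G \<Longrightarrow> frag_sum G f (frag_of p) = f p"
  by (simp add: frag_sum_def add.int_pow_1)

lemma frag_sum_addf:
  assumes "f \<in> Poly_Mapping.keys c \<rightarrow> carrier G" "g \<in> Poly_Mapping.keys c \<rightarrow> carrier G"
  shows "frag_sum G (\<lambda>p. f p \<oplus> g p) c = frag_sum G f c \<oplus> frag_sum G g c"
proof -
  have "frag_sum G (\<lambda>p. f p \<oplus> g p) c
      = (\<Oplus>p\<in>Poly_Mapping.keys c. [Poly_Mapping.lookup c p] \<cdot> f p \<oplus> [Poly_Mapping.lookup c p] \<cdot> g p)"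
    unfolding frag_sum_def
    by (rule finsum_cong')
      (use assms in \<open>auto simp: Pi_iff add.int_pow_closed add.int_pow_mult_distrib a_comm\<close>)
  then show ?thesis
    unfolding frag_sum_def using assms
    by (simp add: finsum_addf Pi_iff add.int_pow_closed)
qed

end

definition additive_map :: "('y, 'l) ring_scheme \<Rightarrow> ('z, 'm) ring_scheme \<Rightarrow> ('y \<Rightarrow> 'z) \<Rightarrow> bool" where
  "additive_map Y Z h \<longleftrightarrow> h \<in> carrier Y \<rightarrow> carrier Z \<and>
     (\<forall>x\<in>carrier Y. \<forall>y\<in>carrier Y. h (x \<oplus>\<^bsub>Y\<^esub> y) = h x \<oplus>\<^bsub>Z\<^esub> h y)"

lemma additive_map_group_hom:
  assumes "abelian_group Y" "abelian_group Z" "additive_map Y Z h"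
  shows "group_hom (add_monoid Y) (add_monoid Z) h"
  using assms
  by (auto simp: additive_map_def hom_def abelian_group.a_group
      intro!: group_hom.intro group_hom_axioms.intro)

lemma additive_map_frag_sum:
  assumes "abelian_group Y" "abelian_group Z" "additive_map Y Z h"
    and f: "f \<in> Poly_Mapping.keys c \<rightarrow> carrier Y"
  shows "h (frag_sum Y f c) = frag_sum Z (\<lambda>p. h (f p)) c"
proof -
  interpret Y: abelian_group Y by fact
  interpret Z: abelian_group Z by fact
  interpret h: group_hom "add_monoid Y" "add_monoid Z" h by (rule additive_map_group_hom) fact+
  have h: "h x \<in> carrier Z" if "x \<in> carrier Y" for x
    using assms(3) that by (auto simp: additive_map_def)
  \<comment> \<open>The coefficients of \<open>c\<close> stay fixed while only the index set grows,
    since a partial sum is not the evaluation of \<open>c\<close> itself.\<close>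
  have "h (\<Oplus>\<^bsub>Y\<^esub>p\<in>I. [Poly_Mapping.lookup c p] \<cdot>\<^bsub>Y\<^esub> f p) = (\<Oplus>\<^bsub>Z\<^esub>p\<in>I. [Poly_Mapping.lookup c p] \<cdot>\<^bsub>Z\<^esub> h (f p))"
    if "finite I" "I \<subseteq> Poly_Mapping.keys c" for I
    using that
  proof (induction I rule: finite_induct)
    case empty
    then show ?case using h.hom_one by simp
  next
    case (insert p I)
    have *: "f q \<in> carrier Y" if "q \<in> insert p I" for q using insert f that by auto
    have "h ([Poly_Mapping.lookup c p] \<cdot>\<^bsub>Y\<^esub> f p) = [Poly_Mapping.lookup c p] \<cdot>\<^bsub>Z\<^esub> h (f p)"
      using h.hom_int_pow * by (simp add: add_pow_def)
    moreover have "h (x \<oplus>\<^bsub>Y\<^esub> y) = h x \<oplus>\<^bsub>Z\<^esub> h y" if "x \<in> carrier Y" "y \<in> carrier Y" for x y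
      using assms(3) that by (simp add: additive_map_def)
    ultimately show ?case
      using insert * h by (simp add: Pi_iff Y.add.int_pow_closed Z.add.int_pow_closed)
  qed
  then show ?thesis
    by (simp add: frag_sum_def)
qed

text \<open>Both formal sums are fixed, so this is the exchange of two finite sums. It later lets
  Sweedler sums be exchanged without a bilinearity check.\<close>

lemma frag_sum_swap:
  assumes "abelian_group Z" and f: "\<And>p q. p \<in> Poly_Mapping.keys c \<Longrightarrow> q \<in> Poly_Mapping.keys d \<Longrightarrow> f p q \<in> carrier Z"
  shows "frag_sum Z (\<lambda>p. frag_sum Z (f p) d) c = frag_sum Z (\<lambda>q. frag_sum Z (\<lambda>p. f p q) c) d"
proof -
  interpret Z: abelian_group Z by fact
  have "\<And>I. finite I \<Longrightarrow> I \<subseteq> Poly_Mapping.keys d \<Longrightarrow>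
      frag_sum Z (\<lambda>p. \<Oplus>\<^bsub>Z\<^esub>q\<in>I. [Poly_Mapping.lookup d q] \<cdot>\<^bsub>Z\<^esub> f p q) c
      = (\<Oplus>\<^bsub>Z\<^esub>q\<in>I. [Poly_Mapping.lookup d q] \<cdot>\<^bsub>Z\<^esub> frag_sum Z (\<lambda>p. f p q) c)"
    subgoal for I
    proof (induction I rule: finite_induct)
      case empty
      then show ?case
        using Z.frag_sum_addf[of "\<lambda>_. \<zero>\<^bsub>Z\<^esub>" c "\<lambda>_. \<zero>\<^bsub>Z\<^esub>"] Z.frag_sum_closed[of "\<lambda>_. \<zero>\<^bsub>Z\<^esub>" c]
        by (simp add: Z.add.l_cancel_one')
    next
      case (insert q I)
      let ?g = "\<lambda>p q. [Poly_Mapping.lookup d q] \<cdot>\<^bsub>Z\<^esub> f p q"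
      have g: "?g p q \<in> carrier Z" if "p \<in> Poly_Mapping.keys c" "q \<in> Poly_Mapping.keys d" for p q
        using f that by (simp add: Z.add.int_pow_closed)
      have "frag_sum Z (\<lambda>p. \<Oplus>\<^bsub>Z\<^esub>q\<in>insert q I. ?g p q) c
          = frag_sum Z (\<lambda>p. ?g p q \<oplus>\<^bsub>Z\<^esub> (\<Oplus>\<^bsub>Z\<^esub>q\<in>I. ?g p q)) c"
        unfolding frag_sum_def
        by (intro Z.finsum_cong' refl arg_cong2[where f = "\<lambda>k x. [k] \<cdot>\<^bsub>Z\<^esub> x"] Z.finsum_insert)
          (use insert f in \<open>auto intro!: Z.add.int_pow_closed Z.finsum_closed Z.a_closed\<close>)
      also have "\<dots> = frag_sum Z (\<lambda>p. ?g p q) c \<oplus>\<^bsub>Z\<^esub> frag_sum Z (\<lambda>p. \<Oplus>\<^bsub>Z\<^esub>q\<in>I. ?g p q) c"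
        by (rule Z.frag_sum_addf) (use insert g in \<open>auto intro!: Z.finsum_closed\<close>)
      \<comment> \<open>Taking a fixed integer multiple is additive, so
        \<open>additive_map_frag_sum\<close> pulls the coefficient of \<open>q\<close> out.\<close>
      also have "frag_sum Z (\<lambda>p. ?g p q) c = [Poly_Mapping.lookup d q] \<cdot>\<^bsub>Z\<^esub> frag_sum Z (\<lambda>p. f p q) c"
        by (rule additive_map_frag_sum[symmetric, OF assms(1) assms(1)])
          (use insert f in \<open>auto simp: additive_map_def Z.add.int_pow_distrib Z.add.int_pow_closed Z.a_comm\<close>)
      finally show ?case
        using insert f by (subst Z.finsum_insert)
          (auto intro!: Z.add.int_pow_closed Z.frag_sum_closed)
    qed
    done
  from this[of "Poly_Mapping.keys d"] show ?thesis
    by (simp add: frag_sum_def[of Z _ d])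
qed

section \<open>Tensor products of abelian groups and evaluation of their elements\<close>

section \<open>Tensor products\<close>

text \<open>Curried \<open>tlift\<close>: iterated Sweedler sums then read as nested binders, in the
  order in which the sums are taken.\<close>

definition tsum :: "('z, 'm) ring_scheme \<Rightarrow> ('v, 'w) tens \<Rightarrow> ('v \<Rightarrow> 'w \<Rightarrow> 'z) \<Rightarrow> 'z" where
  "tsum Z X f = tlift Z (case_prod f) X"

lemma foldSetD_cong:
  "(A, y) \<in> foldSetD D f e \<Longrightarrow> (\<And>x. x \<in> A \<Longrightarrow> f x = g x) \<Longrightarrow> (A, y) \<in> foldSetD D g e"
  by (induction rule: foldSetD.induct) (auto intro: foldSetD.intros)

text \<open>\<open>finprod\<close> inspects its function only on the index set, whatever the
  algebraic structure. With no closure condition here, \<open>tsum_cong\<close> has none on the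
  target either and can serve as a simplifier congruence.\<close>

lemma finprod_eq_cong:
  assumes "\<And>x. x \<in> A \<Longrightarrow> f x = g x"
  shows "finprod G f A = finprod G g A"
proof -
  have "(A, y) \<in> foldSetD (carrier G) (monoid.mult G \<circ> f) e
      \<longleftrightarrow> (A, y) \<in> foldSetD (carrier G) (monoid.mult G \<circ> g) e" for e y
    using assms by (auto intro: foldSetD_cong)
  then show ?thesis unfolding finprod_def foldD_def by presburger
qed

lemma tsum_frag_sum: "tsum Z X f = frag_sum Z (case_prod f) (SOME c. c \<in> X)"
  by (simp add: tsum_def tlift_def frag_sum_def Let_def)

text \<open>\<open>T\<close> agrees with \<open>tensor_group\<close> on carrier, zero and addition,
  so the richer records \<open>talg\<close> and \<open>btensor\<close> are both covered. Abelian
  groups and closure of the actions are the only further assumptions, which also admits the tensor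
  products over \<open>A\<^sub>\<star>\<close>.\<close>

locale tensor_product =
  fixes S :: "'s set" and r :: "'v \<Rightarrow> 's \<Rightarrow> 'v" and l :: "'s \<Rightarrow> 'w \<Rightarrow> 'w"
    and V :: "('v, 'm) ring_scheme" and W :: "('w, 'n) ring_scheme"
    and T :: "(('v, 'w) tens, 't) ring_scheme"
  assumes V: "abelian_group V" and W: "abelian_group W"
    and r_closed: "v \<in> carrier V \<Longrightarrow> s \<in> S \<Longrightarrow> r v s \<in> carrier V"
    and l_closed: "s \<in> S \<Longrightarrow> w \<in> carrier W \<Longrightarrow> l s w \<in> carrier W"
    and T_carrier: "carrier T = carrier (tensor_group S r l V W)"
    and T_zero: "\<zero>\<^bsub>T\<^esub> = \<zero>\<^bsub>tensor_group S r l V W\<^esub>"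
    and T_add: "X \<oplus>\<^bsub>T\<^esub> Y = X \<oplus>\<^bsub>tensor_group S r l V W\<^esub> Y"
begin

abbreviation (input) "G \<equiv> free_Abelian_group (carrier V \<times> carrier W)"
abbreviation (input) "N \<equiv> generate G (tensor_rels S r l V W)"

sublocale V: abelian_group V by (rule V)
sublocale W: abelian_group W by (rule W)

lemma rels_closed: "tensor_rels S r l V W \<subseteq> carrier G"
  unfolding tensor_rels_def
  by (auto simp: r_closed l_closed keys_frag_of dest!: subsetD[OF keys_diff])

lemma N_normal: "N \<lhd> G"
  by (rule comm_group.normal_iff_subgroup[THEN iffD2, OF abelian_free_Abelian_group])
    (rule group.generate_is_subgroup[OF group_free_Abelian_group rels_closed])

lemma T_simps:
  "carrier T = (\<lambda>c. N #>\<^bsub>G\<^esub> c) ` carrier G" "\<zero>\<^bsub>T\<^esub> = N" "X \<oplus>\<^bsub>T\<^esub> Y = X <#>\<^bsub>G\<^esub> Y"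
  by (auto simp: T_carrier T_zero T_add tensor_group_def Let_def FactGroup_def RCOSETS_def)

text \<open>A coset depends on the group only through its operation, so the full free group in
  \<open>ptens_def\<close> gives the same coset as the free group on the two carriers.\<close>

lemma coset_UNIV: "N #>\<^bsub>free_Abelian_group UNIV\<^esub> c = N #>\<^bsub>G\<^esub> c"
  by (simp add: r_coset_def)

lemma coset_add:
  "c \<in> carrier G \<Longrightarrow> d \<in> carrier G \<Longrightarrow> (N #>\<^bsub>G\<^esub> c) \<oplus>\<^bsub>T\<^esub> (N #>\<^bsub>G\<^esub> d) = N #>\<^bsub>G\<^esub> (c + d)"
  using normal.rcos_sum[OF N_normal, of c d] by (simp add: T_simps)

lemma abelian_T: "abelian_group T"
proof -
  interpret Q: comm_group "G Mod N"
    by (rule comm_group.abelian_FactGroup[OF abelian_free_Abelian_group])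
      (rule group.generate_is_subgroup[OF group_free_Abelian_group rels_closed])
  have eq: "carrier T = carrier (G Mod N)" "\<zero>\<^bsub>T\<^esub> = \<one>\<^bsub>G Mod N\<^esub>" "\<And>X Y. X \<oplus>\<^bsub>T\<^esub> Y = X \<otimes>\<^bsub>G Mod N\<^esub> Y"
    by (auto simp: T_carrier T_zero T_add tensor_group_def Let_def)
  show ?thesis
    by (rule abelian_groupI)
      (simp_all only: eq Q.m_closed Q.one_closed Q.m_assoc Q.l_one Q.l_inv_ex, simp_all only: Q.m_comm)
qed

sublocale T: abelian_group T by (rule abelian_T)

lemma ptens_coset: "v \<boxtimes>\<^bsub>T\<^esub> w = N #>\<^bsub>G\<^esub> frag_of (v, w)"
  by (simp add: ptens_def T_simps coset_UNIV)

lemma ptens_closed [intro, simp]: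
  "v \<in> carrier V \<Longrightarrow> w \<in> carrier W \<Longrightarrow> v \<boxtimes>\<^bsub>T\<^esub> w \<in> carrier T"
  by (auto simp: ptens_coset T_simps keys_frag_of)

lemma coset_eqI:
  assumes "c \<in> carrier G" "d \<in> carrier G" "c - d \<in> N"
  shows "N #>\<^bsub>G\<^esub> c = N #>\<^bsub>G\<^esub> d"
proof -
  have N: "subgroup N G" using N_normal by (simp add: normal_def)
  have "c \<in> N #>\<^bsub>G\<^esub> d"
    using assms by (auto simp: r_coset_def intro!: bexI[of _ "c - d"])
  then show ?thesis
    using group.repr_independence[OF group_free_Abelian_group _ assms(2) N] by simp
qed

lemma ptens_add_left:
  assumes "v \<in> carrier V" "v' \<in> carrier V" "w \<in> carrier W"
  shows "(v \<oplus>\<^bsub>V\<^esub> v') \<boxtimes>\<^bsub>T\<^esub> w = v \<boxtimes>\<^bsub>T\<^esub> w \<oplus>\<^bsub>T\<^esub> v' \<boxtimes>\<^bsub>T\<^esub> w"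
proof -
  have "frag_of (v \<oplus>\<^bsub>V\<^esub> v', w) - (frag_of (v, w) + frag_of (v', w)) \<in> N"
    using assms by (intro generate.incl) (auto simp: tensor_rels_def diff_diff_eq)
  from coset_eqI[OF _ _ this] show ?thesis
    using assms keys_add[of "frag_of (v, w)" "frag_of (v', w)"]
    by (simp add: ptens_coset coset_add keys_frag_of) blast
qed

lemma ptens_add_right:
  assumes "v \<in> carrier V" "w \<in> carrier W" "w' \<in> carrier W"
  shows "v \<boxtimes>\<^bsub>T\<^esub> (w \<oplus>\<^bsub>W\<^esub> w') = v \<boxtimes>\<^bsub>T\<^esub> w \<oplus>\<^bsub>T\<^esub> v \<boxtimes>\<^bsub>T\<^esub> w'"
proof -
  have "frag_of (v, w \<oplus>\<^bsub>W\<^esub> w') - (frag_of (v, w) + frag_of (v, w')) \<in> N"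
    using assms by (intro generate.incl) (auto simp: tensor_rels_def diff_diff_eq)
  from coset_eqI[OF _ _ this] show ?thesis
    using assms keys_add[of "frag_of (v, w)" "frag_of (v, w')"]
    by (simp add: ptens_coset coset_add keys_frag_of) blast
qed

lemma ptens_balanced:
  assumes "v \<in> carrier V" "s \<in> S" "w \<in> carrier W"
  shows "r v s \<boxtimes>\<^bsub>T\<^esub> w = v \<boxtimes>\<^bsub>T\<^esub> l s w"
proof -
  have "frag_of (r v s, w) - frag_of (v, l s w) \<in> N"
    using assms by (intro generate.incl) (auto simp: tensor_rels_def)
  from coset_eqI[OF _ _ this] show ?thesis
    using assms by (simp add: ptens_coset keys_frag_of r_closed l_closed)
qed

lemma ptens_zero_left: "w \<in> carrier W \<Longrightarrow> \<zero>\<^bsub>V\<^esub> \<boxtimes>\<^bsub>T\<^esub> w = \<zero>\<^bsub>T\<^esub>"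
  using ptens_add_left[of "\<zero>\<^bsub>V\<^esub>" "\<zero>\<^bsub>V\<^esub>" w] by (simp add: T.add.r_cancel_one')

text \<open>The negative of a pure tensor is again pure, by negating its first factor. Sums of pure
  tensors therefore exhaust the tensor product, and negation is not a case of its own.\<close>

lemma induct [consumes 1, case_names ptens add]:
  assumes X: "X \<in> carrier T"
    and ptens: "\<And>v w. v \<in> carrier V \<Longrightarrow> w \<in> carrier W \<Longrightarrow> P (v \<boxtimes>\<^bsub>T\<^esub> w)"
    and add: "\<And>X Y. X \<in> carrier T \<Longrightarrow> Y \<in> carrier T \<Longrightarrow> P X \<Longrightarrow> P Y \<Longrightarrow> P (X \<oplus>\<^bsub>T\<^esub> Y)"
  shows "P X"
proof -
  obtain c where c: "c \<in> carrier G" and Xc: "X = N #>\<^bsub>G\<^esub> c"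
    using X by (auto simp: T_simps)
  have N0: "P (N #>\<^bsub>G\<^esub> 0)"
  proof -
    have "N #>\<^bsub>G\<^esub> 0 = \<zero>\<^bsub>T\<^esub>" by (simp add: T_simps r_coset_def)
    then show ?thesis using ptens[of "\<zero>\<^bsub>V\<^esub>" "\<zero>\<^bsub>W\<^esub>"] by (simp add: ptens_zero_left)
  qed
  have neg: "N #>\<^bsub>G\<^esub> (- frag_of (v, w)) = (\<ominus>\<^bsub>V\<^esub> v) \<boxtimes>\<^bsub>T\<^esub> w" if "v \<in> carrier V" "w \<in> carrier W" for v w
  proof -
    have "(\<ominus>\<^bsub>V\<^esub> v) \<boxtimes>\<^bsub>T\<^esub> w \<oplus>\<^bsub>T\<^esub> v \<boxtimes>\<^bsub>T\<^esub> w = \<zero>\<^bsub>T\<^esub>"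
      using that ptens_add_left[of "\<ominus>\<^bsub>V\<^esub> v" v w] by (simp add: V.l_neg ptens_zero_left)
    moreover have "(N #>\<^bsub>G\<^esub> (- frag_of (v, w))) \<oplus>\<^bsub>T\<^esub> v \<boxtimes>\<^bsub>T\<^esub> w = \<zero>\<^bsub>T\<^esub>"
      using that by (simp add: ptens_coset coset_add keys_frag_of) (simp add: T_simps r_coset_def)
    moreover have "N #>\<^bsub>G\<^esub> (- frag_of (v, w)) \<in> carrier T"
      using that by (auto simp: T_simps keys_frag_of)
    ultimately show ?thesis
      using that T.add.right_cancel[of "v \<boxtimes>\<^bsub>T\<^esub> w" "N #>\<^bsub>G\<^esub> (- frag_of (v, w))" "(\<ominus>\<^bsub>V\<^esub> v) \<boxtimes>\<^bsub>T\<^esub> w"]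
      by simp
  qed
  have sum: "P (N #>\<^bsub>G\<^esub> (x + y))"
    if "Poly_Mapping.keys x \<subseteq> carrier V \<times> carrier W" "Poly_Mapping.keys y \<subseteq> carrier V \<times> carrier W"
      "P (N #>\<^bsub>G\<^esub> x)" "P (N #>\<^bsub>G\<^esub> y)" for x y
    using that add[of "N #>\<^bsub>G\<^esub> x" "N #>\<^bsub>G\<^esub> y"] by (simp add: coset_add) (auto simp: T_simps)
  \<comment> \<open>The induction on the free group works with differences, so the claim is carried
    for \<open>c\<close> and \<open>- c\<close> together.\<close>
  have "P (N #>\<^bsub>G\<^esub> c) \<and> P (N #>\<^bsub>G\<^esub> (- c))"
  proof (rule free_Abelian_group_induct[of c "carrier V \<times> carrier W"])
    show "Poly_Mapping.keys c \<subseteq> carrier V \<times> carrier W" using c by simp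
  next
    show "P (N #>\<^bsub>G\<^esub> 0) \<and> P (N #>\<^bsub>G\<^esub> (- 0))" using N0 by simp
  next
    fix x y
    assume "Poly_Mapping.keys x \<subseteq> carrier V \<times> carrier W" "Poly_Mapping.keys y \<subseteq> carrier V \<times> carrier W"
      "P (N #>\<^bsub>G\<^esub> x) \<and> P (N #>\<^bsub>G\<^esub> (- x))" "P (N #>\<^bsub>G\<^esub> y) \<and> P (N #>\<^bsub>G\<^esub> (- y))"
    then show "P (N #>\<^bsub>G\<^esub> (x - y)) \<and> P (N #>\<^bsub>G\<^esub> (- (x - y)))"
      using sum[of x "- y"] sum[of "- x" y] by simp
  next
    fix p assume "p \<in> carrier V \<times> carrier W"
    then show "P (N #>\<^bsub>G\<^esub> frag_of p) \<and> P (N #>\<^bsub>G\<^esub> (- frag_of p))"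
      using ptens neg by (cases p) (auto simp flip: ptens_coset)
  qed
  then show ?thesis using Xc by simp
qed

text \<open>Later facts see the choice made by \<open>tlift\<close> through these two properties and
  through its depending on \<open>X\<close> alone.\<close>

lemma some_rep:
  assumes "X \<in> carrier T"
  shows "(SOME c. c \<in> X) \<in> X" "Poly_Mapping.keys (SOME c. c \<in> X) \<subseteq> carrier V \<times> carrier W"
proof -
  obtain d where d: "d \<in> carrier G" and X: "X = N #>\<^bsub>G\<^esub> d"
    using assms by (auto simp: T_simps)
  have N: "subgroup N G" using N_normal by (simp add: normal_def)
  have "d \<in> X" unfolding X by (rule group.rcos_self[OF group_free_Abelian_group d N])
  then show c: "(SOME c. c \<in> X) \<in> X" by (rule someI)
  have "X \<subseteq> carrier G"
    unfolding X using monoid.r_coset_subset_G[OF group.is_monoid[OF group_free_Abelian_group] _ d] subgroup.subset[OF N] by blast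
  from subsetD[OF this c] show "Poly_Mapping.keys (SOME c. c \<in> X) \<subseteq> carrier V \<times> carrier W"
    by simp
qed

text \<open>The chosen representative depends on \<open>X\<close> alone, so both sums run over the
  same formal sum and agreement on the carriers suffices.\<close>

lemma tsum_cong:
  assumes "X \<in> carrier T" "\<And>v w. v \<in> carrier V \<Longrightarrow> w \<in> carrier W \<Longrightarrow> f v w = g v w"
  shows "tsum Z X f = tsum Z X g"
proof -
  have "case_prod f p = case_prod g p" if "p \<in> Poly_Mapping.keys (SOME c. c \<in> X)" for p
    using that some_rep(2)[OF assms(1)] assms(2) by auto
  then show ?thesis
    unfolding tsum_frag_sum frag_sum_def finsum_def by (intro finprod_eq_cong) simp
qed

context
  fixes Z :: "('z, 'q) ring_scheme"
  assumes Z: "abelian_group Z"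
begin

interpretation Z: abelian_group Z by (rule Z)

lemma tsum_closed:
  assumes "X \<in> carrier T" "\<And>v w. v \<in> carrier V \<Longrightarrow> w \<in> carrier W \<Longrightarrow> f v w \<in> carrier Z"
  shows "tsum Z X f \<in> carrier Z"
  unfolding tsum_frag_sum using some_rep(2)[OF assms(1)] assms(2) by (auto intro!: Z.frag_sum_closed)

lemma tsum_addf:
  assumes "X \<in> carrier T" "\<And>v w. v \<in> carrier V \<Longrightarrow> w \<in> carrier W \<Longrightarrow> f v w \<in> carrier Z"
    "\<And>v w. v \<in> carrier V \<Longrightarrow> w \<in> carrier W \<Longrightarrow> g v w \<in> carrier Z"
  shows "tsum Z X (\<lambda>v w. f v w \<oplus>\<^bsub>Z\<^esub> g v w) = tsum Z X f \<oplus>\<^bsub>Z\<^esub> tsum Z X g"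
  unfolding tsum_frag_sum using some_rep(2)[OF assms(1)] assms(2,3)
  by (subst Z.frag_sum_addf[symmetric]) (auto simp: case_prod_unfold)

text \<open>An additive map commutes with the finite sum over the fixed representative, whether or
  not \<open>f\<close> is balanced. By this rule the twisted side is evaluated.\<close>

lemma tsum_hom:
  fixes Z' :: "('y, 'p) ring_scheme"
  assumes "abelian_group Z'" "additive_map Z Z' h" "X \<in> carrier T"
    "\<And>v w. v \<in> carrier V \<Longrightarrow> w \<in> carrier W \<Longrightarrow> f v w \<in> carrier Z"
  shows "h (tsum Z X f) = tsum Z' X (\<lambda>v w. h (f v w))"
  unfolding tsum_frag_sum using some_rep(2)[OF assms(3)] assms(4)
  by (subst additive_map_frag_sum[OF Z assms(1,2)]) (auto simp: case_prod_unfold)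

context
  fixes f :: "'v \<Rightarrow> 'w \<Rightarrow> 'z"
  assumes f_closed: "\<And>v w. v \<in> carrier V \<Longrightarrow> w \<in> carrier W \<Longrightarrow> f v w \<in> carrier Z"
    and f_left: "\<And>v v' w. v \<in> carrier V \<Longrightarrow> v' \<in> carrier V \<Longrightarrow> w \<in> carrier W \<Longrightarrow>
      f (v \<oplus>\<^bsub>V\<^esub> v') w = f v w \<oplus>\<^bsub>Z\<^esub> f v' w"
    and f_right: "\<And>v w w'. v \<in> carrier V \<Longrightarrow> w \<in> carrier W \<Longrightarrow> w' \<in> carrier W \<Longrightarrow>
      f v (w \<oplus>\<^bsub>W\<^esub> w') = f v w \<oplus>\<^bsub>Z\<^esub> f v w'"
    and f_balanced: "\<And>v s w. v \<in> carrier V \<Longrightarrow> s \<in> S \<Longrightarrow> w \<in> carrier W \<Longrightarrow> f (r v s) w = f v (l s w)"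
begin

text \<open>A biadditive balanced \<open>f\<close> kills each of the three kinds of generators, and
  evaluation is a homomorphism, so it kills the subgroup that they generate.\<close>

lemma frag_sum_rels:
  assumes "n \<in> N"
  shows "frag_sum Z (case_prod f) n = \<zero>\<^bsub>Z\<^esub>"
proof -
  have f: "case_prod f \<in> carrier V \<times> carrier W \<rightarrow> carrier Z" using f_closed by auto
  note diff = Z.frag_sum_diff[OF f]
  have frag: "frag_sum Z (case_prod f) (frag_of (v, w)) = f v w" if "v \<in> carrier V" "w \<in> carrier W" for v w
    using f_closed that by (simp add: Z.frag_sum_of)
  have keys: "Poly_Mapping.keys (frag_of (v, w)) \<subseteq> carrier V \<times> carrier W" if "v \<in> carrier V" "w \<in> carrier W" for v w
    using that by (simp add: keys_frag_of)
  have keys2: "Poly_Mapping.keys (frag_of (v, w) - frag_of (v', w')) \<subseteq> carrier V \<times> carrier W"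
    if "v \<in> carrier V" "w \<in> carrier W" "v' \<in> carrier V" "w' \<in> carrier W" for v w v' w'
    using that keys_diff[of "frag_of (v, w)" "frag_of (v', w')"] by (auto simp: keys_frag_of)
  have cancel: "a \<oplus>\<^bsub>Z\<^esub> b \<ominus>\<^bsub>Z\<^esub> a \<ominus>\<^bsub>Z\<^esub> b = \<zero>\<^bsub>Z\<^esub>" if "a \<in> carrier Z" "b \<in> carrier Z" for a b
    using that by (simp add: Z.minus_eq Z.a_assoc Z.a_comm[of b] Z.r_neg Z.r_neg1)
  have minus_self: "a \<ominus>\<^bsub>Z\<^esub> a = \<zero>\<^bsub>Z\<^esub>" if "a \<in> carrier Z" for a
    using that by (simp add: Z.minus_eq Z.r_neg)
  have rel: "frag_sum Z (case_prod f) n = \<zero>\<^bsub>Z\<^esub>" if "n \<in> tensor_rels S r l V W" for n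
    using that unfolding tensor_rels_def
    by (auto simp: diff keys keys2 frag f_left f_right f_balanced f_closed r_closed l_closed cancel minus_self)
  show ?thesis
    using assms
  proof (induction rule: generate.induct)
    case one
    then show ?case by (simp add: Z.frag_sum_0)
  next
    case (incl h)
    then show ?case by (rule rel)
  next
    case (inv h)
    moreover have "Poly_Mapping.keys h \<subseteq> carrier V \<times> carrier W"
      using subsetD[OF rels_closed inv] by simp
    ultimately show ?case using Z.frag_sum_uminus[OF f, of h] rel by simp
  next
    case (eng h1 h2)
    then have "Poly_Mapping.keys h1 \<subseteq> carrier V \<times> carrier W" "Poly_Mapping.keys h2 \<subseteq> carrier V \<times> carrier W"
      using group.generate_in_carrier[OF group_free_Abelian_group rels_closed] by auto
    with eng show ?case by (simp add: Z.frag_sum_add[OF f])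
  qed
qed

text \<open>Independence of the representative: the chosen one differs from \<open>c\<close> by an
  element of the relation subgroup, on which the evaluation vanishes.\<close>

lemma tsum_coset:
  assumes "c \<in> carrier G"
  shows "tsum Z (N #>\<^bsub>G\<^esub> c) f = frag_sum Z (case_prod f) c"
proof -
  have f: "case_prod f \<in> carrier V \<times> carrier W \<rightarrow> carrier Z" using f_closed by auto
  have "N #>\<^bsub>G\<^esub> c \<in> carrier T" using assms by (auto simp: T_simps)
  from some_rep(1)[OF this] obtain n where n: "n \<in> N" "(SOME d. d \<in> N #>\<^bsub>G\<^esub> c) = n + c"
    by (auto simp: r_coset_def)
  moreover have "Poly_Mapping.keys n \<subseteq> carrier V \<times> carrier W"
    using \<open>n \<in> N\<close> group.generate_in_carrier[OF group_free_Abelian_group rels_closed] by auto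
  moreover have "frag_sum Z (case_prod f) c \<in> carrier Z"
    using assms by (intro Z.frag_sum_closed subsetD[OF Pi_anti_mono f]) simp
  ultimately show ?thesis
    using assms frag_sum_rels[of n] by (simp add: tsum_frag_sum Z.frag_sum_add[OF f])
qed

lemma tsum_ptens: "v \<in> carrier V \<Longrightarrow> w \<in> carrier W \<Longrightarrow> tsum Z (v \<boxtimes>\<^bsub>T\<^esub> w) f = f v w"
  by (simp add: ptens_coset tsum_coset keys_frag_of Z.frag_sum_of f_closed)

lemma tsum_add:
  assumes "X \<in> carrier T" "Y \<in> carrier T"
  shows "tsum Z (X \<oplus>\<^bsub>T\<^esub> Y) f = tsum Z X f \<oplus>\<^bsub>Z\<^esub> tsum Z Y f"
proof -
  have f: "case_prod f \<in> carrier V \<times> carrier W \<rightarrow> carrier Z" using f_closed by auto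
  obtain c d where cd: "c \<in> carrier G" "d \<in> carrier G" "X = N #>\<^bsub>G\<^esub> c" "Y = N #>\<^bsub>G\<^esub> d"
    using assms by (auto simp: T_simps)
  have "c + d \<in> carrier G" using cd keys_add[of c d] by auto
  then have "tsum Z (X \<oplus>\<^bsub>T\<^esub> Y) f = frag_sum Z (case_prod f) (c + d)"
    by (simp only: cd coset_add tsum_coset)
  also have "\<dots> = tsum Z X f \<oplus>\<^bsub>Z\<^esub> tsum Z Y f"
    using cd by (simp only: cd(3,4) tsum_coset) (simp add: Z.frag_sum_add[OF f])
  finally show ?thesis .
qed

lemma tsum_additive: "additive_map T Z (\<lambda>X. tsum Z X f)"
  unfolding additive_map_def by (auto intro!: tsum_closed tsum_add f_closed)

end

end

lemma additive_map_eqI: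
  assumes "additive_map T Z g" "additive_map T Z h" "X \<in> carrier T"
    "\<And>v w. v \<in> carrier V \<Longrightarrow> w \<in> carrier W \<Longrightarrow> g (v \<boxtimes>\<^bsub>T\<^esub> w) = h (v \<boxtimes>\<^bsub>T\<^esub> w)"
  shows "g X = h X"
  using assms(3)
  by (induction rule: induct) (use assms(1,2,4) in \<open>auto simp: additive_map_def\<close>)

end

lemma tsum_swap:
  assumes "tensor_product S r l V W T" "tensor_product S' r' l' V' W' T'" "abelian_group Z"
    "X \<in> carrier T" "Y \<in> carrier T'"
    "\<And>v w v' w'. v \<in> carrier V \<Longrightarrow> w \<in> carrier W \<Longrightarrow> v' \<in> carrier V' \<Longrightarrow> w' \<in> carrier W' \<Longrightarrow>
      f v w v' w' \<in> carrier Z"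
  shows "tsum Z X (\<lambda>v w. tsum Z Y (f v w)) = tsum Z Y (\<lambda>v' w'. tsum Z X (\<lambda>v w. f v w v' w'))"
  unfolding tsum_frag_sum case_prod_unfold
  by (rule frag_sum_swap[OF assms(3)], rule assms(6))
    (use tensor_product.some_rep(2)[OF assms(1,4)] tensor_product.some_rep(2)[OF assms(2,5)] in auto)

section \<open>Closure rules for K-linear and K-bilinear maps\<close>

section \<open>Linear maps\<close>

lemma klinearI:
  assumes "\<And>x. x \<in> carrier M \<Longrightarrow> f x \<in> carrier N"
    "\<And>x y. x \<in> carrier M \<Longrightarrow> y \<in> carrier M \<Longrightarrow> f (x \<oplus>\<^bsub>M\<^esub> y) = f x \<oplus>\<^bsub>N\<^esub> f y"
    "\<And>k x. k \<in> carrier K \<Longrightarrow> x \<in> carrier M \<Longrightarrow> f (k \<odot>\<^bsub>M\<^esub> x) = k \<odot>\<^bsub>N\<^esub> f x"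
  shows "klinear K M N f"
  using assms by (auto simp: klinear_def)

lemma klinear_closed: "klinear K M N f \<Longrightarrow> x \<in> carrier M \<Longrightarrow> f x \<in> carrier N"
  by (auto simp: klinear_def)

lemma klinear_add: "klinear K M N f \<Longrightarrow> x \<in> carrier M \<Longrightarrow> y \<in> carrier M \<Longrightarrow> f (x \<oplus>\<^bsub>M\<^esub> y) = f x \<oplus>\<^bsub>N\<^esub> f y"
  by (auto simp: klinear_def)

lemma klinear_smult: "klinear K M N f \<Longrightarrow> k \<in> carrier K \<Longrightarrow> x \<in> carrier M \<Longrightarrow> f (k \<odot>\<^bsub>M\<^esub> x) = k \<odot>\<^bsub>N\<^esub> f x"
  by (auto simp: klinear_def)

lemma klinear_additive: "klinear K M N f \<Longrightarrow> additive_map M N f"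
  by (auto simp: klinear_def additive_map_def)

lemma klinear_ident: "klinear K M M (\<lambda>x. x)"
  by (auto simp: klinear_def)

lemma klinear_comp: "klinear K N P g \<Longrightarrow> klinear K M N f \<Longrightarrow> klinear K M P (\<lambda>x. g (f x))"
  by (auto simp: klinear_def Pi_iff)

lemma klinear_addf:
  assumes "module K N" "klinear K M N f" "klinear K M N g"
  shows "klinear K M N (\<lambda>x. f x \<oplus>\<^bsub>N\<^esub> g x)"
proof -
  interpret N: module K N by fact
  show ?thesis
    using assms(2,3) by (auto simp: klinear_def Pi_iff N.M.a_ac N.smult_r_distr)
qed

lemma klinear_smultf:
  assumes "module K N" "klinear K M N f" "k \<in> carrier K"
  shows "klinear K M N (\<lambda>x. k \<odot>\<^bsub>N\<^esub> f x)"
proof -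
  interpret N: module K N by fact
  show ?thesis
    using assms(2,3)
    by (auto simp: klinear_def Pi_iff N.smult_r_distr N.smult_assoc1[symmetric] N.R.m_comm)
qed

lemma kbilinearI:
  "(\<And>x. x \<in> carrier L \<Longrightarrow> klinear K M N (b x)) \<Longrightarrow> (\<And>y. y \<in> carrier M \<Longrightarrow> klinear K L N (\<lambda>x. b x y))
    \<Longrightarrow> kbilinear K L M N b"
  by (auto simp: kbilinear_def)

lemma kbilinear_left: "kbilinear K L M N b \<Longrightarrow> klinear K P L f \<Longrightarrow> y \<in> carrier M \<Longrightarrow> klinear K P N (\<lambda>x. b (f x) y)"
  unfolding kbilinear_def by (rule klinear_comp[of K L N "\<lambda>x. b x y"]) auto

lemma kbilinear_right: "kbilinear K L M N b \<Longrightarrow> klinear K P M f \<Longrightarrow> x \<in> carrier L \<Longrightarrow> klinear K P N (\<lambda>y. b x (f y))"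
  unfolding kbilinear_def by (rule klinear_comp[of K M N "b x"]) auto

lemma kbilinear_closed: "kbilinear K L M N b \<Longrightarrow> x \<in> carrier L \<Longrightarrow> y \<in> carrier M \<Longrightarrow> b x y \<in> carrier N"
  by (auto simp: kbilinear_def klinear_def)

section \<open>Scalar multiplication on a tensor product and the induced linear maps\<close>

section \<open>Tensor products of modules\<close>

text \<open>Finite sums read only carrier, zero and addition of a record. This passes from the bare
  \<open>tensor_group\<close>, in which the operations of \<open>talg\<close> and
  \<open>btensor\<close> are defined, to the finished record.\<close>

lemma frag_sum_ring_cong:
  fixes Z :: "('z, 'm) ring_scheme" and Z' :: "('z, 'n) ring_scheme"
  assumes "carrier Z = carrier Z'" "\<zero>\<^bsub>Z\<^esub> = \<zero>\<^bsub>Z'\<^esub>" "ring.add Z = ring.add Z'"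
  shows "frag_sum Z f c = frag_sum Z' f c"
proof -
  have "[k] \<cdot>\<^bsub>Z\<^esub> x = [k] \<cdot>\<^bsub>Z'\<^esub> x" for k :: int and x
    by (simp add: add_pow_def int_pow_def nat_pow_def m_inv_def Let_def assms)
  then show ?thesis
    by (simp add: frag_sum_def finsum_def finprod_def assms)
qed

lemma tsum_ring_cong:
  fixes Z :: "('z, 'm) ring_scheme" and Z' :: "('z, 'n) ring_scheme"
  assumes "carrier Z = carrier Z'" "\<zero>\<^bsub>Z\<^esub> = \<zero>\<^bsub>Z'\<^esub>" "ring.add Z = ring.add Z'"
  shows "tsum Z X f = tsum Z' X f"
  unfolding tsum_frag_sum by (rule frag_sum_ring_cong[OF assms])

lemma ptens_ring_cong: "\<zero>\<^bsub>T\<^esub> = \<zero>\<^bsub>T'\<^esub> \<Longrightarrow> v \<boxtimes>\<^bsub>T\<^esub> w = v \<boxtimes>\<^bsub>T'\<^esub> w"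
  by (simp add: ptens_def)

text \<open>\<open>ptens_smult\<close> is the balancing relation itself for tensors over K. For
  tensors over A it follows by writing a scalar as a multiple of the unit of A. Stated as an
  assumption, it covers both.\<close>

locale tensor_module = tensor_product S r l V W T
  for K :: "('k, 'r) ring_scheme" and S :: "'s set" and r l
    and V :: "('k, 'v, 'm) module_scheme" and W :: "('k, 'w, 'n) module_scheme"
    and T :: "('k, ('v, 'w) tens, 't) module_scheme" +
  assumes KV: "module K V" and KW: "module K W"
    and r_smult: "k \<in> carrier K \<Longrightarrow> v \<in> carrier V \<Longrightarrow> s \<in> S \<Longrightarrow> r (k \<odot>\<^bsub>V\<^esub> v) s = k \<odot>\<^bsub>V\<^esub> r v s"
    and ptens_smult: "k \<in> carrier K \<Longrightarrow> v \<in> carrier V \<Longrightarrow> w \<in> carrier W \<Longrightarrow>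
      (k \<odot>\<^bsub>V\<^esub> v) \<boxtimes>\<^bsub>T\<^esub> w = v \<boxtimes>\<^bsub>T\<^esub> (k \<odot>\<^bsub>W\<^esub> w)"
    and T_smult: "k \<odot>\<^bsub>T\<^esub> X = tsum T X (\<lambda>v w. (k \<odot>\<^bsub>V\<^esub> v) \<boxtimes>\<^bsub>T\<^esub> w)"
begin

sublocale KV: module K V by (rule KV)
sublocale KW: module K W by (rule KW)

lemma smult_ptens:
  assumes "k \<in> carrier K" "v \<in> carrier V" "w \<in> carrier W"
  shows "k \<odot>\<^bsub>T\<^esub> (v \<boxtimes>\<^bsub>T\<^esub> w) = (k \<odot>\<^bsub>V\<^esub> v) \<boxtimes>\<^bsub>T\<^esub> w"
  unfolding T_smult using assms
  by (intro tsum_ptens[OF abelian_T])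
    (auto simp: KV.smult_r_distr ptens_add_left ptens_add_right r_smult[symmetric] ptens_balanced)

lemma smult_additive:
  assumes "k \<in> carrier K"
  shows "additive_map T T (\<lambda>X. k \<odot>\<^bsub>T\<^esub> X)"
  unfolding T_smult using assms
  by (intro tsum_additive[OF abelian_T])
    (auto simp: KV.smult_r_distr ptens_add_left ptens_add_right r_smult[symmetric] ptens_balanced)

lemma smult_closed: "k \<in> carrier K \<Longrightarrow> X \<in> carrier T \<Longrightarrow> k \<odot>\<^bsub>T\<^esub> X \<in> carrier T"
  and smult_add: "k \<in> carrier K \<Longrightarrow> X \<in> carrier T \<Longrightarrow> Y \<in> carrier T \<Longrightarrow>
    k \<odot>\<^bsub>T\<^esub> (X \<oplus>\<^bsub>T\<^esub> Y) = k \<odot>\<^bsub>T\<^esub> X \<oplus>\<^bsub>T\<^esub> k \<odot>\<^bsub>T\<^esub> Y"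
  using smult_additive[of k] by (auto simp: additive_map_def)

lemma module_T: "module K T"
proof (rule moduleI[OF KV.R.is_cring abelian_T])
  show "k \<odot>\<^bsub>T\<^esub> X \<in> carrier T" if "k \<in> carrier K" "X \<in> carrier T" for k X
    using that by (rule smult_closed)
  show "(a \<oplus>\<^bsub>K\<^esub> b) \<odot>\<^bsub>T\<^esub> X = a \<odot>\<^bsub>T\<^esub> X \<oplus>\<^bsub>T\<^esub> b \<odot>\<^bsub>T\<^esub> X"
    if "a \<in> carrier K" "b \<in> carrier K" "X \<in> carrier T" for a b X
    using that(3)
    by (induction rule: induct)
      (use that(1,2) in \<open>simp_all add: smult_ptens KV.smult_l_distr ptens_add_left smult_add smult_closed T.add.m_ac\<close>)
  show "k \<odot>\<^bsub>T\<^esub> (X \<oplus>\<^bsub>T\<^esub> Y) = k \<odot>\<^bsub>T\<^esub> X \<oplus>\<^bsub>T\<^esub> k \<odot>\<^bsub>T\<^esub> Y"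
    if "k \<in> carrier K" "X \<in> carrier T" "Y \<in> carrier T" for k X Y
    using that by (rule smult_add)
  show "(a \<otimes>\<^bsub>K\<^esub> b) \<odot>\<^bsub>T\<^esub> X = a \<odot>\<^bsub>T\<^esub> (b \<odot>\<^bsub>T\<^esub> X)"
    if "a \<in> carrier K" "b \<in> carrier K" "X \<in> carrier T" for a b X
    using that(3)
    by (induction rule: induct)
      (use that(1,2) in \<open>simp_all add: smult_ptens KV.smult_assoc1 smult_add smult_closed\<close>)
  show "\<one>\<^bsub>K\<^esub> \<odot>\<^bsub>T\<^esub> X = X" if "X \<in> carrier T" for X
    using that by (induction rule: induct) (simp_all add: smult_ptens smult_add)
qed

lemma kbilinear_ptens: "kbilinear K V W T (\<lambda>v w. v \<boxtimes>\<^bsub>T\<^esub> w)"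
  by (intro kbilinearI klinearI)
    (simp_all add: ptens_add_left ptens_add_right smult_ptens ptens_smult[symmetric])

context
  fixes Z :: "('k, 'z, 'q) module_scheme" and f :: "'v \<Rightarrow> 'w \<Rightarrow> 'z"
  assumes Z: "module K Z" and f: "kbilinear K V W Z f"
    and f_balanced: "\<And>v s w. v \<in> carrier V \<Longrightarrow> s \<in> S \<Longrightarrow> w \<in> carrier W \<Longrightarrow> f (r v s) w = f v (l s w)"
begin

interpretation Z: module K Z by (rule Z)

lemma kbilinear_tsum_ptens: "v \<in> carrier V \<Longrightarrow> w \<in> carrier W \<Longrightarrow> tsum Z (v \<boxtimes>\<^bsub>T\<^esub> w) f = f v w"
  by (rule tsum_ptens[OF Z.M.abelian_group_axioms])
    (use f in \<open>auto simp: kbilinear_def klinear_def f_balanced\<close>)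

lemma kbilinear_tsum: "klinear K T Z (\<lambda>X. tsum Z X f)"
proof -
  have add: "additive_map T Z (\<lambda>X. tsum Z X f)"
    by (rule tsum_additive[OF Z.M.abelian_group_axioms])
      (use f in \<open>auto simp: kbilinear_def klinear_def f_balanced\<close>)
  have "tsum Z (k \<odot>\<^bsub>T\<^esub> X) f = k \<odot>\<^bsub>Z\<^esub> tsum Z X f" if "k \<in> carrier K" "X \<in> carrier T" for k X
    using that(2)
  proof (induction rule: induct)
    case (ptens v w)
    then show ?case
      using that f
      by (simp add: smult_ptens kbilinear_tsum_ptens) (simp add: kbilinear_def klinear_def)
  next
    case (add X Y)
    then show ?case
      using that \<open>additive_map T Z _\<close>
      by (auto simp: smult_add smult_closed additive_map_def Z.smult_r_distr Pi_iff)
  qed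
  with add show ?thesis by (auto simp: klinear_def additive_map_def)
qed

end

lemma klinear_eqI:
  assumes "klinear K T Z g" "klinear K T Z h" "X \<in> carrier T"
    "\<And>v w. v \<in> carrier V \<Longrightarrow> w \<in> carrier W \<Longrightarrow> g (v \<boxtimes>\<^bsub>T\<^esub> w) = h (v \<boxtimes>\<^bsub>T\<^esub> w)"
  shows "g X = h X"
  using additive_map_eqI[OF assms(1,2)[THEN klinear_additive] assms(3,4)] .

text \<open>Here the tensor is fixed and the parameter varies, so linearity is inherited from the
  terms of a finite sum.\<close>

lemma klinear_tsumf:
  assumes "module K Z" "X \<in> carrier T"
    "\<And>v w. v \<in> carrier V \<Longrightarrow> w \<in> carrier W \<Longrightarrow> klinear K M Z (\<lambda>a. f a v w)"
  shows "klinear K M Z (\<lambda>a. tsum Z X (f a))"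
proof (rule klinearI)
  interpret Z: module K Z by fact
  note ab = Z.M.abelian_group_axioms
  show "tsum Z X (f a) \<in> carrier Z" if "a \<in> carrier M" for a
    by (rule tsum_closed[OF ab assms(2)]) (rule klinear_closed[OF assms(3) that])
  show "tsum Z X (f (a \<oplus>\<^bsub>M\<^esub> b)) = tsum Z X (f a) \<oplus>\<^bsub>Z\<^esub> tsum Z X (f b)"
    if "a \<in> carrier M" "b \<in> carrier M" for a b
    using that assms(2) klinear_closed[OF assms(3)] klinear_add[OF assms(3)]
    by (subst tsum_addf[OF ab, symmetric]) (simp_all cong: tsum_cong)
  show "tsum Z X (f (k \<odot>\<^bsub>M\<^esub> a)) = k \<odot>\<^bsub>Z\<^esub> tsum Z X (f a)"
    if "k \<in> carrier K" "a \<in> carrier M" for k a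
    using that assms(2) klinear_closed[OF assms(3)] klinear_smult[OF assms(3)]
    by (subst tsum_hom[OF ab ab, where h = "\<lambda>x. k \<odot>\<^bsub>Z\<^esub> x"])
      (simp_all add: additive_map_def Z.smult_r_distr cong: tsum_cong)
qed

end

section \<open>The algebra structure on a tensor product of algebras over K\<close>

section \<open>Tensor products of algebras\<close>

lemma talg_tensor_module:
  assumes "module K A" "module K B"
  shows "tensor_module K (carrier K) (\<lambda>a k. k \<odot>\<^bsub>A\<^esub> a) (\<lambda>k b. k \<odot>\<^bsub>B\<^esub> b) A B (talg K A B)"
proof -
  interpret A: module K A by fact
  interpret B: module K B by fact
  let ?T = "talg K A B"
  interpret tensor_product "carrier K" "\<lambda>a k. k \<odot>\<^bsub>A\<^esub> a" "\<lambda>k b. k \<odot>\<^bsub>B\<^esub> b" A B ?T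
    by unfold_locales (auto simp: talg_def Let_def)
  show ?thesis
  proof unfold_locales
    show "(k \<odot>\<^bsub>A\<^esub> v) \<boxtimes>\<^bsub>?T\<^esub> w = v \<boxtimes>\<^bsub>?T\<^esub> (k \<odot>\<^bsub>B\<^esub> w)"
      if "k \<in> carrier K" "v \<in> carrier A" "w \<in> carrier B" for k v w
      using that ptens_balanced by blast
    show "k \<odot>\<^bsub>?T\<^esub> X = tsum ?T X (\<lambda>v w. (k \<odot>\<^bsub>A\<^esub> v) \<boxtimes>\<^bsub>?T\<^esub> w)" for k X
    proof -
      let ?G = "tensor_group (carrier K) (\<lambda>a k. k \<odot>\<^bsub>A\<^esub> a) (\<lambda>k b. k \<odot>\<^bsub>B\<^esub> b) A B"
      have eq: "carrier ?G = carrier ?T" "\<zero>\<^bsub>?G\<^esub> = \<zero>\<^bsub>?T\<^esub>" "ring.add ?G = ring.add ?T"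
        by (auto simp: talg_def Let_def)
      have "k \<odot>\<^bsub>?T\<^esub> X = tsum ?G X (\<lambda>v w. (k \<odot>\<^bsub>A\<^esub> v) \<boxtimes>\<^bsub>?G\<^esub> w)"
        by (simp add: talg_def Let_def tmap_def tsum_def)
      then show ?thesis
        by (simp only: tsum_ring_cong[OF eq] ptens_ring_cong[OF eq(2)])
    qed
  qed (auto simp: A.smult_assoc1[symmetric] B.smult_assoc1[symmetric] A.R.m_comm A.smult_r_distr)
qed

definition alg_hom :: "('k, 'r) ring_scheme \<Rightarrow> ('k, 'a, 'm) module_scheme \<Rightarrow> ('k, 'b, 'n) module_scheme
    \<Rightarrow> ('a \<Rightarrow> 'b) \<Rightarrow> bool" where
  "alg_hom K A B h \<longleftrightarrow> h \<in> ring_hom A B \<and> klinear K A B h"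

definition ktrilinear ::
    "('k, 'r) ring_scheme \<Rightarrow> ('k, 'a, 'l) module_scheme \<Rightarrow> ('k, 'b, 'm) module_scheme
      \<Rightarrow> ('k, 'c, 'n) module_scheme \<Rightarrow> ('k, 'z, 'o) module_scheme \<Rightarrow> ('a \<Rightarrow> 'b \<Rightarrow> 'c \<Rightarrow> 'z) \<Rightarrow> bool" where
  "ktrilinear K A B C Z f \<longleftrightarrow>
     (\<forall>a\<in>carrier A. kbilinear K B C Z (f a)) \<and>
     (\<forall>c\<in>carrier C. kbilinear K A B Z (\<lambda>a b. f a b c))"

lemma ktrilinearI:
  assumes "\<And>b c. b \<in> carrier B \<Longrightarrow> c \<in> carrier C \<Longrightarrow> klinear K A Z (\<lambda>a. f a b c)"
    "\<And>a c. a \<in> carrier A \<Longrightarrow> c \<in> carrier C \<Longrightarrow> klinear K B Z (\<lambda>b. f a b c)"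
    "\<And>a b. a \<in> carrier A \<Longrightarrow> b \<in> carrier B \<Longrightarrow> klinear K C Z (\<lambda>c. f a b c)"
  shows "ktrilinear K A B C Z f"
  using assms by (auto simp: ktrilinear_def kbilinear_def)

lemma ktrilinear_closed:
  "ktrilinear K A B C Z f \<Longrightarrow> a \<in> carrier A \<Longrightarrow> b \<in> carrier B \<Longrightarrow> c \<in> carrier C \<Longrightarrow> f a b c \<in> carrier Z"
  unfolding ktrilinear_def by (blast intro: kbilinear_closed)

text \<open>Evaluation of a trilinear map on (H \<otimes> H) \<otimes> H, the bracketing in which
  \<open>comult_id\<close>, \<open>id_comult\<close> and the legs take their values.\<close>

definition tsum3 :: "('z, 'm) ring_scheme \<Rightarrow> (('u, 'v) tens, 'w) tens \<Rightarrow> ('u \<Rightarrow> 'v \<Rightarrow> 'w \<Rightarrow> 'z) \<Rightarrow> 'z" where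
  "tsum3 Z X f = tsum Z X (\<lambda>p c. tsum Z p (\<lambda>a b. f a b c))"

locale tensor_algebra =
  fixes K :: "('k, 'r) ring_scheme" and A :: "('k, 'a, 'm) module_scheme"
    and B :: "('k, 'b, 'n) module_scheme"
  assumes A: "assoc_algebra K A" and B: "assoc_algebra K B"
begin

sublocale A: ring A using A by (simp add: assoc_algebra_def)
sublocale B: ring B using B by (simp add: assoc_algebra_def)

abbreviation (input) "T \<equiv> talg K A B"

sublocale tensor_module K "carrier K" "\<lambda>a k. k \<odot>\<^bsub>A\<^esub> a" "\<lambda>k b. k \<odot>\<^bsub>B\<^esub> b" A B T
  by (rule talg_tensor_module) (use A B in \<open>auto simp: assoc_algebra_def\<close>)

lemma A_mult: "kbilinear K A A A (\<lambda>a b. a \<otimes>\<^bsub>A\<^esub> b)"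
  using A by (simp add: assoc_algebra_def)

lemma B_mult: "kbilinear K B B B (\<lambda>a b. a \<otimes>\<^bsub>B\<^esub> b)"
  using B by (simp add: assoc_algebra_def)

context
  fixes Z :: "('k, 'z, 'q) module_scheme" and f :: "'a \<Rightarrow> 'b \<Rightarrow> 'z"
  assumes Z: "module K Z" and f: "kbilinear K A B Z f"
begin

text \<open>Over K the balancing relation is part of bilinearity, so for Sweedler sums in H only
  linearity in each variable has to be checked.\<close>

lemma bilinear_balanced:
  "a \<in> carrier A \<Longrightarrow> k \<in> carrier K \<Longrightarrow> b \<in> carrier B \<Longrightarrow> f (k \<odot>\<^bsub>A\<^esub> a) b = f a (k \<odot>\<^bsub>B\<^esub> b)"
  using f by (simp add: kbilinear_def klinear_def)

lemma bilinear_tsum_ptens: "a \<in> carrier A \<Longrightarrow> b \<in> carrier B \<Longrightarrow> tsum Z (a \<boxtimes>\<^bsub>T\<^esub> b) f = f a b"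
  using kbilinear_tsum_ptens[OF Z f] bilinear_balanced by simp

lemma bilinear_tsum: "klinear K T Z (\<lambda>X. tsum Z X f)"
  using kbilinear_tsum[OF Z f] bilinear_balanced by simp

lemma bilinear_tsum_comp: "klinear K M T g \<Longrightarrow> klinear K M Z (\<lambda>x. tsum Z (g x) f)"
  by (rule klinear_comp[OF bilinear_tsum])

end

lemma mult_tsum:
  "X \<otimes>\<^bsub>T\<^esub> Y = tsum T X (\<lambda>a b. tsum T Y (\<lambda>a' b'. (a \<otimes>\<^bsub>A\<^esub> a') \<boxtimes>\<^bsub>T\<^esub> (b \<otimes>\<^bsub>B\<^esub> b')))"
proof -
  let ?G = "tensor_group (carrier K) (\<lambda>a k. k \<odot>\<^bsub>A\<^esub> a) (\<lambda>k b. k \<odot>\<^bsub>B\<^esub> b) A B"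
  have eq: "carrier ?G = carrier T" "\<zero>\<^bsub>?G\<^esub> = \<zero>\<^bsub>T\<^esub>" "ring.add ?G = ring.add T"
    by (auto simp: talg_def Let_def)
  have "X \<otimes>\<^bsub>T\<^esub> Y = tsum ?G X (\<lambda>a b. tsum ?G Y (\<lambda>a' b'. (a \<otimes>\<^bsub>A\<^esub> a') \<boxtimes>\<^bsub>?G\<^esub> (b \<otimes>\<^bsub>B\<^esub> b')))"
    by (simp add: talg_def Let_def tsum_def)
  then show ?thesis
    by (simp only: tsum_ring_cong[OF eq] ptens_ring_cong[OF eq(2)])
qed

lemma bilinear_mult_left:
  assumes "a \<in> carrier A" "b \<in> carrier B"
  shows "kbilinear K A B T (\<lambda>a' b'. (a \<otimes>\<^bsub>A\<^esub> a') \<boxtimes>\<^bsub>T\<^esub> (b \<otimes>\<^bsub>B\<^esub> b'))"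
  using assms
  by (intro kbilinearI kbilinear_left[OF kbilinear_ptens] kbilinear_right[OF kbilinear_ptens]
      kbilinear_right[OF A_mult] kbilinear_right[OF B_mult] klinear_ident) auto

lemma bilinear_mult_tsum:
  assumes "Y \<in> carrier T"
  shows "kbilinear K A B T (\<lambda>a b. tsum T Y (\<lambda>a' b'. (a \<otimes>\<^bsub>A\<^esub> a') \<boxtimes>\<^bsub>T\<^esub> (b \<otimes>\<^bsub>B\<^esub> b')))"
  using assms
  by (intro kbilinearI klinear_tsumf[OF module_T] kbilinear_left[OF kbilinear_ptens] kbilinear_right[OF kbilinear_ptens]
      kbilinear_left[OF A_mult] kbilinear_left[OF B_mult] klinear_ident) auto

lemma mult_ptens:
  assumes "a \<in> carrier A" "b \<in> carrier B" "a' \<in> carrier A" "b' \<in> carrier B"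
  shows "(a \<boxtimes>\<^bsub>T\<^esub> b) \<otimes>\<^bsub>T\<^esub> (a' \<boxtimes>\<^bsub>T\<^esub> b') = (a \<otimes>\<^bsub>A\<^esub> a') \<boxtimes>\<^bsub>T\<^esub> (b \<otimes>\<^bsub>B\<^esub> b')"
  unfolding mult_tsum using assms
  by (simp add: bilinear_tsum_ptens[OF module_T] bilinear_mult_left bilinear_mult_tsum)

lemma bilinear_mult: "kbilinear K T T T (\<lambda>X Y. X \<otimes>\<^bsub>T\<^esub> Y)"
proof (rule kbilinearI)
  show "klinear K T T (\<lambda>X. X \<otimes>\<^bsub>T\<^esub> Y)" if "Y \<in> carrier T" for Y
    unfolding mult_tsum using that
    by (intro bilinear_tsum[OF module_T] bilinear_mult_tsum)
  show "klinear K T T (\<lambda>Y. X \<otimes>\<^bsub>T\<^esub> Y)" if "X \<in> carrier T" for X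
    unfolding mult_tsum using that
    by (intro klinear_tsumf[OF module_T] bilinear_tsum[OF module_T] bilinear_mult_left)
qed

lemma one_eq: "\<one>\<^bsub>T\<^esub> = \<one>\<^bsub>A\<^esub> \<boxtimes>\<^bsub>T\<^esub> \<one>\<^bsub>B\<^esub>"
  by (simp add: talg_def Let_def ptens_def)

lemma mult_closed: "X \<in> carrier T \<Longrightarrow> Y \<in> carrier T \<Longrightarrow> X \<otimes>\<^bsub>T\<^esub> Y \<in> carrier T"
  using bilinear_mult by (rule kbilinear_closed)

lemma mult_l_distr: "X \<in> carrier T \<Longrightarrow> Y \<in> carrier T \<Longrightarrow> U \<in> carrier T \<Longrightarrow>
    (X \<oplus>\<^bsub>T\<^esub> Y) \<otimes>\<^bsub>T\<^esub> U = X \<otimes>\<^bsub>T\<^esub> U \<oplus>\<^bsub>T\<^esub> Y \<otimes>\<^bsub>T\<^esub> U"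
  and mult_r_distr: "X \<in> carrier T \<Longrightarrow> Y \<in> carrier T \<Longrightarrow> U \<in> carrier T \<Longrightarrow>
    U \<otimes>\<^bsub>T\<^esub> (X \<oplus>\<^bsub>T\<^esub> Y) = U \<otimes>\<^bsub>T\<^esub> X \<oplus>\<^bsub>T\<^esub> U \<otimes>\<^bsub>T\<^esub> Y"
  using bilinear_mult by (simp_all add: kbilinear_def klinear_def)

lemma assoc_algebra_T: "assoc_algebra K T"
proof -
  have assoc: "(X \<otimes>\<^bsub>T\<^esub> Y) \<otimes>\<^bsub>T\<^esub> U = X \<otimes>\<^bsub>T\<^esub> (Y \<otimes>\<^bsub>T\<^esub> U)"
    if "X \<in> carrier T" "Y \<in> carrier T" "U \<in> carrier T" for X Y U
    using that(1)
  proof (induction rule: induct)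
    case (ptens a b)
    show ?case
      using that(2)
    proof (induction rule: induct)
      case (ptens a' b')
      show ?case
        using that(3)
        by (induction rule: induct)
          (use \<open>a \<in> _\<close> \<open>b \<in> _\<close> ptens in \<open>simp_all add: mult_ptens A.m_assoc B.m_assoc mult_r_distr mult_closed\<close>)
    qed (use that ptens in \<open>simp add: mult_l_distr mult_r_distr mult_closed\<close>)
  qed (use that in \<open>simp add: mult_l_distr mult_closed\<close>)
  have one: "\<one>\<^bsub>T\<^esub> \<in> carrier T" by (simp add: one_eq)
  have l_one: "\<one>\<^bsub>T\<^esub> \<otimes>\<^bsub>T\<^esub> X = X" if "X \<in> carrier T" for X
    using that
    by (induction rule: induct) (simp_all add: one_eq mult_ptens mult_r_distr)
  have r_one: "X \<otimes>\<^bsub>T\<^esub> \<one>\<^bsub>T\<^esub> = X" if "X \<in> carrier T" for X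
    using that
    by (induction rule: induct) (simp_all add: one_eq mult_ptens mult_l_distr)
  have "ring T"
    by (intro ringI abelian_T monoidI) (simp_all add: mult_closed mult_l_distr mult_r_distr assoc one l_one r_one)
  then show ?thesis by (simp add: assoc_algebra_def module_T bilinear_mult)
qed

sublocale T: ring T using assoc_algebra_T by (simp add: assoc_algebra_def)

text \<open>The product is itself defined as a sum of pure tensors; evaluation, being additive for
  bilinear \<open>f\<close>, is pushed through that sum. All Sweedler rules for products come from
  here.\<close>

lemma tsum_mult:
  assumes "module K Z" "kbilinear K A B Z f" "X \<in> carrier T" "Y \<in> carrier T"
  shows "tsum Z (X \<otimes>\<^bsub>T\<^esub> Y) f = tsum Z X (\<lambda>a b. tsum Z Y (\<lambda>a' b'. f (a \<otimes>\<^bsub>A\<^esub> a') (b \<otimes>\<^bsub>B\<^esub> b')))"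
proof -
  interpret Z: module K Z by fact
  note ab = Z.M.abelian_group_axioms
  note add = klinear_additive[OF bilinear_tsum[OF assms(1,2)]]
  have "tsum Z (X \<otimes>\<^bsub>T\<^esub> Y) f
      = tsum Z X (\<lambda>a b. tsum Z (tsum T Y (\<lambda>a' b'. (a \<otimes>\<^bsub>A\<^esub> a') \<boxtimes>\<^bsub>T\<^esub> (b \<otimes>\<^bsub>B\<^esub> b'))) f)"
    unfolding mult_tsum using assms
    by (intro tsum_hom[OF abelian_T ab add])
      (auto intro!: tsum_closed[OF abelian_T])
  also have "\<dots> = tsum Z X (\<lambda>a b. tsum Z Y (\<lambda>a' b'. f (a \<otimes>\<^bsub>A\<^esub> a') (b \<otimes>\<^bsub>B\<^esub> b')))"
    using assms
    by (intro tsum_cong) (simp_all add: tsum_hom[OF abelian_T ab add] bilinear_tsum_ptens cong: tsum_cong)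
  finally show ?thesis .
qed

lemma alg_homI:
  assumes C: "assoc_algebra K C" and lin: "klinear K T C h"
    and one: "h (\<one>\<^bsub>A\<^esub> \<boxtimes>\<^bsub>T\<^esub> \<one>\<^bsub>B\<^esub>) = \<one>\<^bsub>C\<^esub>"
    and mult: "\<And>a b a' b'. a \<in> carrier A \<Longrightarrow> b \<in> carrier B \<Longrightarrow> a' \<in> carrier A \<Longrightarrow> b' \<in> carrier B \<Longrightarrow>
      h ((a \<otimes>\<^bsub>A\<^esub> a') \<boxtimes>\<^bsub>T\<^esub> (b \<otimes>\<^bsub>B\<^esub> b')) = h (a \<boxtimes>\<^bsub>T\<^esub> b) \<otimes>\<^bsub>C\<^esub> h (a' \<boxtimes>\<^bsub>T\<^esub> b')"
  shows "alg_hom K T C h"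
proof -
  interpret C: ring C using C by (simp add: assoc_algebra_def)
  have h: "h X \<in> carrier C" if "X \<in> carrier T" for X
    using lin that by (rule klinear_closed)
  have hadd: "h (X \<oplus>\<^bsub>T\<^esub> Y) = h X \<oplus>\<^bsub>C\<^esub> h Y" if "X \<in> carrier T" "Y \<in> carrier T" for X Y
    using lin that by (rule klinear_add)
  have "h (X \<otimes>\<^bsub>T\<^esub> Y) = h X \<otimes>\<^bsub>C\<^esub> h Y" if "X \<in> carrier T" "Y \<in> carrier T" for X Y
    using that(1)
  proof (induction rule: induct)
    case (ptens a b)
    show ?case
      using that(2)
      by (induction rule: induct)
        (use ptens in \<open>simp_all add: mult_ptens mult h hadd mult_r_distr mult_closed C.r_distr\<close>)
  qed (use that in \<open>simp add: h hadd mult_l_distr mult_closed C.l_distr\<close>)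
  then show ?thesis
    using one lin h hadd by (simp add: alg_hom_def ring_hom_def one_eq)
qed

end

lemma alg_hom_one: "alg_hom K A B h \<Longrightarrow> h \<one>\<^bsub>A\<^esub> = \<one>\<^bsub>B\<^esub>"
  and alg_hom_mult: "alg_hom K A B h \<Longrightarrow> x \<in> carrier A \<Longrightarrow> y \<in> carrier A \<Longrightarrow> h (x \<otimes>\<^bsub>A\<^esub> y) = h x \<otimes>\<^bsub>B\<^esub> h y"
  and alg_hom_klinear: "alg_hom K A B h \<Longrightarrow> klinear K A B h"
  and alg_hom_closed: "alg_hom K A B h \<Longrightarrow> x \<in> carrier A \<Longrightarrow> h x \<in> carrier B"
  by (auto simp: alg_hom_def ring_hom_def)

lemma alg_hom_ident: "alg_hom K A A id" "alg_hom K A A (\<lambda>x. x)"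
  by (auto simp: alg_hom_def ring_hom_def klinear_def)

lemma alg_hom_comp: "alg_hom K A B f \<Longrightarrow> alg_hom K B C g \<Longrightarrow> alg_hom K A C (\<lambda>x. g (f x))"
  by (auto simp: alg_hom_def ring_hom_def klinear_def Pi_iff)

text \<open>Inverses are unique, so an algebra map carries them along. Applied to the legs and
  coproducts of F and R, this yields the corresponding identities for their inverses.\<close>

lemma alg_hom_unit_inv:
  assumes A: "assoc_algebra K A" and B: "assoc_algebra K B" and h: "alg_hom K A B h" and u: "u \<in> Units A"
  shows "h u \<in> Units B" "h (inv\<^bsub>A\<^esub> u) = inv\<^bsub>B\<^esub> h u"
proof -
  interpret A: ring A using A by (simp add: assoc_algebra_def)
  interpret B: ring B using B by (simp add: assoc_algebra_def)
  have u': "u \<in> carrier A" "inv\<^bsub>A\<^esub> u \<in> carrier A" using u by auto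
  have eq: "h u \<otimes>\<^bsub>B\<^esub> h (inv\<^bsub>A\<^esub> u) = \<one>\<^bsub>B\<^esub>" "h (inv\<^bsub>A\<^esub> u) \<otimes>\<^bsub>B\<^esub> h u = \<one>\<^bsub>B\<^esub>"
    using u u' by (simp_all add: alg_hom_mult[OF h, symmetric] alg_hom_one[OF h])
  have cl: "h u \<in> carrier B" "h (inv\<^bsub>A\<^esub> u) \<in> carrier B"
    using u' alg_hom_closed[OF h] by simp_all
  show "h u \<in> Units B" using eq cl by (auto simp: Units_def)
  show "h (inv\<^bsub>A\<^esub> u) = inv\<^bsub>B\<^esub> h u" using B.inv_unique'[OF cl(1,2) eq] .
qed

lemma tmap_eq: "tmap T f g X = tsum T X (\<lambda>v w. f v \<boxtimes>\<^bsub>T\<^esub> g w)"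
  by (simp add: tmap_def tsum_def)

lemma tassoc_eq: "tassoc T XY X = tsum T X (\<lambda>x q. tsum T q (\<lambda>y z. (x \<boxtimes>\<^bsub>XY\<^esub> y) \<boxtimes>\<^bsub>T\<^esub> z))"
  by (simp add: tassoc_def tsum_def)

lemma tmap_alg_hom:
  assumes "assoc_algebra K A" "assoc_algebra K B" "assoc_algebra K A'" "assoc_algebra K B'"
    and f: "alg_hom K A A' f" and g: "alg_hom K B B' g"
  shows "alg_hom K (talg K A B) (talg K A' B') (tmap (talg K A' B') f g)"
    and "a \<in> carrier A \<Longrightarrow> b \<in> carrier B \<Longrightarrow>
      tmap (talg K A' B') f g (a \<boxtimes>\<^bsub>talg K A B\<^esub> b) = f a \<boxtimes>\<^bsub>talg K A' B'\<^esub> g b"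
    and "kbilinear K A B (talg K A' B') (\<lambda>a b. f a \<boxtimes>\<^bsub>talg K A' B'\<^esub> g b)"
proof -
  interpret T: tensor_algebra K A B by unfold_locales fact+
  interpret T': tensor_algebra K A' B' by unfold_locales fact+
  note [simp] = alg_hom_closed[OF f] alg_hom_closed[OF g] alg_hom_mult[OF f] alg_hom_mult[OF g]
    alg_hom_one[OF f] alg_hom_one[OF g]
  show bil: "kbilinear K A B (talg K A' B') (\<lambda>a b. f a \<boxtimes>\<^bsub>talg K A' B'\<^esub> g b)"
    by (intro kbilinearI kbilinear_left[OF T'.kbilinear_ptens] kbilinear_right[OF T'.kbilinear_ptens]
        alg_hom_klinear[OF f] alg_hom_klinear[OF g]) simp_all
  note val = T.bilinear_tsum_ptens[OF T'.module_T bil]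
  show "tmap (talg K A' B') f g (a \<boxtimes>\<^bsub>talg K A B\<^esub> b) = f a \<boxtimes>\<^bsub>talg K A' B'\<^esub> g b"
    if "a \<in> carrier A" "b \<in> carrier B" for a b
    using that by (simp add: tmap_eq val)
  show "alg_hom K (talg K A B) (talg K A' B') (tmap (talg K A' B') f g)"
    unfolding tmap_eq[abs_def]
    by (rule T.alg_homI[OF T'.assoc_algebra_T T.bilinear_tsum[OF T'.module_T bil]])
      (simp_all add: val T'.one_eq T'.mult_ptens)
qed

text \<open>The second claim keeps \<open>q\<close> arbitrary because \<open>id_comult\<close> puts
  a coproduct, not a pure tensor, into the second slot. Multiplicativity is a check on pure
  tensors.\<close>

lemma tassoc_alg_hom:
  assumes "assoc_algebra K A" "assoc_algebra K B" "assoc_algebra K C"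
  shows "alg_hom K (talg K A (talg K B C)) (talg K (talg K A B) C) (tassoc (talg K (talg K A B) C) (talg K A B))"
    and "a \<in> carrier A \<Longrightarrow> q \<in> carrier (talg K B C) \<Longrightarrow>
      tassoc (talg K (talg K A B) C) (talg K A B) (a \<boxtimes>\<^bsub>talg K A (talg K B C)\<^esub> q) = tsum (talg K (talg K A B) C) q (\<lambda>b c. (a \<boxtimes>\<^bsub>talg K A B\<^esub> b) \<boxtimes>\<^bsub>talg K (talg K A B) C\<^esub> c)"
proof -
  let ?S = "talg K A (talg K B C)" and ?T = "talg K (talg K A B) C"
  interpret AB: tensor_algebra K A B by unfold_locales fact+
  interpret BC: tensor_algebra K B C by unfold_locales fact+
  interpret S: tensor_algebra K A "talg K B C" by unfold_locales (fact | rule BC.assoc_algebra_T)+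
  interpret T: tensor_algebra K "talg K A B" C by unfold_locales (fact | rule AB.assoc_algebra_T)+
  have bil: "kbilinear K B C ?T (\<lambda>b c. (a \<boxtimes>\<^bsub>talg K A B\<^esub> b) \<boxtimes>\<^bsub>?T\<^esub> c)" if "a \<in> carrier A" for a
    using that
    by (intro kbilinearI kbilinear_left[OF T.kbilinear_ptens] kbilinear_right[OF T.kbilinear_ptens]
        kbilinear_right[OF AB.kbilinear_ptens] klinear_ident) simp_all
  have bil2: "kbilinear K A (talg K B C) ?T (\<lambda>a q. tsum ?T q (\<lambda>b c. (a \<boxtimes>\<^bsub>talg K A B\<^esub> b) \<boxtimes>\<^bsub>?T\<^esub> c))"
  proof (rule kbilinearI)
    show "klinear K (talg K B C) ?T (\<lambda>q. tsum ?T q (\<lambda>b c. (a \<boxtimes>\<^bsub>talg K A B\<^esub> b) \<boxtimes>\<^bsub>?T\<^esub> c))" if "a \<in> carrier A" for a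
      by (rule BC.bilinear_tsum[OF T.module_T bil[OF that]])
    show "klinear K A ?T (\<lambda>a. tsum ?T q (\<lambda>b c. (a \<boxtimes>\<^bsub>talg K A B\<^esub> b) \<boxtimes>\<^bsub>?T\<^esub> c))" if "q \<in> carrier (talg K B C)" for q
      using that
      by (intro BC.klinear_tsumf[OF T.module_T] kbilinear_left[OF T.kbilinear_ptens]
          kbilinear_left[OF AB.kbilinear_ptens] klinear_ident)
  qed
  note val = S.bilinear_tsum_ptens[OF T.module_T bil2]
  show val': "tassoc ?T (talg K A B) (a \<boxtimes>\<^bsub>?S\<^esub> q) = tsum ?T q (\<lambda>b c. (a \<boxtimes>\<^bsub>talg K A B\<^esub> b) \<boxtimes>\<^bsub>?T\<^esub> c)"
    if "a \<in> carrier A" "q \<in> carrier (talg K B C)" for a q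
    using that by (simp add: tassoc_eq val)
  have val3: "tassoc ?T (talg K A B) (a \<boxtimes>\<^bsub>?S\<^esub> (b \<boxtimes>\<^bsub>talg K B C\<^esub> c)) = (a \<boxtimes>\<^bsub>talg K A B\<^esub> b) \<boxtimes>\<^bsub>?T\<^esub> c"
    if "a \<in> carrier A" "b \<in> carrier B" "c \<in> carrier C" for a b c
    using that by (simp add: val' BC.bilinear_tsum_ptens[OF T.module_T bil])
  have lin: "klinear K ?S ?T (tassoc ?T (talg K A B))"
    unfolding tassoc_eq[abs_def]
    by (rule S.bilinear_tsum[OF T.module_T bil2])
  have clos: "tassoc ?T (talg K A B) X \<in> carrier ?T" if "X \<in> carrier ?S" for X
    using lin that by (rule klinear_closed)
  have add: "tassoc ?T (talg K A B) (X \<oplus>\<^bsub>?S\<^esub> Y) = tassoc ?T (talg K A B) X \<oplus>\<^bsub>?T\<^esub> tassoc ?T (talg K A B) Y"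
    if "X \<in> carrier ?S" "Y \<in> carrier ?S" for X Y
    using lin that by (rule klinear_add)
  have "tassoc ?T (talg K A B) ((a \<otimes>\<^bsub>A\<^esub> a') \<boxtimes>\<^bsub>?S\<^esub> (q \<otimes>\<^bsub>talg K B C\<^esub> q'))
      = tassoc ?T (talg K A B) (a \<boxtimes>\<^bsub>?S\<^esub> q) \<otimes>\<^bsub>?T\<^esub> tassoc ?T (talg K A B) (a' \<boxtimes>\<^bsub>?S\<^esub> q')"
    if a: "a \<in> carrier A" "a' \<in> carrier A" and q: "q \<in> carrier (talg K B C)" "q' \<in> carrier (talg K B C)" for a a' q q'
    using q(1)
  proof (induction rule: BC.induct)
    case (ptens b c)
    show ?case
      using q(2)
      by (induction rule: BC.induct)
        (use a ptens in \<open>simp_all add: BC.mult_ptens val3 T.mult_ptens AB.mult_ptens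
          BC.mult_r_distr S.ptens_add_right BC.mult_closed add clos T.T.r_distr\<close>)
  qed (use a q in \<open>simp add: BC.mult_l_distr S.ptens_add_right BC.mult_closed add clos T.T.l_distr\<close>)
  then show "alg_hom K ?S ?T (tassoc ?T (talg K A B))"
    by (intro S.alg_homI) (use T.assoc_algebra_T lin val3 in \<open>simp_all add: BC.one_eq T.one_eq AB.one_eq\<close>)
qed

section \<open>Sweedler notation for coproduct, counit, antipode and legs\<close>

section \<open>Sweedler calculus in a Hopf algebra\<close>

text \<open>Rules for linearity of an expression in one variable. \<open>intro klin\<close>
  discharges the bilinearity obligations that accompany the rewriting of a Sweedler sum.\<close>

named_theorems klin

locale hopf_alg =
  fixes K :: "('k, 'r) ring_scheme" and H :: "('k, 'h) hopf"
  assumes hopf: "hopf_algebra K H"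
begin

lemma H_alg: "assoc_algebra K H"
  using hopf by (simp add: hopf_algebra_def)

sublocale HH: tensor_algebra K H H
  by unfold_locales (rule H_alg)+
sublocale HHH: tensor_algebra K "HH K H" H
  by unfold_locales (rule H_alg HH.assoc_algebra_T)+
sublocale H_HH: tensor_algebra K H "HH K H"
  by unfold_locales (rule H_alg HH.assoc_algebra_T)+

abbreviation (input) H_mult (infixl \<open>\<bullet>\<close> 70) where "x \<bullet> y \<equiv> x \<otimes>\<^bsub>H\<^esub> y"
abbreviation (input) "\<Delta> \<equiv> comult H"
abbreviation (input) "S \<equiv> antipode H"
abbreviation (input) "\<epsilon> \<equiv> counit H"

lemma comult_alg_hom: "alg_hom K H (HH K H) \<Delta>"
  using hopf by (simp add: hopf_algebra_def alg_hom_def)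

lemma klinear_comult: "klinear K H (HH K H) \<Delta>"
  by (rule alg_hom_klinear[OF comult_alg_hom])

lemma comult_closed [simp]: "\<xi> \<in> carrier H \<Longrightarrow> \<Delta> \<xi> \<in> carrier (HH K H)"
  by (rule alg_hom_closed[OF comult_alg_hom])

lemma klinear_antipode: "klinear K H H S"
  using hopf by (simp add: hopf_algebra_def)

lemma antipode_closed [simp]: "\<xi> \<in> carrier H \<Longrightarrow> S \<xi> \<in> carrier H"
  by (rule klinear_closed[OF klinear_antipode])

lemma counit_closed [simp]: "\<xi> \<in> carrier H \<Longrightarrow> \<epsilon> \<xi> \<in> carrier K"
  using hopf by (auto simp: hopf_algebra_def ring_hom_def)

lemma counit_one: "\<epsilon> \<one>\<^bsub>H\<^esub> = \<one>\<^bsub>K\<^esub>"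
  and counit_add: "\<xi> \<in> carrier H \<Longrightarrow> \<eta> \<in> carrier H \<Longrightarrow> \<epsilon> (\<xi> \<oplus>\<^bsub>H\<^esub> \<eta>) = \<epsilon> \<xi> \<oplus>\<^bsub>K\<^esub> \<epsilon> \<eta>"
  and counit_mult: "\<xi> \<in> carrier H \<Longrightarrow> \<eta> \<in> carrier H \<Longrightarrow> \<epsilon> (\<xi> \<bullet> \<eta>) = \<epsilon> \<xi> \<otimes>\<^bsub>K\<^esub> \<epsilon> \<eta>"
  and counit_smult: "k \<in> carrier K \<Longrightarrow> \<xi> \<in> carrier H \<Longrightarrow> \<epsilon> (k \<odot>\<^bsub>H\<^esub> \<xi>) = k \<otimes>\<^bsub>K\<^esub> \<epsilon> \<xi>"
  using hopf by (auto simp: hopf_algebra_def ring_hom_def)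

lemma klinear_counit:
  assumes "module K Z" "klinear K M H f" "z \<in> carrier Z"
  shows "klinear K M Z (\<lambda>\<xi>. \<epsilon> (f \<xi>) \<odot>\<^bsub>Z\<^esub> z)"
proof -
  interpret Z: module K Z by fact
  show ?thesis
    using assms(3) klinear_closed[OF assms(2)] klinear_add[OF assms(2)] klinear_smult[OF assms(2)]
    by (auto intro!: klinearI simp: counit_add counit_smult Z.smult_l_distr Z.smult_assoc1)
qed

lemma klinear_mult_left: "klinear K M H f \<Longrightarrow> b \<in> carrier H \<Longrightarrow> klinear K M H (\<lambda>x. f x \<bullet> b)"
  by (rule kbilinear_left[OF HH.A_mult])

lemma klinear_mult_right: "klinear K M H f \<Longrightarrow> a \<in> carrier H \<Longrightarrow> klinear K M H (\<lambda>x. a \<bullet> f x)"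
  by (rule kbilinear_right[OF HH.A_mult])

lemma klinear_antipode_comp: "klinear K M H f \<Longrightarrow> klinear K M H (\<lambda>x. S (f x))"
  by (rule klinear_comp[OF klinear_antipode])

lemma klinear_tsum_comult:
  "klinear K M H f \<Longrightarrow> module K Z \<Longrightarrow> kbilinear K H H Z g \<Longrightarrow> klinear K M Z (\<lambda>m. tsum Z (\<Delta> (f m)) g)"
  by (rule HH.bilinear_tsum_comp) (simp_all add: klinear_comp[OF klinear_comult])

lemmas [klin] = klinear_ident klinear_mult_left klinear_mult_right klinear_antipode_comp
  klinear_tsum_comult HH.klinear_tsumf klinear_counit kbilinearI ktrilinearI

lemma ktrilinear_kbilinear_HH:
  assumes "module K Z" "ktrilinear K H H H Z f"
  shows "kbilinear K (HH K H) H Z (\<lambda>p c. tsum Z p (\<lambda>a b. f a b c))"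
  using assms(2) unfolding ktrilinear_def
  by (intro kbilinearI HH.bilinear_tsum HH.klinear_tsumf assms(1)) (auto simp: kbilinear_def)

lemma klinear_tsum3: "module K Z \<Longrightarrow> ktrilinear K H H H Z f \<Longrightarrow> klinear K (HHH K H) Z (\<lambda>X. tsum3 Z X f)"
  unfolding tsum3_def by (intro HHH.bilinear_tsum ktrilinear_kbilinear_HH)

lemma tsum3_ptens: "module K Z \<Longrightarrow> ktrilinear K H H H Z f \<Longrightarrow> X \<in> carrier (HH K H) \<Longrightarrow> c \<in> carrier H \<Longrightarrow>
    tsum3 Z (X \<boxtimes>\<^bsub>HHH K H\<^esub> c) f = tsum Z X (\<lambda>a b. f a b c)"
  unfolding tsum3_def by (simp add: HHH.bilinear_tsum_ptens ktrilinear_kbilinear_HH)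

lemma tsum3_ptens_ptens:
  "module K Z \<Longrightarrow> ktrilinear K H H H Z f \<Longrightarrow> a \<in> carrier H \<Longrightarrow> b \<in> carrier H \<Longrightarrow> c \<in> carrier H \<Longrightarrow>
    tsum3 Z ((a \<boxtimes>\<^bsub>HH K H\<^esub> b) \<boxtimes>\<^bsub>HHH K H\<^esub> c) f = f a b c"
  by (simp add: tsum3_ptens HH.bilinear_tsum_ptens ktrilinear_def)

lemma tsum3_cong:
  assumes "X \<in> carrier (HHH K H)"
    "\<And>a b c. a \<in> carrier H \<Longrightarrow> b \<in> carrier H \<Longrightarrow> c \<in> carrier H \<Longrightarrow> f a b c = g a b c"
  shows "tsum3 Z X f = tsum3 Z X g"
  unfolding tsum3_def using assms by (auto intro!: HHH.tsum_cong HH.tsum_cong)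

lemma klinear_tsum3f:
  assumes "module K Z" "X \<in> carrier (HHH K H)"
    "\<And>a b c. a \<in> carrier H \<Longrightarrow> b \<in> carrier H \<Longrightarrow> c \<in> carrier H \<Longrightarrow> klinear K M Z (\<lambda>m. f m a b c)"
  shows "klinear K M Z (\<lambda>m. tsum3 Z X (f m))"
  unfolding tsum3_def using assms by (intro HHH.klinear_tsumf HH.klinear_tsumf)

text \<open>Both sides are linear in \<open>X\<close> and in \<open>Y\<close>, so each tensor is
  reduced to pure tensors one layer at a time; on these the product is componentwise.\<close>

lemma tsum3_mult:
  assumes Z: "module K Z" and f: "ktrilinear K H H H Z f"
    and X: "X \<in> carrier (HHH K H)" and Y: "Y \<in> carrier (HHH K H)"
  shows "tsum3 Z (X \<otimes>\<^bsub>HHH K H\<^esub> Y) f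
    = tsum3 Z X (\<lambda>a b c. tsum3 Z Y (\<lambda>a' b' c'. f (a \<bullet> a') (b \<bullet> b') (c \<bullet> c')))"
proof -
  have fl: "klinear K M Z (\<lambda>m. f (g m) b c)" if "klinear K M H g" "b \<in> carrier H" "c \<in> carrier H" for M :: "('k, 'm, 'x) module_scheme" and g b c
    using f that klinear_comp[of K H Z "\<lambda>a. f a b c" M g] by (simp add: ktrilinear_def kbilinear_def)
  have fm: "klinear K M Z (\<lambda>m. f a (g m) c)" if "klinear K M H g" "a \<in> carrier H" "c \<in> carrier H" for M :: "('k, 'm, 'x) module_scheme" and g a c
    using f that klinear_comp[of K H Z "\<lambda>b. f a b c" M g] by (simp add: ktrilinear_def kbilinear_def)
  have fr: "klinear K M Z (\<lambda>m. f a b (g m))" if "klinear K M H g" "a \<in> carrier H" "b \<in> carrier H" for M :: "('k, 'm, 'x) module_scheme" and g a b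
    using f that klinear_comp[of K H Z "\<lambda>c. f a b c" M g] by (simp add: ktrilinear_def kbilinear_def)
  have tri: "ktrilinear K H H H Z (\<lambda>a b c. tsum3 Z Y (\<lambda>a' b' c'. f (a \<bullet> a') (b \<bullet> b') (c \<bullet> c')))"
    using Y by (intro ktrilinearI klinear_tsum3f[OF Z] fl fm fr klin) simp_all
  have tri': "ktrilinear K H H H Z (\<lambda>a' b' c'. f (a \<bullet> a') (b \<bullet> b') (c \<bullet> c'))"
    if "a \<in> carrier H" "b \<in> carrier H" "c \<in> carrier H" for a b c
    using that by (intro ktrilinearI fl fm fr klin) simp_all
  have lin: "klinear K (HHH K H) Z (\<lambda>X. tsum3 Z (X \<otimes>\<^bsub>HHH K H\<^esub> Y) f)"
    by (intro klinear_comp[OF klinear_tsum3[OF Z f]] kbilinear_left[OF HHH.bilinear_mult] klinear_ident Y)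
  show ?thesis
  proof (rule HHH.klinear_eqI[OF lin klinear_tsum3[OF Z tri] X])
    fix p c assume p: "p \<in> carrier (HH K H)" and c: "c \<in> carrier H"
    have "tsum3 Z ((p \<boxtimes>\<^bsub>HHH K H\<^esub> c) \<otimes>\<^bsub>HHH K H\<^esub> Y) f
        = tsum Z p (\<lambda>a b. tsum3 Z Y (\<lambda>a' b' c'. f (a \<bullet> a') (b \<bullet> b') (c \<bullet> c')))" (is "?L p = ?R p")
    proof (rule HH.klinear_eqI[OF _ _ p])
      show "klinear K (HH K H) Z ?L"
        by (intro klinear_comp[OF klinear_tsum3[OF Z f]] kbilinear_left[OF HHH.bilinear_mult]
            kbilinear_left[OF HHH.kbilinear_ptens] klinear_ident Y c)
      show "klinear K (HH K H) Z ?R"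
        using tri c by (intro HH.bilinear_tsum[OF Z]) (simp add: ktrilinear_def)
      fix a b assume ab': "a \<in> carrier H" "b \<in> carrier H"
      have "tsum3 Z (((a \<boxtimes>\<^bsub>HH K H\<^esub> b) \<boxtimes>\<^bsub>HHH K H\<^esub> c) \<otimes>\<^bsub>HHH K H\<^esub> Y) f
        = tsum3 Z Y (\<lambda>a' b' c'. f (a \<bullet> a') (b \<bullet> b') (c \<bullet> c'))" (is "?L' Y = ?R' Y")
      proof (rule HHH.klinear_eqI[OF _ _ Y])
        show "klinear K (HHH K H) Z ?L'"
          using ab' c by (intro klinear_comp[OF klinear_tsum3[OF Z f]] kbilinear_right[OF HHH.bilinear_mult] klinear_ident) simp
        show "klinear K (HHH K H) Z ?R'"
          using ab' c by (intro klinear_tsum3[OF Z] tri')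
        fix q c' assume q: "q \<in> carrier (HH K H)" and c': "c' \<in> carrier H"
        show "?L' (q \<boxtimes>\<^bsub>HHH K H\<^esub> c') = ?R' (q \<boxtimes>\<^bsub>HHH K H\<^esub> c')"
        proof (rule HH.klinear_eqI[OF _ _ q])
          show "klinear K (HH K H) Z (\<lambda>q. ?L' (q \<boxtimes>\<^bsub>HHH K H\<^esub> c'))"
            using ab' c c' by (intro klinear_comp[OF klinear_tsum3[OF Z f]] kbilinear_right[OF HHH.bilinear_mult]
              kbilinear_left[OF HHH.kbilinear_ptens] klinear_ident) simp_all
          show "klinear K (HH K H) Z (\<lambda>q. ?R' (q \<boxtimes>\<^bsub>HHH K H\<^esub> c'))"
            using ab' c c' by (intro klinear_comp[OF klinear_tsum3[OF Z]] tri'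
              kbilinear_left[OF HHH.kbilinear_ptens] klinear_ident)
          fix a' b' assume "a' \<in> carrier H" "b' \<in> carrier H"
          then show "?L' ((a' \<boxtimes>\<^bsub>HH K H\<^esub> b') \<boxtimes>\<^bsub>HHH K H\<^esub> c') = ?R' ((a' \<boxtimes>\<^bsub>HH K H\<^esub> b') \<boxtimes>\<^bsub>HHH K H\<^esub> c')"
            using ab' c c' by (simp add: HHH.mult_ptens HH.mult_ptens tsum3_ptens_ptens[OF Z f] tsum3_ptens_ptens[OF Z tri'])
        qed
      qed
      then show "?L (a \<boxtimes>\<^bsub>HH K H\<^esub> b) = ?R (a \<boxtimes>\<^bsub>HH K H\<^esub> b)"
        using ab' tri c by (simp add: HH.bilinear_tsum_ptens[OF Z] ktrilinear_def)
    qed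
    then show "tsum3 Z ((p \<boxtimes>\<^bsub>HHH K H\<^esub> c) \<otimes>\<^bsub>HHH K H\<^esub> Y) f
        = tsum3 Z (p \<boxtimes>\<^bsub>HHH K H\<^esub> c) (\<lambda>a b c. tsum3 Z Y (\<lambda>a' b' c'. f (a \<bullet> a') (b \<bullet> b') (c \<bullet> c')))"
      using p c by (simp add: tsum3_ptens[OF Z tri])
  qed
qed

lemma comult_id_alg_hom: "alg_hom K (HH K H) (HHH K H) (comult_id K H)"
  unfolding comult_id_def
  by (rule tmap_alg_hom(1)[OF H_alg H_alg HH.assoc_algebra_T H_alg comult_alg_hom alg_hom_ident(1)])

lemma id_comult_alg_hom: "alg_hom K (HH K H) (HHH K H) (id_comult K H)"
  unfolding id_comult_def[abs_def]
  by (rule alg_hom_comp[OF tmap_alg_hom(1)[OF H_alg H_alg H_alg HH.assoc_algebra_T alg_hom_ident(1) comult_alg_hom]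
        tassoc_alg_hom(1)[OF H_alg H_alg H_alg]])

lemma ptens_one_alg_hom:
  assumes "tensor_algebra K A B"
  shows "alg_hom K A (talg K A B) (\<lambda>a. a \<boxtimes>\<^bsub>talg K A B\<^esub> \<one>\<^bsub>B\<^esub>)"
    and "alg_hom K B (talg K A B) (\<lambda>b. \<one>\<^bsub>A\<^esub> \<boxtimes>\<^bsub>talg K A B\<^esub> b)"
proof -
  interpret tensor_algebra K A B by fact
  show "alg_hom K A (talg K A B) (\<lambda>a. a \<boxtimes>\<^bsub>talg K A B\<^esub> \<one>\<^bsub>B\<^esub>)"
    using kbilinear_ptens by (auto simp: alg_hom_def ring_hom_def kbilinear_def mult_ptens one_eq ptens_add_left)
  show "alg_hom K B (talg K A B) (\<lambda>b. \<one>\<^bsub>A\<^esub> \<boxtimes>\<^bsub>talg K A B\<^esub> b)"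
    using kbilinear_ptens by (auto simp: alg_hom_def ring_hom_def kbilinear_def mult_ptens one_eq ptens_add_right)
qed

lemma leg12_alg_hom: "alg_hom K (HH K H) (HHH K H) (leg12 K H)"
  unfolding leg12_def[abs_def] by (rule ptens_one_alg_hom(1)) unfold_locales

lemma leg23_alg_hom: "alg_hom K (HH K H) (HHH K H) (leg23 K H)"
  unfolding leg23_def[abs_def]
  by (rule alg_hom_comp[OF ptens_one_alg_hom(2) tassoc_alg_hom(1)[OF H_alg H_alg H_alg]]) unfold_locales

lemma leg13_alg_hom: "alg_hom K (HH K H) (HHH K H) (leg13 K H)"
  unfolding leg13_def
  by (rule tmap_alg_hom(1)[OF H_alg H_alg HH.assoc_algebra_T H_alg ptens_one_alg_hom(1) alg_hom_ident(1)]) unfold_locales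

lemma tsum3_hom:
  assumes Z: "module K Z" and f: "ktrilinear K H H H Z f" and X: "X \<in> carrier (HH K H)"
    "\<And>a b. a \<in> carrier H \<Longrightarrow> b \<in> carrier H \<Longrightarrow> g a b \<in> carrier (HHH K H)"
  shows "tsum3 Z (tsum (HHH K H) X g) f = tsum Z X (\<lambda>a b. tsum3 Z (g a b) f)"
  using HH.tsum_hom[OF HHH.abelian_T _ klinear_additive[OF klinear_tsum3[OF Z f]] X] Z
  by (simp add: module_def)

context
  fixes Z :: "('k, 'z, 'q) module_scheme" and f X
  assumes Z: "module K Z" and f: "ktrilinear K H H H Z f" and X: "X \<in> carrier (HH K H)"
begin

text \<open>With its companions for the legs, this translates equations in H \<otimes> H \<otimes> H
  into iterated sums over components.\<close>

lemma tsum3_comult_id: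
  "tsum3 Z (comult_id K H X) f = tsum Z X (\<lambda>x y. tsum Z (\<Delta> x) (\<lambda>x\<^sub>1 x\<^sub>2. f x\<^sub>1 x\<^sub>2 y))"
  unfolding comult_id_def tmap_eq using X
  by (subst tsum3_hom[OF Z f]) (auto intro!: HH.tsum_cong simp: tsum3_ptens[OF Z f])

lemma tsum3_tassoc:
  "tsum3 Z (tsum (HHH K H) X (\<lambda>y\<^sub>1 y\<^sub>2. (x \<boxtimes>\<^bsub>HH K H\<^esub> y\<^sub>1) \<boxtimes>\<^bsub>HHH K H\<^esub> y\<^sub>2)) f
    = tsum Z X (\<lambda>y\<^sub>1 y\<^sub>2. f x y\<^sub>1 y\<^sub>2)" if "x \<in> carrier H" for x
  using X that
  by (subst tsum3_hom[OF Z f]) (auto intro!: HH.tsum_cong simp: tsum3_ptens_ptens[OF Z f])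

lemma tsum3_leg12: "tsum3 Z (leg12 K H X) f = tsum Z X (\<lambda>x y. f x y \<one>\<^bsub>H\<^esub>)"
  using X by (simp add: leg12_def tsum3_ptens[OF Z f])

lemma tsum3_leg23: "tsum3 Z (leg23 K H X) f = tsum Z X (\<lambda>x y. f \<one>\<^bsub>H\<^esub> x y)"
  using X by (simp add: leg23_def tassoc_alg_hom(2)[OF H_alg H_alg H_alg] tsum3_tassoc)

lemma tsum3_leg13: "tsum3 Z (leg13 K H X) f = tsum Z X (\<lambda>x y. f x \<one>\<^bsub>H\<^esub> y)"
  unfolding leg13_def tmap_eq using X
  by (subst tsum3_hom[OF Z f]) (auto intro!: HH.tsum_cong simp: tsum3_ptens_ptens[OF Z f])

end

lemma tsum3_id_comult:
  assumes Z: "module K Z" and f: "ktrilinear K H H H Z f" and X: "X \<in> carrier (HH K H)"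
  shows "tsum3 Z (id_comult K H X) f = tsum Z X (\<lambda>x y. tsum Z (\<Delta> y) (\<lambda>y\<^sub>1 y\<^sub>2. f x y\<^sub>1 y\<^sub>2))"
proof -
  let ?a = "tassoc (HHH K H) (HH K H)"
  have a: "klinear K (H_HH K H) (HHH K H) ?a"
    by (rule alg_hom_klinear[OF tassoc_alg_hom(1)[OF H_alg H_alg H_alg]])
  let ?g = "\<lambda>x y. tsum (HHH K H) (\<Delta> y) (\<lambda>y\<^sub>1 y\<^sub>2. (x \<boxtimes>\<^bsub>HH K H\<^esub> y\<^sub>1) \<boxtimes>\<^bsub>HHH K H\<^esub> y\<^sub>2)"
  have "id_comult K H X = tsum (HHH K H) X (\<lambda>x y. ?a (x \<boxtimes>\<^bsub>H_HH K H\<^esub> \<Delta> y))"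
    unfolding id_comult_def tmap_eq using X
    by (subst HH.tsum_hom[OF H_HH.abelian_T HHH.abelian_T klinear_additive[OF a]]) simp_all
  also have "\<dots> = tsum (HHH K H) X ?g"
    using X by (intro HH.tsum_cong) (simp_all add: tassoc_alg_hom(2)[OF H_alg H_alg H_alg])
  finally have "tsum3 Z (id_comult K H X) f = tsum3 Z (tsum (HHH K H) X ?g) f" by simp
  also have "\<dots> = tsum Z X (\<lambda>x y. tsum3 Z (?g x y) f)"
    using X by (intro tsum3_hom[OF Z f] HH.tsum_closed[OF HHH.abelian_T]) simp_all
  also have "\<dots> = tsum Z X (\<lambda>x y. tsum Z (\<Delta> y) (\<lambda>y\<^sub>1 y\<^sub>2. f x y\<^sub>1 y\<^sub>2))"
    using X by (intro HH.tsum_cong) (simp_all add: tsum3_tassoc[OF Z f])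
  finally show ?thesis .
qed

lemma comult_mult:
  assumes "module K Z" "kbilinear K H H Z f" "\<xi> \<in> carrier H" "\<eta> \<in> carrier H"
  shows "tsum Z (\<Delta> (\<xi> \<bullet> \<eta>)) f
    = tsum Z (\<Delta> \<xi>) (\<lambda>x y. tsum Z (\<Delta> \<eta>) (\<lambda>x' y'. f (x \<bullet> x') (y \<bullet> y')))"
  using assms by (simp add: alg_hom_mult[OF comult_alg_hom] HH.tsum_mult)

lemma comult_one: "module K Z \<Longrightarrow> kbilinear K H H Z f \<Longrightarrow> tsum Z (\<Delta> \<one>\<^bsub>H\<^esub>) f = f \<one>\<^bsub>H\<^esub> \<one>\<^bsub>H\<^esub>"
  by (simp add: alg_hom_one[OF comult_alg_hom] HH.one_eq HH.bilinear_tsum_ptens)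

lemma coassoc:
  assumes "module K Z" "ktrilinear K H H H Z f" "\<xi> \<in> carrier H"
  shows "tsum Z (\<Delta> \<xi>) (\<lambda>x y. tsum Z (\<Delta> x) (\<lambda>x\<^sub>1 x\<^sub>2. f x\<^sub>1 x\<^sub>2 y))
    = tsum Z (\<Delta> \<xi>) (\<lambda>x y. tsum Z (\<Delta> y) (\<lambda>y\<^sub>1 y\<^sub>2. f x y\<^sub>1 y\<^sub>2))"
proof -
  have "comult_id K H (\<Delta> \<xi>) = id_comult K H (\<Delta> \<xi>)"
    using hopf assms(3) by (simp add: hopf_algebra_def)
  then show ?thesis
    using tsum3_comult_id[OF assms(1,2)] tsum3_id_comult[OF assms(1,2)] assms(3) by (metis comult_closed)
qed

lemma klinear_tsum_H:
  assumes Z: "module K Z" and g: "klinear K H Z g"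
    and "X \<in> carrier (HH K H)" "\<And>x y. x \<in> carrier H \<Longrightarrow> y \<in> carrier H \<Longrightarrow> f x y \<in> carrier H"
  shows "g (tsum H X f) = tsum Z X (\<lambda>x y. g (f x y))"
  using HH.tsum_hom[OF HH.V _ klinear_additive[OF g] assms(3,4)] Z by (simp add: module_def)

lemma tsum_smult:
  assumes Z: "module K Z" and "k \<in> carrier K"
    and "X \<in> carrier (HH K H)" "\<And>x y. x \<in> carrier H \<Longrightarrow> y \<in> carrier H \<Longrightarrow> f x y \<in> carrier Z"
  shows "tsum Z X (\<lambda>x y. k \<odot>\<^bsub>Z\<^esub> f x y) = k \<odot>\<^bsub>Z\<^esub> tsum Z X f"
proof -
  interpret Z: module K Z by fact
  note ab = Z.M.abelian_group_axioms
  show ?thesis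
    using assms
    by (intro HH.tsum_hom[OF ab ab, symmetric]) (simp_all add: additive_map_def Z.smult_r_distr)
qed

context
  fixes Z :: "('k, 'z, 'q) module_scheme" and g :: "'h \<Rightarrow> 'z" and \<xi>
  assumes Z: "module K Z" and g: "klinear K H Z g" and \<xi>: "\<xi> \<in> carrier H"
begin

text \<open>The Hopf axiom is an identity in H; a linear \<open>g\<close> carries it to a module,
  the form in which it is met inside longer expressions. The next three lemmas transport their
  axioms in the same way.\<close>

lemma counit_left: "tsum Z (\<Delta> \<xi>) (\<lambda>x y. \<epsilon> x \<odot>\<^bsub>Z\<^esub> g y) = g \<xi>"
proof -
  have "tsum H (\<Delta> \<xi>) (\<lambda>x y. \<epsilon> x \<odot>\<^bsub>H\<^esub> y) = \<xi>"
    using hopf \<xi> by (simp add: hopf_algebra_def tsum_def)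
  then have "g \<xi> = tsum Z (\<Delta> \<xi>) (\<lambda>x y. g (\<epsilon> x \<odot>\<^bsub>H\<^esub> y))"
    using klinear_tsum_H[OF Z g, of "\<Delta> \<xi>" "\<lambda>x y. \<epsilon> x \<odot>\<^bsub>H\<^esub> y"] \<xi> by simp
  also have "\<dots> = tsum Z (\<Delta> \<xi>) (\<lambda>x y. \<epsilon> x \<odot>\<^bsub>Z\<^esub> g y)"
    using \<xi> by (intro HH.tsum_cong) (simp_all add: klinear_smult[OF g])
  finally show ?thesis ..
qed

lemma counit_right: "tsum Z (\<Delta> \<xi>) (\<lambda>x y. \<epsilon> y \<odot>\<^bsub>Z\<^esub> g x) = g \<xi>"
proof -
  have "tsum H (\<Delta> \<xi>) (\<lambda>x y. \<epsilon> y \<odot>\<^bsub>H\<^esub> x) = \<xi>"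
    using hopf \<xi> by (simp add: hopf_algebra_def tsum_def)
  then have "g \<xi> = tsum Z (\<Delta> \<xi>) (\<lambda>x y. g (\<epsilon> y \<odot>\<^bsub>H\<^esub> x))"
    using klinear_tsum_H[OF Z g, of "\<Delta> \<xi>" "\<lambda>x y. \<epsilon> y \<odot>\<^bsub>H\<^esub> x"] \<xi> by simp
  also have "\<dots> = tsum Z (\<Delta> \<xi>) (\<lambda>x y. \<epsilon> y \<odot>\<^bsub>Z\<^esub> g x)"
    using \<xi> by (intro HH.tsum_cong) (simp_all add: klinear_smult[OF g])
  finally show ?thesis ..
qed

lemma antipode_left: "tsum Z (\<Delta> \<xi>) (\<lambda>x y. g (S x \<bullet> y)) = \<epsilon> \<xi> \<odot>\<^bsub>Z\<^esub> g \<one>\<^bsub>H\<^esub>"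
proof -
  have "tsum H (\<Delta> \<xi>) (\<lambda>x y. S x \<bullet> y) = \<epsilon> \<xi> \<odot>\<^bsub>H\<^esub> \<one>\<^bsub>H\<^esub>"
    using hopf \<xi> by (simp add: hopf_algebra_def tsum_def)
  then show ?thesis
    using klinear_tsum_H[OF Z g, of "\<Delta> \<xi>" "\<lambda>x y. S x \<bullet> y"] \<xi> by (simp add: klinear_smult[OF g])
qed

lemma antipode_right: "tsum Z (\<Delta> \<xi>) (\<lambda>x y. g (x \<bullet> S y)) = \<epsilon> \<xi> \<odot>\<^bsub>Z\<^esub> g \<one>\<^bsub>H\<^esub>"
proof -
  have "tsum H (\<Delta> \<xi>) (\<lambda>x y. x \<bullet> S y) = \<epsilon> \<xi> \<odot>\<^bsub>H\<^esub> \<one>\<^bsub>H\<^esub>"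
    using hopf \<xi> by (simp add: hopf_algebra_def tsum_def)
  then show ?thesis
    using klinear_tsum_H[OF Z g, of "\<Delta> \<xi>" "\<lambda>x y. x \<bullet> S y"] \<xi> by (simp add: klinear_smult[OF g])
qed

end

end

section \<open>Convolution identities, anti-multiplicativity of the antipode, counit and
  flip\<close>

context hopf_alg
begin

lemma module_H [simp]: "module K H"
  by (rule HH.KV)

lemma abelian_H [simp]: "abelian_group H"
  by (rule HH.V)

lemma module_abelian: "module K Z \<Longrightarrow> abelian_group Z"
  by (simp add: module_def)

text \<open>Coassociativity moves the antipode next to its partner, and \<xi>_2 S(\<xi>_3) collapses
  to a counit. This removes the inner antipode of the adjoint action in
  \<open>adj_transport\<close>.\<close>

lemma convolution_right:
  assumes Z: "module K Z" and \<Theta>: "kbilinear K H H Z \<Theta>" and \<xi>: "\<xi> \<in> carrier H"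
  shows "tsum Z (\<Delta> \<xi>) (\<lambda>p q. tsum Z (\<Delta> p) (\<lambda>p\<^sub>1 p\<^sub>2. \<Theta> p\<^sub>1 (p\<^sub>2 \<bullet> S q))) = \<Theta> \<xi> \<one>\<^bsub>H\<^esub>"
proof -
  note \<Theta>_klin = kbilinear_left[OF \<Theta>] kbilinear_right[OF \<Theta>]
  have "tsum Z (\<Delta> \<xi>) (\<lambda>p q. tsum Z (\<Delta> p) (\<lambda>p\<^sub>1 p\<^sub>2. \<Theta> p\<^sub>1 (p\<^sub>2 \<bullet> S q)))
      = tsum Z (\<Delta> \<xi>) (\<lambda>x y. tsum Z (\<Delta> y) (\<lambda>y\<^sub>1 y\<^sub>2. \<Theta> x (y\<^sub>1 \<bullet> S y\<^sub>2)))"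
    using \<xi> by (intro coassoc[OF Z] klin \<Theta>_klin) simp_all
  also have "\<dots> = tsum Z (\<Delta> \<xi>) (\<lambda>x y. \<epsilon> y \<odot>\<^bsub>Z\<^esub> \<Theta> x \<one>\<^bsub>H\<^esub>)"
    using \<xi> by (intro HH.tsum_cong antipode_right[OF Z] klin \<Theta>_klin) simp_all
  also have "\<dots> = \<Theta> \<xi> \<one>\<^bsub>H\<^esub>"
    using \<xi> by (intro counit_right[OF Z] klin \<Theta>_klin) simp_all
  finally show ?thesis .
qed

text \<open>The same collapse for S(\<xi>_2) \<xi>_3; it makes the adjoint action compatible with
  evaluation.\<close>

lemma convolution_left:
  assumes Z: "module K Z" and \<Theta>: "kbilinear K H H Z \<Theta>" and \<xi>: "\<xi> \<in> carrier H"
  shows "tsum Z (\<Delta> \<xi>) (\<lambda>p q. tsum Z (\<Delta> p) (\<lambda>p\<^sub>1 p\<^sub>2. \<Theta> p\<^sub>1 (S p\<^sub>2 \<bullet> q))) = \<Theta> \<xi> \<one>\<^bsub>H\<^esub>"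
proof -
  note \<Theta>_klin = kbilinear_left[OF \<Theta>] kbilinear_right[OF \<Theta>]
  have "tsum Z (\<Delta> \<xi>) (\<lambda>p q. tsum Z (\<Delta> p) (\<lambda>p\<^sub>1 p\<^sub>2. \<Theta> p\<^sub>1 (S p\<^sub>2 \<bullet> q)))
      = tsum Z (\<Delta> \<xi>) (\<lambda>x y. tsum Z (\<Delta> y) (\<lambda>y\<^sub>1 y\<^sub>2. \<Theta> x (S y\<^sub>1 \<bullet> y\<^sub>2)))"
    using \<xi> by (intro coassoc[OF Z] klin \<Theta>_klin) simp_all
  also have "\<dots> = tsum Z (\<Delta> \<xi>) (\<lambda>x y. \<epsilon> y \<odot>\<^bsub>Z\<^esub> \<Theta> x \<one>\<^bsub>H\<^esub>)"
    using \<xi> by (intro HH.tsum_cong antipode_left[OF Z] klin \<Theta>_klin) simp_all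
  also have "\<dots> = \<Theta> \<xi> \<one>\<^bsub>H\<^esub>"
    using \<xi> by (intro counit_right[OF Z] klin \<Theta>_klin) simp_all
  finally show ?thesis .
qed

lemma antipode_one: "S \<one>\<^bsub>H\<^esub> = \<one>\<^bsub>H\<^esub>"
proof -
  have "tsum H (\<Delta> \<one>\<^bsub>H\<^esub>) (\<lambda>x y. S x \<bullet> y) = \<epsilon> \<one>\<^bsub>H\<^esub> \<odot>\<^bsub>H\<^esub> \<one>\<^bsub>H\<^esub>"
    by (rule antipode_left[where g = "\<lambda>x. x"]) (simp_all add: klinear_ident)
  moreover have "tsum H (\<Delta> \<one>\<^bsub>H\<^esub>) (\<lambda>x y. S x \<bullet> y) = S \<one>\<^bsub>H\<^esub> \<bullet> \<one>\<^bsub>H\<^esub>"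
    by (intro comult_one klin) simp_all
  ultimately show ?thesis by (simp add: counit_one)
qed

text \<open>Both sides are evaluations of \<open>S (x\<^sub>1 y\<^sub>1) x\<^sub>2 y\<^sub>2 S y\<^sub>3 S x\<^sub>3\<close>.\<close>

lemma antipode_mult:
  assumes x: "x \<in> carrier H" and y: "y \<in> carrier H"
  shows "S (x \<bullet> y) = S y \<bullet> S x"
proof -
  let ?f = "\<lambda>x\<^sub>1 x\<^sub>2 x\<^sub>3 y\<^sub>1 y\<^sub>2 y\<^sub>3.
    S (x\<^sub>1 \<bullet> y\<^sub>1) \<bullet> ((x\<^sub>2 \<bullet> y\<^sub>2) \<bullet> (S y\<^sub>3 \<bullet> S x\<^sub>3))"
  let ?R = "\<lambda>\<xi> f. tsum H (\<Delta> \<xi>) (\<lambda>p q. tsum H (\<Delta> q) (\<lambda>q\<^sub>1 q\<^sub>2. f p q\<^sub>1 q\<^sub>2))"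
  let ?L = "\<lambda>\<xi> f. tsum H (\<Delta> \<xi>) (\<lambda>p q. tsum H (\<Delta> p) (\<lambda>p\<^sub>1 p\<^sub>2. f p\<^sub>1 p\<^sub>2 q))"
  \<comment> \<open>In this evaluation y_2 S(y_3) collapses first, then x_2 S(x_3), and S(x y) is
    left.\<close>
  have "?R y (?f x\<^sub>1 x\<^sub>2 x\<^sub>3) = S (x\<^sub>1 \<bullet> y) \<bullet> (x\<^sub>2 \<bullet> S x\<^sub>3)"
    if "x\<^sub>1 \<in> carrier H" "x\<^sub>2 \<in> carrier H" "x\<^sub>3 \<in> carrier H" for x\<^sub>1 x\<^sub>2 x\<^sub>3
  proof -
    have "tsum H (\<Delta> q) (\<lambda>q\<^sub>1 q\<^sub>2. ?f x\<^sub>1 x\<^sub>2 x\<^sub>3 p q\<^sub>1 q\<^sub>2) = \<epsilon> q \<odot>\<^bsub>H\<^esub> (S (x\<^sub>1 \<bullet> p) \<bullet> (x\<^sub>2 \<bullet> S x\<^sub>3))"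
      if "p \<in> carrier H" "q \<in> carrier H" for p q
      using antipode_right[of H "\<lambda>z. S (x\<^sub>1 \<bullet> p) \<bullet> ((x\<^sub>2 \<bullet> z) \<bullet> S x\<^sub>3)" q]
        that \<open>x\<^sub>1 \<in> _\<close> \<open>x\<^sub>2 \<in> _\<close> \<open>x\<^sub>3 \<in> _\<close>
      by (simp add: klin HH.A.m_assoc cong: HH.tsum_cong)
    then have "?R y (?f x\<^sub>1 x\<^sub>2 x\<^sub>3) = tsum H (\<Delta> y) (\<lambda>p q. \<epsilon> q \<odot>\<^bsub>H\<^esub> (S (x\<^sub>1 \<bullet> p) \<bullet> (x\<^sub>2 \<bullet> S x\<^sub>3)))"
      using y that by (intro HH.tsum_cong) simp_all
    also have "\<dots> = S (x\<^sub>1 \<bullet> y) \<bullet> (x\<^sub>2 \<bullet> S x\<^sub>3)"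
      using y that by (intro counit_right klin) simp_all
    finally show ?thesis .
  qed
  then have "?R x (\<lambda>x\<^sub>1 x\<^sub>2 x\<^sub>3. ?R y (?f x\<^sub>1 x\<^sub>2 x\<^sub>3)) = ?R x (\<lambda>x\<^sub>1 x\<^sub>2 x\<^sub>3. S (x\<^sub>1 \<bullet> y) \<bullet> (x\<^sub>2 \<bullet> S x\<^sub>3))"
    using x by (intro HH.tsum_cong) simp_all
  also have "\<dots> = tsum H (\<Delta> x) (\<lambda>p q. \<epsilon> q \<odot>\<^bsub>H\<^esub> (S (p \<bullet> y) \<bullet> \<one>\<^bsub>H\<^esub>))"
    using x y by (intro HH.tsum_cong antipode_right klin) simp_all
  also have "\<dots> = S (x \<bullet> y) \<bullet> \<one>\<^bsub>H\<^esub>"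
    using x y by (intro counit_right klin) simp_all
  finally have 1: "?R x (\<lambda>x\<^sub>1 x\<^sub>2 x\<^sub>3. ?R y (?f x\<^sub>1 x\<^sub>2 x\<^sub>3)) = S (x \<bullet> y)"
    using x y by simp
  have "?R x (\<lambda>x\<^sub>1 x\<^sub>2 x\<^sub>3. ?R y (?f x\<^sub>1 x\<^sub>2 x\<^sub>3)) = ?R x (\<lambda>x\<^sub>1 x\<^sub>2 x\<^sub>3. ?L y (?f x\<^sub>1 x\<^sub>2 x\<^sub>3))"
    using x y by (intro HH.tsum_cong coassoc[symmetric] klin) simp_all
  also have "\<dots> = ?L x (\<lambda>x\<^sub>1 x\<^sub>2 x\<^sub>3. ?L y (?f x\<^sub>1 x\<^sub>2 x\<^sub>3))"
    using x y by (intro coassoc[symmetric] klin) simp_all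
  \<comment> \<open>Regrouped the other way, the two inner coproducts stand together as the
    coproduct of \<open>p \<bullet> q\<close>, and S(x_1 y_1) x_2 y_2 collapses to a scalar.\<close>
  also have "\<dots> = tsum H (\<Delta> x) (\<lambda>p x\<^sub>3. tsum H (\<Delta> y) (\<lambda>q y\<^sub>3. tsum H (\<Delta> p) (\<lambda>x\<^sub>1 x\<^sub>2. tsum H (\<Delta> q)
      (\<lambda>y\<^sub>1 y\<^sub>2. ?f x\<^sub>1 x\<^sub>2 x\<^sub>3 y\<^sub>1 y\<^sub>2 y\<^sub>3))))"
    using x y
    by (intro HH.tsum_cong tsum_swap[OF HH.tensor_product_axioms HH.tensor_product_axioms] HH.tsum_closed) simp_all
  also have "\<dots> = tsum H (\<Delta> x) (\<lambda>p x\<^sub>3. tsum H (\<Delta> y) (\<lambda>q y\<^sub>3. \<epsilon> q \<odot>\<^bsub>H\<^esub> (\<epsilon> p \<odot>\<^bsub>H\<^esub> (S y\<^sub>3 \<bullet> S x\<^sub>3))))"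
  proof (intro HH.tsum_cong)
    fix p x\<^sub>3 q y\<^sub>3 assume [simp]: "p \<in> carrier H" "x\<^sub>3 \<in> carrier H" "q \<in> carrier H" "y\<^sub>3 \<in> carrier H"
    have "tsum H (\<Delta> p) (\<lambda>x\<^sub>1 x\<^sub>2. tsum H (\<Delta> q) (\<lambda>y\<^sub>1 y\<^sub>2. ?f x\<^sub>1 x\<^sub>2 x\<^sub>3 y\<^sub>1 y\<^sub>2 y\<^sub>3))
       = tsum H (\<Delta> (p \<bullet> q)) (\<lambda>a b. S a \<bullet> (b \<bullet> (S y\<^sub>3 \<bullet> S x\<^sub>3)))"
      by (intro comult_mult[symmetric] klin) simp_all
    also have "\<dots> = \<epsilon> (p \<bullet> q) \<odot>\<^bsub>H\<^esub> (S y\<^sub>3 \<bullet> S x\<^sub>3)"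
      using antipode_left[of H "\<lambda>z. z \<bullet> (S y\<^sub>3 \<bullet> S x\<^sub>3)" "p \<bullet> q"]
      by (simp add: klin HH.A.m_assoc cong: HH.tsum_cong)
    also have "\<dots> = \<epsilon> q \<odot>\<^bsub>H\<^esub> (\<epsilon> p \<odot>\<^bsub>H\<^esub> (S y\<^sub>3 \<bullet> S x\<^sub>3))"
      by (simp add: counit_mult HH.KV.smult_assoc1[symmetric] HH.KV.R.m_comm)
    finally show "tsum H (\<Delta> p) (\<lambda>x\<^sub>1 x\<^sub>2. tsum H (\<Delta> q) (\<lambda>y\<^sub>1 y\<^sub>2. ?f x\<^sub>1 x\<^sub>2 x\<^sub>3 y\<^sub>1 y\<^sub>2 y\<^sub>3))
      = \<epsilon> q \<odot>\<^bsub>H\<^esub> (\<epsilon> p \<odot>\<^bsub>H\<^esub> (S y\<^sub>3 \<bullet> S x\<^sub>3))" .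
  qed (use x y in simp_all)
  also have "\<dots> = tsum H (\<Delta> x) (\<lambda>p x\<^sub>3. \<epsilon> p \<odot>\<^bsub>H\<^esub> (S y \<bullet> S x\<^sub>3))"
    using x y by (intro HH.tsum_cong counit_left klin klinear_smultf) simp_all
  also have "\<dots> = S y \<bullet> S x"
    using x y by (intro counit_left klin) simp_all
  finally show ?thesis using 1 by simp
qed

text \<open>Being algebra maps, \<epsilon> \<otimes> id and id \<otimes> \<epsilon> take inverses to
  inverses. This is how the normalisation of F reaches F^-1.\<close>

lemma counit_tsum_alg_hom:
  "alg_hom K (HH K H) H (\<lambda>X. tsum H X (\<lambda>x y. \<epsilon> x \<odot>\<^bsub>H\<^esub> y))"
  "alg_hom K (HH K H) H (\<lambda>X. tsum H X (\<lambda>x y. \<epsilon> y \<odot>\<^bsub>H\<^esub> x))"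
proof -
  have bil: "kbilinear K H H H (\<lambda>x y. \<epsilon> x \<odot>\<^bsub>H\<^esub> y)" "kbilinear K H H H (\<lambda>x y. \<epsilon> y \<odot>\<^bsub>H\<^esub> x)"
    by (intro klin klinear_smultf; simp)+
  have mult: "(a \<odot>\<^bsub>H\<^esub> x) \<bullet> (b \<odot>\<^bsub>H\<^esub> y) = (a \<otimes>\<^bsub>K\<^esub> b) \<odot>\<^bsub>H\<^esub> (x \<bullet> y)"
    if "a \<in> carrier K" "b \<in> carrier K" "x \<in> carrier H" "y \<in> carrier H" for a b x y
    using that klinear_smult[OF kbilinear_left[OF HH.A_mult klinear_ident, of "b \<odot>\<^bsub>H\<^esub> y"], of a x]
      klinear_smult[OF kbilinear_right[OF HH.A_mult klinear_ident, of x], of b y]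
    by (simp add: HH.KV.smult_assoc1)
  show "alg_hom K (HH K H) H (\<lambda>X. tsum H X (\<lambda>x y. \<epsilon> x \<odot>\<^bsub>H\<^esub> y))"
    by (rule HH.alg_homI[OF H_alg HH.bilinear_tsum[OF _ bil(1)]])
      (simp_all add: HH.bilinear_tsum_ptens bil counit_one counit_mult mult)
  show "alg_hom K (HH K H) H (\<lambda>X. tsum H X (\<lambda>x y. \<epsilon> y \<odot>\<^bsub>H\<^esub> x))"
    by (rule HH.alg_homI[OF H_alg HH.bilinear_tsum[OF _ bil(2)]])
      (simp_all add: HH.bilinear_tsum_ptens bil counit_one counit_mult mult)
qed

lemma flip_eq: "flip K H X = tsum (HH K H) X (\<lambda>x y. y \<boxtimes>\<^bsub>HH K H\<^esub> x)"
  by (simp add: flip_def tsum_def)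

lemma bilinear_flip: "kbilinear K H H (HH K H) (\<lambda>x y. y \<boxtimes>\<^bsub>HH K H\<^esub> x)"
  using HH.kbilinear_ptens by (simp add: kbilinear_def)

lemma flip_alg_hom: "alg_hom K (HH K H) (HH K H) (flip K H)"
  unfolding flip_eq[abs_def]
  by (rule HH.alg_homI[OF HH.assoc_algebra_T HH.bilinear_tsum[OF HH.module_T bilinear_flip]])
    (simp_all add: HH.bilinear_tsum_ptens[OF HH.module_T bilinear_flip] HH.one_eq HH.mult_ptens)

lemma tsum_flip:
  assumes "module K Z" "kbilinear K H H Z f" "X \<in> carrier (HH K H)"
  shows "tsum Z (flip K H X) f = tsum Z X (\<lambda>x y. f y x)"
  unfolding flip_eq using assms
  by (subst HH.tsum_hom[OF HH.abelian_T module_abelian klinear_additive[OF HH.bilinear_tsum]])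
    (simp_all add: HH.bilinear_tsum_ptens cong: HH.tsum_cong)

lemma tsum_inverse:
  assumes "module K Z" "kbilinear K H H Z f" "X \<in> Units (HH K H)"
  shows "tsum Z X (\<lambda>x y. tsum Z (inv\<^bsub>HH K H\<^esub> X) (\<lambda>x' y'. f (x \<bullet> x') (y \<bullet> y'))) = f \<one>\<^bsub>H\<^esub> \<one>\<^bsub>H\<^esub>"
    "tsum Z (inv\<^bsub>HH K H\<^esub> X) (\<lambda>x y. tsum Z X (\<lambda>x' y'. f (x \<bullet> x') (y \<bullet> y'))) = f \<one>\<^bsub>H\<^esub> \<one>\<^bsub>H\<^esub>"
  using assms HH.tsum_mult[OF assms(1,2), of X "inv\<^bsub>HH K H\<^esub> X"] HH.tsum_mult[OF assms(1,2), of "inv\<^bsub>HH K H\<^esub> X" X]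
    HH.T.Units_closed HH.T.Units_inv_closed
  by (simp_all add: HH.one_eq HH.bilinear_tsum_ptens)

end

lemma (in monoid) inv_mult_Units:
  assumes "x \<in> Units G" "y \<in> Units G"
  shows "inv (x \<otimes> y) = inv y \<otimes> inv x"
proof (rule inv_unique'[symmetric])
  have [simp]: "x \<in> carrier G" "y \<in> carrier G" using assms by auto
  have "x \<otimes> y \<otimes> (inv y \<otimes> inv x) = x \<otimes> (y \<otimes> inv y) \<otimes> inv x"
    using assms by (simp only: m_assoc Units_inv_closed Units_closed m_closed)
  then show "x \<otimes> y \<otimes> (inv y \<otimes> inv x) = \<one>" using assms by simp
  have "inv y \<otimes> inv x \<otimes> (x \<otimes> y) = inv y \<otimes> (inv x \<otimes> x) \<otimes> y"
    using assms by (simp only: m_assoc Units_inv_closed Units_closed m_closed)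
  then show "inv y \<otimes> inv x \<otimes> (x \<otimes> y) = \<one>" using assms by simp
qed (use assms in auto)

context hopf_alg
begin

lemma HH_swap:
  assumes "module K Z" "X \<in> carrier (HH K H)" "Y \<in> carrier (HH K H)"
    "\<And>a b c d. a \<in> carrier H \<Longrightarrow> b \<in> carrier H \<Longrightarrow> c \<in> carrier H \<Longrightarrow> d \<in> carrier H \<Longrightarrow> f a b c d \<in> carrier Z"
  shows "tsum Z X (\<lambda>a b. tsum Z Y (f a b)) = tsum Z Y (\<lambda>c d. tsum Z X (\<lambda>a b. f a b c d))"
  by (rule tsum_swap[OF HH.tensor_product_axioms HH.tensor_product_axioms module_abelian])
    (use assms in simp_all)

lemma legs_closed:
  assumes "X \<in> carrier (HH K H)"
  shows "leg12 K H X \<in> carrier (HHH K H)" "leg23 K H X \<in> carrier (HHH K H)" "leg13 K H X \<in> carrier (HHH K H)"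
    "comult_id K H X \<in> carrier (HHH K H)" "id_comult K H X \<in> carrier (HHH K H)"
  using assms alg_hom_closed leg12_alg_hom leg23_alg_hom leg13_alg_hom comult_id_alg_hom id_comult_alg_hom
  by metis+

lemma ktrilinear_klin:
  assumes f: "ktrilinear K H H H Z f"
  shows "klinear K M H g \<Longrightarrow> b \<in> carrier H \<Longrightarrow> c \<in> carrier H \<Longrightarrow> klinear K M Z (\<lambda>m. f (g m) b c)"
    "klinear K M H g \<Longrightarrow> a \<in> carrier H \<Longrightarrow> c \<in> carrier H \<Longrightarrow> klinear K M Z (\<lambda>m. f a (g m) c)"
    "klinear K M H g \<Longrightarrow> a \<in> carrier H \<Longrightarrow> b \<in> carrier H \<Longrightarrow> klinear K M Z (\<lambda>m. f a b (g m))"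
  using f klinear_comp[of K H Z "\<lambda>a. f a b c" M g] klinear_comp[of K H Z "\<lambda>b. f a b c" M g]
    klinear_comp[of K H Z "\<lambda>c. f a b c" M g]
  by (simp_all add: ktrilinear_def kbilinear_def)

text \<open>A dictionary from products of legs to iterated sums. Items 1 and 2 serve the inverted
  cocycle identity, 3 to 6 its mixed forms, 7 to 9 the coproducts of R and of its inverse.\<close>

lemma tsum3_leg_mult:
  assumes Z: "module K Z" and f: "ktrilinear K H H H Z f"
    and XY: "X \<in> carrier (HH K H)" "Y \<in> carrier (HH K H)"
  shows "tsum3 Z (comult_id K H X \<otimes>\<^bsub>HHH K H\<^esub> leg12 K H Y) f
    = tsum Z X (\<lambda>x y. tsum Z (\<Delta> x) (\<lambda>x\<^sub>1 x\<^sub>2. tsum Z Y (\<lambda>a b. f (x\<^sub>1 \<bullet> a) (x\<^sub>2 \<bullet> b) y)))"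
    "tsum3 Z (id_comult K H X \<otimes>\<^bsub>HHH K H\<^esub> leg23 K H Y) f
    = tsum Z X (\<lambda>x y. tsum Z (\<Delta> y) (\<lambda>y\<^sub>1 y\<^sub>2. tsum Z Y (\<lambda>a b. f x (y\<^sub>1 \<bullet> a) (y\<^sub>2 \<bullet> b))))"
    "tsum3 Z (leg23 K H X \<otimes>\<^bsub>HHH K H\<^esub> leg12 K H Y) f
    = tsum Z X (\<lambda>x y. tsum Z Y (\<lambda>a b. f a (x \<bullet> b) y))"
    "tsum3 Z (leg12 K H X \<otimes>\<^bsub>HHH K H\<^esub> leg23 K H Y) f
    = tsum Z X (\<lambda>x y. tsum Z Y (\<lambda>a b. f x (y \<bullet> a) b))"
    "tsum3 Z (id_comult K H X \<otimes>\<^bsub>HHH K H\<^esub> comult_id K H Y) f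
    = tsum Z X (\<lambda>x y. tsum Z (\<Delta> y) (\<lambda>y\<^sub>1 y\<^sub>2. tsum Z Y (\<lambda>a b. tsum Z (\<Delta> a) (\<lambda>a\<^sub>1 a\<^sub>2. f (x \<bullet> a\<^sub>1) (y\<^sub>1 \<bullet> a\<^sub>2) (y\<^sub>2 \<bullet> b)))))"
    "tsum3 Z (comult_id K H X \<otimes>\<^bsub>HHH K H\<^esub> id_comult K H Y) f
    = tsum Z X (\<lambda>x y. tsum Z (\<Delta> x) (\<lambda>x\<^sub>1 x\<^sub>2. tsum Z Y (\<lambda>a b. tsum Z (\<Delta> b) (\<lambda>b\<^sub>1 b\<^sub>2. f (x\<^sub>1 \<bullet> a) (x\<^sub>2 \<bullet> b\<^sub>1) (y \<bullet> b\<^sub>2)))))"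
    "tsum3 Z (leg13 K H X \<otimes>\<^bsub>HHH K H\<^esub> leg23 K H Y) f
    = tsum Z X (\<lambda>x y. tsum Z Y (\<lambda>a b. f x a (y \<bullet> b)))"
    "tsum3 Z (leg13 K H X \<otimes>\<^bsub>HHH K H\<^esub> leg12 K H Y) f
    = tsum Z X (\<lambda>x y. tsum Z Y (\<lambda>a b. f (x \<bullet> a) b y))"
    "tsum3 Z (leg23 K H X \<otimes>\<^bsub>HHH K H\<^esub> leg13 K H Y) f
    = tsum Z X (\<lambda>x y. tsum Z Y (\<lambda>a b. f a x (y \<bullet> b)))"
  by (subst tsum3_mult[OF Z f], simp_all only: legs_closed XY,
      simp add: XY legs_closed tsum3_leg12[OF Z] tsum3_leg23[OF Z] tsum3_leg13[OF Z] tsum3_comult_id[OF Z]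
        tsum3_id_comult[OF Z] Z ktrilinear_klin[OF f] klin cong: HH.tsum_cong tsum3_cong)+

end

section \<open>Forms of the cocycle identity, and invertibility of \<chi>\<close>

section \<open>Twists\<close>

locale twisted_hopf = hopf_alg K H
  for K :: "('k, 'r) ring_scheme" and H :: "('k, 'h) hopf" +
  fixes F :: "('h, 'h) tens"
  assumes twist: "twist K H F"
begin

abbreviation (input) "Fb \<equiv> inv\<^bsub>HH K H\<^esub> F"

lemma F_Units: "F \<in> Units (HH K H)"
  using twist by (simp add: twist_def)

lemma F_closed [simp]: "F \<in> carrier (HH K H)" "Fb \<in> carrier (HH K H)"
  using F_Units by auto

lemma cocycle: "leg12 K H F \<otimes>\<^bsub>HHH K H\<^esub> comult_id K H F = leg23 K H F \<otimes>\<^bsub>HHH K H\<^esub> id_comult K H F"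
  using twist by (simp add: twist_def)

lemma twist_hom_Units:
  assumes "alg_hom K (HH K H) (HHH K H) h"
  shows "h F \<in> Units (HHH K H)" "h Fb = inv\<^bsub>HHH K H\<^esub> (h F)"
  using alg_hom_unit_inv[OF HH.assoc_algebra_T HHH.assoc_algebra_T assms F_Units] by simp_all

lemmas twist_Units =
  twist_hom_Units[OF leg12_alg_hom] twist_hom_Units[OF leg23_alg_hom]
  twist_hom_Units[OF comult_id_alg_hom] twist_hom_Units[OF id_comult_alg_hom]

text \<open>Inversion reverses the order of the factors. This form governs \<phi>, which is built
  from F^-1.\<close>

lemma cocycle_inv:
  "comult_id K H Fb \<otimes>\<^bsub>HHH K H\<^esub> leg12 K H Fb = id_comult K H Fb \<otimes>\<^bsub>HHH K H\<^esub> leg23 K H Fb"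
  using arg_cong[OF cocycle, of "m_inv (HHH K H)"] by (simp add: HHH.T.inv_mult_Units twist_Units)

text \<open>The cocycle identity solved for other factors. The first two forms, in which F^-1 meets
  F in the middle component, are used to invert \<chi>. The third is solved for (\<Delta> \<otimes>
  id) F^-1 and is used where a factor F has to appear: in D_F and in the inverse of R^F.\<close>

lemma cocycle_mixed:
  "leg23 K H Fb \<otimes>\<^bsub>HHH K H\<^esub> leg12 K H F = id_comult K H F \<otimes>\<^bsub>HHH K H\<^esub> comult_id K H Fb"
  "leg12 K H Fb \<otimes>\<^bsub>HHH K H\<^esub> leg23 K H F = comult_id K H F \<otimes>\<^bsub>HHH K H\<^esub> id_comult K H Fb"
  "comult_id K H Fb = id_comult K H Fb \<otimes>\<^bsub>HHH K H\<^esub> (leg23 K H Fb \<otimes>\<^bsub>HHH K H\<^esub> leg12 K H F)"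
proof -
  let ?m = "\<lambda>x y. x \<otimes>\<^bsub>HHH K H\<^esub> y"
  let ?a = "leg12 K H F" and ?b = "comult_id K H F" and ?c = "leg23 K H F" and ?d = "id_comult K H F"
  let ?i = "m_inv (HHH K H)"
  have U: "?a \<in> Units (HHH K H)" "?b \<in> Units (HHH K H)" "?c \<in> Units (HHH K H)" "?d \<in> Units (HHH K H)"
    by (simp_all add: twist_Units)
  have C: "?a \<in> carrier (HHH K H)" "?b \<in> carrier (HHH K H)" "?c \<in> carrier (HHH K H)" "?d \<in> carrier (HHH K H)"
    "?i ?a \<in> carrier (HHH K H)" "?i ?b \<in> carrier (HHH K H)" "?i ?c \<in> carrier (HHH K H)" "?i ?d \<in> carrier (HHH K H)"
    using U by auto
  have eq: "?m ?a ?b = ?m ?c ?d" by (rule cocycle)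
  have "?m (?i ?c) ?a = ?m (?m (?i ?c) (?m ?a ?b)) (?i ?b)"
    using C U by (simp add: HHH.T.m_assoc)
  also have "\<dots> = ?m ?d (?i ?b)"
    unfolding eq using C U by (simp add: HHH.T.m_assoc[symmetric])
  finally show 1: "?m (leg23 K H Fb) ?a = ?m ?d (comult_id K H Fb)"
    by (simp add: twist_Units)
  have "?m (?i ?a) ?c = ?m (?m (?i ?a) (?m ?c ?d)) (?i ?d)"
    using C U by (simp add: HHH.T.m_assoc)
  also have "\<dots> = ?m ?b (?i ?d)"
    unfolding eq[symmetric] using C U by (simp add: HHH.T.m_assoc[symmetric])
  finally show "?m (leg12 K H Fb) ?c = ?m ?b (id_comult K H Fb)"
    by (simp add: twist_Units)
  show "comult_id K H Fb = ?m (id_comult K H Fb) (?m (leg23 K H Fb) ?a)"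
    unfolding 1 using C U by (simp add: twist_Units HHH.T.m_assoc[symmetric])
qed

context
  fixes Z :: "('k, 'z, 'q) module_scheme" and f :: "'h \<Rightarrow> 'h \<Rightarrow> 'h \<Rightarrow> 'z"
  assumes Z: "module K Z" and f: "ktrilinear K H H H Z f"
begin

lemma tsum_cocycle_inv:
  "tsum Z Fb (\<lambda>x y. tsum Z (\<Delta> x) (\<lambda>x\<^sub>1 x\<^sub>2. tsum Z Fb (\<lambda>a b. f (x\<^sub>1 \<bullet> a) (x\<^sub>2 \<bullet> b) y)))
    = tsum Z Fb (\<lambda>x y. tsum Z (\<Delta> y) (\<lambda>y\<^sub>1 y\<^sub>2. tsum Z Fb (\<lambda>a b. f x (y\<^sub>1 \<bullet> a) (y\<^sub>2 \<bullet> b))))"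
  using tsum3_leg_mult(1,2)[OF Z f F_closed(2) F_closed(2)] cocycle_inv by simp

lemma tsum_cocycle_mixed:
  "tsum Z Fb (\<lambda>x y. tsum Z F (\<lambda>a b. f a (x \<bullet> b) y))
    = tsum Z F (\<lambda>x y. tsum Z (\<Delta> y) (\<lambda>y\<^sub>1 y\<^sub>2. tsum Z Fb (\<lambda>a b. tsum Z (\<Delta> a) (\<lambda>a\<^sub>1 a\<^sub>2.
        f (x \<bullet> a\<^sub>1) (y\<^sub>1 \<bullet> a\<^sub>2) (y\<^sub>2 \<bullet> b)))))"
  "tsum Z Fb (\<lambda>x y. tsum Z F (\<lambda>a b. f x (y \<bullet> a) b))
    = tsum Z F (\<lambda>x y. tsum Z (\<Delta> x) (\<lambda>x\<^sub>1 x\<^sub>2. tsum Z Fb (\<lambda>a b. tsum Z (\<Delta> b) (\<lambda>b\<^sub>1 b\<^sub>2.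
        f (x\<^sub>1 \<bullet> a) (x\<^sub>2 \<bullet> b\<^sub>1) (y \<bullet> b\<^sub>2)))))"
  "tsum Z Fb (\<lambda>x y. tsum Z (\<Delta> x) (\<lambda>x\<^sub>1 x\<^sub>2. f x\<^sub>1 x\<^sub>2 y))
    = tsum Z Fb (\<lambda>x y. tsum Z (\<Delta> y) (\<lambda>y\<^sub>1 y\<^sub>2. tsum Z Fb (\<lambda>u v. tsum Z F (\<lambda>p q.
        f (x \<bullet> p) (y\<^sub>1 \<bullet> (u \<bullet> q)) (y\<^sub>2 \<bullet> v)))))"
proof -
  show "tsum Z Fb (\<lambda>x y. tsum Z F (\<lambda>a b. f a (x \<bullet> b) y))
    = tsum Z F (\<lambda>x y. tsum Z (\<Delta> y) (\<lambda>y\<^sub>1 y\<^sub>2. tsum Z Fb (\<lambda>a b. tsum Z (\<Delta> a) (\<lambda>a\<^sub>1 a\<^sub>2.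
        f (x \<bullet> a\<^sub>1) (y\<^sub>1 \<bullet> a\<^sub>2) (y\<^sub>2 \<bullet> b)))))"
    using tsum3_leg_mult(3)[OF Z f F_closed(2) F_closed(1)] tsum3_leg_mult(5)[OF Z f F_closed(1) F_closed(2)]
      cocycle_mixed(1) by simp
  show "tsum Z Fb (\<lambda>x y. tsum Z F (\<lambda>a b. f x (y \<bullet> a) b))
    = tsum Z F (\<lambda>x y. tsum Z (\<Delta> x) (\<lambda>x\<^sub>1 x\<^sub>2. tsum Z Fb (\<lambda>a b. tsum Z (\<Delta> b) (\<lambda>b\<^sub>1 b\<^sub>2.
        f (x\<^sub>1 \<bullet> a) (x\<^sub>2 \<bullet> b\<^sub>1) (y \<bullet> b\<^sub>2)))))"
    using tsum3_leg_mult(4)[OF Z f F_closed(2) F_closed(1)] tsum3_leg_mult(6)[OF Z f F_closed(1) F_closed(2)]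
      cocycle_mixed(2) by simp
  have "tsum3 Z (comult_id K H Fb) f
    = tsum3 Z (id_comult K H Fb \<otimes>\<^bsub>HHH K H\<^esub> (leg23 K H Fb \<otimes>\<^bsub>HHH K H\<^esub> leg12 K H F)) f"
    using cocycle_mixed(3) by simp
  also have "\<dots> = tsum3 Z (id_comult K H Fb) (\<lambda>a b c. tsum3 Z (leg23 K H Fb \<otimes>\<^bsub>HHH K H\<^esub> leg12 K H F)
      (\<lambda>a' b' c'. f (a \<bullet> a') (b \<bullet> b') (c \<bullet> c')))"
    by (rule tsum3_mult[OF Z f]) (simp_all add: legs_closed HHH.mult_closed)
  also have "\<dots> = tsum Z Fb (\<lambda>x y. tsum Z (\<Delta> y) (\<lambda>y\<^sub>1 y\<^sub>2. tsum Z Fb (\<lambda>u v. tsum Z F (\<lambda>p q.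
        f (x \<bullet> p) (y\<^sub>1 \<bullet> (u \<bullet> q)) (y\<^sub>2 \<bullet> v)))))"
    by (simp add: legs_closed tsum3_leg_mult(3)[OF Z] tsum3_id_comult[OF Z] Z ktrilinear_klin[OF f] klin
        cong: HH.tsum_cong tsum3_cong)
  finally show "tsum Z Fb (\<lambda>x y. tsum Z (\<Delta> x) (\<lambda>x\<^sub>1 x\<^sub>2. f x\<^sub>1 x\<^sub>2 y))
    = tsum Z Fb (\<lambda>x y. tsum Z (\<Delta> y) (\<lambda>y\<^sub>1 y\<^sub>2. tsum Z Fb (\<lambda>u v. tsum Z F (\<lambda>p q.
        f (x \<bullet> p) (y\<^sub>1 \<bullet> (u \<bullet> q)) (y\<^sub>2 \<bullet> v)))))"
    using tsum3_comult_id[OF Z f F_closed(2)] by simp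
qed

end

lemma twist_counit:
  "tsum H F (\<lambda>x y. \<epsilon> x \<odot>\<^bsub>H\<^esub> y) = \<one>\<^bsub>H\<^esub>" "tsum H F (\<lambda>x y. \<epsilon> y \<odot>\<^bsub>H\<^esub> x) = \<one>\<^bsub>H\<^esub>"
  "tsum H Fb (\<lambda>x y. \<epsilon> x \<odot>\<^bsub>H\<^esub> y) = \<one>\<^bsub>H\<^esub>" "tsum H Fb (\<lambda>x y. \<epsilon> y \<odot>\<^bsub>H\<^esub> x) = \<one>\<^bsub>H\<^esub>"
proof -
  show 1: "tsum H F (\<lambda>x y. \<epsilon> x \<odot>\<^bsub>H\<^esub> y) = \<one>\<^bsub>H\<^esub>" "tsum H F (\<lambda>x y. \<epsilon> y \<odot>\<^bsub>H\<^esub> x) = \<one>\<^bsub>H\<^esub>"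
    using twist by (simp_all add: twist_def tsum_def)
  show "tsum H Fb (\<lambda>x y. \<epsilon> x \<odot>\<^bsub>H\<^esub> y) = \<one>\<^bsub>H\<^esub>" "tsum H Fb (\<lambda>x y. \<epsilon> y \<odot>\<^bsub>H\<^esub> x) = \<one>\<^bsub>H\<^esub>"
    using alg_hom_unit_inv(2)[OF HH.assoc_algebra_T H_alg counit_tsum_alg_hom(1) F_Units]
      alg_hom_unit_inv(2)[OF HH.assoc_algebra_T H_alg counit_tsum_alg_hom(2) F_Units]
    by (simp_all add: 1)
qed

lemma tsum_twist_counit:
  assumes Z: "module K Z" and g: "klinear K H Z g"
  shows "tsum Z F (\<lambda>x y. \<epsilon> x \<odot>\<^bsub>Z\<^esub> g y) = g \<one>\<^bsub>H\<^esub>" "tsum Z F (\<lambda>x y. \<epsilon> y \<odot>\<^bsub>Z\<^esub> g x) = g \<one>\<^bsub>H\<^esub>"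
    "tsum Z Fb (\<lambda>x y. \<epsilon> x \<odot>\<^bsub>Z\<^esub> g y) = g \<one>\<^bsub>H\<^esub>" "tsum Z Fb (\<lambda>x y. \<epsilon> y \<odot>\<^bsub>Z\<^esub> g x) = g \<one>\<^bsub>H\<^esub>"
  using klinear_tsum_H[OF Z g F_closed(1), of "\<lambda>x y. \<epsilon> x \<odot>\<^bsub>H\<^esub> y"]
    klinear_tsum_H[OF Z g F_closed(1), of "\<lambda>x y. \<epsilon> y \<odot>\<^bsub>H\<^esub> x"]
    klinear_tsum_H[OF Z g F_closed(2), of "\<lambda>x y. \<epsilon> x \<odot>\<^bsub>H\<^esub> y"]
    klinear_tsum_H[OF Z g F_closed(2), of "\<lambda>x y. \<epsilon> y \<odot>\<^bsub>H\<^esub> x"]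
  by (simp_all add: twist_counit klinear_smult[OF g] cong: HH.tsum_cong)

definition "\<chi> = tsum H F (\<lambda>x y. x \<bullet> S y)"

text \<open>The classical formula for the inverse of \<chi>: F is replaced by F^-1 and the antipode
  sits on the other leg.\<close>

definition "\<upsilon> = tsum H Fb (\<lambda>x y. S x \<bullet> y)"

lemma chi_closed [simp]: "\<chi> \<in> carrier H" "\<upsilon> \<in> carrier H"
  unfolding \<chi>_def \<upsilon>_def by (auto intro!: HH.tsum_closed)

lemma chi_inverse: "\<chi> \<bullet> \<upsilon> = \<one>\<^bsub>H\<^esub>" "\<upsilon> \<bullet> \<chi> = \<one>\<^bsub>H\<^esub>"
proof -
  have mult_l: "tsum H X f \<bullet> b = tsum H X (\<lambda>x y. f x y \<bullet> b)"
    and mult_r: "b \<bullet> tsum H X f = tsum H X (\<lambda>x y. b \<bullet> f x y)"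
    if "X \<in> carrier (HH K H)" "b \<in> carrier H" "\<And>x y. x \<in> carrier H \<Longrightarrow> y \<in> carrier H \<Longrightarrow> f x y \<in> carrier H" for X f b
    using that klinear_tsum_H[of H "\<lambda>x. x \<bullet> b"] klinear_tsum_H[of H "\<lambda>x. b \<bullet> x"] by (simp_all add: klin)
  have "\<chi> \<bullet> \<upsilon> = tsum H Fb (\<lambda>x y. tsum H F (\<lambda>a b. (a \<bullet> S b) \<bullet> (S x \<bullet> y)))"
    unfolding \<upsilon>_def by (simp add: mult_r) (simp add: \<chi>_def mult_l cong: HH.tsum_cong)
  also have "\<dots> = tsum H Fb (\<lambda>x y. tsum H F (\<lambda>a b. a \<bullet> S (x \<bullet> b) \<bullet> y))"
    by (simp add: antipode_mult HH.A.m_assoc cong: HH.tsum_cong)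
  \<comment> \<open>F^-1 and F meet in the middle component \<open>x \<bullet> b\<close> under
    \<open>S\<close>, so the first mixed form applies. Afterwards the antipode axioms remove both
    coproducts, and the normalisations of F^-1 and F remove the rest.\<close>
  also have "\<dots> = tsum H F (\<lambda>x y. tsum H (\<Delta> y) (\<lambda>y\<^sub>1 y\<^sub>2. tsum H Fb (\<lambda>a b. tsum H (\<Delta> a) (\<lambda>a\<^sub>1 a\<^sub>2.
        (x \<bullet> a\<^sub>1) \<bullet> S (y\<^sub>1 \<bullet> a\<^sub>2) \<bullet> (y\<^sub>2 \<bullet> b)))))"
    by (rule tsum_cocycle_mixed(1)[OF module_H]) (intro klin, simp_all)
  also have "\<dots> = tsum H F (\<lambda>x y. tsum H (\<Delta> y) (\<lambda>y\<^sub>1 y\<^sub>2. tsum H Fb (\<lambda>a b. \<epsilon> a \<odot>\<^bsub>H\<^esub>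
        (x \<bullet> (S y\<^sub>1 \<bullet> y\<^sub>2) \<bullet> b))))"
  proof (intro HH.tsum_cong)
    fix x y y\<^sub>1 y\<^sub>2 a b
    assume [simp]: "x \<in> carrier H" "y \<in> carrier H" "y\<^sub>1 \<in> carrier H" "y\<^sub>2 \<in> carrier H" "a \<in> carrier H" "b \<in> carrier H"
    show "tsum H (\<Delta> a) (\<lambda>a\<^sub>1 a\<^sub>2. (x \<bullet> a\<^sub>1) \<bullet> S (y\<^sub>1 \<bullet> a\<^sub>2) \<bullet> (y\<^sub>2 \<bullet> b))
      = \<epsilon> a \<odot>\<^bsub>H\<^esub> (x \<bullet> (S y\<^sub>1 \<bullet> y\<^sub>2) \<bullet> b)"
      using antipode_right[of H "\<lambda>z. x \<bullet> (z \<bullet> (S y\<^sub>1 \<bullet> (y\<^sub>2 \<bullet> b)))" a]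
      by (simp add: klin antipode_mult HH.A.m_assoc cong: HH.tsum_cong)
  qed simp_all
  also have "\<dots> = tsum H F (\<lambda>x y. tsum H (\<Delta> y) (\<lambda>y\<^sub>1 y\<^sub>2. x \<bullet> (S y\<^sub>1 \<bullet> y\<^sub>2) \<bullet> \<one>\<^bsub>H\<^esub>))"
    by (intro HH.tsum_cong tsum_twist_counit klin) simp_all
  also have "\<dots> = tsum H F (\<lambda>x y. \<epsilon> y \<odot>\<^bsub>H\<^esub> (x \<bullet> \<one>\<^bsub>H\<^esub> \<bullet> \<one>\<^bsub>H\<^esub>))"
    by (intro HH.tsum_cong antipode_left klin) simp_all
  also have "\<dots> = \<one>\<^bsub>H\<^esub>"
    using tsum_twist_counit(2)[of H "\<lambda>x. x"] by (simp add: klin cong: HH.tsum_cong)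
  finally show "\<chi> \<bullet> \<upsilon> = \<one>\<^bsub>H\<^esub>" .
  have "\<upsilon> \<bullet> \<chi> = tsum H Fb (\<lambda>x y. tsum H F (\<lambda>a b. (S x \<bullet> y) \<bullet> (a \<bullet> S b)))"
    unfolding \<upsilon>_def by (simp add: mult_l) (simp add: \<chi>_def mult_r cong: HH.tsum_cong)
  also have "\<dots> = tsum H Fb (\<lambda>x y. tsum H F (\<lambda>a b. S x \<bullet> (y \<bullet> a) \<bullet> S b))"
    by (simp add: HH.A.m_assoc cong: HH.tsum_cong)
  \<comment> \<open>Here the middle component is \<open>y \<bullet> a\<close>, which calls for the
    second mixed form.\<close>
  also have "\<dots> = tsum H F (\<lambda>x y. tsum H (\<Delta> x) (\<lambda>x\<^sub>1 x\<^sub>2. tsum H Fb (\<lambda>a b. tsum H (\<Delta> b) (\<lambda>b\<^sub>1 b\<^sub>2.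
        S (x\<^sub>1 \<bullet> a) \<bullet> (x\<^sub>2 \<bullet> b\<^sub>1) \<bullet> S (y \<bullet> b\<^sub>2)))))"
    by (rule tsum_cocycle_mixed(2)[OF module_H]) (intro klin, simp_all)
  also have "\<dots> = tsum H F (\<lambda>x y. tsum H (\<Delta> x) (\<lambda>x\<^sub>1 x\<^sub>2. tsum H Fb (\<lambda>a b. \<epsilon> b \<odot>\<^bsub>H\<^esub>
        (S a \<bullet> (S x\<^sub>1 \<bullet> x\<^sub>2) \<bullet> S y))))"
  proof (intro HH.tsum_cong)
    fix x y x\<^sub>1 x\<^sub>2 a b
    assume [simp]: "x \<in> carrier H" "y \<in> carrier H" "x\<^sub>1 \<in> carrier H" "x\<^sub>2 \<in> carrier H" "a \<in> carrier H" "b \<in> carrier H"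
    show "tsum H (\<Delta> b) (\<lambda>b\<^sub>1 b\<^sub>2. S (x\<^sub>1 \<bullet> a) \<bullet> (x\<^sub>2 \<bullet> b\<^sub>1) \<bullet> S (y \<bullet> b\<^sub>2))
      = \<epsilon> b \<odot>\<^bsub>H\<^esub> (S a \<bullet> (S x\<^sub>1 \<bullet> x\<^sub>2) \<bullet> S y)"
      using antipode_right[of H "\<lambda>z. S a \<bullet> (S x\<^sub>1 \<bullet> (x\<^sub>2 \<bullet> (z \<bullet> S y)))" b]
      by (simp add: klin antipode_mult HH.A.m_assoc cong: HH.tsum_cong)
  qed simp_all
  also have "\<dots> = tsum H F (\<lambda>x y. tsum H (\<Delta> x) (\<lambda>x\<^sub>1 x\<^sub>2. S \<one>\<^bsub>H\<^esub> \<bullet> (S x\<^sub>1 \<bullet> x\<^sub>2) \<bullet> S y))"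
    by (intro HH.tsum_cong tsum_twist_counit klin) simp_all
  also have "\<dots> = tsum H F (\<lambda>x y. \<epsilon> x \<odot>\<^bsub>H\<^esub> (S \<one>\<^bsub>H\<^esub> \<bullet> \<one>\<^bsub>H\<^esub> \<bullet> S y))"
    by (intro HH.tsum_cong antipode_left klin) simp_all
  also have "\<dots> = \<one>\<^bsub>H\<^esub>"
    using tsum_twist_counit(1)[of H "\<lambda>x. S x"] by (simp add: klin antipode_one cong: HH.tsum_cong)
  finally show "\<upsilon> \<bullet> \<chi> = \<one>\<^bsub>H\<^esub>" .
qed

lemma inv_chi: "inv\<^bsub>H\<^esub> \<chi> = \<upsilon>"
  by (rule HH.A.inv_unique'[symmetric]) (simp_all add: chi_inverse)

text \<open>The element \<open>f\<^sub>1 \<otimes> S(f\<^sub>2) f'\<close>, summed over \<open>F\<^sup>-\<^sup>1 = f \<otimes> f'\<close>, through which \<open>DF\<close> acts on linear maps.\<close>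

lemma tsum_twist_adjoint:
  assumes Z: "module K Z" and \<Phi>: "kbilinear K H H Z \<Phi>"
  shows "tsum Z Fb (\<lambda>x y. tsum Z (\<Delta> x) (\<lambda>x\<^sub>1 x\<^sub>2. \<Phi> x\<^sub>1 (S x\<^sub>2 \<bullet> y)))
    = tsum Z F (\<lambda>x y. \<Phi> x (S y \<bullet> \<upsilon>))"
proof -
  note \<Phi>_klin = kbilinear_left[OF \<Phi>] kbilinear_right[OF \<Phi>]
  note \<Phi>_closed = kbilinear_closed[OF \<Phi>]
  \<comment> \<open>The cocycle identity solved for (\<Delta> \<otimes> id) F^-1 leads to S(y_1)
    y_2, so the coproduct of \<open>y\<close> disappears. The inner F^-1 becomes
    \<open>\<upsilon>\<close>, and a sum over F remains.\<close>
  have "tsum Z Fb (\<lambda>x y. tsum Z (\<Delta> x) (\<lambda>x\<^sub>1 x\<^sub>2. \<Phi> x\<^sub>1 (S x\<^sub>2 \<bullet> y)))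
    = tsum Z Fb (\<lambda>x y. tsum Z (\<Delta> y) (\<lambda>y\<^sub>1 y\<^sub>2. tsum Z Fb (\<lambda>u v. tsum Z F (\<lambda>p q.
        \<Phi> (x \<bullet> p) (S (y\<^sub>1 \<bullet> (u \<bullet> q)) \<bullet> (y\<^sub>2 \<bullet> v))))))"
    by (rule tsum_cocycle_mixed(3)[OF Z]) (intro klin \<Phi>_klin, simp_all)
  also have "\<dots> = tsum Z Fb (\<lambda>x y. tsum Z (\<Delta> y) (\<lambda>y\<^sub>1 y\<^sub>2. tsum Z Fb (\<lambda>u v. tsum Z F (\<lambda>p q.
        \<Phi> (x \<bullet> p) (S (u \<bullet> q) \<bullet> ((S y\<^sub>1 \<bullet> y\<^sub>2) \<bullet> v))))))"
    by (simp add: antipode_mult HH.A.m_assoc cong: HH.tsum_cong)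
  also have "\<dots> = tsum Z Fb (\<lambda>x y. tsum Z Fb (\<lambda>u v. tsum Z (\<Delta> y) (\<lambda>y\<^sub>1 y\<^sub>2. tsum Z F (\<lambda>p q.
        \<Phi> (x \<bullet> p) (S (u \<bullet> q) \<bullet> ((S y\<^sub>1 \<bullet> y\<^sub>2) \<bullet> v))))))"
    by (intro HH.tsum_cong HH_swap[OF Z] HH.tsum_closed[OF module_abelian[OF Z]]) (simp_all add: \<Phi>_closed)
  also have "\<dots> = tsum Z Fb (\<lambda>x y. tsum Z Fb (\<lambda>u v. tsum Z F (\<lambda>p q. tsum Z (\<Delta> y) (\<lambda>y\<^sub>1 y\<^sub>2.
        \<Phi> (x \<bullet> p) (S (u \<bullet> q) \<bullet> ((S y\<^sub>1 \<bullet> y\<^sub>2) \<bullet> v))))))"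
    by (intro HH.tsum_cong HH_swap[OF Z]) (simp_all add: \<Phi>_closed)
  also have "\<dots> = tsum Z Fb (\<lambda>x y. tsum Z Fb (\<lambda>u v. tsum Z F (\<lambda>p q. \<epsilon> y \<odot>\<^bsub>Z\<^esub>
        \<Phi> (x \<bullet> p) (S (u \<bullet> q) \<bullet> (\<one>\<^bsub>H\<^esub> \<bullet> v)))))"
    by (intro HH.tsum_cong antipode_left[OF Z] klin \<Phi>_klin) simp_all
  also have "\<dots> = tsum Z Fb (\<lambda>x y. \<epsilon> y \<odot>\<^bsub>Z\<^esub> tsum Z Fb (\<lambda>u v. tsum Z F (\<lambda>p q.
        \<Phi> (x \<bullet> p) (S (u \<bullet> q) \<bullet> v))))"
    by (simp add: tsum_smult[OF Z] \<Phi>_closed HH.tsum_closed[OF module_abelian[OF Z]] cong: HH.tsum_cong)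
  also have "\<dots> = tsum Z Fb (\<lambda>u v. tsum Z F (\<lambda>p q. \<Phi> (\<one>\<^bsub>H\<^esub> \<bullet> p) (S (u \<bullet> q) \<bullet> v)))"
    by (intro tsum_twist_counit[OF Z] klin \<Phi>_klin Z) simp_all
  also have "\<dots> = tsum Z F (\<lambda>p q. tsum Z Fb (\<lambda>u v. \<Phi> p (S q \<bullet> (S u \<bullet> v))))"
    by (subst HH_swap[OF Z]) (simp_all add: \<Phi>_closed antipode_mult HH.A.m_assoc cong: HH.tsum_cong)
  also have "\<dots> = tsum Z F (\<lambda>p q. \<Phi> p (S q \<bullet> \<upsilon>))"
    unfolding \<upsilon>_def by (intro HH.tsum_cong klinear_tsum_H[OF Z, symmetric] klin \<Phi>_klin) simp_all
  finally show ?thesis .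
qed

end

section \<open>Quasi-cocommutativity, the coproducts of R, and its counit\<close>

section \<open>Universal R-matrices\<close>

locale quasitriangular_hopf = hopf_alg K H
  for K :: "('k, 'r) ring_scheme" and H :: "('k, 'h) hopf" +
  fixes R :: "('h, 'h) tens"
  assumes quasitriangular: "quasitriangular K H R"
begin

abbreviation (input) "Rb \<equiv> inv\<^bsub>HH K H\<^esub> R"

lemma R_Units: "R \<in> Units (HH K H)"
  using quasitriangular by (simp add: quasitriangular_def)

lemma R_closed [simp]: "R \<in> carrier (HH K H)" "Rb \<in> carrier (HH K H)"
  using R_Units by auto

lemma R_inverse [simp]: "R \<otimes>\<^bsub>HH K H\<^esub> Rb = \<one>\<^bsub>HH K H\<^esub>" "Rb \<otimes>\<^bsub>HH K H\<^esub> R = \<one>\<^bsub>HH K H\<^esub>"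
  using R_Units by simp_all

lemma flip_closed [simp]: "X \<in> carrier (HH K H) \<Longrightarrow> flip K H X \<in> carrier (HH K H)"
  by (rule alg_hom_closed[OF flip_alg_hom])

text \<open>Quasi-cocommutativity with one factor moved across, so that R or its inverse can be slid
  past a coproduct.\<close>

lemma R_comult:
  assumes "\<xi> \<in> carrier H"
  shows "R \<otimes>\<^bsub>HH K H\<^esub> \<Delta> \<xi> = flip K H (\<Delta> \<xi>) \<otimes>\<^bsub>HH K H\<^esub> R"
    "Rb \<otimes>\<^bsub>HH K H\<^esub> flip K H (\<Delta> \<xi>) = \<Delta> \<xi> \<otimes>\<^bsub>HH K H\<^esub> Rb"
proof -
  have eq: "flip K H (\<Delta> \<xi>) = R \<otimes>\<^bsub>HH K H\<^esub> \<Delta> \<xi> \<otimes>\<^bsub>HH K H\<^esub> Rb"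
    using quasitriangular assms by (simp add: quasitriangular_def)
  show "R \<otimes>\<^bsub>HH K H\<^esub> \<Delta> \<xi> = flip K H (\<Delta> \<xi>) \<otimes>\<^bsub>HH K H\<^esub> R"
    using assms by (simp add: eq HH.T.m_assoc)
  have "Rb \<otimes>\<^bsub>HH K H\<^esub> (R \<otimes>\<^bsub>HH K H\<^esub> (\<Delta> \<xi> \<otimes>\<^bsub>HH K H\<^esub> Rb)) = \<Delta> \<xi> \<otimes>\<^bsub>HH K H\<^esub> Rb"
    using assms by (simp add: HH.T.m_assoc[symmetric])
  then show "Rb \<otimes>\<^bsub>HH K H\<^esub> flip K H (\<Delta> \<xi>) = \<Delta> \<xi> \<otimes>\<^bsub>HH K H\<^esub> Rb"
    using assms by (simp add: eq HH.T.m_assoc)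
qed

lemma R_coproducts:
  "comult_id K H R = leg13 K H R \<otimes>\<^bsub>HHH K H\<^esub> leg23 K H R"
  "id_comult K H R = leg13 K H R \<otimes>\<^bsub>HHH K H\<^esub> leg12 K H R"
  using quasitriangular by (simp_all add: quasitriangular_def)

lemma R_hom_Units:
  assumes "alg_hom K (HH K H) (HHH K H) h"
  shows "h R \<in> Units (HHH K H)" "h Rb = inv\<^bsub>HHH K H\<^esub> (h R)"
  using alg_hom_unit_inv[OF HH.assoc_algebra_T HHH.assoc_algebra_T assms R_Units] by simp_all

text \<open>Inversion reverses the legs: in the iterated sum the first component now comes from the
  inner copy of R^-1, unlike for R.\<close>

lemma Rb_coproduct: "comult_id K H Rb = leg23 K H Rb \<otimes>\<^bsub>HHH K H\<^esub> leg13 K H Rb"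
  using R_hom_Units[OF leg13_alg_hom] R_hom_Units[OF leg23_alg_hom] R_hom_Units[OF comult_id_alg_hom]
  by (simp add: R_coproducts HHH.T.inv_mult_Units)

context
  fixes Z :: "('k, 'z, 'q) module_scheme"
  assumes Z: "module K Z"
begin

lemma tsum_R_comult:
  assumes "kbilinear K H H Z f" "\<xi> \<in> carrier H"
  shows "tsum Z R (\<lambda>x y. tsum Z (\<Delta> \<xi>) (\<lambda>a b. f (x \<bullet> a) (y \<bullet> b)))
    = tsum Z (\<Delta> \<xi>) (\<lambda>a b. tsum Z R (\<lambda>x y. f (b \<bullet> x) (a \<bullet> y)))"
    "tsum Z Rb (\<lambda>x y. tsum Z (\<Delta> \<xi>) (\<lambda>a b. f (x \<bullet> b) (y \<bullet> a)))
    = tsum Z (\<Delta> \<xi>) (\<lambda>a b. tsum Z Rb (\<lambda>x y. f (a \<bullet> x) (b \<bullet> y)))"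
proof -
  have f_klin: "klinear K M Z (\<lambda>m. f (g m) b)" "klinear K M Z (\<lambda>m. f b (g m))"
    if "klinear K M H g" "b \<in> carrier H" for M :: "('k, 'm, 'x) module_scheme" and g b
    using that assms(1) by (auto intro: kbilinear_left kbilinear_right)
  have bil: "kbilinear K H H Z (\<lambda>a b. tsum Z X (\<lambda>x y. f (a \<bullet> x) (b \<bullet> y)))"
    if "X \<in> carrier (HH K H)" for X
    using that Z by (intro klin f_klin) simp_all
  have bil': "kbilinear K H H Z (\<lambda>x y. f (a \<bullet> x) (b \<bullet> y))"
    if "a \<in> carrier H" "b \<in> carrier H" for a b
    using that by (intro klin f_klin) simp_all
  show "tsum Z R (\<lambda>x y. tsum Z (\<Delta> \<xi>) (\<lambda>a b. f (x \<bullet> a) (y \<bullet> b)))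
    = tsum Z (\<Delta> \<xi>) (\<lambda>a b. tsum Z R (\<lambda>x y. f (b \<bullet> x) (a \<bullet> y)))"
    using HH.tsum_mult[OF Z assms(1), of R "\<Delta> \<xi>"] HH.tsum_mult[OF Z assms(1), of "flip K H (\<Delta> \<xi>)" R]
      R_comult(1)[OF assms(2)] assms(2) by (simp add: tsum_flip[OF Z] bil)
  show "tsum Z Rb (\<lambda>x y. tsum Z (\<Delta> \<xi>) (\<lambda>a b. f (x \<bullet> b) (y \<bullet> a)))
    = tsum Z (\<Delta> \<xi>) (\<lambda>a b. tsum Z Rb (\<lambda>x y. f (a \<bullet> x) (b \<bullet> y)))"
    using HH.tsum_mult[OF Z assms(1), of "\<Delta> \<xi>" Rb] HH.tsum_mult[OF Z assms(1), of Rb "flip K H (\<Delta> \<xi>)"]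
      R_comult(2)[OF assms(2)] assms(2) by (simp add: tsum_flip[OF Z] bil' cong: HH.tsum_cong) metis
qed

lemma tsum_R_coproduct:
  assumes f: "ktrilinear K H H H Z f"
  shows "tsum Z R (\<lambda>x y. tsum Z (\<Delta> x) (\<lambda>x\<^sub>1 x\<^sub>2. f x\<^sub>1 x\<^sub>2 y))
    = tsum Z R (\<lambda>x y. tsum Z R (\<lambda>a b. f x a (y \<bullet> b)))"
    "tsum Z R (\<lambda>x y. tsum Z (\<Delta> y) (\<lambda>y\<^sub>1 y\<^sub>2. f x y\<^sub>1 y\<^sub>2))
    = tsum Z R (\<lambda>x y. tsum Z R (\<lambda>a b. f (x \<bullet> a) b y))"
    "tsum Z Rb (\<lambda>x y. tsum Z (\<Delta> x) (\<lambda>x\<^sub>1 x\<^sub>2. f x\<^sub>1 x\<^sub>2 y))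
    = tsum Z Rb (\<lambda>x y. tsum Z Rb (\<lambda>a b. f a x (y \<bullet> b)))"
  using tsum3_leg_mult(7-9)[OF Z f R_closed(1) R_closed(1)] tsum3_leg_mult(9)[OF Z f R_closed(2) R_closed(2)]
    tsum3_comult_id[OF Z f] tsum3_id_comult[OF Z f R_closed(1)]
  by (simp_all flip: R_coproducts Rb_coproduct)

lemma tsum_R_inverse:
  assumes "kbilinear K H H Z f"
  shows "tsum Z R (\<lambda>x y. tsum Z Rb (\<lambda>x' y'. f (x \<bullet> x') (y \<bullet> y'))) = f \<one>\<^bsub>H\<^esub> \<one>\<^bsub>H\<^esub>"
    "tsum Z Rb (\<lambda>x y. tsum Z R (\<lambda>x' y'. f (x \<bullet> x') (y \<bullet> y'))) = f \<one>\<^bsub>H\<^esub> \<one>\<^bsub>H\<^esub>"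
  by (rule tsum_inverse[OF Z assms R_Units])+

end

text \<open>The identity \<open>(id \<otimes> \<Delta>) R = R\<^sub>1\<^sub>3 R\<^sub>1\<^sub>2\<close> makes \<open>(id \<otimes> \<epsilon>) R\<close> an invertible idempotent.\<close>

lemma Rb_counit: "tsum H Rb (\<lambda>x y. \<epsilon> y \<odot>\<^bsub>H\<^esub> x) = \<one>\<^bsub>H\<^esub>"
proof -
  let ?e = "\<lambda>X. tsum H X (\<lambda>x y. \<epsilon> y \<odot>\<^bsub>H\<^esub> x)"
  note hom = counit_tsum_alg_hom(2)
  have U: "?e R \<in> Units H" "?e Rb = inv\<^bsub>H\<^esub> (?e R)"
    using alg_hom_unit_inv[OF HH.assoc_algebra_T H_alg hom R_Units] by simp_all
  have C: "?e R \<in> carrier H" using U by auto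
  have tri: "ktrilinear K H H H H (\<lambda>a b c. \<epsilon> b \<odot>\<^bsub>H\<^esub> (\<epsilon> c \<odot>\<^bsub>H\<^esub> a))"
    by (intro klin klinear_smultf) simp_all
  have "?e R = tsum H R (\<lambda>x y. tsum H (\<Delta> y) (\<lambda>y\<^sub>1 y\<^sub>2. \<epsilon> y\<^sub>1 \<odot>\<^bsub>H\<^esub> (\<epsilon> y\<^sub>2 \<odot>\<^bsub>H\<^esub> x)))"
    by (intro HH.tsum_cong counit_left[symmetric] klin) simp_all
  also have "\<dots> = tsum H R (\<lambda>x y. tsum H R (\<lambda>a b. \<epsilon> b \<odot>\<^bsub>H\<^esub> (\<epsilon> y \<odot>\<^bsub>H\<^esub> (x \<bullet> a))))"
    by (rule tsum_R_coproduct(2)[OF module_H tri])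
  also have "\<dots> = tsum H R (\<lambda>x y. tsum H R (\<lambda>a b. \<epsilon> (y \<bullet> b) \<odot>\<^bsub>H\<^esub> (x \<bullet> a)))"
    by (simp add: counit_mult HH.KV.smult_assoc1[symmetric] HH.KV.R.m_comm cong: HH.tsum_cong)
  also have "\<dots> = ?e (R \<otimes>\<^bsub>HH K H\<^esub> R)"
    by (rule HH.tsum_mult[OF module_H, symmetric]) (intro klin klinear_smultf, simp_all)
  also have "\<dots> = ?e R \<bullet> ?e R"
    by (rule alg_hom_mult[OF hom]) simp_all
  finally have "?e R = ?e R \<bullet> ?e R" .
  \<comment> \<open>The factor 1 is written out so that the unit \<open>?e R\<close> can be
    cancelled on the left.\<close>
  then have "?e R \<bullet> \<one>\<^bsub>H\<^esub> = ?e R \<bullet> ?e R" using C by simp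
  then have "?e R = \<one>\<^bsub>H\<^esub>" using U C by (simp del: HH.A.r_one)
  then show ?thesis using U by simp
qed

lemma tsum_Rb_counit:
  assumes Z: "module K Z" and g: "klinear K H Z g"
  shows "tsum Z Rb (\<lambda>x y. \<epsilon> y \<odot>\<^bsub>Z\<^esub> g x) = g \<one>\<^bsub>H\<^esub>"
  using klinear_tsum_H[OF Z g R_closed(2), of "\<lambda>x y. \<epsilon> y \<odot>\<^bsub>H\<^esub> x"]
  by (simp add: Rb_counit klinear_smult[OF g] cong: HH.tsum_cong)

end

locale twisted_quasitriangular_hopf = quasitriangular_hopf K H R + twisted_hopf K H F
  for K :: "('k, 'r) ring_scheme" and H :: "('k, 'h) hopf" and R F
begin

lemma twist_R_closed [simp]: "twist_R K H F R \<in> carrier (HH K H)"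
  "inv\<^bsub>HH K H\<^esub> (twist_R K H F R) \<in> carrier (HH K H)"
  and inv_twist_R: "inv\<^bsub>HH K H\<^esub> (twist_R K H F R) = F \<otimes>\<^bsub>HH K H\<^esub> (Rb \<otimes>\<^bsub>HH K H\<^esub> flip K H Fb)"
proof -
  have U: "flip K H F \<in> Units (HH K H)" "flip K H Fb = inv\<^bsub>HH K H\<^esub> (flip K H F)"
    using alg_hom_unit_inv[OF HH.assoc_algebra_T HH.assoc_algebra_T flip_alg_hom F_Units] by simp_all
  have RF: "twist_R K H F R \<in> Units (HH K H)"
    unfolding twist_R_def using U R_Units F_Units by simp
  then show "twist_R K H F R \<in> carrier (HH K H)" "inv\<^bsub>HH K H\<^esub> (twist_R K H F R) \<in> carrier (HH K H)"
    by auto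
  show "inv\<^bsub>HH K H\<^esub> (twist_R K H F R) = F \<otimes>\<^bsub>HH K H\<^esub> (Rb \<otimes>\<^bsub>HH K H\<^esub> flip K H Fb)"
    unfolding twist_R_def using U R_Units F_Units by (simp add: HH.T.inv_mult_Units)
qed

text \<open>The flipped factors show as exchanged components: \<open>b\<close> stands before
  \<open>a\<close> in the first formula, \<open>d\<close> before \<open>c\<close> in the second. The
  second pattern is the one recognised later when the second summand of a sum of connections is
  deformed.\<close>

lemma tsum_twist_R:
  assumes Z: "module K Z" and f: "kbilinear K H H Z f"
  shows "tsum Z (twist_R K H F R) f = tsum Z F (\<lambda>a b. tsum Z R (\<lambda>x y. tsum Z Fb (\<lambda>c d.
      f (b \<bullet> (x \<bullet> c)) (a \<bullet> (y \<bullet> d)))))"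
    "tsum Z (inv\<^bsub>HH K H\<^esub> (twist_R K H F R)) f = tsum Z F (\<lambda>a b. tsum Z Rb (\<lambda>x y. tsum Z Fb (\<lambda>c d.
      f (a \<bullet> (x \<bullet> d)) (b \<bullet> (y \<bullet> c)))))"
proof -
  have f_klin: "klinear K M Z (\<lambda>m. f (g m) b)" "klinear K M Z (\<lambda>m. f b (g m))"
    if "klinear K M H g" "b \<in> carrier H" for M :: "('k, 'm, 'x) module_scheme" and g b
    using that f by (auto intro: kbilinear_left kbilinear_right)
  have eq: "twist_R K H F R = flip K H F \<otimes>\<^bsub>HH K H\<^esub> (R \<otimes>\<^bsub>HH K H\<^esub> Fb)"
    by (simp add: twist_R_def HH.T.m_assoc)
  show "tsum Z (twist_R K H F R) f = tsum Z F (\<lambda>a b. tsum Z R (\<lambda>x y. tsum Z Fb (\<lambda>c d.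
      f (b \<bullet> (x \<bullet> c)) (a \<bullet> (y \<bullet> d)))))"
    unfolding eq using Z f
    by (simp add: HH.tsum_mult[OF Z] tsum_flip[OF Z] HH.mult_closed klin f_klin cong: HH.tsum_cong)
  show "tsum Z (inv\<^bsub>HH K H\<^esub> (twist_R K H F R)) f = tsum Z F (\<lambda>a b. tsum Z Rb (\<lambda>x y. tsum Z Fb (\<lambda>c d.
      f (a \<bullet> (x \<bullet> d)) (b \<bullet> (y \<bullet> c)))))"
    unfolding inv_twist_R using Z f
    by (simp add: HH.tsum_mult[OF Z] tsum_flip[OF Z] HH.mult_closed klin f_klin cong: HH.tsum_cong)
qed

end

section \<open>Module algebras, bimodules and their tensor products over A\<close>

section \<open>Module algebras and bimodules\<close>

context hopf_alg
begin

context
  fixes V :: "('k, 'v, 'h, 'm) hmod_scheme"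
  assumes V: "left_H_module K H V"
begin

lemma hact_bilinear: "kbilinear K H V V (hact V)"
  using V by (simp add: left_H_module_def)

lemma hact_klin:
  "klinear K M H f \<Longrightarrow> v \<in> carrier V \<Longrightarrow> klinear K M V (\<lambda>x. hact V (f x) v)"
  "klinear K M V g \<Longrightarrow> \<xi> \<in> carrier H \<Longrightarrow> klinear K M V (\<lambda>x. hact V \<xi> (g x))"
  using kbilinear_left[OF hact_bilinear] kbilinear_right[OF hact_bilinear] by blast+

lemma hact_closed: "\<xi> \<in> carrier H \<Longrightarrow> v \<in> carrier V \<Longrightarrow> hact V \<xi> v \<in> carrier V"
  by (rule kbilinear_closed[OF hact_bilinear])

lemma hact_module: "module K V"
  using V by (simp add: left_H_module_def)

lemma hact_mult: "\<xi> \<in> carrier H \<Longrightarrow> \<eta> \<in> carrier H \<Longrightarrow> v \<in> carrier V \<Longrightarrow>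
    hact V (\<xi> \<bullet> \<eta>) v = hact V \<xi> (hact V \<eta> v)"
  and hact_one: "v \<in> carrier V \<Longrightarrow> hact V \<one>\<^bsub>H\<^esub> v = v"
  using V by (simp_all add: left_H_module_def)

end

lemma klinear_tsum_out:
  assumes "klinear K Z Z' h" "module K Z" "module K Z'" "X \<in> carrier (HH K H)"
    "\<And>x y. x \<in> carrier H \<Longrightarrow> y \<in> carrier H \<Longrightarrow> f x y \<in> carrier Z"
  shows "h (tsum Z X f) = tsum Z' X (\<lambda>x y. h (f x y))"
  by (rule HH.tsum_hom[OF module_abelian[OF assms(2)] module_abelian[OF assms(3)] klinear_additive[OF assms(1)] assms(4,5)])

lemma HH_tsum_closed:
  "module K Z \<Longrightarrow> X \<in> carrier (HH K H) \<Longrightarrow>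
    (\<And>x y. x \<in> carrier H \<Longrightarrow> y \<in> carrier H \<Longrightarrow> f x y \<in> carrier Z) \<Longrightarrow> tsum Z X f \<in> carrier Z"
  by (rule HH.tsum_closed[OF module_abelian])

end

text \<open>Rules drawing a Sweedler sum out of an action or a tensor slot. Simplification with them
  brings expressions to nested sums of pure terms, often leaving only an exchange of sums.\<close>

named_theorems tsum_out

locale hopf_module_algebra = hopf_alg K H
  for K :: "('k, 'r) ring_scheme" and H :: "('k, 'h) hopf" +
  fixes A :: "('k, 'a, 'h) hmod"
  assumes A: "H_module_algebra K H A"
begin

abbreviation bim :: "('k, 'v, 'h, 'a) hbimod \<Rightarrow> bool" where
  "bim V \<equiv> H_module_bimodule K H A V"

abbreviation tensor :: "('k, 'v, 'h, 'a) hbimod \<Rightarrow> ('k, 'w, 'h, 'a) hbimod \<Rightarrow> ('k, ('v, 'w) tens, 'h, 'a) hbimod"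
    (infixl \<open>\<otimes>\<^sub>A\<close> 75) where
  "V \<otimes>\<^sub>A W \<equiv> btensor H A V W"

lemma A_alg: "assoc_algebra K A"
  using A by (simp add: H_module_algebra_def)

sublocale A: ring A
  using A_alg by (simp add: assoc_algebra_def)

lemma A_H_module: "left_H_module K H A"
  using A by (simp add: H_module_algebra_def)

lemma A_module [simp]: "module K A"
  by (rule hact_module[OF A_H_module])

lemmas A_klin [klin] = hact_klin[OF A_H_module]
lemmas A_simps [simp] = hact_closed[OF A_H_module] hact_one[OF A_H_module]
lemmas A_hact_mult = hact_mult[OF A_H_module]

lemma A_mult_bilinear: "kbilinear K A A A (\<lambda>a b. a \<otimes>\<^bsub>A\<^esub> b)"
  using A_alg by (simp add: assoc_algebra_def)

lemmas A_mult_klin [klin] = kbilinear_left[OF A_mult_bilinear] kbilinear_right[OF A_mult_bilinear]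

context
  fixes V :: "('k, 'v, 'h, 'a) hbimod"
  assumes V: "bim V"
begin

lemma bim_H_module: "left_H_module K H V"
  using V by (simp add: H_module_bimodule_def)

lemma bim_module: "module K V"
  by (rule hact_module[OF bim_H_module])

lemma bim_lact: "kbilinear K A V V (lact V)"
  and bim_ract: "kbilinear K V A V (ract V)"
  using V by (simp_all add: H_module_bimodule_def)

lemma bim_closed:
  "\<xi> \<in> carrier H \<Longrightarrow> v \<in> carrier V \<Longrightarrow> hact V \<xi> v \<in> carrier V"
  "a \<in> carrier A \<Longrightarrow> v \<in> carrier V \<Longrightarrow> lact V a v \<in> carrier V"
  "a \<in> carrier A \<Longrightarrow> v \<in> carrier V \<Longrightarrow> ract V v a \<in> carrier V"
  by (simp_all add: hact_closed[OF bim_H_module] kbilinear_closed[OF bim_lact] kbilinear_closed[OF bim_ract])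

lemma bim_one:
  "v \<in> carrier V \<Longrightarrow> hact V \<one>\<^bsub>H\<^esub> v = v" "v \<in> carrier V \<Longrightarrow> lact V \<one>\<^bsub>A\<^esub> v = v" "v \<in> carrier V \<Longrightarrow> ract V v \<one>\<^bsub>A\<^esub> = v"
  using V by (simp_all add: H_module_bimodule_def left_H_module_def)

lemma bim_hact_mult:
  "\<xi> \<in> carrier H \<Longrightarrow> \<eta> \<in> carrier H \<Longrightarrow> v \<in> carrier V \<Longrightarrow> hact V (\<xi> \<bullet> \<eta>) v = hact V \<xi> (hact V \<eta> v)"
  by (rule hact_mult[OF bim_H_module])

lemma bim_lact_mult:
    "a \<in> carrier A \<Longrightarrow> b \<in> carrier A \<Longrightarrow> v \<in> carrier V \<Longrightarrow> lact V (a \<otimes>\<^bsub>A\<^esub> b) v = lact V a (lact V b v)"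
  and bim_ract_mult:
    "a \<in> carrier A \<Longrightarrow> b \<in> carrier A \<Longrightarrow> v \<in> carrier V \<Longrightarrow> ract V v (a \<otimes>\<^bsub>A\<^esub> b) = ract V (ract V v a) b"
  and bim_assoc:
    "a \<in> carrier A \<Longrightarrow> b \<in> carrier A \<Longrightarrow> v \<in> carrier V \<Longrightarrow> ract V (lact V a v) b = lact V a (ract V v b)"
  using V by (simp_all add: H_module_bimodule_def)

lemma bim_hact_lact: "\<xi> \<in> carrier H \<Longrightarrow> a \<in> carrier A \<Longrightarrow> v \<in> carrier V \<Longrightarrow>
    hact V \<xi> (lact V a v) = tsum V (\<Delta> \<xi>) (\<lambda>x y. lact V (hact A x a) (hact V y v))"
  and bim_hact_ract: "\<xi> \<in> carrier H \<Longrightarrow> a \<in> carrier A \<Longrightarrow> v \<in> carrier V \<Longrightarrow>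
    hact V \<xi> (ract V v a) = tsum V (\<Delta> \<xi>) (\<lambda>x y. ract V (hact V x v) (hact A y a))"
  using V by (simp_all add: H_module_bimodule_def tsum_def)

end

lemma bim_klin [klin]:
  "bim V \<Longrightarrow> klinear K M H f \<Longrightarrow> v \<in> carrier V \<Longrightarrow> klinear K M V (\<lambda>x. hact V (f x) v)"
  "bim V \<Longrightarrow> klinear K M V g \<Longrightarrow> \<xi> \<in> carrier H \<Longrightarrow> klinear K M V (\<lambda>x. hact V \<xi> (g x))"
  "bim V \<Longrightarrow> klinear K M A h \<Longrightarrow> v \<in> carrier V \<Longrightarrow> klinear K M V (\<lambda>x. lact V (h x) v)"
  "bim V \<Longrightarrow> klinear K M V g \<Longrightarrow> a \<in> carrier A \<Longrightarrow> klinear K M V (\<lambda>x. lact V a (g x))"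
  "bim V \<Longrightarrow> klinear K M A h \<Longrightarrow> v \<in> carrier V \<Longrightarrow> klinear K M V (\<lambda>x. ract V v (h x))"
  "bim V \<Longrightarrow> klinear K M V g \<Longrightarrow> a \<in> carrier A \<Longrightarrow> klinear K M V (\<lambda>x. ract V (g x) a)"
  by (blast intro: hact_klin[OF bim_H_module] kbilinear_left[OF bim_lact] kbilinear_right[OF bim_lact]
      kbilinear_left[OF bim_ract] kbilinear_right[OF bim_ract])+

lemmas [simp] = bim_module bim_closed bim_one HH_tsum_closed

lemma bim_tsum_out [tsum_out]:
  assumes "bim V" "X \<in> carrier (HH K H)"
  shows "(\<And>x y. x \<in> carrier H \<Longrightarrow> y \<in> carrier H \<Longrightarrow> f x y \<in> carrier V) \<Longrightarrow> \<xi> \<in> carrier H \<Longrightarrow>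
      hact V \<xi> (tsum V X f) = tsum V X (\<lambda>x y. hact V \<xi> (f x y))"
    "(\<And>x y. x \<in> carrier H \<Longrightarrow> y \<in> carrier H \<Longrightarrow> f x y \<in> carrier V) \<Longrightarrow> a \<in> carrier A \<Longrightarrow>
      lact V a (tsum V X f) = tsum V X (\<lambda>x y. lact V a (f x y))"
    "(\<And>x y. x \<in> carrier H \<Longrightarrow> y \<in> carrier H \<Longrightarrow> f x y \<in> carrier V) \<Longrightarrow> a \<in> carrier A \<Longrightarrow>
      ract V (tsum V X f) a = tsum V X (\<lambda>x y. ract V (f x y) a)"
    "(\<And>x y. x \<in> carrier H \<Longrightarrow> y \<in> carrier H \<Longrightarrow> g x y \<in> carrier A) \<Longrightarrow> v \<in> carrier V \<Longrightarrow>
      lact V (tsum A X g) v = tsum V X (\<lambda>x y. lact V (g x y) v)"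
    "(\<And>x y. x \<in> carrier H \<Longrightarrow> y \<in> carrier H \<Longrightarrow> g x y \<in> carrier A) \<Longrightarrow> v \<in> carrier V \<Longrightarrow>
      ract V v (tsum A X g) = tsum V X (\<lambda>x y. ract V v (g x y))"
  using assms
  by (auto intro!: klinear_tsum_out[where h = "\<lambda>z. hact V \<xi> z"] klinear_tsum_out[where h = "\<lambda>z. lact V a z"]
      klinear_tsum_out[where h = "\<lambda>z. ract V z a"] klinear_tsum_out[where h = "\<lambda>z. lact V z v"]
      klinear_tsum_out[where h = "\<lambda>z. ract V v z"] intro: klin)

end

lemma btensor_eqs:
  fixes H :: "('k, 'h) hopf" and A :: "('k, 'a, 'h) hmod"
    and V :: "('k, 'v, 'h, 'a) hbimod" and W :: "('k, 'w, 'h, 'a) hbimod"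
  shows "k \<odot>\<^bsub>btensor H A V W\<^esub> X = tsum (btensor H A V W) X (\<lambda>v w. (k \<odot>\<^bsub>V\<^esub> v) \<boxtimes>\<^bsub>btensor H A V W\<^esub> w)"
    "hact (btensor H A V W) \<xi> X = tsum (btensor H A V W) X (\<lambda>v w. tsum (btensor H A V W) (comult H \<xi>)
        (\<lambda>x y. hact V x v \<boxtimes>\<^bsub>btensor H A V W\<^esub> hact W y w))"
    "lact (btensor H A V W) a X = tsum (btensor H A V W) X (\<lambda>v w. lact V a v \<boxtimes>\<^bsub>btensor H A V W\<^esub> w)"
    "ract (btensor H A V W) X a = tsum (btensor H A V W) X (\<lambda>v w. v \<boxtimes>\<^bsub>btensor H A V W\<^esub> ract W w a)"
proof -
  let ?G = "tensor_group (carrier A) (ract V) (lact W) V W" and ?T = "btensor H A V W"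
  have eq: "carrier ?G = carrier ?T" "\<zero>\<^bsub>?G\<^esub> = \<zero>\<^bsub>?T\<^esub>" "ring.add ?G = ring.add ?T"
    by (auto simp: btensor_def Let_def)
  note cong = tsum_ring_cong[OF eq] ptens_ring_cong[OF eq(2)]
  have "k \<odot>\<^bsub>?T\<^esub> X = tsum ?G X (\<lambda>v w. (k \<odot>\<^bsub>V\<^esub> v) \<boxtimes>\<^bsub>?G\<^esub> w)"
    "hact ?T \<xi> X = tsum ?G X (\<lambda>v w. tsum ?G (comult H \<xi>) (\<lambda>x y. hact V x v \<boxtimes>\<^bsub>?G\<^esub> hact W y w))"
    "lact ?T a X = tsum ?G X (\<lambda>v w. lact V a v \<boxtimes>\<^bsub>?G\<^esub> w)"
    "ract ?T X a = tsum ?G X (\<lambda>v w. v \<boxtimes>\<^bsub>?G\<^esub> ract W w a)"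
    by (simp_all add: btensor_def Let_def tmap_def tsum_def)
  then show "k \<odot>\<^bsub>?T\<^esub> X = tsum ?T X (\<lambda>v w. (k \<odot>\<^bsub>V\<^esub> v) \<boxtimes>\<^bsub>?T\<^esub> w)"
    "hact ?T \<xi> X = tsum ?T X (\<lambda>v w. tsum ?T (comult H \<xi>) (\<lambda>x y. hact V x v \<boxtimes>\<^bsub>?T\<^esub> hact W y w))"
    "lact ?T a X = tsum ?T X (\<lambda>v w. lact V a v \<boxtimes>\<^bsub>?T\<^esub> w)"
    "ract ?T X a = tsum ?T X (\<lambda>v w. v \<boxtimes>\<^bsub>?T\<^esub> ract W w a)"
    by (simp_all only: cong)
qed

lemma btensor_tensor_product:
  fixes H :: "('k, 'h) hopf" and A :: "('k, 'a, 'h) hmod"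
    and V :: "('k, 'v, 'h, 'a) hbimod" and W :: "('k, 'w, 'h, 'a) hbimod"
  assumes "abelian_group V" "abelian_group W"
    "\<And>v a. v \<in> carrier V \<Longrightarrow> a \<in> carrier A \<Longrightarrow> ract V v a \<in> carrier V"
    "\<And>w a. w \<in> carrier W \<Longrightarrow> a \<in> carrier A \<Longrightarrow> lact W a w \<in> carrier W"
  shows "tensor_product (carrier A) (ract V) (lact W) V W (btensor H A V W)"
  using assms by (auto simp: tensor_product_def btensor_def Let_def)

context hopf_module_algebra
begin

lemma btensor_tensor_module:
  assumes bV: "bim V" and bW: "bim W"
  shows "tensor_module K (carrier A) (ract V) (lact W) V W (V \<otimes>\<^sub>A W)"
proof -
  interpret V: module K V using bV by simp
  interpret W: module K W using bW by simp
  interpret AM: module K A by simp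
  interpret tensor_product "carrier A" "ract V" "lact W" V W "V \<otimes>\<^sub>A W"
    using bV bW by (intro btensor_tensor_product module_abelian) simp_all
  show ?thesis
  proof unfold_locales
    show "ract V (k \<odot>\<^bsub>V\<^esub> v) s = k \<odot>\<^bsub>V\<^esub> ract V v s"
      if "k \<in> carrier K" "v \<in> carrier V" "s \<in> carrier A" for k v s
      using bim_ract[OF bV] that by (simp add: kbilinear_def klinear_def)
    show "(k \<odot>\<^bsub>V\<^esub> v) \<boxtimes>\<^bsub>V \<otimes>\<^sub>A W\<^esub> w = v \<boxtimes>\<^bsub>V \<otimes>\<^sub>A W\<^esub> (k \<odot>\<^bsub>W\<^esub> w)"
      if "k \<in> carrier K" "v \<in> carrier V" "w \<in> carrier W" for k v w
    proof -
      \<comment> \<open>A scalar crosses the tensor sign as the corresponding multiple of the unit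
        of A; this is where balancing over A yields balancing over K.\<close>
      have "k \<odot>\<^bsub>V\<^esub> v = ract V v (k \<odot>\<^bsub>A\<^esub> \<one>\<^bsub>A\<^esub>)"
        using bim_ract[OF bV] that bim_one(3)[OF bV, of v] by (simp add: kbilinear_def klinear_def)
      moreover have "k \<odot>\<^bsub>W\<^esub> w = lact W (k \<odot>\<^bsub>A\<^esub> \<one>\<^bsub>A\<^esub>) w"
        using bim_lact[OF bW] that bim_one(2)[OF bW, of w] by (simp add: kbilinear_def klinear_def)
      ultimately show ?thesis
        using ptens_balanced that by simp
    qed
  qed (auto simp: btensor_eqs V.smult_r_distr V.smult_l_distr V.smult_assoc1 W.smult_r_distr W.smult_l_distr W.smult_assoc1)
qed

context
  fixes V :: "('k, 'v, 'h, 'a) hbimod" and W :: "('k, 'w, 'h, 'a) hbimod"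
  assumes V: "bim V" and W: "bim W"
begin

interpretation T: tensor_module K "carrier A" "ract V" "lact W" V W "V \<otimes>\<^sub>A W"
  by (rule btensor_tensor_module[OF V W])

lemma btensor_module: "module K (V \<otimes>\<^sub>A W)"
  by (rule T.module_T)

lemma bptens_closed: "v \<in> carrier V \<Longrightarrow> w \<in> carrier W \<Longrightarrow> v \<boxtimes>\<^bsub>V \<otimes>\<^sub>A W\<^esub> w \<in> carrier (V \<otimes>\<^sub>A W)"
  by (rule T.ptens_closed)

lemma bptens_balanced: "v \<in> carrier V \<Longrightarrow> a \<in> carrier A \<Longrightarrow> w \<in> carrier W \<Longrightarrow>
    ract V v a \<boxtimes>\<^bsub>V \<otimes>\<^sub>A W\<^esub> w = v \<boxtimes>\<^bsub>V \<otimes>\<^sub>A W\<^esub> lact W a w"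
  by (rule T.ptens_balanced)

lemma bptens_klin:
  "klinear K M V f \<Longrightarrow> w \<in> carrier W \<Longrightarrow> klinear K M (V \<otimes>\<^sub>A W) (\<lambda>x. f x \<boxtimes>\<^bsub>V \<otimes>\<^sub>A W\<^esub> w)"
  "klinear K M W g \<Longrightarrow> v \<in> carrier V \<Longrightarrow> klinear K M (V \<otimes>\<^sub>A W) (\<lambda>x. v \<boxtimes>\<^bsub>V \<otimes>\<^sub>A W\<^esub> g x)"
  using kbilinear_left[OF T.kbilinear_ptens] kbilinear_right[OF T.kbilinear_ptens] by blast+

lemma btensor_tsum_ptens:
  "module K Z \<Longrightarrow> kbilinear K V W Z f \<Longrightarrow>
    (\<And>v a w. v \<in> carrier V \<Longrightarrow> a \<in> carrier A \<Longrightarrow> w \<in> carrier W \<Longrightarrow> f (ract V v a) w = f v (lact W a w)) \<Longrightarrow>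
    v \<in> carrier V \<Longrightarrow> w \<in> carrier W \<Longrightarrow> tsum Z (v \<boxtimes>\<^bsub>V \<otimes>\<^sub>A W\<^esub> w) f = f v w"
  using T.kbilinear_tsum_ptens by blast

lemma btensor_tsum_klinear:
  "module K Z \<Longrightarrow> kbilinear K V W Z f \<Longrightarrow>
    (\<And>v a w. v \<in> carrier V \<Longrightarrow> a \<in> carrier A \<Longrightarrow> w \<in> carrier W \<Longrightarrow> f (ract V v a) w = f v (lact W a w)) \<Longrightarrow>
    klinear K (V \<otimes>\<^sub>A W) Z (\<lambda>X. tsum Z X f)"
  using T.kbilinear_tsum by blast

lemma btensor_eqI:
  "klinear K (V \<otimes>\<^sub>A W) Z g \<Longrightarrow> klinear K (V \<otimes>\<^sub>A W) Z h \<Longrightarrow> X \<in> carrier (V \<otimes>\<^sub>A W) \<Longrightarrow>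
    (\<And>v w. v \<in> carrier V \<Longrightarrow> w \<in> carrier W \<Longrightarrow> g (v \<boxtimes>\<^bsub>V \<otimes>\<^sub>A W\<^esub> w) = h (v \<boxtimes>\<^bsub>V \<otimes>\<^sub>A W\<^esub> w)) \<Longrightarrow> g X = h X"
  by (rule T.klinear_eqI)

lemma bptens_tsum_out:
  assumes "X \<in> carrier (HH K H)"
  shows "(\<And>x y. x \<in> carrier H \<Longrightarrow> y \<in> carrier H \<Longrightarrow> f x y \<in> carrier V) \<Longrightarrow> w \<in> carrier W \<Longrightarrow>
      tsum V X f \<boxtimes>\<^bsub>V \<otimes>\<^sub>A W\<^esub> w = tsum (V \<otimes>\<^sub>A W) X (\<lambda>x y. f x y \<boxtimes>\<^bsub>V \<otimes>\<^sub>A W\<^esub> w)"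
    "(\<And>x y. x \<in> carrier H \<Longrightarrow> y \<in> carrier H \<Longrightarrow> g x y \<in> carrier W) \<Longrightarrow> v \<in> carrier V \<Longrightarrow>
      v \<boxtimes>\<^bsub>V \<otimes>\<^sub>A W\<^esub> tsum W X g = tsum (V \<otimes>\<^sub>A W) X (\<lambda>x y. v \<boxtimes>\<^bsub>V \<otimes>\<^sub>A W\<^esub> g x y)"
  using assms bim_module[OF V] bim_module[OF W]
  by (intro klinear_tsum_out[where h = "\<lambda>z. z \<boxtimes>\<^bsub>V \<otimes>\<^sub>A W\<^esub> w"]
      klinear_tsum_out[where h = "\<lambda>z. v \<boxtimes>\<^bsub>V \<otimes>\<^sub>A W\<^esub> z"] bptens_klin klinear_ident btensor_module; simp)+

end

lemmas [simp] = btensor_module bptens_closed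
lemmas [klin] = bptens_klin
lemmas [tsum_out] = bptens_tsum_out

context
  fixes V :: "('k, 'v, 'h, 'a) hbimod" and W :: "('k, 'w, 'h, 'a) hbimod"
  assumes V [simp]: "bim V" and W [simp]: "bim W"
begin

interpretation T: tensor_module K "carrier A" "ract V" "lact W" V W "V \<otimes>\<^sub>A W"
  by (rule btensor_tensor_module[OF V W])

lemma btensor_hact_bilinear:
  "\<xi> \<in> carrier H \<Longrightarrow> kbilinear K V W (V \<otimes>\<^sub>A W) (\<lambda>v w. tsum (V \<otimes>\<^sub>A W) (\<Delta> \<xi>)
      (\<lambda>x y. hact V x v \<boxtimes>\<^bsub>V \<otimes>\<^sub>A W\<^esub> hact W y w))"
  by (intro klin) simp_all

text \<open>Expanding the actions on \<open>v a\<close> and on \<open>a w\<close> gives the two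
  sides of coassociativity with the algebra element in the middle; balancing over A identifies the
  terms.\<close>

lemma btensor_hact_balanced:
  assumes [simp]: "\<xi> \<in> carrier H" "v \<in> carrier V" "a \<in> carrier A" "w \<in> carrier W"
  shows "tsum (V \<otimes>\<^sub>A W) (\<Delta> \<xi>) (\<lambda>x y. hact V x (ract V v a) \<boxtimes>\<^bsub>V \<otimes>\<^sub>A W\<^esub> hact W y w)
    = tsum (V \<otimes>\<^sub>A W) (\<Delta> \<xi>) (\<lambda>x y. hact V x v \<boxtimes>\<^bsub>V \<otimes>\<^sub>A W\<^esub> hact W y (lact W a w))"
proof -
  have "tsum (V \<otimes>\<^sub>A W) (\<Delta> \<xi>) (\<lambda>x y. tsum (V \<otimes>\<^sub>A W) (\<Delta> x) (\<lambda>x\<^sub>1 x\<^sub>2.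
        hact V x\<^sub>1 v \<boxtimes>\<^bsub>V \<otimes>\<^sub>A W\<^esub> lact W (hact A x\<^sub>2 a) (hact W y w)))
    = tsum (V \<otimes>\<^sub>A W) (\<Delta> \<xi>) (\<lambda>x y. tsum (V \<otimes>\<^sub>A W) (\<Delta> y) (\<lambda>y\<^sub>1 y\<^sub>2.
        hact V x v \<boxtimes>\<^bsub>V \<otimes>\<^sub>A W\<^esub> lact W (hact A y\<^sub>1 a) (hact W y\<^sub>2 w)))"
    by (intro coassoc klin) simp_all
  then show ?thesis
    by (simp add: bim_hact_ract bim_hact_lact tsum_out bptens_balanced cong: HH.tsum_cong)
qed

lemma btensor_hact_ptens:
  "\<xi> \<in> carrier H \<Longrightarrow> v \<in> carrier V \<Longrightarrow> w \<in> carrier W \<Longrightarrow>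
    hact (V \<otimes>\<^sub>A W) \<xi> (v \<boxtimes>\<^bsub>V \<otimes>\<^sub>A W\<^esub> w)
    = tsum (V \<otimes>\<^sub>A W) (\<Delta> \<xi>) (\<lambda>x y. hact V x v \<boxtimes>\<^bsub>V \<otimes>\<^sub>A W\<^esub> hact W y w)"
  unfolding btensor_eqs
  by (rule btensor_tsum_ptens) (simp_all add: btensor_hact_bilinear btensor_hact_balanced)

lemma btensor_lact_bilinear:
  "a \<in> carrier A \<Longrightarrow> kbilinear K V W (V \<otimes>\<^sub>A W) (\<lambda>v w. lact V a v \<boxtimes>\<^bsub>V \<otimes>\<^sub>A W\<^esub> w)"
  "a \<in> carrier A \<Longrightarrow> kbilinear K V W (V \<otimes>\<^sub>A W) (\<lambda>v w. v \<boxtimes>\<^bsub>V \<otimes>\<^sub>A W\<^esub> ract W w a)"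
  by (intro klin; simp)+

lemma btensor_lact_balanced:
  "a \<in> carrier A \<Longrightarrow> v \<in> carrier V \<Longrightarrow> b \<in> carrier A \<Longrightarrow> w \<in> carrier W \<Longrightarrow>
    lact V a (ract V v b) \<boxtimes>\<^bsub>V \<otimes>\<^sub>A W\<^esub> w = lact V a v \<boxtimes>\<^bsub>V \<otimes>\<^sub>A W\<^esub> lact W b w"
  by (simp add: bim_assoc[symmetric] bptens_balanced)

lemma btensor_lact_ptens:
  "a \<in> carrier A \<Longrightarrow> v \<in> carrier V \<Longrightarrow> w \<in> carrier W \<Longrightarrow>
    lact (V \<otimes>\<^sub>A W) a (v \<boxtimes>\<^bsub>V \<otimes>\<^sub>A W\<^esub> w) = lact V a v \<boxtimes>\<^bsub>V \<otimes>\<^sub>A W\<^esub> w"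
  unfolding btensor_eqs
  by (rule btensor_tsum_ptens) (simp_all add: btensor_lact_bilinear btensor_lact_balanced bim_assoc bptens_balanced)

lemma btensor_ract_ptens:
  "a \<in> carrier A \<Longrightarrow> v \<in> carrier V \<Longrightarrow> w \<in> carrier W \<Longrightarrow>
    ract (V \<otimes>\<^sub>A W) (v \<boxtimes>\<^bsub>V \<otimes>\<^sub>A W\<^esub> w) a = v \<boxtimes>\<^bsub>V \<otimes>\<^sub>A W\<^esub> ract W w a"
  unfolding btensor_eqs
  by (rule btensor_tsum_ptens) (simp_all add: btensor_lact_bilinear btensor_lact_balanced bim_assoc bptens_balanced)

lemma btensor_act_klin:
  "\<xi> \<in> carrier H \<Longrightarrow> klinear K (V \<otimes>\<^sub>A W) (V \<otimes>\<^sub>A W) (hact (V \<otimes>\<^sub>A W) \<xi>)"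
  "a \<in> carrier A \<Longrightarrow> klinear K (V \<otimes>\<^sub>A W) (V \<otimes>\<^sub>A W) (lact (V \<otimes>\<^sub>A W) a)"
  "a \<in> carrier A \<Longrightarrow> klinear K (V \<otimes>\<^sub>A W) (V \<otimes>\<^sub>A W) (\<lambda>X. ract (V \<otimes>\<^sub>A W) X a)"
  "X \<in> carrier (V \<otimes>\<^sub>A W) \<Longrightarrow> klinear K H (V \<otimes>\<^sub>A W) (\<lambda>\<xi>. hact (V \<otimes>\<^sub>A W) \<xi> X)"
  "X \<in> carrier (V \<otimes>\<^sub>A W) \<Longrightarrow> klinear K A (V \<otimes>\<^sub>A W) (\<lambda>a. lact (V \<otimes>\<^sub>A W) a X)"
  "X \<in> carrier (V \<otimes>\<^sub>A W) \<Longrightarrow> klinear K A (V \<otimes>\<^sub>A W) (\<lambda>a. ract (V \<otimes>\<^sub>A W) X a)"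
proof -
  note eqs = btensor_eqs[where H = H and A = A and V = V and W = W]
  show "\<xi> \<in> carrier H \<Longrightarrow> klinear K (V \<otimes>\<^sub>A W) (V \<otimes>\<^sub>A W) (hact (V \<otimes>\<^sub>A W) \<xi>)"
    unfolding eqs(2)[abs_def]
    by (rule btensor_tsum_klinear) (simp_all add: btensor_hact_bilinear btensor_hact_balanced)
  show "a \<in> carrier A \<Longrightarrow> klinear K (V \<otimes>\<^sub>A W) (V \<otimes>\<^sub>A W) (lact (V \<otimes>\<^sub>A W) a)"
    unfolding eqs(3)[abs_def]
    by (rule btensor_tsum_klinear) (simp_all add: btensor_lact_bilinear btensor_lact_balanced)
  show "a \<in> carrier A \<Longrightarrow> klinear K (V \<otimes>\<^sub>A W) (V \<otimes>\<^sub>A W) (\<lambda>X. ract (V \<otimes>\<^sub>A W) X a)"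
    unfolding eqs(4)
    by (rule btensor_tsum_klinear) (simp_all add: btensor_lact_bilinear bim_assoc bptens_balanced)
  show "X \<in> carrier (V \<otimes>\<^sub>A W) \<Longrightarrow> klinear K H (V \<otimes>\<^sub>A W) (\<lambda>\<xi>. hact (V \<otimes>\<^sub>A W) \<xi> X)"
    unfolding eqs(2) by (intro T.klinear_tsumf klin) simp_all
  show "X \<in> carrier (V \<otimes>\<^sub>A W) \<Longrightarrow> klinear K A (V \<otimes>\<^sub>A W) (\<lambda>a. lact (V \<otimes>\<^sub>A W) a X)"
    unfolding eqs(3) by (intro T.klinear_tsumf klin) simp_all
  show "X \<in> carrier (V \<otimes>\<^sub>A W) \<Longrightarrow> klinear K A (V \<otimes>\<^sub>A W) (\<lambda>a. ract (V \<otimes>\<^sub>A W) X a)"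
    unfolding eqs(4) by (intro T.klinear_tsumf klin) simp_all
qed

text \<open>Iterated tensor products become objects of the same kind, so all rules for bimodules
  apply to them at once. Compatibility of the H-action with the A-actions is coassociativity;
  compatibility with products in H is multiplicativity of \<Delta>.\<close>

lemma bim_btensor: "bim (V \<otimes>\<^sub>A W)"
proof -
  let ?T = "V \<otimes>\<^sub>A W"
  note act = btensor_hact_ptens btensor_lact_ptens btensor_ract_ptens
  note lin = btensor_act_klin klinear_comp[OF btensor_act_klin(1)] klinear_comp[OF btensor_act_klin(2)]
    klinear_comp[OF btensor_act_klin(3)]
  have mult: "hact ?T (\<xi> \<bullet> \<eta>) X = hact ?T \<xi> (hact ?T \<eta> X)"
    if [simp]: "\<xi> \<in> carrier H" "\<eta> \<in> carrier H" and X: "X \<in> carrier ?T" for \<xi> \<eta> X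
  proof (rule btensor_eqI[OF V W, where Z = "V \<otimes>\<^sub>A W", OF _ _ X])
    fix v w assume [simp]: "v \<in> carrier V" "w \<in> carrier W"
    have "hact ?T (\<xi> \<bullet> \<eta>) (v \<boxtimes>\<^bsub>?T\<^esub> w)
      = tsum ?T (\<Delta> \<xi>) (\<lambda>x y. tsum ?T (\<Delta> \<eta>) (\<lambda>x' y'. hact V (x \<bullet> x') v \<boxtimes>\<^bsub>?T\<^esub> hact W (y \<bullet> y') w))"
      by (simp add: act) (intro comult_mult klin; simp)
    also have "\<dots> = tsum ?T (\<Delta> \<eta>) (\<lambda>x' y'. tsum ?T (\<Delta> \<xi>) (\<lambda>x y. hact V (x \<bullet> x') v \<boxtimes>\<^bsub>?T\<^esub> hact W (y \<bullet> y') w))"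
      by (intro tsum_swap[OF HH.tensor_product_axioms HH.tensor_product_axioms T.abelian_T]) simp_all
    also have "\<dots> = hact ?T \<xi> (hact ?T \<eta> (v \<boxtimes>\<^bsub>?T\<^esub> w))"
      by (simp add: act bim_hact_mult klinear_tsum_out[OF btensor_act_klin(1)] cong: HH.tsum_cong)
    finally show "hact ?T (\<xi> \<bullet> \<eta>) (v \<boxtimes>\<^bsub>?T\<^esub> w) = hact ?T \<xi> (hact ?T \<eta> (v \<boxtimes>\<^bsub>?T\<^esub> w))" .
  qed (simp_all add: lin)
  have one: "hact ?T \<one>\<^bsub>H\<^esub> X = X" if X: "X \<in> carrier ?T" for X
    by (rule btensor_eqI[OF V W _ klinear_ident X]) (simp_all add: lin act comult_one klin)
  have H_module: "left_H_module K H ?T"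
    by (simp add: left_H_module_def mult one) (intro kbilinearI lin)
  have bilin: "kbilinear K A ?T ?T (lact ?T)" "kbilinear K ?T A ?T (ract ?T)"
    by (intro kbilinearI lin; assumption)+
  have unit: "lact ?T \<one>\<^bsub>A\<^esub> X = X" "ract ?T X \<one>\<^bsub>A\<^esub> = X" if X: "X \<in> carrier ?T" for X
    by (rule btensor_eqI[OF V W _ klinear_ident X]; simp add: lin act)+
  have assoc: "lact ?T (a \<otimes>\<^bsub>A\<^esub> b) X = lact ?T a (lact ?T b X)"
    "ract ?T X (a \<otimes>\<^bsub>A\<^esub> b) = ract ?T (ract ?T X a) b"
    "ract ?T (lact ?T a X) b = lact ?T a (ract ?T X b)"
    if [simp]: "a \<in> carrier A" "b \<in> carrier A" and X: "X \<in> carrier ?T" for a b X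
    by (rule btensor_eqI[OF V W, where Z = "V \<otimes>\<^sub>A W", OF _ _ X]; simp add: lin act bim_lact_mult bim_ract_mult)+
  have hact_lact: "hact ?T \<xi> (lact ?T a X) = tsum ?T (\<Delta> \<xi>) (\<lambda>x y. lact ?T (hact A x a) (hact ?T y X))"
    if [simp]: "\<xi> \<in> carrier H" "a \<in> carrier A" and X: "X \<in> carrier ?T" for \<xi> a X
  proof (rule btensor_eqI[OF V W, where Z = "V \<otimes>\<^sub>A W", OF _ _ X])
    fix v w assume [simp]: "v \<in> carrier V" "w \<in> carrier W"
    have "hact ?T \<xi> (lact ?T a (v \<boxtimes>\<^bsub>?T\<^esub> w)) = tsum ?T (\<Delta> \<xi>) (\<lambda>x y. tsum ?T (\<Delta> x) (\<lambda>x\<^sub>1 x\<^sub>2.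
        lact V (hact A x\<^sub>1 a) (hact V x\<^sub>2 v) \<boxtimes>\<^bsub>?T\<^esub> hact W y w))"
      by (simp add: act bim_hact_lact tsum_out cong: HH.tsum_cong)
    also have "\<dots> = tsum ?T (\<Delta> \<xi>) (\<lambda>x y. tsum ?T (\<Delta> y) (\<lambda>y\<^sub>1 y\<^sub>2.
        lact V (hact A x a) (hact V y\<^sub>1 v) \<boxtimes>\<^bsub>?T\<^esub> hact W y\<^sub>2 w))"
      by (intro coassoc klin) simp_all
    also have "\<dots> = tsum ?T (\<Delta> \<xi>) (\<lambda>x y. lact ?T (hact A x a) (hact ?T y (v \<boxtimes>\<^bsub>?T\<^esub> w)))"
      by (simp add: act klinear_tsum_out[OF btensor_act_klin(2)] cong: HH.tsum_cong)
    finally show "hact ?T \<xi> (lact ?T a (v \<boxtimes>\<^bsub>?T\<^esub> w))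
      = tsum ?T (\<Delta> \<xi>) (\<lambda>x y. lact ?T (hact A x a) (hact ?T y (v \<boxtimes>\<^bsub>?T\<^esub> w)))" .
  qed (simp_all add: lin HH.klinear_tsumf)
  have hact_ract: "hact ?T \<xi> (ract ?T X a) = tsum ?T (\<Delta> \<xi>) (\<lambda>x y. ract ?T (hact ?T x X) (hact A y a))"
    if [simp]: "\<xi> \<in> carrier H" "a \<in> carrier A" and X: "X \<in> carrier ?T" for \<xi> a X
  proof (rule btensor_eqI[OF V W, where Z = "V \<otimes>\<^sub>A W", OF _ _ X])
    fix v w assume [simp]: "v \<in> carrier V" "w \<in> carrier W"
    have "hact ?T \<xi> (ract ?T (v \<boxtimes>\<^bsub>?T\<^esub> w) a) = tsum ?T (\<Delta> \<xi>) (\<lambda>x y. tsum ?T (\<Delta> y) (\<lambda>y\<^sub>1 y\<^sub>2.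
        hact V x v \<boxtimes>\<^bsub>?T\<^esub> ract W (hact W y\<^sub>1 w) (hact A y\<^sub>2 a)))"
      by (simp add: act bim_hact_ract tsum_out cong: HH.tsum_cong)
    also have "\<dots> = tsum ?T (\<Delta> \<xi>) (\<lambda>x y. tsum ?T (\<Delta> x) (\<lambda>x\<^sub>1 x\<^sub>2.
        hact V x\<^sub>1 v \<boxtimes>\<^bsub>?T\<^esub> ract W (hact W x\<^sub>2 w) (hact A y a)))"
      by (intro coassoc[symmetric] klin) simp_all
    also have "\<dots> = tsum ?T (\<Delta> \<xi>) (\<lambda>x y. ract ?T (hact ?T x (v \<boxtimes>\<^bsub>?T\<^esub> w)) (hact A y a))"
      by (simp add: act klinear_tsum_out[OF btensor_act_klin(3)] cong: HH.tsum_cong)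
    finally show "hact ?T \<xi> (ract ?T (v \<boxtimes>\<^bsub>?T\<^esub> w) a)
      = tsum ?T (\<Delta> \<xi>) (\<lambda>x y. ract ?T (hact ?T x (v \<boxtimes>\<^bsub>?T\<^esub> w)) (hact A y a))" .
  qed (simp_all add: lin HH.klinear_tsumf)
  show ?thesis
    unfolding H_module_bimodule_def tsum_def[symmetric]
    by (intro conjI ballI H_module bilin unit assoc hact_lact hact_ract) assumption+
qed

end

lemmas [simp] = bim_btensor
lemmas btensor_act = btensor_hact_ptens btensor_lact_ptens btensor_ract_ptens

end

section \<open>Deformed actions, \<phi> on pure tensors, and maps into star modules\<close>

section \<open>Twisting bimodules\<close>

lemma abelian_group_ring_cong:
  fixes Z :: "('z, 'm) ring_scheme" and Z' :: "('z, 'n) ring_scheme"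
  assumes "abelian_group Z" "carrier Z' = carrier Z" "\<zero>\<^bsub>Z'\<^esub> = \<zero>\<^bsub>Z\<^esub>" "ring.add Z' = ring.add Z"
  shows "abelian_group Z'"
proof -
  interpret abelian_group Z by fact
  show ?thesis
    by (rule abelian_groupI) (simp_all only: assms a_closed zero_closed a_assoc l_zero add.l_inv_ex, rule a_comm)
qed

locale twisted_module_algebra = hopf_module_algebra K H A + twisted_hopf K H F
  for K :: "('k, 'r) ring_scheme" and H :: "('k, 'h) hopf" and A :: "('k, 'a, 'h) hmod"
    and F :: "('h, 'h) tens"
begin

abbreviation "HF \<equiv> twist_hopf K H F"
abbreviation "As \<equiv> twist_alg K H F A"

abbreviation star_tensor :: "('k, 'v, 'h, 'a) hbimod \<Rightarrow> ('k, 'w, 'h, 'a) hbimod \<Rightarrow> ('k, ('v, 'w) tens, 'h, 'a) hbimod"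
    (infixl \<open>\<otimes>\<^sub>\<star>\<close> 75) where
  "P \<otimes>\<^sub>\<star> Q \<equiv> btensor HF As P Q"

lemma carrier_As [simp]: "carrier As = carrier A"
  by (simp add: twist_alg_def)

lemma comult_HF: "comult HF \<xi> = F \<otimes>\<^bsub>HH K H\<^esub> comult H \<xi> \<otimes>\<^bsub>HH K H\<^esub> Fb"
  by (simp add: twist_hopf_def Let_def)

lemma comult_HF_closed [simp]: "\<xi> \<in> carrier H \<Longrightarrow> comult HF \<xi> \<in> carrier (HH K H)"
  by (simp add: comult_HF HH.mult_closed)

lemma antipode_HF: "antipode HF \<xi> = \<chi> \<bullet> S \<xi> \<bullet> \<upsilon>"
  unfolding twist_hopf_def Let_def tsum_def[symmetric] \<chi>_def[symmetric] inv_chi by simp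

definition star_lact :: "('k, 'v, 'h, 'a) hbimod \<Rightarrow> 'a \<Rightarrow> 'v \<Rightarrow> 'v" where
  "star_lact V a v = tsum V Fb (\<lambda>x y. lact V (hact A x a) (hact V y v))"

definition star_ract :: "('k, 'v, 'h, 'a) hbimod \<Rightarrow> 'v \<Rightarrow> 'a \<Rightarrow> 'v" where
  "star_ract V v a = tsum V Fb (\<lambda>x y. ract V (hact V x v) (hact A y a))"

text \<open>The value of \<phi> at a pure tensor. Its values lie in the untwisted tensor product, so
  its identities can be proved before any tensor product over \<open>A\<^sub>\<star>\<close> is
  considered.\<close>

definition star_ptens :: "('k, 'v, 'h, 'a) hbimod \<Rightarrow> ('k, 'w, 'h, 'a) hbimod \<Rightarrow> 'v \<Rightarrow> 'w \<Rightarrow> ('v, 'w) tens" where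
  "star_ptens V W v w = tsum (V \<otimes>\<^sub>A W) Fb (\<lambda>x y. hact V x v \<boxtimes>\<^bsub>V \<otimes>\<^sub>A W\<^esub> hact W y w)"

lemma star_closed [simp]:
  "bim V \<Longrightarrow> a \<in> carrier A \<Longrightarrow> v \<in> carrier V \<Longrightarrow> star_lact V a v \<in> carrier V"
  "bim V \<Longrightarrow> a \<in> carrier A \<Longrightarrow> v \<in> carrier V \<Longrightarrow> star_ract V v a \<in> carrier V"
  "bim V \<Longrightarrow> bim W \<Longrightarrow> v \<in> carrier V \<Longrightarrow> w \<in> carrier W \<Longrightarrow> star_ptens V W v w \<in> carrier (V \<otimes>\<^sub>A W)"
  by (simp_all add: star_lact_def star_ract_def star_ptens_def)

lemma star_ptens_bilinear: "bim V \<Longrightarrow> bim W \<Longrightarrow> kbilinear K V W (V \<otimes>\<^sub>A W) (star_ptens V W)"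
  unfolding star_ptens_def[abs_def] by (intro klin) simp_all

lemma star_ptens_klin [klin]:
  "bim V \<Longrightarrow> bim W \<Longrightarrow> klinear K M V f \<Longrightarrow> w \<in> carrier W \<Longrightarrow> klinear K M (V \<otimes>\<^sub>A W) (\<lambda>x. star_ptens V W (f x) w)"
  "bim V \<Longrightarrow> bim W \<Longrightarrow> klinear K M W h \<Longrightarrow> v \<in> carrier V \<Longrightarrow> klinear K M (V \<otimes>\<^sub>A W) (\<lambda>x. star_ptens V W v (h x))"
  by (rule kbilinear_left[OF star_ptens_bilinear] kbilinear_right[OF star_ptens_bilinear]; assumption)+

context
  fixes V :: "('k, 'v, 'h, 'a) hbimod" and W :: "('k, 'w, 'h, 'a) hbimod"
  assumes V [simp]: "bim V" and W [simp]: "bim W"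
begin

text \<open>Expanded, these are the two sides of the inverted cocycle identity with \<open>a\<close>
  in the middle slot. Hence \<phi> is well defined over \<open>A\<^sub>\<star>\<close>.\<close>

lemma star_ptens_balanced:
  assumes [simp]: "v \<in> carrier V" "a \<in> carrier A" "w \<in> carrier W"
  shows "star_ptens V W (star_ract V v a) w = star_ptens V W v (star_lact W a w)"
proof -
  let ?f = "\<lambda>p q r. hact V p v \<boxtimes>\<^bsub>V \<otimes>\<^sub>A W\<^esub> lact W (hact A q a) (hact W r w)"
  have "star_ptens V W (star_ract V v a) w = tsum (V \<otimes>\<^sub>A W) Fb (\<lambda>x y. tsum (V \<otimes>\<^sub>A W) (\<Delta> x) (\<lambda>x\<^sub>1 x\<^sub>2.
      tsum (V \<otimes>\<^sub>A W) Fb (\<lambda>b c. ?f (x\<^sub>1 \<bullet> b) (x\<^sub>2 \<bullet> c) y)))"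
    by (simp add: star_ptens_def star_ract_def tsum_out bim_hact_ract bim_hact_mult A_hact_mult bptens_balanced
        cong: HH.tsum_cong) (intro HH.tsum_cong HH_swap; simp)
  also have "\<dots> = tsum (V \<otimes>\<^sub>A W) Fb (\<lambda>x y. tsum (V \<otimes>\<^sub>A W) (\<Delta> y) (\<lambda>y\<^sub>1 y\<^sub>2.
      tsum (V \<otimes>\<^sub>A W) Fb (\<lambda>b c. ?f x (y\<^sub>1 \<bullet> b) (y\<^sub>2 \<bullet> c))))"
    by (rule tsum_cocycle_inv[where f = ?f]) (simp, intro klin, simp_all)
  also have "\<dots> = star_ptens V W v (star_lact W a w)"
    by (simp add: star_ptens_def star_lact_def tsum_out bim_hact_lact bim_hact_mult A_hact_mult
        cong: HH.tsum_cong) (intro HH.tsum_cong HH_swap; simp)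
  finally show ?thesis .
qed

text \<open>The same identity with the algebra element in the last slot;
  \<open>star_ptens_lact\<close> has it in the first. Together they make \<phi> compatible with the
  bimodule actions.\<close>

lemma star_ptens_ract:
  assumes [simp]: "v \<in> carrier V" "a \<in> carrier A" "w \<in> carrier W"
  shows "star_ptens V W v (star_ract W w a) = star_ract (V \<otimes>\<^sub>A W) (star_ptens V W v w) a"
proof -
  let ?f = "\<lambda>p q r. hact V p v \<boxtimes>\<^bsub>V \<otimes>\<^sub>A W\<^esub> ract W (hact W q w) (hact A r a)"
  have "star_ract (V \<otimes>\<^sub>A W) (star_ptens V W v w) a = tsum (V \<otimes>\<^sub>A W) Fb (\<lambda>x y. tsum (V \<otimes>\<^sub>A W) (\<Delta> x) (\<lambda>x\<^sub>1 x\<^sub>2.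
      tsum (V \<otimes>\<^sub>A W) Fb (\<lambda>b c. ?f (x\<^sub>1 \<bullet> b) (x\<^sub>2 \<bullet> c) y)))"
    by (simp add: star_ptens_def star_ract_def tsum_out btensor_act bim_hact_mult
        cong: HH.tsum_cong) (intro HH.tsum_cong HH_swap; simp)
  also have "\<dots> = tsum (V \<otimes>\<^sub>A W) Fb (\<lambda>x y. tsum (V \<otimes>\<^sub>A W) (\<Delta> y) (\<lambda>y\<^sub>1 y\<^sub>2.
      tsum (V \<otimes>\<^sub>A W) Fb (\<lambda>b c. ?f x (y\<^sub>1 \<bullet> b) (y\<^sub>2 \<bullet> c))))"
    by (rule tsum_cocycle_inv[where f = ?f]) (simp, intro klin, simp_all)
  also have "\<dots> = star_ptens V W v (star_ract W w a)"
    by (simp add: star_ptens_def star_ract_def tsum_out bim_hact_ract bim_hact_mult A_hact_mult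
        cong: HH.tsum_cong) (intro HH.tsum_cong HH_swap; simp)
  finally show ?thesis by simp
qed

lemma star_ptens_lact:
  assumes [simp]: "v \<in> carrier V" "a \<in> carrier A" "w \<in> carrier W"
  shows "star_ptens V W (star_lact V a v) w = star_lact (V \<otimes>\<^sub>A W) a (star_ptens V W v w)"
proof -
  let ?f = "\<lambda>p q r. lact V (hact A p a) (hact V q v) \<boxtimes>\<^bsub>V \<otimes>\<^sub>A W\<^esub> hact W r w"
  have "star_ptens V W (star_lact V a v) w = tsum (V \<otimes>\<^sub>A W) Fb (\<lambda>x y. tsum (V \<otimes>\<^sub>A W) (\<Delta> x) (\<lambda>x\<^sub>1 x\<^sub>2.
      tsum (V \<otimes>\<^sub>A W) Fb (\<lambda>b c. ?f (x\<^sub>1 \<bullet> b) (x\<^sub>2 \<bullet> c) y)))"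
    by (simp add: star_ptens_def star_lact_def tsum_out bim_hact_lact bim_hact_mult A_hact_mult
        cong: HH.tsum_cong) (intro HH.tsum_cong HH_swap; simp)
  also have "\<dots> = tsum (V \<otimes>\<^sub>A W) Fb (\<lambda>x y. tsum (V \<otimes>\<^sub>A W) (\<Delta> y) (\<lambda>y\<^sub>1 y\<^sub>2.
      tsum (V \<otimes>\<^sub>A W) Fb (\<lambda>b c. ?f x (y\<^sub>1 \<bullet> b) (y\<^sub>2 \<bullet> c))))"
    by (rule tsum_cocycle_inv[where f = ?f]) (simp, intro klin, simp_all)
  also have "\<dots> = star_lact (V \<otimes>\<^sub>A W) a (star_ptens V W v w)"
    by (simp add: star_ptens_def star_lact_def tsum_out btensor_act bim_hact_mult
        cong: HH.tsum_cong) (intro HH.tsum_cong HH_swap; simp)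
  finally show ?thesis .
qed

text \<open>F^-1 cancels the left factor of the twisted coproduct: F^-1 \<Delta>^F(\<xi>) =
  \<Delta>(\<xi>) F^-1. Hence \<phi> is compatible with the H-actions.\<close>

lemma star_ptens_hact:
  assumes [simp]: "v \<in> carrier V" "\<xi> \<in> carrier H" "w \<in> carrier W"
  shows "tsum (V \<otimes>\<^sub>A W) (comult HF \<xi>) (\<lambda>x y. star_ptens V W (hact V x v) (hact W y w))
    = hact (V \<otimes>\<^sub>A W) \<xi> (star_ptens V W v w)"
proof -
  let ?f = "\<lambda>p q. hact V p v \<boxtimes>\<^bsub>V \<otimes>\<^sub>A W\<^esub> hact W q w"
  have f: "kbilinear K H H (V \<otimes>\<^sub>A W) ?f" by (intro klin) simp_all
  have eq: "Fb \<otimes>\<^bsub>HH K H\<^esub> comult HF \<xi> = \<Delta> \<xi> \<otimes>\<^bsub>HH K H\<^esub> Fb"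
    using HH.T.Units_l_inv[OF F_Units]
    by (simp add: comult_HF HH.T.m_assoc[symmetric])
  have "tsum (V \<otimes>\<^sub>A W) (comult HF \<xi>) (\<lambda>x y. star_ptens V W (hact V x v) (hact W y w))
    = tsum (V \<otimes>\<^sub>A W) (Fb \<otimes>\<^bsub>HH K H\<^esub> comult HF \<xi>) ?f"
    by (simp add: HH.tsum_mult[OF _ f] star_ptens_def bim_hact_mult cong: HH.tsum_cong)
      (intro HH_swap; simp)
  also have "\<dots> = tsum (V \<otimes>\<^sub>A W) (\<Delta> \<xi>) (\<lambda>a b. tsum (V \<otimes>\<^sub>A W) Fb (\<lambda>x y. ?f (a \<bullet> x) (b \<bullet> y)))"
    unfolding eq by (simp add: HH.tsum_mult[OF _ f])
  also have "\<dots> = hact (V \<otimes>\<^sub>A W) \<xi> (star_ptens V W v w)"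
    by (simp add: star_ptens_def tsum_out btensor_act bim_hact_mult cong: HH.tsum_cong) (intro HH_swap; simp)
  finally show ?thesis .
qed

end

text \<open>\<open>star_map P V g\<close> says that \<open>g\<close> is a linear map of \<open>H\<close>-modules from \<open>P\<close> to \<open>V\<^sub>\<star>\<close> compatible with the
  \<open>A\<^sub>\<star>\<close>-actions. The bimodule axioms for \<open>P\<close> are not part of it: \<open>P\<close> will be an iterated tensor product over
  \<open>A\<^sub>\<star>\<close>, whose operations need never be known to be independent of representatives.\<close>

definition star_map :: "('k, 'p, 'h, 'a) hbimod \<Rightarrow> ('k, 'v, 'h, 'a) hbimod \<Rightarrow> ('p \<Rightarrow> 'v) \<Rightarrow> bool" where
  "star_map P V g \<longleftrightarrow> abelian_group P \<and> additive_map P V g \<and>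
     (\<forall>\<xi>\<in>carrier H. \<forall>p\<in>carrier P. hact P \<xi> p \<in> carrier P \<and> g (hact P \<xi> p) = hact V \<xi> (g p)) \<and>
     (\<forall>a\<in>carrier A. \<forall>p\<in>carrier P. lact P a p \<in> carrier P \<and> g (lact P a p) = star_lact V a (g p)) \<and>
     (\<forall>a\<in>carrier A. \<forall>p\<in>carrier P. ract P p a \<in> carrier P \<and> g (ract P p a) = star_ract V (g p) a)"

text \<open>The composite of \<phi> with \<open>g\<close> and \<open>h\<close> on the factors, taken
  as a single sum over a representative. Iterated comparison maps such as \<phi> after \<phi>
  \<otimes> id then arise by nesting, with no intermediate tensor product.\<close>

definition psi :: "('k, 'v, 'h, 'a) hbimod \<Rightarrow> ('k, 'w, 'h, 'a) hbimod \<Rightarrow> ('p \<Rightarrow> 'v) \<Rightarrow> ('q \<Rightarrow> 'w)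
    \<Rightarrow> ('p, 'q) tens \<Rightarrow> ('v, 'w) tens" where
  "psi V W g h X = tsum (V \<otimes>\<^sub>A W) X (\<lambda>p q. star_ptens V W (g p) (h q))"

lemma phi_psi: "phi K H F A V W = psi V W (\<lambda>v. v) (\<lambda>w. w)"
  by (simp add: phi_def psi_def[abs_def] star_ptens_def tsum_def Let_def)

context
  fixes P :: "('k, 'p, 'h, 'a) hbimod" and Q :: "('k, 'q, 'h, 'a) hbimod"
    and V :: "('k, 'v, 'h, 'a) hbimod" and W :: "('k, 'w, 'h, 'a) hbimod" and g h
  assumes g: "star_map P V g" and h: "star_map Q W h" and V [simp]: "bim V" and W [simp]: "bim W"
begin

lemma star_map_closed [simp]:
  "p \<in> carrier P \<Longrightarrow> g p \<in> carrier V" "q \<in> carrier Q \<Longrightarrow> h q \<in> carrier W"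
  "\<xi> \<in> carrier H \<Longrightarrow> p \<in> carrier P \<Longrightarrow> hact P \<xi> p \<in> carrier P"
  "\<xi> \<in> carrier H \<Longrightarrow> q \<in> carrier Q \<Longrightarrow> hact Q \<xi> q \<in> carrier Q"
  "a \<in> carrier A \<Longrightarrow> p \<in> carrier P \<Longrightarrow> lact P a p \<in> carrier P"
  "a \<in> carrier A \<Longrightarrow> p \<in> carrier P \<Longrightarrow> ract P p a \<in> carrier P"
  "a \<in> carrier A \<Longrightarrow> q \<in> carrier Q \<Longrightarrow> lact Q a q \<in> carrier Q"
  "a \<in> carrier A \<Longrightarrow> q \<in> carrier Q \<Longrightarrow> ract Q q a \<in> carrier Q"
  using g h by (auto simp: star_map_def additive_map_def)

lemma star_map_eqs:
  "\<xi> \<in> carrier H \<Longrightarrow> p \<in> carrier P \<Longrightarrow> g (hact P \<xi> p) = hact V \<xi> (g p)"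
  "\<xi> \<in> carrier H \<Longrightarrow> q \<in> carrier Q \<Longrightarrow> h (hact Q \<xi> q) = hact W \<xi> (h q)"
  "a \<in> carrier A \<Longrightarrow> p \<in> carrier P \<Longrightarrow> g (lact P a p) = star_lact V a (g p)"
  "a \<in> carrier A \<Longrightarrow> p \<in> carrier P \<Longrightarrow> g (ract P p a) = star_ract V (g p) a"
  "a \<in> carrier A \<Longrightarrow> q \<in> carrier Q \<Longrightarrow> h (lact Q a q) = star_lact W a (h q)"
  "a \<in> carrier A \<Longrightarrow> q \<in> carrier Q \<Longrightarrow> h (ract Q q a) = star_ract W (h q) a"
  "p \<in> carrier P \<Longrightarrow> p' \<in> carrier P \<Longrightarrow> g (p \<oplus>\<^bsub>P\<^esub> p') = g p \<oplus>\<^bsub>V\<^esub> g p'"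
  "q \<in> carrier Q \<Longrightarrow> q' \<in> carrier Q \<Longrightarrow> h (q \<oplus>\<^bsub>Q\<^esub> q') = h q \<oplus>\<^bsub>W\<^esub> h q'"
  using g h by (auto simp: star_map_def additive_map_def)

lemma star_tensor_product: "tensor_product (carrier A) (ract P) (lact Q) P Q (P \<otimes>\<^sub>\<star> Q)"
proof -
  have "abelian_group P" "abelian_group Q" using g h unfolding star_map_def by blast+
  from btensor_tensor_product[of P Q As HF, OF this] show ?thesis by simp
qed

interpretation T: tensor_product "carrier A" "ract P" "lact Q" P Q "P \<otimes>\<^sub>\<star> Q"
  by (rule star_tensor_product)

lemma star_ptens_add:
  "v \<in> carrier V \<Longrightarrow> v' \<in> carrier V \<Longrightarrow> w \<in> carrier W \<Longrightarrow>
    star_ptens V W (v \<oplus>\<^bsub>V\<^esub> v') w = star_ptens V W v w \<oplus>\<^bsub>V \<otimes>\<^sub>A W\<^esub> star_ptens V W v' w"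
  "v \<in> carrier V \<Longrightarrow> w \<in> carrier W \<Longrightarrow> w' \<in> carrier W \<Longrightarrow>
    star_ptens V W v (w \<oplus>\<^bsub>W\<^esub> w') = star_ptens V W v w \<oplus>\<^bsub>V \<otimes>\<^sub>A W\<^esub> star_ptens V W v w'"
  using star_ptens_bilinear[OF V W] by (simp_all add: kbilinear_def klinear_def)

lemma psi_additive: "additive_map (P \<otimes>\<^sub>\<star> Q) (V \<otimes>\<^sub>A W) (psi V W g h)"
  unfolding psi_def[abs_def]
  by (rule T.tsum_additive[OF module_abelian])
    (simp_all add: star_map_eqs star_ptens_add star_ptens_balanced)

lemma psi_ptens: "p \<in> carrier P \<Longrightarrow> q \<in> carrier Q \<Longrightarrow> psi V W g h (p \<boxtimes>\<^bsub>P \<otimes>\<^sub>\<star> Q\<^esub> q) = star_ptens V W (g p) (h q)"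
  unfolding psi_def
  by (rule T.tsum_ptens[OF module_abelian])
    (simp_all add: star_map_eqs star_ptens_add star_ptens_balanced)

lemma psi_closed: "X \<in> carrier (P \<otimes>\<^sub>\<star> Q) \<Longrightarrow> psi V W g h X \<in> carrier (V \<otimes>\<^sub>A W)"
  using psi_additive by (auto simp: additive_map_def)

lemma psi_tsum:
  assumes "tensor_product S' r' l' P' Q' T'" "X \<in> carrier T'"
    "\<And>p q. p \<in> carrier P' \<Longrightarrow> q \<in> carrier Q' \<Longrightarrow> f p q \<in> carrier (P \<otimes>\<^sub>\<star> Q)"
  shows "psi V W g h (tsum (P \<otimes>\<^sub>\<star> Q) X f) = tsum (V \<otimes>\<^sub>A W) X (\<lambda>p q. psi V W g h (f p q))"
  by (rule tensor_product.tsum_hom[OF assms(1) T.abelian_T module_abelian psi_additive assms(2,3)]) simp_all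

lemma star_tensor_eqs:
  "hact (P \<otimes>\<^sub>\<star> Q) \<xi> X = tsum (P \<otimes>\<^sub>\<star> Q) X (\<lambda>p q. tsum (P \<otimes>\<^sub>\<star> Q) (comult HF \<xi>)
      (\<lambda>x y. hact P x p \<boxtimes>\<^bsub>P \<otimes>\<^sub>\<star> Q\<^esub> hact Q y q))"
  "lact (P \<otimes>\<^sub>\<star> Q) a X = tsum (P \<otimes>\<^sub>\<star> Q) X (\<lambda>p q. lact P a p \<boxtimes>\<^bsub>P \<otimes>\<^sub>\<star> Q\<^esub> q)"
  "ract (P \<otimes>\<^sub>\<star> Q) X a = tsum (P \<otimes>\<^sub>\<star> Q) X (\<lambda>p q. p \<boxtimes>\<^bsub>P \<otimes>\<^sub>\<star> Q\<^esub> ract Q q a)"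
  by (rule btensor_eqs)+

text \<open>This lets the construction iterate. The twisted action on \<open>X\<close> and
  \<open>psi\<close> are evaluated on the same representative of \<open>X\<close>, and on its pure
  terms the claims are the compatibilities of \<open>star_ptens\<close>.\<close>

lemma star_map_psi: "star_map (P \<otimes>\<^sub>\<star> Q) (V \<otimes>\<^sub>A W) (psi V W g h)"
proof -
  let ?T = "P \<otimes>\<^sub>\<star> Q" and ?U = "V \<otimes>\<^sub>A W"
  note hom = psi_tsum[OF star_tensor_product] psi_tsum[OF HH.tensor_product_axioms]
  have pull: "k (psi V W g h X) = tsum ?U X (\<lambda>p q. k (star_ptens V W (g p) (h q)))"
    if "klinear K ?U ?U k" "X \<in> carrier ?T" for k X
    unfolding psi_def using that
    by (intro T.tsum_hom[OF module_abelian module_abelian klinear_additive]) simp_all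
  have 1: "hact ?T \<xi> X \<in> carrier ?T \<and> psi V W g h (hact ?T \<xi> X) = hact ?U \<xi> (psi V W g h X)"
    if [simp]: "\<xi> \<in> carrier H" "X \<in> carrier ?T" for \<xi> X
  proof
    show cl: "hact ?T \<xi> X \<in> carrier ?T"
      unfolding star_tensor_eqs
      by (simp add: T.tsum_closed[OF T.abelian_T] HH.tsum_closed[OF T.abelian_T])
    have "psi V W g h (hact ?T \<xi> X) = tsum ?U X (\<lambda>p q. psi V W g h (tsum ?T (comult HF \<xi>)
        (\<lambda>x y. hact P x p \<boxtimes>\<^bsub>?T\<^esub> hact Q y q)))"
      unfolding star_tensor_eqs by (rule hom(1)) (simp_all add: HH.tsum_closed[OF T.abelian_T])
    also have "\<dots> = tsum ?U X (\<lambda>p q. hact ?U \<xi> (star_ptens V W (g p) (h q)))"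
      by (intro T.tsum_cong)
        (simp_all add: hom(2) psi_ptens star_map_eqs star_ptens_hact cong: HH.tsum_cong)
    also have "\<dots> = hact ?U \<xi> (psi V W g h X)"
      by (rule pull[symmetric]) (simp_all add: klin klinear_ident)
    finally show "psi V W g h (hact ?T \<xi> X) = hact ?U \<xi> (psi V W g h X)" .
  qed
  have 2: "lact ?T a X \<in> carrier ?T \<and> psi V W g h (lact ?T a X) = star_lact ?U a (psi V W g h X)"
    if [simp]: "a \<in> carrier A" "X \<in> carrier ?T" for a X
  proof -
    have "klinear K ?U ?U (star_lact ?U a)"
      unfolding star_lact_def[abs_def] by (intro klin) simp_all
    then show ?thesis
      unfolding star_tensor_eqs
      by (simp add: hom pull T.tsum_closed[OF T.abelian_T] psi_ptens star_map_eqs star_ptens_lact cong: T.tsum_cong)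
  qed
  have 3: "ract ?T X a \<in> carrier ?T \<and> psi V W g h (ract ?T X a) = star_ract ?U (psi V W g h X) a"
    if [simp]: "a \<in> carrier A" "X \<in> carrier ?T" for a X
  proof -
    have "klinear K ?U ?U (\<lambda>u. star_ract ?U u a)"
      unfolding star_ract_def[abs_def] by (intro klin) simp_all
    from pull[OF this] show ?thesis
      unfolding star_tensor_eqs
      by (simp add: hom T.tsum_closed[OF T.abelian_T] psi_ptens star_map_eqs star_ptens_ract cong: T.tsum_cong)
  qed
  show ?thesis
    unfolding star_map_def
    by (intro conjI ballI T.abelian_T psi_additive 1[THEN conjunct1] 1[THEN conjunct2] 2[THEN conjunct1]
        2[THEN conjunct2] 3[THEN conjunct1] 3[THEN conjunct2])
qed

end

lemma star_map_twist_bimod: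
  assumes [simp]: "bim V"
  shows "star_map (twist_bimod K H F A V) V (\<lambda>v. v)"
proof -
  let ?V = "twist_bimod K H F A V"
  have ab: "abelian_group ?V"
    by (rule abelian_group_ring_cong[OF module_abelian[OF bim_module[OF assms]]]) (simp_all add: twist_bimod_def)
  have eqs: "carrier ?V = carrier V" "hact ?V = hact V" "ring.add ?V = ring.add V"
    "lact ?V = star_lact V" "ract ?V = star_ract V"
    by (simp_all add: twist_bimod_def star_lact_def star_ract_def tsum_def fun_eq_iff)
  show ?thesis
    unfolding star_map_def additive_map_def eqs by (intro conjI ballI ab) simp_all
qed

end

section \<open>Associativity isomorphisms, quasi-commutativity and the inverse braiding\<close>

section \<open>Associativity and the braiding\<close>

context hopf_module_algebra
begin

abbreviation assoc :: "('k, 'u, 'h, 'a) hbimod \<Rightarrow> ('k, 'v, 'h, 'a) hbimod \<Rightarrow> ('k, 'w, 'h, 'a) hbimod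
    \<Rightarrow> ('u, ('v, 'w) tens) tens \<Rightarrow> (('u, 'v) tens, 'w) tens" where
  "assoc U V W \<equiv> tassoc ((U \<otimes>\<^sub>A V) \<otimes>\<^sub>A W) (U \<otimes>\<^sub>A V)"

context
  fixes U :: "('k, 'u, 'h, 'a) hbimod" and V :: "('k, 'v, 'h, 'a) hbimod" and W :: "('k, 'w, 'h, 'a) hbimod"
  assumes U [simp]: "bim U" and V [simp]: "bim V" and W [simp]: "bim W"
begin

interpretation VW: tensor_module K "carrier A" "ract V" "lact W" V W "V \<otimes>\<^sub>A W"
  by (rule btensor_tensor_module[OF V W])

lemma assoc_inner_balanced:
  "u \<in> carrier U \<Longrightarrow> v \<in> carrier V \<Longrightarrow> a \<in> carrier A \<Longrightarrow> w \<in> carrier W \<Longrightarrow>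
    (u \<boxtimes>\<^bsub>U \<otimes>\<^sub>A V\<^esub> ract V v a) \<boxtimes>\<^bsub>(U \<otimes>\<^sub>A V) \<otimes>\<^sub>A W\<^esub> w
    = (u \<boxtimes>\<^bsub>U \<otimes>\<^sub>A V\<^esub> v) \<boxtimes>\<^bsub>(U \<otimes>\<^sub>A V) \<otimes>\<^sub>A W\<^esub> lact W a w"
  by (simp add: bptens_balanced[symmetric] btensor_act)

lemma assoc_inner_bilinear:
  "u \<in> carrier U \<Longrightarrow> kbilinear K V W ((U \<otimes>\<^sub>A V) \<otimes>\<^sub>A W) (\<lambda>v w. (u \<boxtimes>\<^bsub>U \<otimes>\<^sub>A V\<^esub> v) \<boxtimes>\<^bsub>(U \<otimes>\<^sub>A V) \<otimes>\<^sub>A W\<^esub> w)"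
  by (intro klin) simp_all

lemma assoc_inner_klinear:
  "u \<in> carrier U \<Longrightarrow> klinear K (V \<otimes>\<^sub>A W) ((U \<otimes>\<^sub>A V) \<otimes>\<^sub>A W)
    (\<lambda>q. tsum ((U \<otimes>\<^sub>A V) \<otimes>\<^sub>A W) q (\<lambda>v w. (u \<boxtimes>\<^bsub>U \<otimes>\<^sub>A V\<^esub> v) \<boxtimes>\<^bsub>(U \<otimes>\<^sub>A V) \<otimes>\<^sub>A W\<^esub> w))"
  by (rule btensor_tsum_klinear) (simp_all add: assoc_inner_balanced assoc_inner_bilinear)

lemma assoc_inner_ptens:
  "u \<in> carrier U \<Longrightarrow> v \<in> carrier V \<Longrightarrow> w \<in> carrier W \<Longrightarrow>
    tsum ((U \<otimes>\<^sub>A V) \<otimes>\<^sub>A W) (v \<boxtimes>\<^bsub>V \<otimes>\<^sub>A W\<^esub> w) (\<lambda>v w. (u \<boxtimes>\<^bsub>U \<otimes>\<^sub>A V\<^esub> v) \<boxtimes>\<^bsub>(U \<otimes>\<^sub>A V) \<otimes>\<^sub>A W\<^esub> w)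
    = (u \<boxtimes>\<^bsub>U \<otimes>\<^sub>A V\<^esub> v) \<boxtimes>\<^bsub>(U \<otimes>\<^sub>A V) \<otimes>\<^sub>A W\<^esub> w"
  by (rule btensor_tsum_ptens) (simp_all add: assoc_inner_balanced assoc_inner_bilinear)

lemma assoc_balanced:
  assumes [simp]: "u \<in> carrier U" "a \<in> carrier A" and q: "q \<in> carrier (V \<otimes>\<^sub>A W)"
  shows "tsum ((U \<otimes>\<^sub>A V) \<otimes>\<^sub>A W) q (\<lambda>v w. (ract U u a \<boxtimes>\<^bsub>U \<otimes>\<^sub>A V\<^esub> v) \<boxtimes>\<^bsub>(U \<otimes>\<^sub>A V) \<otimes>\<^sub>A W\<^esub> w)
    = tsum ((U \<otimes>\<^sub>A V) \<otimes>\<^sub>A W) (lact (V \<otimes>\<^sub>A W) a q) (\<lambda>v w. (u \<boxtimes>\<^bsub>U \<otimes>\<^sub>A V\<^esub> v) \<boxtimes>\<^bsub>(U \<otimes>\<^sub>A V) \<otimes>\<^sub>A W\<^esub> w)"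
proof (rule btensor_eqI[OF V W assoc_inner_klinear klinear_comp[OF assoc_inner_klinear btensor_act_klin(2)[OF V W]] q])
  fix v w assume "v \<in> carrier V" "w \<in> carrier W"
  then show "tsum ((U \<otimes>\<^sub>A V) \<otimes>\<^sub>A W) (v \<boxtimes>\<^bsub>V \<otimes>\<^sub>A W\<^esub> w) (\<lambda>v w. (ract U u a \<boxtimes>\<^bsub>U \<otimes>\<^sub>A V\<^esub> v) \<boxtimes>\<^bsub>(U \<otimes>\<^sub>A V) \<otimes>\<^sub>A W\<^esub> w)
    = tsum ((U \<otimes>\<^sub>A V) \<otimes>\<^sub>A W) (lact (V \<otimes>\<^sub>A W) a (v \<boxtimes>\<^bsub>V \<otimes>\<^sub>A W\<^esub> w)) (\<lambda>v w. (u \<boxtimes>\<^bsub>U \<otimes>\<^sub>A V\<^esub> v) \<boxtimes>\<^bsub>(U \<otimes>\<^sub>A V) \<otimes>\<^sub>A W\<^esub> w)"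
    by (simp add: assoc_inner_ptens btensor_act bptens_balanced)
qed simp_all

lemma assoc_bilinear:
  "kbilinear K U (V \<otimes>\<^sub>A W) ((U \<otimes>\<^sub>A V) \<otimes>\<^sub>A W)
    (\<lambda>u q. tsum ((U \<otimes>\<^sub>A V) \<otimes>\<^sub>A W) q (\<lambda>v w. (u \<boxtimes>\<^bsub>U \<otimes>\<^sub>A V\<^esub> v) \<boxtimes>\<^bsub>(U \<otimes>\<^sub>A V) \<otimes>\<^sub>A W\<^esub> w))"
  by (intro kbilinearI assoc_inner_klinear VW.klinear_tsumf klin) simp_all

lemma assoc_klinear: "klinear K (U \<otimes>\<^sub>A (V \<otimes>\<^sub>A W)) ((U \<otimes>\<^sub>A V) \<otimes>\<^sub>A W) (assoc U V W)"
  unfolding tassoc_eq[abs_def]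
  by (rule btensor_tsum_klinear) (simp_all add: assoc_bilinear assoc_balanced)

lemma assoc_ptens_tsum:
  "u \<in> carrier U \<Longrightarrow> q \<in> carrier (V \<otimes>\<^sub>A W) \<Longrightarrow> assoc U V W (u \<boxtimes>\<^bsub>U \<otimes>\<^sub>A (V \<otimes>\<^sub>A W)\<^esub> q)
    = tsum ((U \<otimes>\<^sub>A V) \<otimes>\<^sub>A W) q (\<lambda>v w. (u \<boxtimes>\<^bsub>U \<otimes>\<^sub>A V\<^esub> v) \<boxtimes>\<^bsub>(U \<otimes>\<^sub>A V) \<otimes>\<^sub>A W\<^esub> w)"
  unfolding tassoc_eq
  by (rule btensor_tsum_ptens) (simp_all add: assoc_bilinear assoc_balanced)

lemma assoc_ptens:
  "u \<in> carrier U \<Longrightarrow> v \<in> carrier V \<Longrightarrow> w \<in> carrier W \<Longrightarrow>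
    assoc U V W (u \<boxtimes>\<^bsub>U \<otimes>\<^sub>A (V \<otimes>\<^sub>A W)\<^esub> (v \<boxtimes>\<^bsub>V \<otimes>\<^sub>A W\<^esub> w)) = (u \<boxtimes>\<^bsub>U \<otimes>\<^sub>A V\<^esub> v) \<boxtimes>\<^bsub>(U \<otimes>\<^sub>A V) \<otimes>\<^sub>A W\<^esub> w"
  by (simp add: assoc_ptens_tsum assoc_inner_ptens)

lemma assoc_closed: "X \<in> carrier (U \<otimes>\<^sub>A (V \<otimes>\<^sub>A W)) \<Longrightarrow> assoc U V W X \<in> carrier ((U \<otimes>\<^sub>A V) \<otimes>\<^sub>A W)"
  by (rule klinear_closed[OF assoc_klinear])

lemma assoc_klin: "klinear K M (U \<otimes>\<^sub>A (V \<otimes>\<^sub>A W)) f \<Longrightarrow> klinear K M ((U \<otimes>\<^sub>A V) \<otimes>\<^sub>A W) (\<lambda>x. assoc U V W (f x))"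
  by (rule klinear_comp[OF assoc_klinear])

lemma assoc_tsum_out:
  assumes "X \<in> carrier (HH K H)" "\<And>x y. x \<in> carrier H \<Longrightarrow> y \<in> carrier H \<Longrightarrow> f x y \<in> carrier (U \<otimes>\<^sub>A (V \<otimes>\<^sub>A W))"
  shows "assoc U V W (tsum (U \<otimes>\<^sub>A (V \<otimes>\<^sub>A W)) X f) = tsum ((U \<otimes>\<^sub>A V) \<otimes>\<^sub>A W) X (\<lambda>x y. assoc U V W (f x y))"
  by (rule klinear_tsum_out[OF assoc_klinear _ _ assms]) simp_all

lemma assoc_eqI:
  assumes f: "klinear K (U \<otimes>\<^sub>A (V \<otimes>\<^sub>A W)) Z f" and g: "klinear K (U \<otimes>\<^sub>A (V \<otimes>\<^sub>A W)) Z g"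
    and X: "X \<in> carrier (U \<otimes>\<^sub>A (V \<otimes>\<^sub>A W))"
    and eq: "\<And>u v w. u \<in> carrier U \<Longrightarrow> v \<in> carrier V \<Longrightarrow> w \<in> carrier W \<Longrightarrow>
      f (u \<boxtimes>\<^bsub>U \<otimes>\<^sub>A (V \<otimes>\<^sub>A W)\<^esub> (v \<boxtimes>\<^bsub>V \<otimes>\<^sub>A W\<^esub> w)) = g (u \<boxtimes>\<^bsub>U \<otimes>\<^sub>A (V \<otimes>\<^sub>A W)\<^esub> (v \<boxtimes>\<^bsub>V \<otimes>\<^sub>A W\<^esub> w))"
  shows "f X = g X"
proof (rule btensor_eqI[OF U bim_btensor[OF V W] f g X])
  fix u q assume u: "u \<in> carrier U" and q: "q \<in> carrier (V \<otimes>\<^sub>A W)"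
  show "f (u \<boxtimes>\<^bsub>U \<otimes>\<^sub>A (V \<otimes>\<^sub>A W)\<^esub> q) = g (u \<boxtimes>\<^bsub>U \<otimes>\<^sub>A (V \<otimes>\<^sub>A W)\<^esub> q)"
    by (rule btensor_eqI[OF V W klinear_comp[OF f] klinear_comp[OF g] q])
      (use u eq in \<open>simp_all add: klin klinear_ident\<close>)
qed

text \<open>On pure tensors the two ways of splitting \<xi> into three components are exchanged by
  coassociativity.\<close>

lemma assoc_hact:
  assumes [simp]: "\<xi> \<in> carrier H" and X: "X \<in> carrier (U \<otimes>\<^sub>A (V \<otimes>\<^sub>A W))"
  shows "assoc U V W (hact (U \<otimes>\<^sub>A (V \<otimes>\<^sub>A W)) \<xi> X) = hact ((U \<otimes>\<^sub>A V) \<otimes>\<^sub>A W) \<xi> (assoc U V W X)"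
proof (rule assoc_eqI[OF _ _ X, where Z = "(U \<otimes>\<^sub>A V) \<otimes>\<^sub>A W"])
  fix u v w assume [simp]: "u \<in> carrier U" "v \<in> carrier V" "w \<in> carrier W"
  let ?f = "\<lambda>p q r. (hact U p u \<boxtimes>\<^bsub>U \<otimes>\<^sub>A V\<^esub> hact V q v) \<boxtimes>\<^bsub>(U \<otimes>\<^sub>A V) \<otimes>\<^sub>A W\<^esub> hact W r w"
  have "assoc U V W (hact (U \<otimes>\<^sub>A (V \<otimes>\<^sub>A W)) \<xi> (u \<boxtimes>\<^bsub>U \<otimes>\<^sub>A (V \<otimes>\<^sub>A W)\<^esub> (v \<boxtimes>\<^bsub>V \<otimes>\<^sub>A W\<^esub> w)))
    = tsum ((U \<otimes>\<^sub>A V) \<otimes>\<^sub>A W) (\<Delta> \<xi>) (\<lambda>x y. tsum ((U \<otimes>\<^sub>A V) \<otimes>\<^sub>A W) (\<Delta> y) (\<lambda>y\<^sub>1 y\<^sub>2. ?f x y\<^sub>1 y\<^sub>2))"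
    by (simp add: btensor_act tsum_out assoc_tsum_out assoc_ptens cong: HH.tsum_cong)
  also have "\<dots> = tsum ((U \<otimes>\<^sub>A V) \<otimes>\<^sub>A W) (\<Delta> \<xi>) (\<lambda>x y. tsum ((U \<otimes>\<^sub>A V) \<otimes>\<^sub>A W) (\<Delta> x) (\<lambda>x\<^sub>1 x\<^sub>2. ?f x\<^sub>1 x\<^sub>2 y))"
    by (rule coassoc[symmetric]) (simp, intro klin, simp_all)
  also have "\<dots> = hact ((U \<otimes>\<^sub>A V) \<otimes>\<^sub>A W) \<xi> (assoc U V W (u \<boxtimes>\<^bsub>U \<otimes>\<^sub>A (V \<otimes>\<^sub>A W)\<^esub> (v \<boxtimes>\<^bsub>V \<otimes>\<^sub>A W\<^esub> w)))"
    by (simp add: btensor_act tsum_out assoc_ptens cong: HH.tsum_cong)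
  finally show "assoc U V W (hact (U \<otimes>\<^sub>A (V \<otimes>\<^sub>A W)) \<xi> (u \<boxtimes>\<^bsub>U \<otimes>\<^sub>A (V \<otimes>\<^sub>A W)\<^esub> (v \<boxtimes>\<^bsub>V \<otimes>\<^sub>A W\<^esub> w)))
    = hact ((U \<otimes>\<^sub>A V) \<otimes>\<^sub>A W) \<xi> (assoc U V W (u \<boxtimes>\<^bsub>U \<otimes>\<^sub>A (V \<otimes>\<^sub>A W)\<^esub> (v \<boxtimes>\<^bsub>V \<otimes>\<^sub>A W\<^esub> w)))" .
qed (simp_all add: assoc_klin klin klinear_ident)

end

end

locale quasitriangular_module_algebra = hopf_module_algebra K H A + quasitriangular_hopf K H R
  for K :: "('k, 'r) ring_scheme" and H :: "('k, 'h) hopf" and A :: "('k, 'a, 'h) hmod"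
    and R :: "('h, 'h) tens"
begin

abbreviation qcomm :: "('k, 'v, 'h, 'a) hbimod \<Rightarrow> bool" where
  "qcomm V \<equiv> quasi_commutative K H R A V"

text \<open>The second quasi-commutativity relation, which a graded quasi-commutative calculus satisfies besides
  \<^term>\<open>qcomm\<close>.\<close>

definition qcomm_left :: "('k, 'v, 'h, 'a) hbimod \<Rightarrow> bool" where
  "qcomm_left V \<longleftrightarrow> (\<forall>a\<in>carrier A. \<forall>v\<in>carrier V.
     lact V a v = tsum V Rb (\<lambda>x y. ract V (hact V x v) (hact A y a)))"

lemma qcomm_ract:
  "qcomm V \<Longrightarrow> a \<in> carrier A \<Longrightarrow> v \<in> carrier V \<Longrightarrow>
    ract V v a = tsum V Rb (\<lambda>x y. lact V (hact A x a) (hact V y v))"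
  by (simp add: quasi_commutative_def tsum_def)

text \<open>Inserting the quasi-commutativity relation on the right produces R^-1 R, which
  cancels.\<close>

lemma qcomm_lact:
  assumes V [simp]: "bim V" and qc: "qcomm V" and [simp]: "a \<in> carrier A" "v \<in> carrier V"
  shows "lact V a v = tsum V R (\<lambda>x y. ract V (hact V y v) (hact A x a))"
proof -
  let ?f = "\<lambda>p q. lact V (hact A p a) (hact V q v)"
  have f: "kbilinear K H H V ?f" by (intro klin) simp_all
  have "tsum V R (\<lambda>x y. ract V (hact V y v) (hact A x a))
    = tsum V R (\<lambda>x y. tsum V Rb (\<lambda>x' y'. ?f (x' \<bullet> x) (y' \<bullet> y)))"
    by (simp add: qcomm_ract[OF qc] bim_hact_mult A_hact_mult cong: HH.tsum_cong)
  also have "\<dots> = tsum V Rb (\<lambda>x' y'. tsum V R (\<lambda>x y. ?f (x' \<bullet> x) (y' \<bullet> y)))"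
    by (rule HH_swap) simp_all
  also have "\<dots> = ?f \<one>\<^bsub>H\<^esub> \<one>\<^bsub>H\<^esub>"
    by (rule tsum_R_inverse(2)[OF _ f]) simp
  finally show ?thesis by simp
qed

end

context quasitriangular_module_algebra
begin

lemma qcomm_left_lact:
  "qcomm_left V \<Longrightarrow> a \<in> carrier A \<Longrightarrow> v \<in> carrier V \<Longrightarrow>
    lact V a v = tsum V Rb (\<lambda>x y. ract V (hact V x v) (hact A y a))"
  by (simp add: qcomm_left_def)

context
  fixes V :: "('k, 'v, 'h, 'a) hbimod" and Om :: "('k, 'o, 'h, 'a) hbimod" and W :: "('k, 'w, 'h, 'a) hbimod"
  assumes V [simp]: "bim V" and Om [simp]: "bim Om" and W [simp]: "bim W"
    and qW: "qcomm W" and qOm: "qcomm_left Om"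
begin

abbreviation (input) "VW \<equiv> V \<otimes>\<^sub>A W"
abbreviation (input) "VWO \<equiv> (V \<otimes>\<^sub>A W) \<otimes>\<^sub>A Om"
abbreviation (input) "VOW \<equiv> (V \<otimes>\<^sub>A Om) \<otimes>\<^sub>A W"

interpretation VOm: tensor_module K "carrier A" "ract V" "lact Om" V Om "V \<otimes>\<^sub>A Om"
  by (rule btensor_tensor_module[OF V Om])

definition braid :: "'v \<Rightarrow> 'o \<Rightarrow> 'w \<Rightarrow> (('v, 'w) tens, 'o) tens" where
  "braid v \<theta> w = tsum VWO R (\<lambda>x y. (v \<boxtimes>\<^bsub>VW\<^esub> hact W y w) \<boxtimes>\<^bsub>VWO\<^esub> hact Om x \<theta>)"

lemma braid_klin:
  "klinear K M V f \<Longrightarrow> \<theta> \<in> carrier Om \<Longrightarrow> w \<in> carrier W \<Longrightarrow> klinear K M VWO (\<lambda>m. braid (f m) \<theta> w)"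
  "klinear K M Om g \<Longrightarrow> v \<in> carrier V \<Longrightarrow> w \<in> carrier W \<Longrightarrow> klinear K M VWO (\<lambda>m. braid v (g m) w)"
  "klinear K M W h \<Longrightarrow> v \<in> carrier V \<Longrightarrow> \<theta> \<in> carrier Om \<Longrightarrow> klinear K M VWO (\<lambda>m. braid v \<theta> (h m))"
  unfolding braid_def by (intro klin; simp)+

text \<open>(\<Delta> \<otimes> id) R splits into two copies of R. One turns the right action on
  \<open>w\<close> into the left action of \<open>a\<close>, which the tensor sign passes on to
  \<open>v\<close>; the other is the braiding.\<close>

lemma braid_balanced_left:
  assumes [simp]: "v \<in> carrier V" "a \<in> carrier A" "\<theta> \<in> carrier Om" "w \<in> carrier W"
  shows "braid (ract V v a) \<theta> w = braid v (lact Om a \<theta>) w"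
proof -
  let ?f = "\<lambda>p q r. (v \<boxtimes>\<^bsub>VW\<^esub> ract W (hact W r w) (hact A p a)) \<boxtimes>\<^bsub>VWO\<^esub> hact Om q \<theta>"
  have "braid v (lact Om a \<theta>) w = tsum VWO R (\<lambda>x y. tsum VWO (\<Delta> x) (\<lambda>x\<^sub>1 x\<^sub>2. ?f x\<^sub>1 x\<^sub>2 y))"
    by (simp add: braid_def bim_hact_lact tsum_out bptens_balanced[symmetric] btensor_act cong: HH.tsum_cong)
  also have "\<dots> = tsum VWO R (\<lambda>x y. tsum VWO R (\<lambda>b c. ?f x b (y \<bullet> c)))"
    by (rule tsum_R_coproduct(1)[where f = ?f]) (simp, intro klin, simp_all)
  also have "\<dots> = tsum VWO R (\<lambda>b c. tsum VWO R (\<lambda>x y. ?f x b (y \<bullet> c)))"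
    by (rule HH_swap) simp_all
  also have "\<dots> = braid (ract V v a) \<theta> w"
    by (simp add: braid_def bim_hact_mult bptens_balanced qcomm_lact[OF W qW] tsum_out cong: HH.tsum_cong)
  finally show ?thesis by simp
qed

text \<open>The algebra element passes \<open>w\<close> at the cost of R, by quasi-commutativity of
  W, and \<theta> at the cost of R^-1, by that of \<Omega>. What accumulates is R^-1 \<Delta>^op(s)
  R, which quasi-cocommutativity reduces to \<Delta>(s).\<close>

lemma braid_balanced_right:
  assumes [simp]: "v \<in> carrier V" "a \<in> carrier A" "\<theta> \<in> carrier Om" "w \<in> carrier W"
  shows "braid v (ract Om \<theta> a) w = braid v \<theta> (lact W a w)"
proof -
  let ?g = "\<lambda>t p q. (v \<boxtimes>\<^bsub>VW\<^esub> hact W t w) \<boxtimes>\<^bsub>VWO\<^esub> ract Om (hact Om p \<theta>) (hact A q a)"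
  let ?G = "\<lambda>d x r. tsum VWO R (\<lambda>b c. tsum VWO Rb (\<lambda>p q. ?g r (p \<bullet> (x \<bullet> b)) (q \<bullet> (d \<bullet> c))))"
  let ?f = "\<lambda>p q r. (v \<boxtimes>\<^bsub>VW\<^esub> lact W (hact A q a) (hact W r w)) \<boxtimes>\<^bsub>VWO\<^esub> hact Om p \<theta>"
  have "braid v \<theta> (lact W a w) = tsum VWO R (\<lambda>x y. tsum VWO (\<Delta> y) (\<lambda>y\<^sub>1 y\<^sub>2. ?f x y\<^sub>1 y\<^sub>2))"
    by (simp add: braid_def bim_hact_lact tsum_out cong: HH.tsum_cong)
  also have "\<dots> = tsum VWO R (\<lambda>x y. tsum VWO R (\<lambda>b c. ?f (x \<bullet> b) c y))"
    by (rule tsum_R_coproduct(2)[where f = ?f]) (simp, intro klin, simp_all)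
  also have "\<dots> = tsum VWO R (\<lambda>x y. tsum VWO R (\<lambda>b c. tsum VWO R (\<lambda>d e. tsum VWO Rb (\<lambda>p q.
      ?g (e \<bullet> y) (p \<bullet> (x \<bullet> b)) (q \<bullet> (d \<bullet> c))))))"
    by (simp add: qcomm_lact[OF W qW] qcomm_left_lact[OF qOm] assoc_inner_balanced tsum_out bim_hact_mult A_hact_mult
        cong: HH.tsum_cong)
  also have "\<dots> = tsum VWO R (\<lambda>x y. tsum VWO R (\<lambda>d e. ?G d x (e \<bullet> y)))"
    by (rule HH.tsum_cong[OF R_closed(1)], rule HH_swap) simp_all
  also have "\<dots> = tsum VWO R (\<lambda>d e. tsum VWO R (\<lambda>x y. ?G d x (e \<bullet> y)))"
    by (rule HH_swap) simp_all
  \<comment> \<open>The outer copy of R and the one contributed by W multiply in the component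
    acting on \<open>w\<close>; together they are (\<Delta> \<otimes> id) R read backwards.\<close>
  also have "\<dots> = tsum VWO R (\<lambda>s t. tsum VWO (\<Delta> s) (\<lambda>s\<^sub>1 s\<^sub>2. ?G s\<^sub>1 s\<^sub>2 t))"
    by (rule tsum_R_coproduct(1)[where f = ?G, symmetric]) (simp, intro klin, simp_all)
  also have "\<dots> = tsum VWO R (\<lambda>s t. tsum VWO (\<Delta> s) (\<lambda>s\<^sub>1 s\<^sub>2. ?g t s\<^sub>1 s\<^sub>2))"
  proof (rule HH.tsum_cong)
    fix s t assume [simp]: "s \<in> carrier H" "t \<in> carrier H"
    show "tsum VWO (\<Delta> s) (\<lambda>s\<^sub>1 s\<^sub>2. ?G s\<^sub>1 s\<^sub>2 t) = tsum VWO (\<Delta> s) (\<lambda>s\<^sub>1 s\<^sub>2. ?g t s\<^sub>1 s\<^sub>2)"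
    proof -
      let ?k = "\<lambda>u u'. tsum VWO R (\<lambda>b c. ?g t (u \<bullet> b) (u' \<bullet> c))"
      have k: "kbilinear K H H VWO ?k" by (intro klin) simp_all
      have "tsum VWO (\<Delta> s) (\<lambda>s\<^sub>1 s\<^sub>2. ?G s\<^sub>1 s\<^sub>2 t)
        = tsum VWO (\<Delta> s) (\<lambda>s\<^sub>1 s\<^sub>2. tsum VWO Rb (\<lambda>p q. ?k (p \<bullet> s\<^sub>2) (q \<bullet> s\<^sub>1)))"
        by (rule HH.tsum_cong, simp, subst HH_swap) (simp_all add: HH.A.m_assoc cong: HH.tsum_cong)
      also have "\<dots> = tsum VWO Rb (\<lambda>p q. tsum VWO (\<Delta> s) (\<lambda>s\<^sub>1 s\<^sub>2. ?k (p \<bullet> s\<^sub>2) (q \<bullet> s\<^sub>1)))"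
        by (rule HH_swap) simp_all
      also have "\<dots> = tsum VWO (\<Delta> s) (\<lambda>s\<^sub>1 s\<^sub>2. tsum VWO Rb (\<lambda>p q. ?k (s\<^sub>1 \<bullet> p) (s\<^sub>2 \<bullet> q)))"
        by (rule tsum_R_comult(2)[OF _ k]) simp_all
      also have "\<dots> = tsum VWO (\<Delta> s) (\<lambda>s\<^sub>1 s\<^sub>2. ?g t s\<^sub>1 s\<^sub>2)"
      proof (rule HH.tsum_cong)
        fix s\<^sub>1 s\<^sub>2 assume [simp]: "s\<^sub>1 \<in> carrier H" "s\<^sub>2 \<in> carrier H"
        have g': "kbilinear K H H VWO (\<lambda>u u'. ?g t (s\<^sub>1 \<bullet> u) (s\<^sub>2 \<bullet> u'))" by (intro klin) simp_all
        show "tsum VWO Rb (\<lambda>p q. ?k (s\<^sub>1 \<bullet> p) (s\<^sub>2 \<bullet> q)) = ?g t s\<^sub>1 s\<^sub>2"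
          using tsum_R_inverse(2)[OF _ g'] by (simp add: HH.A.m_assoc cong: HH.tsum_cong)
      qed simp
      finally show ?thesis .
    qed
  qed simp
  also have "\<dots> = braid v (ract Om \<theta> a) w"
    by (simp add: braid_def bim_hact_ract tsum_out cong: HH.tsum_cong)
  finally show ?thesis by simp
qed

definition braid1 :: "('v, 'o) tens \<Rightarrow> 'w \<Rightarrow> (('v, 'w) tens, 'o) tens" where
  "braid1 q w = tsum VWO q (\<lambda>v \<theta>. braid v \<theta> w)"

lemma braid_bilinear: "w \<in> carrier W \<Longrightarrow> kbilinear K V Om VWO (\<lambda>v \<theta>. braid v \<theta> w)"
  by (intro kbilinearI braid_klin klinear_ident)

lemma braid1_klinear: "w \<in> carrier W \<Longrightarrow> klinear K (V \<otimes>\<^sub>A Om) VWO (\<lambda>q. braid1 q w)"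
  unfolding braid1_def
  by (rule btensor_tsum_klinear) (simp_all add: braid_bilinear braid_balanced_left)

lemma braid1_ptens:
  "v \<in> carrier V \<Longrightarrow> \<theta> \<in> carrier Om \<Longrightarrow> w \<in> carrier W \<Longrightarrow> braid1 (v \<boxtimes>\<^bsub>V \<otimes>\<^sub>A Om\<^esub> \<theta>) w = braid v \<theta> w"
  unfolding braid1_def
  by (rule btensor_tsum_ptens) (simp_all add: braid_bilinear braid_balanced_left)

lemma braid1_bilinear: "kbilinear K (V \<otimes>\<^sub>A Om) W VWO braid1"
  unfolding braid1_def[abs_def]
  by (intro kbilinearI braid1_klinear[unfolded braid1_def] VOm.klinear_tsumf braid_klin klinear_ident) simp_all

lemma braid1_balanced:
  assumes [simp]: "a \<in> carrier A" "w \<in> carrier W" and q: "q \<in> carrier (V \<otimes>\<^sub>A Om)"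
  shows "braid1 (ract (V \<otimes>\<^sub>A Om) q a) w = braid1 q (lact W a w)"
  by (rule btensor_eqI[OF V Om klinear_comp[OF braid1_klinear btensor_act_klin(3)[OF V Om]] braid1_klinear q])
    (simp_all add: btensor_act braid1_ptens braid_balanced_right)

abbreviation (input) "tau \<equiv> tau23_inv H R A V W Om"

lemma tau_eq: "tau X = tsum VWO X braid1"
  by (simp add: tau23_inv_def Let_def tsum_def braid1_def[abs_def] braid_def case_prod_unfold)

lemma tau_klinear: "klinear K VOW VWO tau"
  unfolding tau_eq[abs_def]
  by (rule btensor_tsum_klinear) (simp_all add: braid1_bilinear braid1_balanced)

lemma tau_ptens1: "q \<in> carrier (V \<otimes>\<^sub>A Om) \<Longrightarrow> w \<in> carrier W \<Longrightarrow> tau (q \<boxtimes>\<^bsub>VOW\<^esub> w) = braid1 q w"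
  unfolding tau_eq
  by (rule btensor_tsum_ptens) (simp_all add: braid1_bilinear braid1_balanced)

lemma tau_ptens:
  "v \<in> carrier V \<Longrightarrow> \<theta> \<in> carrier Om \<Longrightarrow> w \<in> carrier W \<Longrightarrow>
    tau ((v \<boxtimes>\<^bsub>V \<otimes>\<^sub>A Om\<^esub> \<theta>) \<boxtimes>\<^bsub>VOW\<^esub> w) = braid v \<theta> w"
  by (simp add: tau_ptens1 braid1_ptens)

lemma tau_closed: "X \<in> carrier VOW \<Longrightarrow> tau X \<in> carrier VWO"
  by (rule klinear_closed[OF tau_klinear])

lemma tau_klin: "klinear K M VOW f \<Longrightarrow> klinear K M VWO (\<lambda>x. tau (f x))"
  by (rule klinear_comp[OF tau_klinear])

lemma tau_tsum_out:
  assumes "X \<in> carrier (HH K H)" "\<And>x y. x \<in> carrier H \<Longrightarrow> y \<in> carrier H \<Longrightarrow> f x y \<in> carrier VOW"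
  shows "tau (tsum VOW X f) = tsum VWO X (\<lambda>x y. tau (f x y))"
  by (rule klinear_tsum_out[OF tau_klinear _ _ assms]) simp_all

lemma tau_eqI:
  assumes f: "klinear K VOW Z f" and g: "klinear K VOW Z g" and X: "X \<in> carrier VOW"
    and eq: "\<And>v \<theta> w. v \<in> carrier V \<Longrightarrow> \<theta> \<in> carrier Om \<Longrightarrow> w \<in> carrier W \<Longrightarrow>
      f ((v \<boxtimes>\<^bsub>V \<otimes>\<^sub>A Om\<^esub> \<theta>) \<boxtimes>\<^bsub>VOW\<^esub> w) = g ((v \<boxtimes>\<^bsub>V \<otimes>\<^sub>A Om\<^esub> \<theta>) \<boxtimes>\<^bsub>VOW\<^esub> w)"
  shows "f X = g X"
proof (rule btensor_eqI[OF bim_btensor[OF V Om] W f g X])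
  fix q w assume q: "q \<in> carrier (V \<otimes>\<^sub>A Om)" and w: "w \<in> carrier W"
  show "f (q \<boxtimes>\<^bsub>VOW\<^esub> w) = g (q \<boxtimes>\<^bsub>VOW\<^esub> w)"
    by (rule btensor_eqI[OF V Om klinear_comp[OF f] klinear_comp[OF g] q])
      (use w eq in \<open>simp_all add: klin klinear_ident\<close>)
qed

text \<open>R \<Delta> = \<Delta>^op R, applied to the two factors that change places, after
  coassociativity has isolated their components.\<close>

lemma tau_hact:
  assumes [simp]: "\<xi> \<in> carrier H" and X: "X \<in> carrier VOW"
  shows "tau (hact VOW \<xi> X) = hact VWO \<xi> (tau X)"
proof (rule tau_eqI[OF _ _ X, where Z = VWO])
  fix v \<theta> w assume [simp]: "v \<in> carrier V" "\<theta> \<in> carrier Om" "w \<in> carrier W"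
  let ?h = "\<lambda>p q r. (hact V p v \<boxtimes>\<^bsub>VW\<^esub> hact W q w) \<boxtimes>\<^bsub>VWO\<^esub> hact Om r \<theta>"
  let ?f = "\<lambda>p q r. tsum VWO R (\<lambda>x y. ?h p (y \<bullet> r) (x \<bullet> q))"
  let ?f' = "\<lambda>p q r. tsum VWO R (\<lambda>x y. ?h p (q \<bullet> y) (r \<bullet> x))"
  have "tau (hact VOW \<xi> ((v \<boxtimes>\<^bsub>V \<otimes>\<^sub>A Om\<^esub> \<theta>) \<boxtimes>\<^bsub>VOW\<^esub> w))
    = tsum VWO (\<Delta> \<xi>) (\<lambda>x y. tsum VWO (\<Delta> x) (\<lambda>x\<^sub>1 x\<^sub>2. ?f x\<^sub>1 x\<^sub>2 y))"
    by (simp add: btensor_act tsum_out tau_tsum_out tau_ptens braid_def bim_hact_mult cong: HH.tsum_cong)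
  also have "\<dots> = tsum VWO (\<Delta> \<xi>) (\<lambda>x y. tsum VWO (\<Delta> y) (\<lambda>y\<^sub>1 y\<^sub>2. ?f x y\<^sub>1 y\<^sub>2))"
    by (rule coassoc[where f = ?f]) (simp, intro klin, simp_all)
  also have "\<dots> = tsum VWO (\<Delta> \<xi>) (\<lambda>x y. tsum VWO (\<Delta> y) (\<lambda>y\<^sub>1 y\<^sub>2. ?f' x y\<^sub>1 y\<^sub>2))"
  proof (rule HH.tsum_cong)
    fix x y assume [simp]: "x \<in> carrier H" "y \<in> carrier H"
    have k: "kbilinear K H H VWO (\<lambda>p q. ?h x q p)" by (intro klin) simp_all
    have "tsum VWO (\<Delta> y) (\<lambda>y\<^sub>1 y\<^sub>2. ?f x y\<^sub>1 y\<^sub>2)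
      = tsum VWO R (\<lambda>a b. tsum VWO (\<Delta> y) (\<lambda>y\<^sub>1 y\<^sub>2. ?h x (b \<bullet> y\<^sub>2) (a \<bullet> y\<^sub>1)))"
      by (rule HH_swap) simp_all
    also have "\<dots> = tsum VWO (\<Delta> y) (\<lambda>y\<^sub>1 y\<^sub>2. ?f' x y\<^sub>1 y\<^sub>2)"
      by (rule tsum_R_comult(1)[OF _ k]) simp_all
    finally show "tsum VWO (\<Delta> y) (\<lambda>y\<^sub>1 y\<^sub>2. ?f x y\<^sub>1 y\<^sub>2) = tsum VWO (\<Delta> y) (\<lambda>y\<^sub>1 y\<^sub>2. ?f' x y\<^sub>1 y\<^sub>2)" .
  qed simp
  also have "\<dots> = tsum VWO (\<Delta> \<xi>) (\<lambda>x y. tsum VWO (\<Delta> x) (\<lambda>x\<^sub>1 x\<^sub>2. ?f' x\<^sub>1 x\<^sub>2 y))"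
    by (rule coassoc[where f = ?f', symmetric]) (simp, intro klin, simp_all)
  also have "\<dots> = tsum VWO (\<Delta> \<xi>) (\<lambda>s t. tsum VWO R (\<lambda>x y. tsum VWO (\<Delta> s) (\<lambda>s\<^sub>1 s\<^sub>2.
      ?h s\<^sub>1 (s\<^sub>2 \<bullet> y) (t \<bullet> x))))"
    by (rule HH.tsum_cong, simp, rule HH_swap) simp_all
  also have "\<dots> = tsum VWO R (\<lambda>x y. tsum VWO (\<Delta> \<xi>) (\<lambda>s t. tsum VWO (\<Delta> s) (\<lambda>s\<^sub>1 s\<^sub>2.
      ?h s\<^sub>1 (s\<^sub>2 \<bullet> y) (t \<bullet> x))))"
    by (rule HH_swap) simp_all
  also have "\<dots> = hact VWO \<xi> (tau ((v \<boxtimes>\<^bsub>V \<otimes>\<^sub>A Om\<^esub> \<theta>) \<boxtimes>\<^bsub>VOW\<^esub> w))"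
    by (simp add: btensor_act tsum_out tau_ptens braid_def bim_hact_mult cong: HH.tsum_cong)
  finally show "tau (hact VOW \<xi> ((v \<boxtimes>\<^bsub>V \<otimes>\<^sub>A Om\<^esub> \<theta>) \<boxtimes>\<^bsub>VOW\<^esub> w))
    = hact VWO \<xi> (tau ((v \<boxtimes>\<^bsub>V \<otimes>\<^sub>A Om\<^esub> \<theta>) \<boxtimes>\<^bsub>VOW\<^esub> w))" .
qed (simp_all add: tau_klin klin klinear_ident)

end

end

section \<open>The adjoint action: evaluation, multiplicativity, computation on tensors\<close>

section \<open>The adjoint action on linear maps\<close>

context hopf_alg
begin

lemma adj_act_eq: "adj_act H M N \<xi> P u = tsum N (\<Delta> \<xi>) (\<lambda>x y. hact N x (P (hact M (S y) u)))"
  by (simp add: adj_act_def tsum_def)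

text \<open>\<open>c s t\<close> stands for the value of a map at a tensor whose two parts are acted
  on by \<open>s\<close> and \<open>t\<close>. If \<xi> passes through it as in \<open>eq\<close>,
  leaving its first component in \<Psi>, then in the adjoint action the components that reach the
  two parts meet the antipode and collapse to 1.\<close>

lemma adj_transport:
  assumes N: "left_H_module K H N" and \<Psi>: "ktrilinear K H H H N \<Psi>" and c: "kbilinear K H H N c"
    and eq: "\<And>\<xi> s t. \<xi> \<in> carrier H \<Longrightarrow> s \<in> carrier H \<Longrightarrow> t \<in> carrier H \<Longrightarrow> hact N \<xi> (c s t)
      = tsum N (\<Delta> \<xi>) (\<lambda>p q. tsum N (\<Delta> q) (\<lambda>a b. \<Psi> p (a \<bullet> s) (b \<bullet> t)))"
    and \<xi> [simp]: "\<xi> \<in> carrier H"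
  shows "tsum N (\<Delta> \<xi>) (\<lambda>x y. hact N x (tsum N (\<Delta> (S y)) c)) = \<Psi> \<xi> \<one>\<^bsub>H\<^esub> \<one>\<^bsub>H\<^esub>"
proof -
  note [simp] = hact_module[OF N] hact_closed[OF N] ktrilinear_closed[OF \<Psi>] kbilinear_closed[OF c]
    HH.tsum_closed[OF module_abelian]
  let ?\<Theta> = "\<lambda>p q. tsum N (\<Delta> q) (\<lambda>a b. \<Psi> p a b)"
  have "tsum N (\<Delta> \<xi>) (\<lambda>x y. hact N x (tsum N (\<Delta> (S y)) c))
    = tsum N (\<Delta> \<xi>) (\<lambda>x y. tsum N (\<Delta> (S y)) (\<lambda>s t. tsum N (\<Delta> x) (\<lambda>p q. tsum N (\<Delta> q)
        (\<lambda>a b. \<Psi> p (a \<bullet> s) (b \<bullet> t)))))"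
    by (rule HH.tsum_cong, simp)
      (simp add: klinear_tsum_out[OF hact_klin(2)[OF N klinear_ident]] eq cong: HH.tsum_cong)
  also have "\<dots> = tsum N (\<Delta> \<xi>) (\<lambda>x y. tsum N (\<Delta> x) (\<lambda>p q. tsum N (\<Delta> (S y)) (\<lambda>s t. tsum N (\<Delta> q)
        (\<lambda>a b. \<Psi> p (a \<bullet> s) (b \<bullet> t)))))"
    by (rule HH.tsum_cong, simp, rule HH_swap) simp_all
  also have "\<dots> = tsum N (\<Delta> \<xi>) (\<lambda>x y. tsum N (\<Delta> x) (\<lambda>p q. tsum N (\<Delta> q) (\<lambda>a b. tsum N (\<Delta> (S y))
        (\<lambda>s t. \<Psi> p (a \<bullet> s) (b \<bullet> t)))))"
    by (rule HH.tsum_cong, simp, rule HH.tsum_cong, simp, rule HH_swap) simp_all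
  \<comment> \<open>Multiplicativity of \<Delta> joins the two coproducts into that of
    \<open>q \<bullet> S y\<close>, the shape that \<open>convolution_right\<close> removes.\<close>
  also have "\<dots> = tsum N (\<Delta> \<xi>) (\<lambda>x y. tsum N (\<Delta> x) (\<lambda>p q. ?\<Theta> p (q \<bullet> S y)))"
  proof (rule HH.tsum_cong, simp, rule HH.tsum_cong, simp)
    fix x y p q assume [simp]: "x \<in> carrier H" "y \<in> carrier H" "p \<in> carrier H" "q \<in> carrier H"
    have "kbilinear K H H N (\<Psi> p)" by (intro klin ktrilinear_klin[OF \<Psi>]) simp_all
    from comult_mult[OF _ this, of q "S y"]
    show "tsum N (\<Delta> q) (\<lambda>a b. tsum N (\<Delta> (S y)) (\<lambda>s t. \<Psi> p (a \<bullet> s) (b \<bullet> t))) = ?\<Theta> p (q \<bullet> S y)"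
      by simp
  qed
  also have "\<dots> = ?\<Theta> \<xi> \<one>\<^bsub>H\<^esub>"
    by (rule convolution_right[where \<Theta> = ?\<Theta>]) (simp, intro klin ktrilinear_klin[OF \<Psi>], simp_all)
  also have "\<dots> = \<Psi> \<xi> \<one>\<^bsub>H\<^esub> \<one>\<^bsub>H\<^esub>"
    by (rule comult_one) (simp, intro klin ktrilinear_klin[OF \<Psi>], simp_all)
  finally show ?thesis .
qed

context
  fixes M :: "('k, 'm, 'h, 'x) hmod_scheme" and N :: "('k, 'n, 'h, 'y) hmod_scheme" and P
  assumes M: "left_H_module K H M" and N: "left_H_module K H N" and P: "klinear K M N P"
begin

lemma adj_simps:
  "module K M" "module K N"
  "\<xi> \<in> carrier H \<Longrightarrow> u \<in> carrier M \<Longrightarrow> hact M \<xi> u \<in> carrier M"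
  "\<xi> \<in> carrier H \<Longrightarrow> n \<in> carrier N \<Longrightarrow> hact N \<xi> n \<in> carrier N"
  "u \<in> carrier M \<Longrightarrow> P u \<in> carrier N"
  by (simp_all add: hact_module[OF M] hact_module[OF N] hact_closed[OF M] hact_closed[OF N] klinear_closed[OF P])

lemma adj_klin_aux:
  "klinear K L H f \<Longrightarrow> u \<in> carrier M \<Longrightarrow> klinear K L M (\<lambda>x. hact M (f x) u)"
  "klinear K L M g \<Longrightarrow> \<xi> \<in> carrier H \<Longrightarrow> klinear K L M (\<lambda>x. hact M \<xi> (g x))"
  "klinear K L H f \<Longrightarrow> n \<in> carrier N \<Longrightarrow> klinear K L N (\<lambda>x. hact N (f x) n)"
  "klinear K L N h \<Longrightarrow> \<xi> \<in> carrier H \<Longrightarrow> klinear K L N (\<lambda>x. hact N \<xi> (h x))"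
  "klinear K L M g \<Longrightarrow> klinear K L N (\<lambda>x. P (g x))"
  by (rule hact_klin[OF M] hact_klin[OF N] klinear_comp[OF P]; assumption)+

lemma adj_closed: "\<xi> \<in> carrier H \<Longrightarrow> u \<in> carrier M \<Longrightarrow> adj_act H M N \<xi> P u \<in> carrier N"
  unfolding adj_act_eq by (intro HH_tsum_closed) (simp_all add: adj_simps)

lemma adj_klin:
  "klinear K L H f \<Longrightarrow> u \<in> carrier M \<Longrightarrow> klinear K L N (\<lambda>x. adj_act H M N (f x) P u)"
  "klinear K L M g \<Longrightarrow> \<xi> \<in> carrier H \<Longrightarrow> klinear K L N (\<lambda>x. adj_act H M N \<xi> P (g x))"
  unfolding adj_act_eq by (intro klin adj_klin_aux; simp add: adj_simps)+

text \<open>The antipode inside the adjoint action cancels against the component acting on the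
  argument, so \<xi> acts on a value by distributing over map and argument.\<close>

lemma adj_ev:
  assumes [simp]: "\<xi> \<in> carrier H" "u \<in> carrier M"
  shows "tsum N (\<Delta> \<xi>) (\<lambda>x y. adj_act H M N x P (hact M y u)) = hact N \<xi> (P u)"
proof -
  note [simp] = adj_simps
  let ?\<Theta> = "\<lambda>p q. hact N p (P (hact M q u))"
  have "tsum N (\<Delta> \<xi>) (\<lambda>x y. adj_act H M N x P (hact M y u))
    = tsum N (\<Delta> \<xi>) (\<lambda>p q. tsum N (\<Delta> p) (\<lambda>p\<^sub>1 p\<^sub>2. ?\<Theta> p\<^sub>1 (S p\<^sub>2 \<bullet> q)))"
    by (simp add: adj_act_eq hact_mult[OF M] cong: HH.tsum_cong)
  also have "\<dots> = ?\<Theta> \<xi> \<one>\<^bsub>H\<^esub>"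
    by (rule convolution_left[where \<Theta> = ?\<Theta>]) (simp, intro klin adj_klin_aux, simp_all)
  finally show ?thesis by (simp add: hact_one[OF M])
qed

text \<open>\<Delta> is multiplicative and \<open>S\<close> reverses products, which matches the
  order in which the inner actions are composed.\<close>

lemma adj_adj:
  assumes [simp]: "\<xi> \<in> carrier H" "\<eta> \<in> carrier H" "u \<in> carrier M"
  shows "adj_act H M N (\<xi> \<bullet> \<eta>) P u = adj_act H M N \<xi> (adj_act H M N \<eta> P) u"
proof -
  note [simp] = adj_simps
  let ?f = "\<lambda>x y. hact N x (P (hact M (S y) u))"
  have "adj_act H M N (\<xi> \<bullet> \<eta>) P u
    = tsum N (\<Delta> \<xi>) (\<lambda>x y. tsum N (\<Delta> \<eta>) (\<lambda>x' y'. ?f (x \<bullet> x') (y \<bullet> y')))"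
    unfolding adj_act_eq
    by (rule comult_mult[where f = ?f]) (simp, intro klin adj_klin_aux, simp_all)
  also have "\<dots> = adj_act H M N \<xi> (adj_act H M N \<eta> P) u"
    unfolding adj_act_eq
    by (simp add: klinear_tsum_out[OF hact_klin(2)[OF N klinear_ident]] antipode_mult hact_mult[OF M] hact_mult[OF N]
        cong: HH.tsum_cong)
  finally show ?thesis .
qed

end

lemma klinear_adj: "left_H_module K H M \<Longrightarrow> left_H_module K H N \<Longrightarrow> klinear K M N P \<Longrightarrow> \<xi> \<in> carrier H \<Longrightarrow>
    klinear K M N (adj_act H M N \<xi> P)"
  by (rule adj_klin(2)[OF _ _ _ klinear_ident])

lemma adj_hact:
  assumes M: "left_H_module K H M" and N: "left_H_module K H N" and P: "klinear K M N P"
    and [simp]: "\<xi> \<in> carrier H" "\<eta> \<in> carrier H" "u \<in> carrier M"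
  shows "hact N \<xi> (adj_act H M N \<eta> P u) = tsum N (\<Delta> \<xi>) (\<lambda>x y. adj_act H M N (x \<bullet> \<eta>) P (hact M y u))"
  using adj_ev[OF M N klinear_adj[OF M N P], of \<eta> \<xi> u]
  by (simp add: adj_adj[OF M N P] hact_closed[OF M] cong: HH.tsum_cong)

end

section \<open>The sum of two connections and the adjoint action on it\<close>

section \<open>The sum of connections\<close>

context quasitriangular_module_algebra
begin

text \<open>Quasi-commutativity passes from the factors to the tensor product because (id \<otimes>
  \<Delta>) R = R_13 R_12 provides one copy of R for each factor.\<close>

lemma btensor_lact_R:
  assumes V [simp]: "bim V" and W [simp]: "bim W" and qV: "qcomm V" and qW: "qcomm W"
    and a [simp]: "a \<in> carrier A" and q: "q \<in> carrier (V \<otimes>\<^sub>A W)"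
  shows "lact (V \<otimes>\<^sub>A W) a q = tsum (V \<otimes>\<^sub>A W) R (\<lambda>x y. ract (V \<otimes>\<^sub>A W) (hact (V \<otimes>\<^sub>A W) y q) (hact A x a))"
proof (rule btensor_eqI[OF V W _ _ q, where Z = "V \<otimes>\<^sub>A W"])
  fix v w assume [simp]: "v \<in> carrier V" "w \<in> carrier W"
  let ?T = "V \<otimes>\<^sub>A W"
  let ?f = "\<lambda>p q r. hact V q v \<boxtimes>\<^bsub>?T\<^esub> ract W (hact W r w) (hact A p a)"
  have "tsum ?T R (\<lambda>x y. ract ?T (hact ?T y (v \<boxtimes>\<^bsub>?T\<^esub> w)) (hact A x a))
    = tsum ?T R (\<lambda>x y. tsum ?T (\<Delta> y) (\<lambda>y\<^sub>1 y\<^sub>2. ?f x y\<^sub>1 y\<^sub>2))"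
    by (simp add: btensor_act tsum_out cong: HH.tsum_cong)
  also have "\<dots> = tsum ?T R (\<lambda>x y. tsum ?T R (\<lambda>b c. ?f (x \<bullet> b) c y))"
    by (rule tsum_R_coproduct(2)[where f = ?f]) (simp, intro klin, simp_all)
  also have "\<dots> = tsum ?T R (\<lambda>b c. tsum ?T R (\<lambda>x y. ?f (x \<bullet> b) c y))"
    by (rule HH_swap) simp_all
  also have "\<dots> = lact ?T a (v \<boxtimes>\<^bsub>?T\<^esub> w)"
    by (simp add: btensor_act qcomm_lact[OF V qV] qcomm_lact[OF W qW] tsum_out bptens_balanced A_hact_mult
        cong: HH.tsum_cong)
  finally show "lact ?T a (v \<boxtimes>\<^bsub>?T\<^esub> w) = tsum ?T R (\<lambda>x y. ract ?T (hact ?T y (v \<boxtimes>\<^bsub>?T\<^esub> w)) (hact A x a))"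
    by simp
qed (intro klin klinear_ident; simp)+

text \<open>Only the bimodule of one-forms and the differential on A enter, so the sum of
  connections can be studied apart from the graded calculus.\<close>

definition connection :: "('k, 'v, 'h, 'a) hbimod \<Rightarrow> ('k, 'o, 'h, 'a) hbimod \<Rightarrow> ('a \<Rightarrow> 'o)
    \<Rightarrow> ('v \<Rightarrow> ('v, 'o) tens) \<Rightarrow> bool" where
  "connection V Om d P \<longleftrightarrow> klinear K V (V \<otimes>\<^sub>A Om) P \<and>
     (\<forall>v\<in>carrier V. \<forall>a\<in>carrier A.
        P (ract V v a) = ract (V \<otimes>\<^sub>A Om) (P v) a \<oplus>\<^bsub>V \<otimes>\<^sub>A Om\<^esub> (v \<boxtimes>\<^bsub>V \<otimes>\<^sub>A Om\<^esub> d a))"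

lemma connectionD:
  assumes "connection V Om d P"
  shows "klinear K V (V \<otimes>\<^sub>A Om) P"
    "v \<in> carrier V \<Longrightarrow> P v \<in> carrier (V \<otimes>\<^sub>A Om)"
    "v \<in> carrier V \<Longrightarrow> a \<in> carrier A \<Longrightarrow>
      P (ract V v a) = ract (V \<otimes>\<^sub>A Om) (P v) a \<oplus>\<^bsub>V \<otimes>\<^sub>A Om\<^esub> (v \<boxtimes>\<^bsub>V \<otimes>\<^sub>A Om\<^esub> d a)"
    "klinear K M V f \<Longrightarrow> klinear K M (V \<otimes>\<^sub>A Om) (\<lambda>x. P (f x))"
  using assms by (auto simp: connection_def intro: klinear_closed klinear_comp[of K V _ P])

lemma module_a_closed:
  assumes "module K Z"
  shows "x \<in> carrier Z \<Longrightarrow> y \<in> carrier Z \<Longrightarrow> x \<oplus>\<^bsub>Z\<^esub> y \<in> carrier Z"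
proof -
  interpret module K Z by fact
  show "x \<in> carrier Z \<Longrightarrow> y \<in> carrier Z \<Longrightarrow> x \<oplus>\<^bsub>Z\<^esub> y \<in> carrier Z" by simp
qed

lemma tsum_add_HH:
  assumes "module K Z" "X \<in> carrier (HH K H)"
    "\<And>x y. x \<in> carrier H \<Longrightarrow> y \<in> carrier H \<Longrightarrow> f x y \<in> carrier Z"
    "\<And>x y. x \<in> carrier H \<Longrightarrow> y \<in> carrier H \<Longrightarrow> g x y \<in> carrier Z"
  shows "tsum Z X (\<lambda>x y. f x y \<oplus>\<^bsub>Z\<^esub> g x y) = tsum Z X f \<oplus>\<^bsub>Z\<^esub> tsum Z X g"
  by (rule HH.tsum_addf[OF module_abelian[OF assms(1)] assms(2-4)])

context
  fixes W :: "('k, 'w, 'h, 'a) hbimod" and Om :: "('k, 'o, 'h, 'a) hbimod" and d Q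
  assumes W [simp]: "bim W" and Om [simp]: "bim Om"
    and d: "klinear K A Om d" and d_hact: "\<And>\<xi> a. \<xi> \<in> carrier H \<Longrightarrow> a \<in> carrier A \<Longrightarrow> hact Om \<xi> (d a) = d (hact A \<xi> a)"
    and Q: "connection W Om d Q"
begin

abbreviation (input) "WOm \<equiv> W \<otimes>\<^sub>A Om"
abbreviation (input) "adjQ \<equiv> \<lambda>\<xi> w. adj_act H W (W \<otimes>\<^sub>A Om) \<xi> Q w"

lemma d_klin: "klinear K M A f \<Longrightarrow> klinear K M Om (\<lambda>x. d (f x))"
  by (rule klinear_comp[OF d])

lemma d_closed: "a \<in> carrier A \<Longrightarrow> d a \<in> carrier Om"
  by (rule klinear_closed[OF d])

lemma adjQ_closed: "\<xi> \<in> carrier H \<Longrightarrow> w \<in> carrier W \<Longrightarrow> adjQ \<xi> w \<in> carrier WOm"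
  by (rule adj_closed[OF bim_H_module[OF W] bim_H_module[OF bim_btensor[OF W Om]] connectionD(1)[OF Q]])

lemmas adjQ_klin = adj_klin[OF bim_H_module[OF W] bim_H_module[OF bim_btensor[OF W Om]] connectionD(1)[OF Q]]

lemmas adjQ_hact = adj_hact[OF bim_H_module[OF W] bim_H_module[OF bim_btensor[OF W Om]] connectionD(1)[OF Q]]

lemmas adjQ_ev = adj_ev[OF bim_H_module[OF W] bim_H_module[OF bim_btensor[OF W Om]] connectionD(1)[OF Q]]

text \<open>The term with \<open>d a\<close> is equivariant in its arguments, so the adjoint action
  merely scales it by the counit; the other term keeps its form.\<close>

lemma adjQ_ract:
  assumes [simp]: "\<xi> \<in> carrier H" "w \<in> carrier W" "a \<in> carrier A"
  shows "adjQ \<xi> (ract W w a) = ract WOm (adjQ \<xi> w) a \<oplus>\<^bsub>WOm\<^esub> \<epsilon> \<xi> \<odot>\<^bsub>WOm\<^esub> (w \<boxtimes>\<^bsub>WOm\<^esub> d a)"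
proof -
  note [simp] = d_closed adjQ_closed connectionD(2)[OF Q] module_a_closed
  note lin = klin klinear_ident d_klin adjQ_klin connectionD(4)[OF Q] klinear_addf klinear_smultf
  interpret WOm: module K WOm by simp
  let ?c = "\<lambda>s t. Q (ract W (hact W s w) (hact A t a))"
  let ?\<Psi>1 = "\<lambda>h p q. ract WOm (adjQ h (hact W p w)) (hact A q a)"
  let ?\<Psi>2 = "\<lambda>h p q. \<epsilon> h \<odot>\<^bsub>WOm\<^esub> (hact W p w \<boxtimes>\<^bsub>WOm\<^esub> d (hact A q a))"
  have "hact WOm \<xi> (?c s t) = tsum WOm (\<Delta> \<xi>) (\<lambda>p q. tsum WOm (\<Delta> q) (\<lambda>a b.
      ?\<Psi>1 p (a \<bullet> s) (b \<bullet> t) \<oplus>\<^bsub>WOm\<^esub> ?\<Psi>2 p (a \<bullet> s) (b \<bullet> t)))"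
    if [simp]: "\<xi> \<in> carrier H" "s \<in> carrier H" "t \<in> carrier H" for \<xi> s t
  proof -
    let ?f = "\<lambda>p q r. ract WOm (adjQ p (hact W (q \<bullet> s) w)) (hact A (r \<bullet> t) a)"
    let ?g = "\<lambda>q. tsum WOm (\<Delta> q) (\<lambda>x y. hact W (x \<bullet> s) w \<boxtimes>\<^bsub>WOm\<^esub> d (hact A (y \<bullet> t) a))"
    have "hact WOm \<xi> (ract WOm (Q (hact W s w)) (hact A t a))
      = tsum WOm (\<Delta> \<xi>) (\<lambda>x y. tsum WOm (\<Delta> x) (\<lambda>p q. ?f p q y))"
      by (simp add: bim_hact_ract bim_hact_mult A_hact_mult tsum_out adjQ_ev[symmetric] cong: HH.tsum_cong)
    also have "\<dots> = tsum WOm (\<Delta> \<xi>) (\<lambda>x y. tsum WOm (\<Delta> y) (\<lambda>p q. ?f x p q))"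
      by (rule coassoc[where f = ?f]) (simp, intro lin, simp_all)
    finally have 1: "hact WOm \<xi> (ract WOm (Q (hact W s w)) (hact A t a))
      = tsum WOm (\<Delta> \<xi>) (\<lambda>p q. tsum WOm (\<Delta> q) (\<lambda>a' b. ?\<Psi>1 p (a' \<bullet> s) (b \<bullet> t)))" .
    have "hact WOm \<xi> (hact W s w \<boxtimes>\<^bsub>WOm\<^esub> d (hact A t a)) = ?g \<xi>"
      by (simp add: btensor_act d_hact bim_hact_mult A_hact_mult cong: HH.tsum_cong)
    \<comment> \<open>A counit is inserted to bring the equivariant term into the three-component
      form expected by \<open>adj_transport\<close>.\<close>
    also have "\<dots> = tsum WOm (\<Delta> \<xi>) (\<lambda>p q. \<epsilon> p \<odot>\<^bsub>WOm\<^esub> ?g q)"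
      by (rule counit_left[where g = ?g, symmetric]) (simp, intro lin, simp_all)
    finally have 2: "hact WOm \<xi> (hact W s w \<boxtimes>\<^bsub>WOm\<^esub> d (hact A t a))
      = tsum WOm (\<Delta> \<xi>) (\<lambda>p q. tsum WOm (\<Delta> q) (\<lambda>a' b. ?\<Psi>2 p (a' \<bullet> s) (b \<bullet> t)))"
      by (simp add: tsum_smult cong: HH.tsum_cong)
    have "hact WOm \<xi> (?c s t) = hact WOm \<xi> (ract WOm (Q (hact W s w)) (hact A t a))
      \<oplus>\<^bsub>WOm\<^esub> hact WOm \<xi> (hact W s w \<boxtimes>\<^bsub>WOm\<^esub> d (hact A t a))"
      using klinear_add[OF bim_klin(2)[OF bim_btensor[OF W Om] klinear_ident that(1)]]
      by (simp add: connectionD(3)[OF Q])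
    then show ?thesis
      unfolding 1 2 by (simp add: tsum_add_HH cong: HH.tsum_cong)
  qed
  note eq = this
  have "adjQ \<xi> (ract W w a) = tsum WOm (\<Delta> \<xi>) (\<lambda>x y. hact WOm x (tsum WOm (\<Delta> (S y)) ?c))"
    unfolding adj_act_eq
    by (simp add: bim_hact_ract klinear_tsum_out[OF connectionD(1)[OF Q]] cong: HH.tsum_cong)
  also have "\<dots> = ?\<Psi>1 \<xi> \<one>\<^bsub>H\<^esub> \<one>\<^bsub>H\<^esub> \<oplus>\<^bsub>WOm\<^esub> ?\<Psi>2 \<xi> \<one>\<^bsub>H\<^esub> \<one>\<^bsub>H\<^esub>"
  proof (rule adj_transport[where \<Psi> = "\<lambda>h p q. ?\<Psi>1 h p q \<oplus>\<^bsub>WOm\<^esub> ?\<Psi>2 h p q" and c = ?c])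
    show "left_H_module K H WOm" by (rule bim_H_module) simp
    show "ktrilinear K H H H WOm (\<lambda>h p q. ?\<Psi>1 h p q \<oplus>\<^bsub>WOm\<^esub> ?\<Psi>2 h p q)" by (intro lin) simp_all
    show "kbilinear K H H WOm ?c" by (intro lin) simp_all
  qed (use eq in simp_all)
  finally show ?thesis by simp
qed

lemma adjQ_lact:
  assumes qW: "qcomm W" and qOm: "qcomm Om"
    and [simp]: "\<xi> \<in> carrier H" "w \<in> carrier W" "a \<in> carrier A"
  shows "adjQ \<xi> (lact W a w) = tsum WOm R (\<lambda>x y. ract WOm (adjQ \<xi> (hact W y w)) (hact A x a)
    \<oplus>\<^bsub>WOm\<^esub> \<epsilon> \<xi> \<odot>\<^bsub>WOm\<^esub> (hact W y w \<boxtimes>\<^bsub>WOm\<^esub> d (hact A x a)))"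
  by (simp add: qcomm_lact[OF W qW] klinear_tsum_out[OF adjQ_klin(2)[OF klinear_ident]] adjQ_ract cong: HH.tsum_cong)

end

context
  fixes V :: "('k, 'v, 'h, 'a) hbimod" and W :: "('k, 'w, 'h, 'a) hbimod" and Om :: "('k, 'o, 'h, 'a) hbimod"
    and d P Q
  assumes V [simp]: "bim V" and W [simp]: "bim W" and Om [simp]: "bim Om"
    and qW: "qcomm W" and qOm: "qcomm Om" and qOm': "qcomm_left Om"
    and d: "klinear K A Om d" and d_hact: "\<And>\<xi> a. \<xi> \<in> carrier H \<Longrightarrow> a \<in> carrier A \<Longrightarrow> hact Om \<xi> (d a) = d (hact A \<xi> a)"
    and P: "connection V Om d P" and Q: "connection W Om d Q"
begin

abbreviation (input) "VWO' \<equiv> (V \<otimes>\<^sub>A W) \<otimes>\<^sub>A Om"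
abbreviation (input) "VOW' \<equiv> (V \<otimes>\<^sub>A Om) \<otimes>\<^sub>A W"
abbreviation (input) "V_WO \<equiv> V \<otimes>\<^sub>A (W \<otimes>\<^sub>A Om)"
abbreviation (input) "adj_P \<equiv> \<lambda>\<xi> v. adj_act H V (V \<otimes>\<^sub>A Om) \<xi> P v"
abbreviation (input) "adj_Q \<equiv> \<lambda>\<xi> w. adj_act H W (W \<otimes>\<^sub>A Om) \<xi> Q w"
abbreviation (input) "tau' \<equiv> tau23_inv H R A V W Om"
abbreviation (input) "assoc' \<equiv> assoc V W Om"

lemmas P_klin = connectionD(4)[OF P] adjQ_klin[OF V Om d d_hact P]
lemmas Q_klin = connectionD(4)[OF Q] adjQ_klin[OF W Om d d_hact Q]
lemmas tau_klin' = tau_klin[OF V Om W qW qOm']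
lemmas assoc_klin' = assoc_klin[OF V W Om]
lemmas sum_klin = klin klinear_ident P_klin Q_klin tau_klin' assoc_klin' klinear_addf klinear_smultf d_klin[OF W Om d d_hact Q]

lemmas sum_closed = connectionD(2)[OF P] connectionD(2)[OF Q] adjQ_closed[OF V Om d d_hact P] adjQ_closed[OF W Om d d_hact Q]
  tau_closed[OF V Om W qW qOm'] assoc_closed[OF V W Om] d_closed[OF W Om d d_hact Q] module_a_closed

definition con_pair :: "'v \<Rightarrow> 'w \<Rightarrow> (('v, 'w) tens, 'o) tens" where
  "con_pair v w = tau' (P v \<boxtimes>\<^bsub>VOW'\<^esub> w) \<oplus>\<^bsub>VWO'\<^esub>
     assoc' (tsum V_WO Rb (\<lambda>x y. hact V x v \<boxtimes>\<^bsub>V_WO\<^esub> adj_Q y w))"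

abbreviation (input) "csum \<equiv> con_sum K H R A V W Om P Q"

lemma con_sum_eq: "csum X = tsum VWO' X con_pair"
  by (simp add: con_sum_def Let_def tsum_def con_pair_def[abs_def] case_prod_unfold)

text \<open>The coproduct of R^-1 and quasi-commutativity of the tensor product of W and \<Omega>
  bring in a second R^-1 and two copies of R. One pair cancels, and the remaining R is the one that
  exchanges \<open>a\<close> with \<open>w\<close>.\<close>

lemma con_pair_second_balanced:
  assumes [simp]: "v \<in> carrier V" "a \<in> carrier A" "w \<in> carrier W"
  shows "tsum V_WO Rb (\<lambda>x y. tsum V_WO R (\<lambda>b c. hact V x v \<boxtimes>\<^bsub>V_WO\<^esub> ract (W \<otimes>\<^sub>A Om) (adj_Q y (hact W c w)) (hact A b a)))
    = tsum V_WO Rb (\<lambda>x y. hact V x (ract V v a) \<boxtimes>\<^bsub>V_WO\<^esub> adj_Q y w)"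
proof -
  note [simp] = sum_closed
  let ?h = "\<lambda>p q r s. hact V p v \<boxtimes>\<^bsub>V_WO\<^esub> ract (W \<otimes>\<^sub>A Om) (adj_Q q (hact W r w)) (hact A s a)"
  let ?f = "\<lambda>p q r. hact V p v \<boxtimes>\<^bsub>V_WO\<^esub> lact (W \<otimes>\<^sub>A Om) (hact A q a) (adj_Q r w)"
  have "tsum V_WO Rb (\<lambda>x y. hact V x (ract V v a) \<boxtimes>\<^bsub>V_WO\<^esub> adj_Q y w)
    = tsum V_WO Rb (\<lambda>x y. tsum V_WO (\<Delta> x) (\<lambda>x\<^sub>1 x\<^sub>2. ?f x\<^sub>1 x\<^sub>2 y))"
    by (simp add: bim_hact_ract tsum_out bptens_balanced cong: HH.tsum_cong)
  also have "\<dots> = tsum V_WO Rb (\<lambda>x y. tsum V_WO Rb (\<lambda>b c. ?f b x (y \<bullet> c)))"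
    by (rule tsum_R_coproduct(3)[where f = ?f]) (simp, intro sum_klin, simp_all)
  also have "\<dots> = tsum V_WO Rb (\<lambda>x y. tsum V_WO Rb (\<lambda>b c. tsum V_WO R (\<lambda>g h. tsum V_WO R (\<lambda>e k.
      ?h b (k \<bullet> (y \<bullet> c)) h (g \<bullet> (e \<bullet> x))))))"
  proof (rule HH.tsum_cong, simp, rule HH.tsum_cong, simp)
    fix x y b c assume [simp]: "x \<in> carrier H" "y \<in> carrier H" "b \<in> carrier H" "c \<in> carrier H"
    let ?k = "\<lambda>p q r. ?h b (q \<bullet> (y \<bullet> c)) r (p \<bullet> x)"
    have "?f b x (y \<bullet> c) = tsum V_WO R (\<lambda>g h. tsum V_WO (\<Delta> h) (\<lambda>h\<^sub>1 h\<^sub>2. ?k g h\<^sub>1 h\<^sub>2))"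
      by (simp add: btensor_lact_R[OF W Om qW qOm] adjQ_hact[OF W Om d d_hact Q] tsum_out A_hact_mult cong: HH.tsum_cong)
    also have "\<dots> = tsum V_WO R (\<lambda>g h. tsum V_WO R (\<lambda>e k. ?k (g \<bullet> e) k h))"
      by (rule tsum_R_coproduct(2)[where f = ?k]) (simp, intro sum_klin, simp_all)
    finally show "?f b x (y \<bullet> c) = tsum V_WO R (\<lambda>g h. tsum V_WO R (\<lambda>e k.
      ?h b (k \<bullet> (y \<bullet> c)) h (g \<bullet> (e \<bullet> x))))"
      by (simp add: HH.A.m_assoc cong: HH.tsum_cong)
  qed
  also have "\<dots> = tsum V_WO Rb (\<lambda>b c. tsum V_WO Rb (\<lambda>x y. tsum V_WO R (\<lambda>g h. tsum V_WO R (\<lambda>e k.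
      ?h b (k \<bullet> (y \<bullet> c)) h (g \<bullet> (e \<bullet> x))))))"
    by (rule HH_swap) simp_all
  also have "\<dots> = tsum V_WO Rb (\<lambda>b c. tsum V_WO R (\<lambda>g h. tsum V_WO Rb (\<lambda>x y. tsum V_WO R (\<lambda>e k.
      ?h b (k \<bullet> (y \<bullet> c)) h (g \<bullet> (e \<bullet> x))))))"
    by (rule HH.tsum_cong, simp, rule HH_swap) simp_all
  also have "\<dots> = tsum V_WO Rb (\<lambda>b c. tsum V_WO R (\<lambda>g h. tsum V_WO R (\<lambda>e k. tsum V_WO Rb (\<lambda>x y.
      ?h b (k \<bullet> (y \<bullet> c)) h (g \<bullet> (e \<bullet> x))))))"
    by (rule HH.tsum_cong, simp, rule HH.tsum_cong, simp, rule HH_swap) simp_all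
  also have "\<dots> = tsum V_WO Rb (\<lambda>b c. tsum V_WO R (\<lambda>g h. ?h b c h g))"
  proof (rule HH.tsum_cong, simp, rule HH.tsum_cong, simp)
    fix b c g h assume [simp]: "b \<in> carrier H" "c \<in> carrier H" "g \<in> carrier H" "h \<in> carrier H"
    have k: "kbilinear K H H V_WO (\<lambda>p q. ?h b (q \<bullet> c) h (g \<bullet> p))"
      by (intro sum_klin) simp_all
    show "tsum V_WO R (\<lambda>e k. tsum V_WO Rb (\<lambda>x y. ?h b (k \<bullet> (y \<bullet> c)) h (g \<bullet> (e \<bullet> x))))
      = ?h b c h g"
      using tsum_R_inverse(1)[OF _ k] by (simp add: HH.A.m_assoc cong: HH.tsum_cong)
  qed
  finally show ?thesis by simp
qed

text \<open>Neither summand is balanced by itself: the Leibniz term of P arises on the left side,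
  that of Q on the right, and the braiding identifies the two.\<close>

lemma con_pair_balanced:
  assumes [simp]: "v \<in> carrier V" "a \<in> carrier A" "w \<in> carrier W"
  shows "con_pair (ract V v a) w = con_pair v (lact W a w)"
proof -
  note [simp] = sum_closed
  interpret VWO: module K VWO' by simp
  have tau_add: "tau' (X \<oplus>\<^bsub>VOW'\<^esub> Y) = tau' X \<oplus>\<^bsub>VWO'\<^esub> tau' Y"
    if "X \<in> carrier VOW'" "Y \<in> carrier VOW'" for X Y
    by (rule klinear_add[OF tau_klinear[OF V Om W qW qOm'] that])
  have assoc_add: "assoc' (X \<oplus>\<^bsub>V_WO\<^esub> Y) = assoc' X \<oplus>\<^bsub>VWO'\<^esub> assoc' Y"
    if "X \<in> carrier V_WO" "Y \<in> carrier V_WO" for X Y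
    by (rule klinear_add[OF assoc_klinear[OF V W Om] that])
  have ptens_add: "(p \<oplus>\<^bsub>V \<otimes>\<^sub>A Om\<^esub> q) \<boxtimes>\<^bsub>VOW'\<^esub> w = p \<boxtimes>\<^bsub>VOW'\<^esub> w \<oplus>\<^bsub>VOW'\<^esub> q \<boxtimes>\<^bsub>VOW'\<^esub> w"
    if "p \<in> carrier (V \<otimes>\<^sub>A Om)" "q \<in> carrier (V \<otimes>\<^sub>A Om)" for p q
    using that by (intro klinear_add[OF bptens_klin(1)[OF _ _ klinear_ident]]) simp_all
  have ptens_add': "u \<boxtimes>\<^bsub>V_WO\<^esub> (p \<oplus>\<^bsub>W \<otimes>\<^sub>A Om\<^esub> q) = u \<boxtimes>\<^bsub>V_WO\<^esub> p \<oplus>\<^bsub>V_WO\<^esub> u \<boxtimes>\<^bsub>V_WO\<^esub> q"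
    if "p \<in> carrier (W \<otimes>\<^sub>A Om)" "q \<in> carrier (W \<otimes>\<^sub>A Om)" "u \<in> carrier V" for u p q
    using that by (intro klinear_add[OF bptens_klin(2)[OF _ _ klinear_ident]]) simp_all
  have ptens_smult: "u \<boxtimes>\<^bsub>V_WO\<^esub> (k \<odot>\<^bsub>W \<otimes>\<^sub>A Om\<^esub> q) = k \<odot>\<^bsub>V_WO\<^esub> (u \<boxtimes>\<^bsub>V_WO\<^esub> q)"
    if "k \<in> carrier K" "q \<in> carrier (W \<otimes>\<^sub>A Om)" "u \<in> carrier V" for u k q
    using that by (intro klinear_smult[OF bptens_klin(2)[OF _ _ klinear_ident]]) simp_all
  interpret WOm: module K "W \<otimes>\<^sub>A Om" by simp
  interpret V_WOm: module K V_WO by simp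
  let ?A = "tau' (P v \<boxtimes>\<^bsub>VOW'\<^esub> lact W a w)" and ?B = "tau' ((v \<boxtimes>\<^bsub>V \<otimes>\<^sub>A Om\<^esub> d a) \<boxtimes>\<^bsub>VOW'\<^esub> w)"
    and ?C = "tsum V_WO Rb (\<lambda>x y. hact V x (ract V v a) \<boxtimes>\<^bsub>V_WO\<^esub> adj_Q y w)"
    and ?D = "tsum V_WO R (\<lambda>b c. v \<boxtimes>\<^bsub>V_WO\<^esub> (hact W c w \<boxtimes>\<^bsub>W \<otimes>\<^sub>A Om\<^esub> d (hact A b a)))"
  have first: "tau' (P (ract V v a) \<boxtimes>\<^bsub>VOW'\<^esub> w) = ?A \<oplus>\<^bsub>VWO'\<^esub> ?B"
    by (simp add: connectionD(3)[OF P] ptens_add tau_add bptens_balanced)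
  let ?E = "\<lambda>u. tsum V_WO R (\<lambda>b c. u \<boxtimes>\<^bsub>V_WO\<^esub> (hact W c w \<boxtimes>\<^bsub>W \<otimes>\<^sub>A Om\<^esub> d (hact A b a)))"
  have "tsum V_WO Rb (\<lambda>x y. hact V x v \<boxtimes>\<^bsub>V_WO\<^esub> adj_Q y (lact W a w))
    = tsum V_WO Rb (\<lambda>x y. tsum V_WO R (\<lambda>b c. hact V x v \<boxtimes>\<^bsub>V_WO\<^esub> ract (W \<otimes>\<^sub>A Om) (adj_Q y (hact W c w)) (hact A b a))
      \<oplus>\<^bsub>V_WO\<^esub> \<epsilon> y \<odot>\<^bsub>V_WO\<^esub> ?E (hact V x v))"
    by (simp add: adjQ_lact[OF W Om d d_hact Q qW qOm] tsum_out ptens_add' ptens_smult tsum_add_HH tsum_smult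
        cong: HH.tsum_cong)
  also have "\<dots> = ?C \<oplus>\<^bsub>V_WO\<^esub> tsum V_WO Rb (\<lambda>x y. \<epsilon> y \<odot>\<^bsub>V_WO\<^esub> ?E (hact V x v))"
    by (subst tsum_add_HH) (simp_all add: con_pair_second_balanced)
  \<comment> \<open>The counit from the Leibniz rule of the adjoint action removes R^-1, since (id
    \<otimes> \<epsilon>) R^-1 = 1.\<close>
  also have "tsum V_WO Rb (\<lambda>x y. \<epsilon> y \<odot>\<^bsub>V_WO\<^esub> ?E (hact V x v)) = ?E (hact V \<one>\<^bsub>H\<^esub> v)"
    by (rule tsum_Rb_counit[where g = "\<lambda>x. ?E (hact V x v)"]) (simp, intro sum_klin, simp_all)
  finally have second: "tsum V_WO Rb (\<lambda>x y. hact V x v \<boxtimes>\<^bsub>V_WO\<^esub> adj_Q y (lact W a w)) = ?C \<oplus>\<^bsub>V_WO\<^esub> ?D"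
    by simp
  \<comment> \<open>As \<open>d\<close> commutes with the H-action, the remaining sum over R is the
    braiding of \<open>d a\<close> with \<open>w\<close>.\<close>
  have D: "assoc' ?D = ?B"
    by (simp add: tau_ptens[OF V Om W qW qOm'] braid_def[OF V Om W qW qOm'] assoc_tsum_out[OF V W Om] assoc_ptens[OF V W Om] d_hact
        cong: HH.tsum_cong)
  show ?thesis
    by (simp add: con_pair_def first second assoc_add D VWO.M.a_ac)
qed

lemma con_pair_bilinear: "kbilinear K V W VWO' con_pair"
  unfolding con_pair_def[abs_def] by (intro sum_klin) (simp_all add: sum_closed)

lemma con_sum_klinear: "klinear K (V \<otimes>\<^sub>A W) VWO' csum"
  unfolding con_sum_eq[abs_def]
  by (rule btensor_tsum_klinear) (simp_all add: con_pair_bilinear con_pair_balanced)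

lemma con_sum_ptens: "v \<in> carrier V \<Longrightarrow> w \<in> carrier W \<Longrightarrow> csum (v \<boxtimes>\<^bsub>V \<otimes>\<^sub>A W\<^esub> w) = con_pair v w"
  unfolding con_sum_eq
  by (rule btensor_tsum_ptens) (simp_all add: con_pair_bilinear con_pair_balanced)

text \<open>\<open>adj_transport\<close> is applied to the sum of both terms. The braiding is
  H-linear, so in the first term \<xi> lands on P; in the second it is slid past R^-1 and ends to
  the right of \<open>y\<close>.\<close>

lemma con_sum_adj:
  assumes [simp]: "\<xi> \<in> carrier H" "v \<in> carrier V" "w \<in> carrier W"
  shows "adj_act H (V \<otimes>\<^sub>A W) VWO' \<xi> csum (v \<boxtimes>\<^bsub>V \<otimes>\<^sub>A W\<^esub> w) = tau' (adj_P \<xi> v \<boxtimes>\<^bsub>VOW'\<^esub> w) \<oplus>\<^bsub>VWO'\<^esub>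
     assoc' (tsum V_WO Rb (\<lambda>x y. hact V x v \<boxtimes>\<^bsub>V_WO\<^esub> adj_Q (y \<bullet> \<xi>) w))"
proof -
  note [simp] = sum_closed
  let ?c = "\<lambda>s t. con_pair (hact V s v) (hact W t w)"
  let ?c1 = "\<lambda>s t. tau' (P (hact V s v) \<boxtimes>\<^bsub>VOW'\<^esub> hact W t w)"
  let ?c2 = "\<lambda>s t. assoc' (tsum V_WO Rb (\<lambda>x y. hact V (x \<bullet> s) v \<boxtimes>\<^bsub>V_WO\<^esub> adj_Q y (hact W t w)))"
  let ?\<Psi>1 = "\<lambda>h p q. tau' (adj_P h (hact V p v) \<boxtimes>\<^bsub>VOW'\<^esub> hact W q w)"
  let ?\<Psi>2 = "\<lambda>h p q. assoc' (tsum V_WO Rb (\<lambda>x y. hact V (x \<bullet> p) v \<boxtimes>\<^bsub>V_WO\<^esub> adj_Q (y \<bullet> h) (hact W q w)))"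
  have eq: "hact VWO' \<xi> (?c s t) = tsum VWO' (\<Delta> \<xi>) (\<lambda>p q. tsum VWO' (\<Delta> q) (\<lambda>a b.
      ?\<Psi>1 p (a \<bullet> s) (b \<bullet> t) \<oplus>\<^bsub>VWO'\<^esub> ?\<Psi>2 p (a \<bullet> s) (b \<bullet> t)))"
    if [simp]: "\<xi> \<in> carrier H" "s \<in> carrier H" "t \<in> carrier H" for \<xi> s t
  proof -
    let ?f = "\<lambda>p q r. ?\<Psi>1 p (q \<bullet> s) (r \<bullet> t)"
    have "hact VWO' \<xi> (?c1 s t) = tsum VWO' (\<Delta> \<xi>) (\<lambda>x y. tsum VWO' (\<Delta> x) (\<lambda>p q. ?f p q y))"
      by (simp add: tau_hact[OF V Om W qW qOm', symmetric] btensor_act bim_hact_mult tsum_out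
          tau_tsum_out[OF V Om W qW qOm'] adjQ_ev[OF V Om d d_hact P, symmetric] cong: HH.tsum_cong)
    also have "\<dots> = tsum VWO' (\<Delta> \<xi>) (\<lambda>x y. tsum VWO' (\<Delta> y) (\<lambda>p q. ?f x p q))"
      by (rule coassoc[where f = ?f]) (simp, intro sum_klin, simp_all)
    finally have 1: "hact VWO' \<xi> (?c1 s t)
      = tsum VWO' (\<Delta> \<xi>) (\<lambda>p q. tsum VWO' (\<Delta> q) (\<lambda>a b. ?\<Psi>1 p (a \<bullet> s) (b \<bullet> t)))" .
    let ?h = "\<lambda>p q r. hact V (p \<bullet> s) v \<boxtimes>\<^bsub>V_WO\<^esub> adj_Q q (hact W (r \<bullet> t) w)"
    let ?g = "\<lambda>p q r. tsum V_WO Rb (\<lambda>x y. ?h (p \<bullet> x) (q \<bullet> y) r)"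
    let ?g' = "\<lambda>p q r. tsum V_WO Rb (\<lambda>x y. ?h (x \<bullet> q) (y \<bullet> p) r)"
    have "hact V_WO \<xi> (tsum V_WO Rb (\<lambda>x y. hact V (x \<bullet> s) v \<boxtimes>\<^bsub>V_WO\<^esub> adj_Q y (hact W t w)))
      = tsum V_WO Rb (\<lambda>x y. tsum V_WO (\<Delta> \<xi>) (\<lambda>p q. tsum V_WO (\<Delta> q) (\<lambda>q\<^sub>1 q\<^sub>2. ?h (p \<bullet> x) (q\<^sub>1 \<bullet> y) q\<^sub>2)))"
      by (simp add: tsum_out btensor_act adjQ_hact[OF W Om d d_hact Q] bim_hact_mult cong: HH.tsum_cong)
    also have "\<dots> = tsum V_WO (\<Delta> \<xi>) (\<lambda>p q. tsum V_WO Rb (\<lambda>x y. tsum V_WO (\<Delta> q) (\<lambda>q\<^sub>1 q\<^sub>2. ?h (p \<bullet> x) (q\<^sub>1 \<bullet> y) q\<^sub>2)))"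
      by (rule HH_swap) simp_all
    also have "\<dots> = tsum V_WO (\<Delta> \<xi>) (\<lambda>p q. tsum V_WO (\<Delta> q) (\<lambda>q\<^sub>1 q\<^sub>2. ?g p q\<^sub>1 q\<^sub>2))"
      by (rule HH.tsum_cong, simp, rule HH_swap) simp_all
    also have "\<dots> = tsum V_WO (\<Delta> \<xi>) (\<lambda>x y. tsum V_WO (\<Delta> x) (\<lambda>p q. ?g p q y))"
      by (rule coassoc[where f = ?g, symmetric]) (simp, intro sum_klin, simp_all)
    \<comment> \<open>Quasi-cocommutativity replaces \<Delta> R^-1 by R^-1 \<Delta>^op. The first
      component of \<xi> is now the one attached to Q, so it survives when the others
      collapse.\<close>
    also have "\<dots> = tsum V_WO (\<Delta> \<xi>) (\<lambda>x y. tsum V_WO (\<Delta> x) (\<lambda>p q. ?g' p q y))"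
    proof (rule HH.tsum_cong)
      fix x y assume [simp]: "x \<in> carrier H" "y \<in> carrier H"
      have k: "kbilinear K H H V_WO (\<lambda>p q. ?h p q y)" by (intro sum_klin) simp_all
      have "tsum V_WO (\<Delta> x) (\<lambda>p q. ?g p q y)
        = tsum V_WO Rb (\<lambda>b c. tsum V_WO (\<Delta> x) (\<lambda>p q. ?h (b \<bullet> q) (c \<bullet> p) y))"
        by (rule tsum_R_comult(2)[OF _ k, symmetric]) simp_all
      also have "\<dots> = tsum V_WO (\<Delta> x) (\<lambda>p q. ?g' p q y)"
        by (rule HH_swap) simp_all
      finally show "tsum V_WO (\<Delta> x) (\<lambda>p q. ?g p q y) = tsum V_WO (\<Delta> x) (\<lambda>p q. ?g' p q y)" .
    qed simp
    also have "\<dots> = tsum V_WO (\<Delta> \<xi>) (\<lambda>x y. tsum V_WO (\<Delta> y) (\<lambda>p q. ?g' x p q))"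
      by (rule coassoc[where f = ?g']) (simp, intro sum_klin, simp_all)
    finally have hact_second: "hact V_WO \<xi> (tsum V_WO Rb (\<lambda>x y. hact V (x \<bullet> s) v \<boxtimes>\<^bsub>V_WO\<^esub> adj_Q y (hact W t w)))
      = tsum V_WO (\<Delta> \<xi>) (\<lambda>x y. tsum V_WO (\<Delta> y) (\<lambda>p q. ?g' x p q))" .
    have "hact VWO' \<xi> (?c2 s t)
      = assoc' (hact V_WO \<xi> (tsum V_WO Rb (\<lambda>x y. hact V (x \<bullet> s) v \<boxtimes>\<^bsub>V_WO\<^esub> adj_Q y (hact W t w))))"
      by (rule assoc_hact[OF V W Om, symmetric]) simp_all
    also have "\<dots> = tsum VWO' (\<Delta> \<xi>) (\<lambda>p q. tsum VWO' (\<Delta> q) (\<lambda>a b. ?\<Psi>2 p (a \<bullet> s) (b \<bullet> t)))"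
      unfolding hact_second by (simp add: assoc_tsum_out[OF V W Om] HH.A.m_assoc cong: HH.tsum_cong)
    finally have 2: "hact VWO' \<xi> (?c2 s t)
      = tsum VWO' (\<Delta> \<xi>) (\<lambda>p q. tsum VWO' (\<Delta> q) (\<lambda>a b. ?\<Psi>2 p (a \<bullet> s) (b \<bullet> t)))" .
    have "hact VWO' \<xi> (?c s t) = hact VWO' \<xi> (?c1 s t) \<oplus>\<^bsub>VWO'\<^esub> hact VWO' \<xi> (?c2 s t)"
      using klinear_add[OF bim_klin(2)[OF _ klinear_ident that(1)], of VWO']
      by (simp add: con_pair_def bim_hact_mult cong: HH.tsum_cong)
    then show ?thesis
      unfolding 1 2 by (simp add: tsum_add_HH cong: HH.tsum_cong)
  qed
  have "adj_act H (V \<otimes>\<^sub>A W) VWO' \<xi> csum (v \<boxtimes>\<^bsub>V \<otimes>\<^sub>A W\<^esub> w)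
    = tsum VWO' (\<Delta> \<xi>) (\<lambda>x y. hact VWO' x (tsum VWO' (\<Delta> (S y)) ?c))"
    unfolding adj_act_eq
    by (simp add: btensor_act klinear_tsum_out[OF con_sum_klinear] con_sum_ptens cong: HH.tsum_cong)
  also have "\<dots> = ?\<Psi>1 \<xi> \<one>\<^bsub>H\<^esub> \<one>\<^bsub>H\<^esub> \<oplus>\<^bsub>VWO'\<^esub> ?\<Psi>2 \<xi> \<one>\<^bsub>H\<^esub> \<one>\<^bsub>H\<^esub>"
  proof (rule adj_transport[where \<Psi> = "\<lambda>h p q. ?\<Psi>1 h p q \<oplus>\<^bsub>VWO'\<^esub> ?\<Psi>2 h p q" and c = ?c])
    show "left_H_module K H VWO'" by (rule bim_H_module) simp
    show "ktrilinear K H H H VWO' (\<lambda>h p q. ?\<Psi>1 h p q \<oplus>\<^bsub>VWO'\<^esub> ?\<Psi>2 h p q)" by (intro sum_klin) simp_all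
    show "kbilinear K H H VWO' ?c" unfolding con_pair_def by (intro sum_klin) simp_all
  qed (use eq in simp_all)
  finally show ?thesis by (simp cong: HH.tsum_cong)
qed

end

end

section \<open>D_F on linear maps; associativity and braiding under the twist\<close>

section \<open>Compatibility with the twist\<close>

context twisted_hopf
begin

text \<open>The algebra H \<otimes> H involves neither coproduct nor antipode, so products and
  inverses there agree for H and its twist.\<close>

lemma HH_twist: "HH K (twist_hopf K H F) = HH K H"
  by (simp add: talg_def tensor_group_def tensor_rels_def twist_hopf_def Let_def)

lemma DF_eq: "DF K H F M N P u = tsum N Fb (\<lambda>x y. adj_act H M N x P (hact M y u))"
  by (simp add: DF_def tsum_def)

context
  fixes M :: "('k, 'm, 'h, 'x) hmod_scheme" and N :: "('k, 'n, 'h, 'y) hmod_scheme" and P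
  assumes M: "left_H_module K H M" and N: "left_H_module K H N" and P: "klinear K M N P"
begin

lemma DF_closed: "u \<in> carrier M \<Longrightarrow> DF K H F M N P u \<in> carrier N"
  unfolding DF_eq by (intro HH_tsum_closed) (simp_all add: hact_module[OF N] hact_closed[OF M] adj_closed[OF M N P])

lemma DF_klinear: "klinear K M N (DF K H F M N P)"
  unfolding DF_eq[abs_def]
  by (intro HH.klinear_tsumf adj_klin(2)[OF M N P] hact_klin(2)[OF M] klinear_ident) (simp_all add: hact_module[OF N])

text \<open>D_F as a sum over F instead of F^-1. In this form F stands where the twisted coproduct
  multiplies it from the left.\<close>

lemma DF_F:
  assumes [simp]: "u \<in> carrier M"
  shows "DF K H F M N P u = tsum N F (\<lambda>x y. hact N x (P (hact M (S y \<bullet> \<upsilon>) u)))"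
proof -
  note [simp] = adj_simps[OF M N P]
  let ?\<Phi> = "\<lambda>p q. hact N p (P (hact M q u))"
  have "DF K H F M N P u = tsum N Fb (\<lambda>x y. tsum N (\<Delta> x) (\<lambda>x\<^sub>1 x\<^sub>2. ?\<Phi> x\<^sub>1 (S x\<^sub>2 \<bullet> y)))"
    by (simp add: DF_eq adj_act_eq hact_mult[OF M] cong: HH.tsum_cong)
  also have "\<dots> = tsum N F (\<lambda>x y. ?\<Phi> x (S y \<bullet> \<upsilon>))"
    by (rule tsum_twist_adjoint[where \<Phi> = ?\<Phi>]) (simp, intro klin adj_klin_aux[OF M N P], simp_all)
  finally show ?thesis .
qed

end

end

context twisted_module_algebra
begin

text \<open>\<Delta>^F(\<xi>) F = F \<Delta>(\<xi>). The factor \<open>\<chi>\<close> of the twisted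
  antipode cancels the \<open>\<upsilon>\<close> of \<open>DF_F\<close>, and its own
  \<open>\<upsilon>\<close> takes that place.\<close>

lemma DF_adj:
  assumes M: "left_H_module K H M" and N: "left_H_module K H N" and P: "klinear K M N P"
    and [simp]: "\<xi> \<in> carrier H" "u \<in> carrier M"
  shows "adj_act HF M N \<xi> (DF K H F M N P) u = DF K H F M N (adj_act H M N \<xi> P) u"
proof -
  note [simp] = adj_simps[OF M N P] HH.mult_closed
  let ?h = "\<lambda>p q. hact N p (P (hact M (S q \<bullet> \<upsilon>) u))"
  have h: "kbilinear K H H N ?h" by (intro klin adj_klin_aux[OF M N P]) simp_all
  have eq: "comult HF \<xi> \<otimes>\<^bsub>HH K H\<^esub> F = F \<otimes>\<^bsub>HH K H\<^esub> \<Delta> \<xi>"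
    using HH.T.Units_l_inv[OF F_Units] by (simp add: comult_HF HH.T.m_assoc)
  have chi: "hact M (S q \<bullet> \<upsilon>) (hact M (\<chi> \<bullet> S y \<bullet> \<upsilon>) u) = hact M (S (y \<bullet> q) \<bullet> \<upsilon>) u"
    if [simp]: "q \<in> carrier H" "y \<in> carrier H" for q y
  proof -
    have "(S q \<bullet> \<upsilon>) \<bullet> (\<chi> \<bullet> S y \<bullet> \<upsilon>) = S q \<bullet> ((\<upsilon> \<bullet> \<chi>) \<bullet> (S y \<bullet> \<upsilon>))"
      by (simp add: HH.A.m_assoc)
    also have "\<dots> = S (y \<bullet> q) \<bullet> \<upsilon>"
      by (simp add: chi_inverse antipode_mult HH.A.m_assoc)
    finally show ?thesis
      by (simp add: hact_mult[OF M, symmetric])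
  qed
  have "adj_act HF M N \<xi> (DF K H F M N P) u = tsum N (comult HF \<xi>) (\<lambda>x y. tsum N F (\<lambda>p q. ?h (x \<bullet> p) (y \<bullet> q)))"
    by (simp add: adj_act_def tsum_def[symmetric] antipode_HF DF_F[OF M N P] klinear_tsum_out[OF hact_klin(2)[OF N klinear_ident]]
        hact_mult[OF N] chi cong: HH.tsum_cong)
  also have "\<dots> = tsum N F (\<lambda>p q. tsum N (\<Delta> \<xi>) (\<lambda>x y. ?h (p \<bullet> x) (q \<bullet> y)))"
    using HH.tsum_mult[OF _ h, of "comult HF \<xi>" F] HH.tsum_mult[OF _ h, of F "\<Delta> \<xi>"] eq by simp
  also have "\<dots> = DF K H F M N (adj_act H M N \<xi> P) u"
    by (simp add: DF_F[OF M N klinear_adj[OF M N P]] adj_act_eq klinear_tsum_out[OF hact_klin(2)[OF N klinear_ident]]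
        hact_mult[OF N] hact_mult[OF M] antipode_mult cong: HH.tsum_cong)
  finally show ?thesis .
qed

text \<open>Once more the two sides of the inverted cocycle identity, now with three vectors in the
  slots.\<close>

lemma star_ptens_assoc:
  assumes U [simp]: "bim U" and V [simp]: "bim V" and W [simp]: "bim W"
    and [simp]: "u \<in> carrier U" "v \<in> carrier V" "w \<in> carrier W"
  shows "star_ptens (U \<otimes>\<^sub>A V) W (star_ptens U V u v) w = assoc U V W (star_ptens U (V \<otimes>\<^sub>A W) u (star_ptens V W v w))"
proof -
  let ?T = "(U \<otimes>\<^sub>A V) \<otimes>\<^sub>A W"
  let ?f = "\<lambda>p q r. (hact U p u \<boxtimes>\<^bsub>U \<otimes>\<^sub>A V\<^esub> hact V q v) \<boxtimes>\<^bsub>?T\<^esub> hact W r w"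
  have "star_ptens (U \<otimes>\<^sub>A V) W (star_ptens U V u v) w = tsum ?T Fb (\<lambda>x y. tsum ?T (\<Delta> x) (\<lambda>x\<^sub>1 x\<^sub>2.
      tsum ?T Fb (\<lambda>b c. ?f (x\<^sub>1 \<bullet> b) (x\<^sub>2 \<bullet> c) y)))"
    by (simp add: star_ptens_def tsum_out btensor_act bim_hact_mult cong: HH.tsum_cong)
      (rule HH.tsum_cong, simp, rule HH_swap, simp_all)
  also have "\<dots> = tsum ?T Fb (\<lambda>x y. tsum ?T (\<Delta> y) (\<lambda>y\<^sub>1 y\<^sub>2.
      tsum ?T Fb (\<lambda>b c. ?f x (y\<^sub>1 \<bullet> b) (y\<^sub>2 \<bullet> c))))"
    by (rule tsum_cocycle_inv[where f = ?f]) (simp, intro klin, simp_all)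
  also have "\<dots> = assoc U V W (star_ptens U (V \<otimes>\<^sub>A W) u (star_ptens V W v w))"
    by (simp add: star_ptens_def tsum_out btensor_act bim_hact_mult assoc_tsum_out assoc_ptens cong: HH.tsum_cong)
      (rule HH.tsum_cong, simp, rule HH_swap, simp_all)
  finally show ?thesis .
qed

text \<open>The twisted associator is evaluated on representatives and pushed through
  \<open>psi\<close> term by term, the untwisted one is pulled out by linearity, and
  \<open>star_ptens_assoc\<close> connects the two.\<close>

lemma psi_assoc:
  assumes g: "star_map P U g" and h: "star_map Q V h" and k: "star_map N W k"
    and U [simp]: "bim U" and V [simp]: "bim V" and W [simp]: "bim W"
    and X: "X \<in> carrier (P \<otimes>\<^sub>\<star> (Q \<otimes>\<^sub>\<star> N))"
  shows "psi (U \<otimes>\<^sub>A V) W (psi U V g h) k (tassoc ((P \<otimes>\<^sub>\<star> Q) \<otimes>\<^sub>\<star> N) (P \<otimes>\<^sub>\<star> Q) X)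
    = assoc U V W (psi U (V \<otimes>\<^sub>A W) g (psi V W h k) X)"
proof -
  note gh = star_map_psi[OF g h U V] and hk = star_map_psi[OF h k V W]
  note bims = bim_btensor[OF U V] bim_btensor[OF V W]
  note T1 = star_tensor_product[OF g hk U bims(2)] and T2 = star_tensor_product[OF h k V W]
  interpret T1: tensor_product "carrier A" "ract P" "lact (Q \<otimes>\<^sub>\<star> N)" P "Q \<otimes>\<^sub>\<star> N" "P \<otimes>\<^sub>\<star> (Q \<otimes>\<^sub>\<star> N)" by (rule T1)
  interpret T2: tensor_product "carrier A" "ract Q" "lact N" Q N "Q \<otimes>\<^sub>\<star> N" by (rule T2)
  interpret PQ: tensor_product "carrier A" "ract P" "lact Q" P Q "P \<otimes>\<^sub>\<star> Q" by (rule star_tensor_product[OF g h U V])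
  interpret PQN: tensor_product "carrier A" "ract (P \<otimes>\<^sub>\<star> Q)" "lact N" "P \<otimes>\<^sub>\<star> Q" N "(P \<otimes>\<^sub>\<star> Q) \<otimes>\<^sub>\<star> N"
    by (rule star_tensor_product[OF gh k bims(1) W])
  let ?T = "(U \<otimes>\<^sub>A V) \<otimes>\<^sub>A W"
  note cl = star_map_closed(1)[OF g h U V] star_map_closed(1,2)[OF h k V W] psi_closed[OF h k V W]
  have T: "abelian_group ?T" by (rule module_abelian) simp
  note tsum_push = psi_tsum[OF gh k bims(1) W]
  have "psi (U \<otimes>\<^sub>A V) W (psi U V g h) k (tassoc ((P \<otimes>\<^sub>\<star> Q) \<otimes>\<^sub>\<star> N) (P \<otimes>\<^sub>\<star> Q) X)
    = tsum ?T X (\<lambda>p q. psi (U \<otimes>\<^sub>A V) W (psi U V g h) k (tsum ((P \<otimes>\<^sub>\<star> Q) \<otimes>\<^sub>\<star> N) q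
        (\<lambda>x y. (p \<boxtimes>\<^bsub>P \<otimes>\<^sub>\<star> Q\<^esub> x) \<boxtimes>\<^bsub>(P \<otimes>\<^sub>\<star> Q) \<otimes>\<^sub>\<star> N\<^esub> y)))"
    unfolding tassoc_eq by (rule tsum_push[OF T1 X]) (simp add: T2.tsum_closed[OF PQN.abelian_T])
  also have "\<dots> = tsum ?T X (\<lambda>p q. tsum ?T q (\<lambda>x y. psi (U \<otimes>\<^sub>A V) W (psi U V g h) k
        ((p \<boxtimes>\<^bsub>P \<otimes>\<^sub>\<star> Q\<^esub> x) \<boxtimes>\<^bsub>(P \<otimes>\<^sub>\<star> Q) \<otimes>\<^sub>\<star> N\<^esub> y)))"
    by (rule T1.tsum_cong[OF X]) (simp add: tsum_push[OF T2])
  also have "\<dots> = tsum ?T X (\<lambda>p q. tsum ?T q (\<lambda>x y. assoc U V W (star_ptens U (V \<otimes>\<^sub>A W) (g p) (star_ptens V W (h x) (k y)))))"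
    by (rule T1.tsum_cong[OF X], rule T2.tsum_cong)
      (simp_all add: psi_ptens[OF gh k bims(1) W] psi_ptens[OF g h U V] star_ptens_assoc cl)
  also have "\<dots> = tsum ?T X (\<lambda>p q. assoc U V W (star_ptens U (V \<otimes>\<^sub>A W) (g p) (psi V W h k q)))"
    unfolding psi_def
    by (rule T1.tsum_cong[OF X], rule T2.tsum_hom[symmetric, OF module_abelian T klinear_additive[where K = K]])
      (simp_all add: cl assoc_klin star_ptens_klin klinear_ident)
  also have "\<dots> = assoc U V W (psi U (V \<otimes>\<^sub>A W) g (psi V W h k) X)"
    unfolding psi_def[of U]
    by (rule T1.tsum_hom[symmetric, OF module_abelian T klinear_additive[where K = K]])
      (simp_all add: cl assoc_klinear X)
  finally show ?thesis .
qed

text \<open>Induction over sums of pure tensors asks only for some preimage of each pure tensor, so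
  an inverse of \<phi> is not constructed as a map.\<close>

lemma psi_surj:
  assumes g: "star_map P V (\<lambda>v. v)" and h: "star_map Q W (\<lambda>w. w)" and V [simp]: "bim V" and W [simp]: "bim W"
    and P: "carrier P = carrier V" and Q: "carrier Q = carrier W" and y: "y \<in> carrier (V \<otimes>\<^sub>A W)"
  shows "y \<in> psi V W (\<lambda>v. v) (\<lambda>w. w) ` carrier (P \<otimes>\<^sub>\<star> Q)"
proof -
  interpret T: tensor_product "carrier A" "ract P" "lact Q" P Q "P \<otimes>\<^sub>\<star> Q"
    by (rule star_tensor_product[OF g h V W])
  interpret VW: tensor_module K "carrier A" "ract V" "lact W" V W "V \<otimes>\<^sub>A W"
    by (rule btensor_tensor_module[OF V W])
  let ?p = "psi V W (\<lambda>v. v) (\<lambda>w. w)"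
  show ?thesis
    using y
  proof (induction rule: VW.induct)
    case (ptens v w)
    then have [simp]: "v \<in> carrier V" "w \<in> carrier W" by simp_all
    let ?f = "\<lambda>p q. hact V p v \<boxtimes>\<^bsub>V \<otimes>\<^sub>A W\<^esub> hact W q w"
    \<comment> \<open>Since \<phi> acts by F^-1, acting with F gives a preimage.\<close>
    let ?X = "tsum (P \<otimes>\<^sub>\<star> Q) F (\<lambda>x y. hact V x v \<boxtimes>\<^bsub>P \<otimes>\<^sub>\<star> Q\<^esub> hact W y w)"
    have f: "kbilinear K H H (V \<otimes>\<^sub>A W) ?f" by (intro klin) simp_all
    have "?p ?X = tsum (V \<otimes>\<^sub>A W) F (\<lambda>x y. ?p (hact V x v \<boxtimes>\<^bsub>P \<otimes>\<^sub>\<star> Q\<^esub> hact W y w))"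
      by (rule psi_tsum[OF g h V W HH.tensor_product_axioms]) (simp_all add: P Q)
    also have "\<dots> = tsum (V \<otimes>\<^sub>A W) F (\<lambda>x y. tsum (V \<otimes>\<^sub>A W) Fb (\<lambda>a b. ?f (a \<bullet> x) (b \<bullet> y)))"
      by (simp add: psi_ptens[OF g h V W] P Q star_ptens_def bim_hact_mult cong: HH.tsum_cong)
    also have "\<dots> = tsum (V \<otimes>\<^sub>A W) Fb (\<lambda>a b. tsum (V \<otimes>\<^sub>A W) F (\<lambda>x y. ?f (a \<bullet> x) (b \<bullet> y)))"
      by (rule HH_swap) simp_all
    also have "\<dots> = ?f \<one>\<^bsub>H\<^esub> \<one>\<^bsub>H\<^esub>"
      by (rule tsum_inverse(2)[OF _ f F_Units]) simp
    finally have eq: "v \<boxtimes>\<^bsub>V \<otimes>\<^sub>A W\<^esub> w = ?p ?X" by simp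
    have "?X \<in> carrier (P \<otimes>\<^sub>\<star> Q)"
      by (rule HH.tsum_closed[OF T.abelian_T]) (simp_all add: P Q)
    with eq show ?case by (rule image_eqI)
  next
    case (add X Y)
    from add.IH obtain X' Y' where X': "X' \<in> carrier (P \<otimes>\<^sub>\<star> Q)" "X = ?p X'" and Y': "Y' \<in> carrier (P \<otimes>\<^sub>\<star> Q)" "Y = ?p Y'"
      by blast
    have "X \<oplus>\<^bsub>V \<otimes>\<^sub>A W\<^esub> Y = ?p (X' \<oplus>\<^bsub>P \<otimes>\<^sub>\<star> Q\<^esub> Y')"
      using psi_additive[OF g h V W] X' Y' unfolding additive_map_def by simp
    then show ?case by (rule image_eqI) (rule T.T.a_closed[OF X'(1) Y'(1)])
  qed
qed

end

locale twisted_quasitriangular_module_algebra =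
  quasitriangular_module_algebra K H A R + twisted_module_algebra K H A F + twisted_quasitriangular_hopf K H R F
  for K :: "('k, 'r) ring_scheme" and H :: "('k, 'h) hopf" and A :: "('k, 'a, 'h) hmod"
    and R F :: "('h, 'h) tens"
begin

abbreviation "RF \<equiv> twist_R K H F R"

context
  fixes V :: "('k, 'v, 'h, 'a) hbimod" and Om :: "('k, 'o, 'h, 'a) hbimod" and W :: "('k, 'w, 'h, 'a) hbimod"
  assumes V [simp]: "bim V" and Om [simp]: "bim Om" and W [simp]: "bim W"
    and qW: "qcomm W" and qOm: "qcomm_left Om"
begin

abbreviation (input) "t_VW \<equiv> V \<otimes>\<^sub>A W"
abbreviation (input) "t_WO \<equiv> W \<otimes>\<^sub>A Om"
abbreviation (input) "t_VWO \<equiv> (V \<otimes>\<^sub>A W) \<otimes>\<^sub>A Om"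
abbreviation (input) "t_tau \<equiv> tau23_inv H R A V W Om"

text \<open>In R^F = F_21 R F^-1 the factor F_21 cancels against the F^-1 of
  \<open>star_ptens\<close>; the legs fit because the second component of R^F acts on
  \<open>w\<close>, the first on \<theta>.\<close>

lemma twist_R_star_ptens:
  assumes [simp]: "w \<in> carrier W" "\<theta> \<in> carrier Om"
  shows "tsum t_WO RF (\<lambda>x y. star_ptens W Om (hact W y w) (hact Om x \<theta>))
    = tsum t_WO R (\<lambda>x y. tsum t_WO Fb (\<lambda>c d. hact W (y \<bullet> d) w \<boxtimes>\<^bsub>t_WO\<^esub> hact Om (x \<bullet> c) \<theta>))"
proof -
  let ?h = "\<lambda>p q. hact W p w \<boxtimes>\<^bsub>t_WO\<^esub> hact Om q \<theta>"
  let ?k = "\<lambda>p q. star_ptens W Om (hact W q w) (hact Om p \<theta>)"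
  have k: "kbilinear K H H t_WO ?k" by (intro klin) simp_all
  have "tsum t_WO RF ?k = tsum t_WO F (\<lambda>a b. tsum t_WO R (\<lambda>x y. tsum t_WO Fb (\<lambda>c d.
      tsum t_WO Fb (\<lambda>e f. ?h (e \<bullet> (a \<bullet> (y \<bullet> d))) (f \<bullet> (b \<bullet> (x \<bullet> c)))))))"
    by (subst tsum_twist_R(1)[OF _ k]) (simp_all add: star_ptens_def bim_hact_mult cong: HH.tsum_cong)
  also have "\<dots> = tsum t_WO R (\<lambda>x y. tsum t_WO F (\<lambda>a b. tsum t_WO Fb (\<lambda>c d.
      tsum t_WO Fb (\<lambda>e f. ?h (e \<bullet> (a \<bullet> (y \<bullet> d))) (f \<bullet> (b \<bullet> (x \<bullet> c)))))))"
    by (rule HH_swap) simp_all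
  also have "\<dots> = tsum t_WO R (\<lambda>x y. tsum t_WO Fb (\<lambda>c d. tsum t_WO F (\<lambda>a b.
      tsum t_WO Fb (\<lambda>e f. ?h (e \<bullet> (a \<bullet> (y \<bullet> d))) (f \<bullet> (b \<bullet> (x \<bullet> c)))))))"
    by (rule HH.tsum_cong, simp, rule HH_swap) simp_all
  also have "\<dots> = tsum t_WO R (\<lambda>x y. tsum t_WO Fb (\<lambda>c d. ?h (y \<bullet> d) (x \<bullet> c)))"
  proof (rule HH.tsum_cong, simp, rule HH.tsum_cong, simp)
    fix x y c d assume [simp]: "x \<in> carrier H" "y \<in> carrier H" "c \<in> carrier H" "d \<in> carrier H"
    have h: "kbilinear K H H t_WO (\<lambda>p q. ?h (p \<bullet> (y \<bullet> d)) (q \<bullet> (x \<bullet> c)))" by (intro klin) simp_all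
    have "tsum t_WO F (\<lambda>a b. tsum t_WO Fb (\<lambda>e f. ?h (e \<bullet> (a \<bullet> (y \<bullet> d))) (f \<bullet> (b \<bullet> (x \<bullet> c)))))
      = tsum t_WO Fb (\<lambda>e f. tsum t_WO F (\<lambda>a b. ?h (e \<bullet> (a \<bullet> (y \<bullet> d))) (f \<bullet> (b \<bullet> (x \<bullet> c)))))"
      by (rule HH_swap) simp_all
    also have "\<dots> = ?h (y \<bullet> d) (x \<bullet> c)"
      using tsum_inverse(2)[OF _ h F_Units] by (simp add: HH.A.m_assoc cong: HH.tsum_cong)
    finally show "tsum t_WO F (\<lambda>a b. tsum t_WO Fb (\<lambda>e f. ?h (e \<bullet> (a \<bullet> (y \<bullet> d))) (f \<bullet> (b \<bullet> (x \<bullet> c)))))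
      = ?h (y \<bullet> d) (x \<bullet> c)" .
  qed
  finally show ?thesis .
qed

text \<open>Rebracketing puts \<open>w\<close> next to \<theta>, where
  \<open>twist_R_star_ptens\<close> applies. The remaining R is slid past \<Delta>(f) and becomes
  the untwisted braiding; rebracketing again gives the claim.\<close>

lemma tau_star_ptens:
  assumes [simp]: "v \<in> carrier V" "w \<in> carrier W" "\<theta> \<in> carrier Om"
  shows "tsum t_VWO RF (\<lambda>x y. star_ptens t_VW Om (star_ptens V W v (hact W y w)) (hact Om x \<theta>))
    = t_tau (star_ptens (V \<otimes>\<^sub>A Om) W (star_ptens V Om v \<theta>) w)"
proof -
  let ?B = "\<lambda>p q r. (hact V p v \<boxtimes>\<^bsub>t_VW\<^esub> hact W q w) \<boxtimes>\<^bsub>t_VWO\<^esub> hact Om r \<theta>"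
  have lin: "klinear K t_WO t_VWO (\<lambda>z. assoc V W Om (star_ptens V t_WO v z))"
    by (intro assoc_klin star_ptens_klin klinear_ident) simp_all
  have "tsum t_VWO RF (\<lambda>x y. star_ptens t_VW Om (star_ptens V W v (hact W y w)) (hact Om x \<theta>))
    = tsum t_VWO RF (\<lambda>x y. assoc V W Om (star_ptens V t_WO v (star_ptens W Om (hact W y w) (hact Om x \<theta>))))"
    by (simp add: star_ptens_assoc cong: HH.tsum_cong)
  also have "\<dots> = assoc V W Om (star_ptens V t_WO v (tsum t_WO RF (\<lambda>x y. star_ptens W Om (hact W y w) (hact Om x \<theta>))))"
    by (rule klinear_tsum_out[OF lin, symmetric]) simp_all
  also have "\<dots> = tsum t_VWO Fb (\<lambda>e f. tsum t_VWO R (\<lambda>x y. tsum t_VWO Fb (\<lambda>c d. tsum t_VWO (\<Delta> f) (\<lambda>f\<^sub>1 f\<^sub>2.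
      ?B e (f\<^sub>1 \<bullet> (y \<bullet> d)) (f\<^sub>2 \<bullet> (x \<bullet> c))))))"
    unfolding twist_R_star_ptens[OF assms(2,3)]
    by (simp add: star_ptens_def tsum_out btensor_act bim_hact_mult assoc_tsum_out assoc_ptens cong: HH.tsum_cong)
  also have "\<dots> = tsum t_VWO Fb (\<lambda>e f. tsum t_VWO Fb (\<lambda>c d. tsum t_VWO R (\<lambda>x y. tsum t_VWO (\<Delta> f) (\<lambda>f\<^sub>1 f\<^sub>2.
      ?B e (f\<^sub>1 \<bullet> (y \<bullet> d)) (f\<^sub>2 \<bullet> (x \<bullet> c))))))"
    by (rule HH.tsum_cong, simp, rule HH_swap) simp_all
  also have "\<dots> = tsum t_VWO Fb (\<lambda>e f. tsum t_VWO Fb (\<lambda>c d. tsum t_VWO (\<Delta> f) (\<lambda>f\<^sub>1 f\<^sub>2. tsum t_VWO R (\<lambda>x y.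
      ?B e (y \<bullet> (f\<^sub>2 \<bullet> d)) (x \<bullet> (f\<^sub>1 \<bullet> c))))))"
  proof (rule HH.tsum_cong, simp, rule HH.tsum_cong, simp)
    fix e f c d assume [simp]: "e \<in> carrier H" "f \<in> carrier H" "c \<in> carrier H" "d \<in> carrier H"
    let ?g = "\<lambda>p q. ?B e (q \<bullet> d) (p \<bullet> c)"
    have g: "kbilinear K H H t_VWO ?g" by (intro klin) simp_all
    have "tsum t_VWO R (\<lambda>x y. tsum t_VWO (\<Delta> f) (\<lambda>f\<^sub>1 f\<^sub>2. ?B e (f\<^sub>1 \<bullet> (y \<bullet> d)) (f\<^sub>2 \<bullet> (x \<bullet> c))))
      = tsum t_VWO (\<Delta> f) (\<lambda>f\<^sub>1 f\<^sub>2. tsum t_VWO R (\<lambda>x y. ?g (f\<^sub>2 \<bullet> x) (f\<^sub>1 \<bullet> y)))"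
      by (subst HH_swap) (simp_all add: HH.A.m_assoc cong: HH.tsum_cong)
    also have "\<dots> = tsum t_VWO R (\<lambda>x y. tsum t_VWO (\<Delta> f) (\<lambda>f\<^sub>1 f\<^sub>2. ?g (x \<bullet> f\<^sub>1) (y \<bullet> f\<^sub>2)))"
      by (rule tsum_R_comult(1)[OF _ g, symmetric]) simp_all
    also have "\<dots> = tsum t_VWO (\<Delta> f) (\<lambda>f\<^sub>1 f\<^sub>2. tsum t_VWO R (\<lambda>x y. ?B e (y \<bullet> (f\<^sub>2 \<bullet> d)) (x \<bullet> (f\<^sub>1 \<bullet> c))))"
      by (subst HH_swap) (simp_all add: HH.A.m_assoc cong: HH.tsum_cong)
    finally show "tsum t_VWO R (\<lambda>x y. tsum t_VWO (\<Delta> f) (\<lambda>f\<^sub>1 f\<^sub>2. ?B e (f\<^sub>1 \<bullet> (y \<bullet> d)) (f\<^sub>2 \<bullet> (x \<bullet> c))))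
      = tsum t_VWO (\<Delta> f) (\<lambda>f\<^sub>1 f\<^sub>2. tsum t_VWO R (\<lambda>x y. ?B e (y \<bullet> (f\<^sub>2 \<bullet> d)) (x \<bullet> (f\<^sub>1 \<bullet> c))))" .
  qed
  also have "\<dots> = t_tau (assoc V Om W (star_ptens V (Om \<otimes>\<^sub>A W) v (star_ptens Om W \<theta> w)))"
    by (simp add: star_ptens_def tsum_out btensor_act bim_hact_mult assoc_tsum_out assoc_ptens
        tau_tsum_out[OF V Om W qW qOm] tau_ptens[OF V Om W qW qOm] braid_def[OF V Om W qW qOm] cong: HH.tsum_cong)
  also have "\<dots> = t_tau (star_ptens (V \<otimes>\<^sub>A Om) W (star_ptens V Om v \<theta>) w)"
    by (simp add: star_ptens_assoc)
  finally show ?thesis .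
qed

text \<open>The scheme of \<open>psi_assoc\<close> with \<open>tau_star_ptens\<close> on pure terms;
  the innermost sum over R^F is pushed through \<open>psi\<close> as well.\<close>

lemma tau_star:
  assumes g: "star_map P V g" and h: "star_map N W h" and k: "star_map Q Om k"
    and X: "X \<in> carrier ((P \<otimes>\<^sub>\<star> Q) \<otimes>\<^sub>\<star> N)"
  shows "psi t_VW Om (psi V W g h) k (tau23_inv HF RF As P N Q X) = t_tau (psi (V \<otimes>\<^sub>A Om) W (psi V Om g k) h X)"
proof -
  note gh = star_map_psi[OF g h V W] and gk = star_map_psi[OF g k V Om]
  note bims = bim_btensor[OF V W] bim_btensor[OF V Om]
  note T1 = star_tensor_product[OF gk h bims(2) W] and T2 = star_tensor_product[OF g k V Om]
  interpret T1: tensor_product "carrier A" "ract (P \<otimes>\<^sub>\<star> Q)" "lact N" "P \<otimes>\<^sub>\<star> Q" N "(P \<otimes>\<^sub>\<star> Q) \<otimes>\<^sub>\<star> N" by (rule T1)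
  interpret T2: tensor_product "carrier A" "ract P" "lact Q" P Q "P \<otimes>\<^sub>\<star> Q" by (rule T2)
  interpret PN: tensor_product "carrier A" "ract P" "lact N" P N "P \<otimes>\<^sub>\<star> N" by (rule star_tensor_product[OF g h V W])
  interpret PNQ: tensor_product "carrier A" "ract (P \<otimes>\<^sub>\<star> N)" "lact Q" "P \<otimes>\<^sub>\<star> N" Q "(P \<otimes>\<^sub>\<star> N) \<otimes>\<^sub>\<star> Q"
    by (rule star_tensor_product[OF gh k bims(1) Om])
  let ?T = "(P \<otimes>\<^sub>\<star> N) \<otimes>\<^sub>\<star> Q"
  let ?psi = "psi t_VW Om (psi V W g h) k"
  note cl = star_map_closed(1-4)[OF g h V W] star_map_closed(1-4)[OF g k V Om] psi_closed[OF g k V Om]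
  note push = psi_tsum[OF gh k bims(1) Om]
  have ab: "abelian_group t_VWO" by (rule module_abelian) simp
  let ?f = "\<lambda>v \<theta> w x y. (v \<boxtimes>\<^bsub>P \<otimes>\<^sub>\<star> N\<^esub> hact N y w) \<boxtimes>\<^bsub>?T\<^esub> hact Q x \<theta>"
  have "?psi (tau23_inv HF RF As P N Q X)
    = ?psi (tsum ?T X (\<lambda>q w. tsum ?T q (\<lambda>v \<theta>. tsum ?T RF (?f v \<theta> w))))"
    by (simp add: tau23_inv_def Let_def tsum_def)
  also have "\<dots> = tsum t_VWO X (\<lambda>q w. ?psi (tsum ?T q (\<lambda>v \<theta>. tsum ?T RF (?f v \<theta> w))))"
    by (rule push[OF T1 X])
      (auto intro!: T2.tsum_closed[OF PNQ.abelian_T] HH.tsum_closed[OF PNQ.abelian_T] simp: cl)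
  also have "\<dots> = tsum t_VWO X (\<lambda>q w. tsum t_VWO q (\<lambda>v \<theta>. ?psi (tsum ?T RF (?f v \<theta> w))))"
    by (rule T1.tsum_cong[OF X], rule push[OF T2])
      (auto intro!: HH.tsum_closed[OF PNQ.abelian_T] simp: cl)
  also have "\<dots> = tsum t_VWO X (\<lambda>q w. tsum t_VWO q (\<lambda>v \<theta>. t_tau (star_ptens (V \<otimes>\<^sub>A Om) W (star_ptens V Om (g v) (k \<theta>)) (h w))))"
  proof (rule T1.tsum_cong[OF X], rule T2.tsum_cong)
    fix q w v \<theta> assume [simp]: "w \<in> carrier N" "v \<in> carrier P" "\<theta> \<in> carrier Q"
    have "?psi (tsum ?T RF (?f v \<theta> w)) = tsum t_VWO RF (\<lambda>x y. ?psi (?f v \<theta> w x y))"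
      by (rule push[OF HH.tensor_product_axioms]) (simp_all add: cl)
    also have "\<dots> = tsum t_VWO RF (\<lambda>x y. star_ptens t_VW Om (star_ptens V W (g v) (hact W y (h w))) (hact Om x (k \<theta>)))"
      by (rule HH.tsum_cong)
        (simp_all add: psi_ptens[OF gh k bims(1) Om] psi_ptens[OF g h V W] star_map_eqs[OF g h V W] star_map_eqs[OF g k V Om] cl)
    also have "\<dots> = t_tau (star_ptens (V \<otimes>\<^sub>A Om) W (star_ptens V Om (g v) (k \<theta>)) (h w))"
      by (rule tau_star_ptens) (simp_all add: cl)
    finally show "?psi (tsum ?T RF (?f v \<theta> w)) = t_tau (star_ptens (V \<otimes>\<^sub>A Om) W (star_ptens V Om (g v) (k \<theta>)) (h w))" .
  qed
  also have "\<dots> = tsum t_VWO X (\<lambda>q w. t_tau (star_ptens (V \<otimes>\<^sub>A Om) W (psi V Om g k q) (h w)))"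
    unfolding psi_def[of V Om]
    by (rule T1.tsum_cong[OF X], rule T2.tsum_hom[symmetric, OF module_abelian ab klinear_additive[where K = K]])
      (simp_all add: cl tau_klin[OF V Om W qW qOm] star_ptens_klin klinear_ident)
  also have "\<dots> = t_tau (psi (V \<otimes>\<^sub>A Om) W (psi V Om g k) h X)"
    unfolding psi_def[of "V \<otimes>\<^sub>A Om"]
    by (rule T1.tsum_hom[symmetric, OF module_abelian ab klinear_additive[where K = K]])
      (simp_all add: cl tau_klinear[OF V Om W qW qOm] X)
  finally show ?thesis .
qed

end

end

section \<open>Deformation of the two summands of a sum of connections\<close>

context twisted_quasitriangular_module_algebra
begin

context
  fixes V :: "('k, 'v, 'h, 'a) hbimod" and W :: "('k, 'w, 'h, 'a) hbimod" and Om :: "('k, 'o, 'h, 'a) hbimod"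
    and d P Q
  assumes V [simp]: "bim V" and W [simp]: "bim W" and Om [simp]: "bim Om"
    and qW: "qcomm W" and qOm: "qcomm Om" and qOm': "qcomm_left Om"
    and d: "klinear K A Om d" and d_hact: "\<And>\<xi> a. \<xi> \<in> carrier H \<Longrightarrow> a \<in> carrier A \<Longrightarrow> hact Om \<xi> (d a) = d (hact A \<xi> a)"
    and P: "connection V Om d P" and Q: "connection W Om d Q"
begin

abbreviation (input) "s_VWO \<equiv> (V \<otimes>\<^sub>A W) \<otimes>\<^sub>A Om"
abbreviation (input) "s_VOW \<equiv> (V \<otimes>\<^sub>A Om) \<otimes>\<^sub>A W"
abbreviation (input) "s_WO \<equiv> W \<otimes>\<^sub>A Om"
abbreviation (input) "s_V_WO \<equiv> V \<otimes>\<^sub>A (W \<otimes>\<^sub>A Om)"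
abbreviation (input) "s_tau \<equiv> tau23_inv H R A V W Om"
abbreviation (input) "s_adjP \<equiv> \<lambda>\<xi> v. adj_act H V (V \<otimes>\<^sub>A Om) \<xi> P v"
abbreviation (input) "s_adjQ \<equiv> \<lambda>\<xi> w. adj_act H W (W \<otimes>\<^sub>A Om) \<xi> Q w"
abbreviation (input) "s_csum \<equiv> con_sum K H R A V W Om P Q"

lemmas s_klin = sum_klin[OF V W Om qW qOm qOm' d d_hact P Q]
lemmas s_closed = sum_closed[OF V W Om qW qOm qOm' d d_hact P Q]
lemmas P_conn = bim_H_module[OF V] bim_H_module[OF bim_btensor[OF V Om]] connectionD(1)[OF P]
lemmas Q_conn = bim_H_module[OF W] bim_H_module[OF bim_btensor[OF W Om]] connectionD(1)[OF Q]
lemmas csum_conn = bim_H_module[OF bim_btensor[OF V W]] bim_H_module[OF bim_btensor[OF bim_btensor[OF V W] Om]]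
  con_sum_klinear[OF V W Om qW qOm qOm' d d_hact P Q]

text \<open>Expansion to the pattern of (\<Delta> \<otimes> id) F^-1 followed by (F^-1)_12, one side
  of the inverted cocycle identity, in which form the deformed sum is compared with it.\<close>

lemma star_ptens_DF_left:
  assumes [simp]: "v \<in> carrier V" "w \<in> carrier W"
  shows "star_ptens (V \<otimes>\<^sub>A Om) W (DF K H F V (V \<otimes>\<^sub>A Om) P v) w = tsum s_VOW Fb (\<lambda>x y. tsum s_VOW (\<Delta> x) (\<lambda>x\<^sub>1 x\<^sub>2.
      tsum s_VOW Fb (\<lambda>a b. s_adjP (x\<^sub>1 \<bullet> a) (hact V (x\<^sub>2 \<bullet> b) v) \<boxtimes>\<^bsub>s_VOW\<^esub> hact W y w)))"
proof -
  note [simp] = s_closed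
  have "star_ptens (V \<otimes>\<^sub>A Om) W (DF K H F V (V \<otimes>\<^sub>A Om) P v) w = tsum s_VOW Fb (\<lambda>x y. tsum s_VOW Fb (\<lambda>a b.
      tsum s_VOW (\<Delta> x) (\<lambda>x\<^sub>1 x\<^sub>2. s_adjP (x\<^sub>1 \<bullet> a) (hact V (x\<^sub>2 \<bullet> b) v) \<boxtimes>\<^bsub>s_VOW\<^esub> hact W y w)))"
    by (simp add: star_ptens_def DF_eq adj_hact[OF P_conn] tsum_out bim_hact_mult cong: HH.tsum_cong)
  also have "\<dots> = tsum s_VOW Fb (\<lambda>x y. tsum s_VOW (\<Delta> x) (\<lambda>x\<^sub>1 x\<^sub>2.
      tsum s_VOW Fb (\<lambda>a b. s_adjP (x\<^sub>1 \<bullet> a) (hact V (x\<^sub>2 \<bullet> b) v) \<boxtimes>\<^bsub>s_VOW\<^esub> hact W y w)))"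
    by (rule HH.tsum_cong, simp, rule HH_swap) simp_all
  finally show ?thesis .
qed

text \<open>Calculated from right to left: R^-1 is slid past \<Delta>(x), and the third mixed
  cocycle form then supplies the factor F that completes the inverse of R^F.\<close>

lemma star_ptens_DF_right:
  assumes [simp]: "v \<in> carrier V" "w \<in> carrier W"
  shows "tsum s_V_WO (inv\<^bsub>HH K H\<^esub> RF) (\<lambda>x y. star_ptens V s_WO (hact V x v) (DF K H F W s_WO (adj_act H W s_WO y Q) w))
    = tsum s_V_WO Fb (\<lambda>x y. tsum s_V_WO (\<Delta> x) (\<lambda>x\<^sub>1 x\<^sub>2. tsum s_V_WO Fb (\<lambda>a b. tsum s_V_WO Rb (\<lambda>r s.
        hact V (r \<bullet> (x\<^sub>2 \<bullet> b)) v \<boxtimes>\<^bsub>s_V_WO\<^esub> s_adjQ (s \<bullet> (x\<^sub>1 \<bullet> a)) (hact W y w)))))"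
proof -
  note [simp] = s_closed
  let ?Z = "V \<otimes>\<^sub>A (W \<otimes>\<^sub>A Om)" and ?RFb = "inv\<^bsub>HH K H\<^esub> RF"
  let ?h = "\<lambda>p q r. hact V p v \<boxtimes>\<^bsub>s_V_WO\<^esub> s_adjQ q (hact W r w)"
  let ?f = "\<lambda>p q t. tsum ?Z Rb (\<lambda>r s. tsum ?Z Fb (\<lambda>a b. ?h (p \<bullet> (r \<bullet> b)) (q \<bullet> (s \<bullet> a)) t))"
  have "tsum ?Z Fb (\<lambda>x y. tsum ?Z (\<Delta> x) (\<lambda>x\<^sub>1 x\<^sub>2. tsum ?Z Fb (\<lambda>a b. tsum ?Z Rb (\<lambda>r s.
        ?h (r \<bullet> (x\<^sub>2 \<bullet> b)) (s \<bullet> (x\<^sub>1 \<bullet> a)) y))))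
    = tsum ?Z Fb (\<lambda>x y. tsum ?Z (\<Delta> x) (\<lambda>x\<^sub>1 x\<^sub>2. ?f x\<^sub>1 x\<^sub>2 y))"
  proof (rule HH.tsum_cong)
    fix x y assume [simp]: "x \<in> carrier H" "y \<in> carrier H"
    have "tsum ?Z (\<Delta> x) (\<lambda>x\<^sub>1 x\<^sub>2. tsum ?Z Fb (\<lambda>a b. tsum ?Z Rb (\<lambda>r s.
        ?h (r \<bullet> (x\<^sub>2 \<bullet> b)) (s \<bullet> (x\<^sub>1 \<bullet> a)) y)))
      = tsum ?Z Fb (\<lambda>a b. tsum ?Z (\<Delta> x) (\<lambda>x\<^sub>1 x\<^sub>2. tsum ?Z Rb (\<lambda>r s.
        ?h (r \<bullet> (x\<^sub>2 \<bullet> b)) (s \<bullet> (x\<^sub>1 \<bullet> a)) y)))"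
      by (rule HH_swap) simp_all
    also have "\<dots> = tsum ?Z Fb (\<lambda>a b. tsum ?Z (\<Delta> x) (\<lambda>x\<^sub>1 x\<^sub>2. tsum ?Z Rb (\<lambda>r s.
        ?h (x\<^sub>1 \<bullet> (r \<bullet> b)) (x\<^sub>2 \<bullet> (s \<bullet> a)) y)))"
    proof (rule HH.tsum_cong)
      fix a b assume [simp]: "a \<in> carrier H" "b \<in> carrier H"
      let ?k = "\<lambda>p q. ?h (p \<bullet> b) (q \<bullet> a) y"
      have k: "kbilinear K H H ?Z ?k" by (intro s_klin) simp_all
      have "tsum ?Z (\<Delta> x) (\<lambda>x\<^sub>1 x\<^sub>2. tsum ?Z Rb (\<lambda>r s. ?h (r \<bullet> (x\<^sub>2 \<bullet> b)) (s \<bullet> (x\<^sub>1 \<bullet> a)) y))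
        = tsum ?Z Rb (\<lambda>r s. tsum ?Z (\<Delta> x) (\<lambda>x\<^sub>1 x\<^sub>2. ?k (r \<bullet> x\<^sub>2) (s \<bullet> x\<^sub>1)))"
        by (subst HH_swap) (simp_all add: HH.A.m_assoc cong: HH.tsum_cong)
      also have "\<dots> = tsum ?Z (\<Delta> x) (\<lambda>x\<^sub>1 x\<^sub>2. tsum ?Z Rb (\<lambda>r s. ?k (x\<^sub>1 \<bullet> r) (x\<^sub>2 \<bullet> s)))"
        by (rule tsum_R_comult(2)[OF _ k]) simp_all
      finally show "tsum ?Z (\<Delta> x) (\<lambda>x\<^sub>1 x\<^sub>2. tsum ?Z Rb (\<lambda>r s. ?h (r \<bullet> (x\<^sub>2 \<bullet> b)) (s \<bullet> (x\<^sub>1 \<bullet> a)) y))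
        = tsum ?Z (\<Delta> x) (\<lambda>x\<^sub>1 x\<^sub>2. tsum ?Z Rb (\<lambda>r s. ?h (x\<^sub>1 \<bullet> (r \<bullet> b)) (x\<^sub>2 \<bullet> (s \<bullet> a)) y))"
        by (simp add: HH.A.m_assoc cong: HH.tsum_cong)
    qed simp
    also have "\<dots> = tsum ?Z (\<Delta> x) (\<lambda>x\<^sub>1 x\<^sub>2. tsum ?Z Fb (\<lambda>a b. tsum ?Z Rb (\<lambda>r s.
        ?h (x\<^sub>1 \<bullet> (r \<bullet> b)) (x\<^sub>2 \<bullet> (s \<bullet> a)) y)))"
      by (rule HH_swap) simp_all
    also have "\<dots> = tsum ?Z (\<Delta> x) (\<lambda>x\<^sub>1 x\<^sub>2. ?f x\<^sub>1 x\<^sub>2 y)"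
      by (rule HH.tsum_cong, simp, rule HH_swap) simp_all
    finally show "tsum ?Z (\<Delta> x) (\<lambda>x\<^sub>1 x\<^sub>2. tsum ?Z Fb (\<lambda>a b. tsum ?Z Rb (\<lambda>r s.
        ?h (r \<bullet> (x\<^sub>2 \<bullet> b)) (s \<bullet> (x\<^sub>1 \<bullet> a)) y))) = tsum ?Z (\<Delta> x) (\<lambda>x\<^sub>1 x\<^sub>2. ?f x\<^sub>1 x\<^sub>2 y)" .
  qed simp
  also have "\<dots> = tsum ?Z Fb (\<lambda>x y. tsum ?Z (\<Delta> y) (\<lambda>y\<^sub>1 y\<^sub>2. tsum ?Z Fb (\<lambda>u v. tsum ?Z F (\<lambda>p q.
        ?f (x \<bullet> p) (y\<^sub>1 \<bullet> (u \<bullet> q)) (y\<^sub>2 \<bullet> v)))))"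
    by (rule tsum_cocycle_mixed(3)[where f = ?f]) (simp, intro s_klin, simp_all)
  also have "\<dots> = tsum ?Z Fb (\<lambda>x y. tsum ?Z (\<Delta> y) (\<lambda>y\<^sub>1 y\<^sub>2. tsum ?Z Fb (\<lambda>u v. tsum ?Z ?RFb (\<lambda>p q.
        ?h (x \<bullet> p) (y\<^sub>1 \<bullet> (u \<bullet> q)) (y\<^sub>2 \<bullet> v)))))"
  proof (rule HH.tsum_cong, simp, rule HH.tsum_cong, simp, rule HH.tsum_cong, simp)
    fix x y y\<^sub>1 y\<^sub>2 u v
    assume [simp]: "x \<in> carrier H" "y \<in> carrier H" "y\<^sub>1 \<in> carrier H" "y\<^sub>2 \<in> carrier H" "u \<in> carrier H" "v \<in> carrier H"
    let ?k = "\<lambda>p q. ?h (x \<bullet> p) (y\<^sub>1 \<bullet> (u \<bullet> q)) (y\<^sub>2 \<bullet> v)"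
    have k: "kbilinear K H H ?Z ?k" by (intro s_klin) simp_all
    have "tsum ?Z F (\<lambda>p q. ?f (x \<bullet> p) (y\<^sub>1 \<bullet> (u \<bullet> q)) (y\<^sub>2 \<bullet> v))
      = tsum ?Z F (\<lambda>p q. tsum ?Z Rb (\<lambda>r s. tsum ?Z Fb (\<lambda>a b. ?k (p \<bullet> (r \<bullet> b)) (q \<bullet> (s \<bullet> a)))))"
      by (simp add: HH.A.m_assoc cong: HH.tsum_cong)
    \<comment> \<open>The sums over F, R^-1 and F^-1 act in the pattern F R^-1 F_21^-1.\<close>
    also have "\<dots> = tsum ?Z ?RFb ?k"
      by (rule tsum_twist_R(2)[OF _ k, symmetric]) simp
    finally show "tsum ?Z F (\<lambda>p q. ?f (x \<bullet> p) (y\<^sub>1 \<bullet> (u \<bullet> q)) (y\<^sub>2 \<bullet> v)) = tsum ?Z ?RFb ?k" .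
  qed
  also have "\<dots> = tsum ?Z Fb (\<lambda>x y. tsum ?Z (\<Delta> y) (\<lambda>y\<^sub>1 y\<^sub>2. tsum ?Z ?RFb (\<lambda>p q. tsum ?Z Fb (\<lambda>u v.
        ?h (x \<bullet> p) (y\<^sub>1 \<bullet> (u \<bullet> q)) (y\<^sub>2 \<bullet> v)))))"
    by (rule HH.tsum_cong, simp, rule HH.tsum_cong, simp, rule HH_swap) simp_all
  also have "\<dots> = tsum ?Z Fb (\<lambda>x y. tsum ?Z ?RFb (\<lambda>p q. tsum ?Z (\<Delta> y) (\<lambda>y\<^sub>1 y\<^sub>2. tsum ?Z Fb (\<lambda>u v.
        ?h (x \<bullet> p) (y\<^sub>1 \<bullet> (u \<bullet> q)) (y\<^sub>2 \<bullet> v)))))"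
    by (rule HH.tsum_cong, simp, rule HH_swap) simp_all
  also have "\<dots> = tsum ?Z ?RFb (\<lambda>p q. tsum ?Z Fb (\<lambda>x y. tsum ?Z (\<Delta> y) (\<lambda>y\<^sub>1 y\<^sub>2. tsum ?Z Fb (\<lambda>u v.
        ?h (x \<bullet> p) (y\<^sub>1 \<bullet> (u \<bullet> q)) (y\<^sub>2 \<bullet> v)))))"
    by (rule HH_swap) simp_all
  also have "\<dots> = tsum ?Z ?RFb (\<lambda>p q. tsum ?Z Fb (\<lambda>x y. tsum ?Z Fb (\<lambda>u v. tsum ?Z (\<Delta> y) (\<lambda>y\<^sub>1 y\<^sub>2.
        ?h (x \<bullet> p) (y\<^sub>1 \<bullet> (u \<bullet> q)) (y\<^sub>2 \<bullet> v)))))"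
    by (rule HH.tsum_cong, simp, rule HH.tsum_cong, simp, rule HH_swap) simp_all
  also have "\<dots> = tsum ?Z ?RFb (\<lambda>p q. star_ptens V s_WO (hact V p v) (DF K H F W s_WO (adj_act H W s_WO q Q) w))"
    by (simp add: star_ptens_def DF_eq adj_adj[OF Q_conn, symmetric] adj_hact[OF Q_conn] tsum_out bim_hact_mult
        cong: HH.tsum_cong)
  finally show ?thesis by (rule sym)
qed

text \<open>The formula of \<open>con_sum_adj\<close> is linear in \<xi> and in the elements acting
  on \<open>v\<close> and \<open>w\<close>. The inverted cocycle identity can thus regroup the two
  copies of F^-1, after which the summands separate.\<close>

lemma DF_con_sum_star_ptens:
  assumes [simp]: "v \<in> carrier V" "w \<in> carrier W"
  shows "DF K H F (V \<otimes>\<^sub>A W) s_VWO s_csum (star_ptens V W v w)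
    = s_tau (star_ptens (V \<otimes>\<^sub>A Om) W (DF K H F V (V \<otimes>\<^sub>A Om) P v) w) \<oplus>\<^bsub>s_VWO\<^esub>
      assoc V W Om (tsum s_V_WO (inv\<^bsub>HH K H\<^esub> RF)
        (\<lambda>x y. star_ptens V s_WO (hact V x v) (DF K H F W s_WO (adj_act H W s_WO y Q) w)))"
proof -
  note [simp] = s_closed adj_closed[OF csum_conn]
  let ?c1 = "\<lambda>f p q. s_tau (s_adjP f (hact V p v) \<boxtimes>\<^bsub>s_VOW\<^esub> hact W q w)"
  let ?c2 = "\<lambda>f p q. assoc V W Om (tsum s_V_WO Rb (\<lambda>r s. hact V (r \<bullet> p) v \<boxtimes>\<^bsub>s_V_WO\<^esub> s_adjQ (s \<bullet> f) (hact W q w)))"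
  let ?C = "\<lambda>f p q. ?c1 f p q \<oplus>\<^bsub>s_VWO\<^esub> ?c2 f p q"
  have "DF K H F (V \<otimes>\<^sub>A W) s_VWO s_csum (star_ptens V W v w)
    = tsum s_VWO Fb (\<lambda>x y. tsum s_VWO Fb (\<lambda>a b. tsum s_VWO (\<Delta> y) (\<lambda>y\<^sub>1 y\<^sub>2. ?C x (y\<^sub>1 \<bullet> a) (y\<^sub>2 \<bullet> b))))"
    by (simp add: DF_eq star_ptens_def tsum_out btensor_act bim_hact_mult con_sum_adj[OF V W Om qW qOm qOm' d d_hact P Q]
        klinear_tsum_out[OF adj_klin(2)[OF csum_conn klinear_ident]] cong: HH.tsum_cong)
  also have "\<dots> = tsum s_VWO Fb (\<lambda>x y. tsum s_VWO (\<Delta> y) (\<lambda>y\<^sub>1 y\<^sub>2. tsum s_VWO Fb (\<lambda>a b. ?C x (y\<^sub>1 \<bullet> a) (y\<^sub>2 \<bullet> b))))"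
    by (rule HH.tsum_cong, simp, rule HH_swap) simp_all
  also have "\<dots> = tsum s_VWO Fb (\<lambda>x y. tsum s_VWO (\<Delta> x) (\<lambda>x\<^sub>1 x\<^sub>2. tsum s_VWO Fb (\<lambda>a b. ?C (x\<^sub>1 \<bullet> a) (x\<^sub>2 \<bullet> b) y)))"
    by (rule tsum_cocycle_inv[where f = ?C, symmetric]) (simp, intro s_klin, simp_all)
  also have "\<dots> = tsum s_VWO Fb (\<lambda>x y. tsum s_VWO (\<Delta> x) (\<lambda>x\<^sub>1 x\<^sub>2. tsum s_VWO Fb (\<lambda>a b. ?c1 (x\<^sub>1 \<bullet> a) (x\<^sub>2 \<bullet> b) y)))
      \<oplus>\<^bsub>s_VWO\<^esub> tsum s_VWO Fb (\<lambda>x y. tsum s_VWO (\<Delta> x) (\<lambda>x\<^sub>1 x\<^sub>2. tsum s_VWO Fb (\<lambda>a b. ?c2 (x\<^sub>1 \<bullet> a) (x\<^sub>2 \<bullet> b) y)))"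
    by (simp add: tsum_add_HH cong: HH.tsum_cong)
  finally show ?thesis
    by (simp add: star_ptens_DF_left star_ptens_DF_right tau_tsum_out[OF V Om W qW qOm'] assoc_tsum_out[OF V W Om]
        cong: HH.tsum_cong)
qed

end

end

section \<open>One-forms as a quasi-commutative bimodule\<close>

section \<open>One-forms of a covariant calculus\<close>

lemma one_forms_simps:
  "carrier (one_forms E) = gr E 1" "\<zero>\<^bsub>one_forms E\<^esub> = \<zero>\<^bsub>E\<^esub>" "x \<oplus>\<^bsub>one_forms E\<^esub> y = x \<oplus>\<^bsub>E\<^esub> y"
  "k \<odot>\<^bsub>one_forms E\<^esub> x = k \<odot>\<^bsub>E\<^esub> x" "hact (one_forms E) = hact E"
  "lact (one_forms E) a x = a \<otimes>\<^bsub>E\<^esub> x" "ract (one_forms E) x a = x \<otimes>\<^bsub>E\<^esub> a"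
  by (simp_all add: one_forms_def)

locale covariant_calculus = quasitriangular_module_algebra K H A R
  for K :: "('k, 'r) ring_scheme" and H :: "('k, 'h) hopf" and A :: "('k, 'e, 'h) hmod" and R +
  fixes E :: "('k, 'e, 'h) calc"
  assumes calculus: "differential_calculus K A E" and covariant: "H_covariant K H A E"
    and graded_commutative: "graded_quasi_commutative K H R E"
begin

abbreviation "Om \<equiv> one_forms E"

lemma E_algebra: "assoc_algebra K E" and E_H_module: "left_H_module K H E"
  using covariant by (simp_all add: H_covariant_def H_module_algebra_def)

sublocale E: module K E
  using E_algebra by (simp add: assoc_algebra_def)

sublocale E: ring E
  using E_algebra by (simp add: assoc_algebra_def)

lemma gr_submodule: "submodule (gr E n) K E"
  using calculus by (simp add: differential_calculus_def graded_algebra_def)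

lemma gr_closed:
  "x \<in> gr E n \<Longrightarrow> x \<in> carrier E"
  "\<zero>\<^bsub>E\<^esub> \<in> gr E n"
  "x \<in> gr E n \<Longrightarrow> y \<in> gr E n \<Longrightarrow> x \<oplus>\<^bsub>E\<^esub> y \<in> gr E n"
  "x \<in> gr E n \<Longrightarrow> \<ominus>\<^bsub>E\<^esub> x \<in> gr E n"
  "k \<in> carrier K \<Longrightarrow> x \<in> gr E n \<Longrightarrow> k \<odot>\<^bsub>E\<^esub> x \<in> gr E n"
  "\<xi> \<in> carrier H \<Longrightarrow> x \<in> gr E n \<Longrightarrow> hact E \<xi> x \<in> gr E n"
proof -
  interpret submodule "gr E n" K E by (rule gr_submodule)
  show "x \<in> gr E n \<Longrightarrow> x \<in> carrier E" "\<zero>\<^bsub>E\<^esub> \<in> gr E n" "x \<in> gr E n \<Longrightarrow> y \<in> gr E n \<Longrightarrow> x \<oplus>\<^bsub>E\<^esub> y \<in> gr E n"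
    "k \<in> carrier K \<Longrightarrow> x \<in> gr E n \<Longrightarrow> k \<odot>\<^bsub>E\<^esub> x \<in> gr E n"
    using subset one_closed m_closed smult_closed by auto
  show "x \<in> gr E n \<Longrightarrow> \<ominus>\<^bsub>E\<^esub> x \<in> gr E n"
    using m_inv_closed by (simp add: a_inv_def)
  show "\<xi> \<in> carrier H \<Longrightarrow> x \<in> gr E n \<Longrightarrow> hact E \<xi> x \<in> gr E n"
    using covariant by (simp add: H_covariant_def)
qed

lemma gr_mult: "x \<in> gr E m \<Longrightarrow> y \<in> gr E n \<Longrightarrow> x \<otimes>\<^bsub>E\<^esub> y \<in> gr E (m + n)"
  using calculus by (simp add: differential_calculus_def graded_algebra_def)

lemma degree_zero:
  "carrier A = gr E 0" "\<one>\<^bsub>A\<^esub> = \<one>\<^bsub>E\<^esub>"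
  "a \<in> carrier A \<Longrightarrow> b \<in> carrier A \<Longrightarrow> a \<otimes>\<^bsub>A\<^esub> b = a \<otimes>\<^bsub>E\<^esub> b"
  "a \<in> carrier A \<Longrightarrow> b \<in> carrier A \<Longrightarrow> a \<oplus>\<^bsub>A\<^esub> b = a \<oplus>\<^bsub>E\<^esub> b"
  "k \<in> carrier K \<Longrightarrow> a \<in> carrier A \<Longrightarrow> k \<odot>\<^bsub>A\<^esub> a = k \<odot>\<^bsub>E\<^esub> a"
  "\<xi> \<in> carrier H \<Longrightarrow> a \<in> carrier A \<Longrightarrow> hact A \<xi> a = hact E \<xi> a"
proof -
  have "is_degree_zero K A E"
    using calculus by (simp add: differential_calculus_def)
  then show "carrier A = gr E 0" "\<one>\<^bsub>A\<^esub> = \<one>\<^bsub>E\<^esub>"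
    "a \<in> carrier A \<Longrightarrow> b \<in> carrier A \<Longrightarrow> a \<otimes>\<^bsub>A\<^esub> b = a \<otimes>\<^bsub>E\<^esub> b"
    "a \<in> carrier A \<Longrightarrow> b \<in> carrier A \<Longrightarrow> a \<oplus>\<^bsub>A\<^esub> b = a \<oplus>\<^bsub>E\<^esub> b"
    "k \<in> carrier K \<Longrightarrow> a \<in> carrier A \<Longrightarrow> k \<odot>\<^bsub>A\<^esub> a = k \<odot>\<^bsub>E\<^esub> a"
    by (simp_all add: is_degree_zero_def)
  show "\<xi> \<in> carrier H \<Longrightarrow> a \<in> carrier A \<Longrightarrow> hact A \<xi> a = hact E \<xi> a"
    using covariant by (simp add: H_covariant_def)
qed

lemma A_in_E: "a \<in> carrier A \<Longrightarrow> a \<in> carrier E"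
  using degree_zero(1) gr_closed(1) by blast

lemma A_hact_E: "\<xi> \<in> carrier H \<Longrightarrow> a \<in> carrier A \<Longrightarrow> hact E \<xi> a \<in> carrier A"
  using degree_zero(1) gr_closed(6) by simp

lemma Om_in_E: "\<theta> \<in> carrier Om \<Longrightarrow> \<theta> \<in> carrier E"
  by (rule gr_closed(1)[where n = 1]) (simp add: one_forms_simps)

lemma Om_closed:
  "a \<in> carrier A \<Longrightarrow> \<theta> \<in> carrier Om \<Longrightarrow> a \<otimes>\<^bsub>E\<^esub> \<theta> \<in> carrier Om"
  "a \<in> carrier A \<Longrightarrow> \<theta> \<in> carrier Om \<Longrightarrow> \<theta> \<otimes>\<^bsub>E\<^esub> a \<in> carrier Om"
  "\<xi> \<in> carrier H \<Longrightarrow> \<theta> \<in> carrier Om \<Longrightarrow> hact E \<xi> \<theta> \<in> carrier Om"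
  "k \<in> carrier K \<Longrightarrow> \<theta> \<in> carrier Om \<Longrightarrow> k \<odot>\<^bsub>E\<^esub> \<theta> \<in> carrier Om"
  "\<theta> \<in> carrier Om \<Longrightarrow> \<theta>' \<in> carrier Om \<Longrightarrow> \<theta> \<oplus>\<^bsub>E\<^esub> \<theta>' \<in> carrier Om"
  using gr_mult[of _ 0 _ 1] gr_mult[of _ 1 _ 0] gr_closed[where n = 1] by (simp_all add: one_forms_simps degree_zero(1))

lemma Om_module: "module K Om"
proof (rule moduleI)
  show "abelian_group Om"
  proof (rule abelian_groupI)
    show "\<exists>y\<in>carrier Om. y \<oplus>\<^bsub>Om\<^esub> x = \<zero>\<^bsub>Om\<^esub>" if "x \<in> carrier Om" for x
      using that gr_closed(1,4)[of x 1] E.l_neg by (auto simp: one_forms_simps intro!: bexI[of _ "\<ominus>\<^bsub>E\<^esub> x"])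
  qed (use gr_closed[where n = 1] in \<open>auto simp: one_forms_simps E.a_ac\<close>)
qed (use gr_closed[where n = 1] in \<open>auto simp: one_forms_simps E.smult_l_distr E.smult_r_distr E.smult_assoc1 HH.KV.cring_axioms\<close>)

text \<open>The inclusion of \<Omega> in the calculus is additive, so sums may be formed in
  either.\<close>

lemma tsum_Om:
  assumes "X \<in> carrier (HH K H)" "\<And>x y. x \<in> carrier H \<Longrightarrow> y \<in> carrier H \<Longrightarrow> f x y \<in> carrier Om"
  shows "tsum Om X f = tsum E X f"
proof -
  have "additive_map Om E (\<lambda>x. x)"
    using Om_in_E by (auto simp: additive_map_def one_forms_simps)
  from HH.tsum_hom[OF module_abelian[OF Om_module] E.abelian_group_axioms this assms] show ?thesis
    by simp
qed

lemma E_mult: "kbilinear K E E E (\<lambda>x y. x \<otimes>\<^bsub>E\<^esub> y)"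
  using E_algebra by (simp add: assoc_algebra_def)

lemma E_mult_smult:
  "k \<in> carrier K \<Longrightarrow> x \<in> carrier E \<Longrightarrow> y \<in> carrier E \<Longrightarrow> k \<odot>\<^bsub>E\<^esub> x \<otimes>\<^bsub>E\<^esub> y = k \<odot>\<^bsub>E\<^esub> (x \<otimes>\<^bsub>E\<^esub> y)"
  "k \<in> carrier K \<Longrightarrow> x \<in> carrier E \<Longrightarrow> y \<in> carrier E \<Longrightarrow> x \<otimes>\<^bsub>E\<^esub> (k \<odot>\<^bsub>E\<^esub> y) = k \<odot>\<^bsub>E\<^esub> (x \<otimes>\<^bsub>E\<^esub> y)"
  using E_mult by (simp_all add: kbilinear_def klinear_def)

lemma E_hact_prod: "\<xi> \<in> carrier H \<Longrightarrow> x \<in> carrier E \<Longrightarrow> y \<in> carrier E \<Longrightarrow>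
    hact E \<xi> (x \<otimes>\<^bsub>E\<^esub> y) = tsum E (\<Delta> \<xi>) (\<lambda>p q. hact E p x \<otimes>\<^bsub>E\<^esub> hact E q y)"
  using covariant by (simp add: H_covariant_def H_module_algebra_def tsum_def)

lemma E_hact_linear:
  "\<xi> \<in> carrier H \<Longrightarrow> klinear K E E (hact E \<xi>)" "x \<in> carrier E \<Longrightarrow> klinear K H E (\<lambda>\<xi>. hact E \<xi> x)"
  using E_H_module by (simp_all add: left_H_module_def kbilinear_def)

lemma Om_H_module: "left_H_module K H Om"
  unfolding left_H_module_def kbilinear_def klinear_def
  using Om_module hact_mult[OF E_H_module] hact_one[OF E_H_module] E_hact_linear Om_in_E Om_closed
  by (simp add: one_forms_simps(2-) klinear_def)

lemma Om_bimodule: "bim Om"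
  unfolding H_module_bimodule_def kbilinear_def klinear_def tsum_def[symmetric]
  using Om_H_module Om_in_E Om_closed A_in_E A_hact_E degree_zero(2-)
  by (simp add: one_forms_simps(2-) E.l_distr E.r_distr E_mult_smult E.m_assoc E_hact_prod tsum_Om
      cong: HH.tsum_cong)

text \<open>One of the two degrees is 0, so the sign is trivial. Allowing either degree to vanish
  yields both quasi-commutativity relations for \<Omega>.\<close>

lemma E_commutative: "x \<in> gr E m \<Longrightarrow> y \<in> gr E n \<Longrightarrow> m * n = 0 \<Longrightarrow>
    x \<otimes>\<^bsub>E\<^esub> y = tsum E Rb (\<lambda>p q. hact E p y \<otimes>\<^bsub>E\<^esub> hact E q x)"
proof -
  assume x: "x \<in> gr E m" and y: "y \<in> gr E n" and mn: "m * n = 0"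
  let ?f = "\<lambda>p q. hact E p y \<otimes>\<^bsub>E\<^esub> hact E q x"
  have "x \<otimes>\<^bsub>E\<^esub> y = sign K (m * n) \<odot>\<^bsub>E\<^esub> tsum E Rb ?f"
    using graded_commutative x y by (auto simp: graded_quasi_commutative_def tsum_def)
  also have "\<dots> = tsum E Rb ?f"
    unfolding mn using gr_closed(1)[OF gr_mult[OF gr_closed(6)[OF _ y] gr_closed(6)[OF _ x]]]
    by (simp add: sign_def HH.tsum_closed[OF E.abelian_group_axioms])
  finally show ?thesis .
qed

lemma Om_commutative:
  assumes "a \<in> carrier A" "\<theta> \<in> carrier Om"
  shows "\<theta> \<otimes>\<^bsub>E\<^esub> a = tsum E Rb (\<lambda>p q. hact E p a \<otimes>\<^bsub>E\<^esub> hact E q \<theta>)"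
    "a \<otimes>\<^bsub>E\<^esub> \<theta> = tsum E Rb (\<lambda>p q. hact E p \<theta> \<otimes>\<^bsub>E\<^esub> hact E q a)"
proof -
  have "a \<in> gr E 0" "\<theta> \<in> gr E 1"
    using assms by (simp_all add: degree_zero(1) one_forms_simps(1))
  note gr = this
  show "\<theta> \<otimes>\<^bsub>E\<^esub> a = tsum E Rb (\<lambda>p q. hact E p a \<otimes>\<^bsub>E\<^esub> hact E q \<theta>)"
    by (rule E_commutative[OF gr(2,1)]) simp
  show "a \<otimes>\<^bsub>E\<^esub> \<theta> = tsum E Rb (\<lambda>p q. hact E p \<theta> \<otimes>\<^bsub>E\<^esub> hact E q a)"
    by (rule E_commutative[OF gr]) simp
qed

lemma Om_qcomm: "qcomm Om" and Om_qcomm_left: "qcomm_left Om"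
  unfolding quasi_commutative_def qcomm_left_def tsum_def[symmetric]
  by (simp_all add: one_forms_simps(2-) tsum_Om Om_closed A_hact_E degree_zero(6) Om_commutative[symmetric] cong: HH.tsum_cong)

lemma diff_klinear: "klinear K A Om (diff E)"
proof -
  have "klinear K E E (diff E)" "\<And>a. a \<in> carrier A \<Longrightarrow> diff E a \<in> carrier Om"
    using calculus degree_zero(1) by (auto simp: differential_calculus_def one_forms_simps)
  then show ?thesis
    using A_in_E degree_zero(4,5) by (simp add: klinear_def one_forms_simps(2-))
qed

lemma diff_hact: "\<xi> \<in> carrier H \<Longrightarrow> a \<in> carrier A \<Longrightarrow> hact Om \<xi> (diff E a) = diff E (hact A \<xi> a)"
  using covariant A_in_E degree_zero(6) by (simp add: H_covariant_def one_forms_simps)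

lemma Con_connection: "P \<in> Con K H A E V \<longleftrightarrow> connection V Om (diff E) P"
  by (simp add: Con_def connection_def Let_def)

end

section \<open>The twisted sum of connections carried through \<phi>\<close>

section \<open>Deformation of sums of connections\<close>

context twisted_quasitriangular_module_algebra
begin

context
  fixes P :: "('k, 'p, 'h, 'a) hbimod" and Q :: "('k, 'q, 'h, 'a) hbimod" and N :: "('k, 'n, 'h, 'a) hbimod"
    and U :: "('k, 'u, 'h, 'a) hbimod" and V :: "('k, 'v, 'h, 'a) hbimod" and W :: "('k, 'w, 'h, 'a) hbimod"
    and g h k
  assumes g: "star_map P U g" and h: "star_map Q V h" and k: "star_map N W k"
    and U [simp]: "bim U" and V [simp]: "bim V" and W [simp]: "bim W"
begin

text \<open>Membership in the group holds on any representative, as a sum of pure tensors; this and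
  the next lemma supply the closure needed to push such sums through \<open>psi\<close>.\<close>

lemma star_assoc_closed:
  assumes X: "X \<in> carrier (P \<otimes>\<^sub>\<star> (Q \<otimes>\<^sub>\<star> N))"
  shows "tassoc ((P \<otimes>\<^sub>\<star> Q) \<otimes>\<^sub>\<star> N) (P \<otimes>\<^sub>\<star> Q) X \<in> carrier ((P \<otimes>\<^sub>\<star> Q) \<otimes>\<^sub>\<star> N)"
proof -
  interpret T1: tensor_product "carrier A" "ract P" "lact (Q \<otimes>\<^sub>\<star> N)" P "Q \<otimes>\<^sub>\<star> N" "P \<otimes>\<^sub>\<star> (Q \<otimes>\<^sub>\<star> N)"
    by (rule star_tensor_product[OF g star_map_psi[OF h k V W] U bim_btensor[OF V W]])
  interpret T2: tensor_product "carrier A" "ract Q" "lact N" Q N "Q \<otimes>\<^sub>\<star> N" by (rule star_tensor_product[OF h k V W])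
  interpret PQ: tensor_product "carrier A" "ract P" "lact Q" P Q "P \<otimes>\<^sub>\<star> Q" by (rule star_tensor_product[OF g h U V])
  interpret PQN: tensor_product "carrier A" "ract (P \<otimes>\<^sub>\<star> Q)" "lact N" "P \<otimes>\<^sub>\<star> Q" N "(P \<otimes>\<^sub>\<star> Q) \<otimes>\<^sub>\<star> N"
    by (rule star_tensor_product[OF star_map_psi[OF g h U V] k bim_btensor[OF U V] W])
  show ?thesis
    unfolding tassoc_eq
    by (intro T1.tsum_closed[OF PQN.abelian_T X] T2.tsum_closed[OF PQN.abelian_T]) simp_all
qed

lemma star_tau_closed:
  assumes X: "X \<in> carrier ((P \<otimes>\<^sub>\<star> Q) \<otimes>\<^sub>\<star> N)"
  shows "tau23_inv HF RF As P N Q X \<in> carrier ((P \<otimes>\<^sub>\<star> N) \<otimes>\<^sub>\<star> Q)"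
proof -
  interpret T1: tensor_product "carrier A" "ract (P \<otimes>\<^sub>\<star> Q)" "lact N" "P \<otimes>\<^sub>\<star> Q" N "(P \<otimes>\<^sub>\<star> Q) \<otimes>\<^sub>\<star> N"
    by (rule star_tensor_product[OF star_map_psi[OF g h U V] k bim_btensor[OF U V] W])
  interpret T2: tensor_product "carrier A" "ract P" "lact Q" P Q "P \<otimes>\<^sub>\<star> Q" by (rule star_tensor_product[OF g h U V])
  interpret PN: tensor_product "carrier A" "ract P" "lact N" P N "P \<otimes>\<^sub>\<star> N" by (rule star_tensor_product[OF g k U W])
  interpret PNQ: tensor_product "carrier A" "ract (P \<otimes>\<^sub>\<star> N)" "lact Q" "P \<otimes>\<^sub>\<star> N" Q "(P \<otimes>\<^sub>\<star> N) \<otimes>\<^sub>\<star> Q"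
    by (rule star_tensor_product[OF star_map_psi[OF g k U W] h bim_btensor[OF U W] V])
  note [simp] = star_map_closed(3,4)[OF h k V W]
  show ?thesis
    unfolding tau23_inv_def Let_def tsum_def[symmetric]
    by (intro T1.tsum_closed[OF PNQ.abelian_T X] T2.tsum_closed[OF PNQ.abelian_T] HH.tsum_closed[OF PNQ.abelian_T]) simp_all
qed

end

end

locale twisted_calculus =
  twisted_quasitriangular_module_algebra K H A R F + covariant_calculus K H A R E
  for K :: "('k, 'r) ring_scheme" and H :: "('k, 'h) hopf" and A :: "('k, 'e, 'h) hmod" and R F
    and E :: "('k, 'e, 'h) calc"
begin

abbreviation "Oms \<equiv> one_forms (twist_alg K H F E)"

text \<open>Twisting the calculus and then taking one-forms gives the same actions as twisting the
  bimodule of one-forms.\<close>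

lemma star_map_one_forms: "star_map Oms Om (\<lambda>\<theta>. \<theta>)"
proof -
  have eqs: "carrier Oms = carrier Om" "\<zero>\<^bsub>Oms\<^esub> = \<zero>\<^bsub>Om\<^esub>" "ring.add Oms = ring.add Om" "hact Oms = hact Om"
    by (simp_all add: one_forms_def twist_alg_def)
  have ab: "abelian_group Oms"
    by (rule abelian_group_ring_cong[OF module_abelian[OF Om_module]]) (simp_all add: eqs)
  have act: "lact Oms a \<theta> = star_lact Om a \<theta>" "ract Oms \<theta> a = star_ract Om \<theta> a"
    if "a \<in> carrier A" "\<theta> \<in> carrier Om" for a \<theta>
  proof -
    have "lact Oms a \<theta> = tsum E Fb (\<lambda>x y. hact E x a \<otimes>\<^bsub>E\<^esub> hact E y \<theta>)"
      "ract Oms \<theta> a = tsum E Fb (\<lambda>x y. hact E x \<theta> \<otimes>\<^bsub>E\<^esub> hact E y a)"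
      by (simp_all add: one_forms_def twist_alg_def tsum_def)
    then show "lact Oms a \<theta> = star_lact Om a \<theta>" "ract Oms \<theta> a = star_ract Om \<theta> a"
      using that by (simp_all add: star_lact_def star_ract_def one_forms_simps(2-) tsum_Om Om_closed A_hact_E degree_zero(6)
          cong: HH.tsum_cong)
  qed
  show ?thesis
    unfolding star_map_def additive_map_def eqs
    by (intro conjI ballI ab) (simp_all add: act Om_bimodule)
qed

lemma carrier_stars: "carrier Oms = carrier Om" "carrier (twist_bimod K H F A V) = carrier V"
  by (simp_all add: one_forms_def twist_alg_def twist_bimod_def)

text \<open>\<open>inv_into\<close> picks some preimage under \<phi>, which exists by surjectivity.
  The deformed connection is later seen only through these two properties.\<close>

lemma DF_con_psi:
  assumes V: "bim V" and P: "connection V Om (diff E) P" and v: "v \<in> carrier V"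
  shows "DF_con K H F A E V P v \<in> carrier (twist_bimod K H F A V \<otimes>\<^sub>\<star> Oms)"
    "psi V Om (\<lambda>v. v) (\<lambda>\<theta>. \<theta>) (DF_con K H F A E V P v) = DF K H F V (V \<otimes>\<^sub>A Om) P v"
proof -
  let ?u = "DF K H F V (V \<otimes>\<^sub>A Om) P v" and ?p = "psi V Om (\<lambda>v. v) (\<lambda>\<theta>. \<theta>)"
  have "?u \<in> carrier (V \<otimes>\<^sub>A Om)"
    by (rule DF_closed[OF bim_H_module[OF V] bim_H_module[OF bim_btensor[OF V Om_bimodule]] connectionD(1)[OF P] v])
  from psi_surj[OF star_map_twist_bimod[OF V] star_map_one_forms V Om_bimodule carrier_stars(2,1) this]
  have u: "?u \<in> ?p ` carrier (twist_bimod K H F A V \<otimes>\<^sub>\<star> Oms)" .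
  have eq: "DF_con K H F A E V P v = inv_into (carrier (twist_bimod K H F A V \<otimes>\<^sub>\<star> Oms)) ?p ?u"
    by (simp add: DF_con_def Let_def phi_psi)
  show "DF_con K H F A E V P v \<in> carrier (twist_bimod K H F A V \<otimes>\<^sub>\<star> Oms)" "?p (DF_con K H F A E V P v) = ?u"
    unfolding eq by (rule inv_into_into[OF u], rule f_inv_into_f[OF u])
qed

context
  fixes V :: "('k, 'v, 'h, 'e) hbimod" and W :: "('k, 'w, 'h, 'e) hbimod" and P Q
  assumes V [simp]: "bim V" and W [simp]: "bim W" and qW: "qcomm W"
    and P: "connection V Om (diff E) P" and Q: "connection W Om (diff E) Q"
begin

abbreviation (input) "Vs \<equiv> twist_bimod K H F A V"
abbreviation (input) "Ws \<equiv> twist_bimod K H F A W"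
abbreviation (input) "DV \<equiv> DF_con K H F A E V P"
abbreviation (input) "DW \<equiv> DF_con K H F A E W Q"
abbreviation (input) "u_VW \<equiv> V \<otimes>\<^sub>A W"
abbreviation (input) "u_WO \<equiv> W \<otimes>\<^sub>A Om"
abbreviation (input) "u_VWO \<equiv> (V \<otimes>\<^sub>A W) \<otimes>\<^sub>A Om"
abbreviation (input) "u_V_WO \<equiv> V \<otimes>\<^sub>A (W \<otimes>\<^sub>A Om)"
abbreviation (input) "u_tau \<equiv> tau23_inv H R A V W Om"
abbreviation (input) "psi_VW \<equiv> psi V W (\<lambda>v. v) (\<lambda>w. w)"
abbreviation (input) "psi_VO \<equiv> psi V Om (\<lambda>v. v) (\<lambda>\<theta>. \<theta>)"
abbreviation (input) "psi_WO \<equiv> psi W Om (\<lambda>w. w) (\<lambda>\<theta>. \<theta>)"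
abbreviation (input) "psi_VWO \<equiv> psi (V \<otimes>\<^sub>A W) Om psi_VW (\<lambda>\<theta>. \<theta>)"

lemmas V_star = star_map_twist_bimod[OF V]
lemmas W_star = star_map_twist_bimod[OF W]
lemmas VW_star = star_map_psi[OF V_star W_star V W]
lemmas VO_star = star_map_psi[OF V_star star_map_one_forms V Om_bimodule]
lemmas WO_star = star_map_psi[OF W_star star_map_one_forms W Om_bimodule]
lemmas tensor_bims = bim_btensor[OF V W] bim_btensor[OF V Om_bimodule] bim_btensor[OF W Om_bimodule]
lemmas W_Q = bim_H_module[OF W] bim_H_module[OF tensor_bims(3)] connectionD(1)[OF Q]

text \<open>\<open>phi3\<close> passes through a tensor product with the twisted bimodule of
  \<open>V \<otimes>\<^sub>A W\<close>; evaluating \<phi> on the terms there removes this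
  intermediate stage.\<close>

lemma phi3_psi:
  assumes X: "X \<in> carrier ((Vs \<otimes>\<^sub>\<star> Ws) \<otimes>\<^sub>\<star> Oms)"
  shows "phi3 K H F A V W Om Oms X = psi_VWO X"
proof -
  let ?VWs = "twist_bimod K H F A u_VW"
  note m = star_map_twist_bimod[OF tensor_bims(1)]
  note T = star_tensor_product[OF VW_star star_map_one_forms tensor_bims(1) Om_bimodule]
  interpret T: tensor_product "carrier A" "ract (Vs \<otimes>\<^sub>\<star> Ws)" "lact Oms" "Vs \<otimes>\<^sub>\<star> Ws" Oms "(Vs \<otimes>\<^sub>\<star> Ws) \<otimes>\<^sub>\<star> Oms" by (rule T)
  interpret T': tensor_product "carrier A" "ract ?VWs" "lact Oms" ?VWs Oms "?VWs \<otimes>\<^sub>\<star> Oms"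
    by (rule star_tensor_product[OF m star_map_one_forms tensor_bims(1) Om_bimodule])
  note [simp] = psi_closed[OF V_star W_star V W]
  have "phi3 K H F A V W Om Oms X = psi u_VW Om (\<lambda>x. x) (\<lambda>\<theta>. \<theta>) (tsum (?VWs \<otimes>\<^sub>\<star> Oms) X (\<lambda>q \<theta>. psi_VW q \<boxtimes>\<^bsub>?VWs \<otimes>\<^sub>\<star> Oms\<^esub> \<theta>))"
    by (simp add: phi3_def Let_def phi_psi tmap_def tsum_def)
  also have "\<dots> = tsum u_VWO X (\<lambda>q \<theta>. psi u_VW Om (\<lambda>x. x) (\<lambda>\<theta>. \<theta>) (psi_VW q \<boxtimes>\<^bsub>?VWs \<otimes>\<^sub>\<star> Oms\<^esub> \<theta>))"
    by (rule psi_tsum[OF m star_map_one_forms tensor_bims(1) Om_bimodule T X]) (simp add: carrier_stars(2))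
  also have "\<dots> = psi_VWO X"
    unfolding psi_def[of u_VW Om psi_VW]
    by (rule T.tsum_cong[OF X]) (simp add: psi_ptens[OF m star_map_one_forms tensor_bims(1) Om_bimodule] carrier_stars(2))
  finally show ?thesis .
qed

text \<open>\<phi> commutes with the H-actions and sends the deformed connection to D_F(Q), so the
  twisted adjoint action becomes one on D_F(Q), and \<open>DF_adj\<close> moves it inside.\<close>

lemma psi_star_adj:
  assumes [simp]: "y \<in> carrier H" "w \<in> carrier W"
  shows "adj_act HF Ws (Ws \<otimes>\<^sub>\<star> Oms) y DW w \<in> carrier (Ws \<otimes>\<^sub>\<star> Oms)"
    "psi_WO (adj_act HF Ws (Ws \<otimes>\<^sub>\<star> Oms) y DW w) = DF K H F W u_WO (adj_act H W u_WO y Q) w"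
proof -
  let ?T = "Ws \<otimes>\<^sub>\<star> Oms"
  interpret T: tensor_product "carrier A" "ract Ws" "lact Oms" Ws Oms ?T
    by (rule star_tensor_product[OF W_star star_map_one_forms W Om_bimodule])
  have hW: "hact Ws = hact W" by (simp add: twist_bimod_def)
  note eq = adj_act_def[of HF Ws ?T y DW w, folded tsum_def, unfolded hW]
  have S [simp]: "antipode HF z \<in> carrier H" if "z \<in> carrier H" for z
    using that by (simp add: antipode_HF)
  note [simp] = DF_con_psi[OF W Q]
  note hact_T = star_map_closed(1,3)[OF WO_star star_map_one_forms tensor_bims(3) Om_bimodule]
  show "adj_act HF Ws ?T y DW w \<in> carrier ?T"
    unfolding eq by (rule HH.tsum_closed[OF T.abelian_T]) (simp_all add: hact_T)
  have "psi_WO (adj_act HF Ws ?T y DW w)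
    = tsum u_WO (comult HF y) (\<lambda>a b. psi_WO (hact ?T a (DW (hact W (antipode HF b) w))))"
    unfolding eq by (rule psi_tsum[OF W_star star_map_one_forms W Om_bimodule HH.tensor_product_axioms]) (simp_all add: hact_T)
  also have "\<dots> = adj_act HF W u_WO y (DF K H F W u_WO Q) w"
    unfolding adj_act_def tsum_def[symmetric]
    by (rule HH.tsum_cong) (simp_all add: star_map_eqs(1)[OF WO_star star_map_one_forms tensor_bims(3) Om_bimodule])
  also have "\<dots> = DF K H F W u_WO (adj_act H W u_WO y Q) w"
    by (rule DF_adj[OF W_Q]) simp_all
  finally show "psi_WO (adj_act HF Ws ?T y DW w) = DF K H F W u_WO (adj_act H W u_WO y Q) w" .
qed

text \<open>Each term of a representative of \<open>X\<close> is carried through \<phi>: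
  \<open>tau_star\<close> treats the braided summand, \<open>psi_assoc\<close> and
  \<open>psi_star_adj\<close> the other, and \<open>DF_con_sum_star_ptens\<close> reassembles
  them.\<close>

lemma psi_con_sum:
  assumes X: "X \<in> carrier (Vs \<otimes>\<^sub>\<star> Ws)"
  shows "con_sum K HF RF As Vs Ws Oms DV DW X \<in> carrier ((Vs \<otimes>\<^sub>\<star> Ws) \<otimes>\<^sub>\<star> Oms)"
    "psi_VWO (con_sum K HF RF As Vs Ws Oms DV DW X) = DF K H F u_VW u_VWO (con_sum K H R A V W Om P Q) (psi_VW X)"
proof -
  let ?T = "(Vs \<otimes>\<^sub>\<star> Ws) \<otimes>\<^sub>\<star> Oms" and ?S = "Vs \<otimes>\<^sub>\<star> (Ws \<otimes>\<^sub>\<star> Oms)" and ?RFb = "inv\<^bsub>HH K H\<^esub> RF"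
  note V_WO = star_tensor_product[OF V_star WO_star V tensor_bims(3)]
  interpret T: tensor_product "carrier A" "ract (Vs \<otimes>\<^sub>\<star> Ws)" "lact Oms" "Vs \<otimes>\<^sub>\<star> Ws" Oms ?T
    by (rule star_tensor_product[OF VW_star star_map_one_forms tensor_bims(1) Om_bimodule])
  interpret VO: tensor_product "carrier A" "ract Vs" "lact Oms" Vs Oms "Vs \<otimes>\<^sub>\<star> Oms"
    by (rule star_tensor_product[OF V_star star_map_one_forms V Om_bimodule])
  interpret VOW: tensor_product "carrier A" "ract (Vs \<otimes>\<^sub>\<star> Oms)" "lact Ws" "Vs \<otimes>\<^sub>\<star> Oms" Ws "(Vs \<otimes>\<^sub>\<star> Oms) \<otimes>\<^sub>\<star> Ws"
    by (rule star_tensor_product[OF VO_star W_star tensor_bims(2) W])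
  interpret V_WO: tensor_product "carrier A" "ract Vs" "lact (Ws \<otimes>\<^sub>\<star> Oms)" Vs "Ws \<otimes>\<^sub>\<star> Oms" ?S
    by (rule V_WO)
  interpret VW: tensor_product "carrier A" "ract Vs" "lact Ws" Vs Ws "Vs \<otimes>\<^sub>\<star> Ws"
    by (rule star_tensor_product[OF V_star W_star V W])
  note [simp] = carrier_stars DF_con_psi[OF V P] DF_con_psi[OF W Q] psi_star_adj
  have hV: "hact Vs = hact V" by (simp add: twist_bimod_def)
  let ?Y = "\<lambda>v w. tsum ?S ?RFb (\<lambda>x y. hact V x v \<boxtimes>\<^bsub>?S\<^esub> adj_act HF Ws (Ws \<otimes>\<^sub>\<star> Oms) y DW w)"
  let ?t = "\<lambda>v w. tau23_inv HF RF As Vs Ws Oms (DV v \<boxtimes>\<^bsub>(Vs \<otimes>\<^sub>\<star> Oms) \<otimes>\<^sub>\<star> Ws\<^esub> w)"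
  let ?a = "\<lambda>v w. tassoc ?T (Vs \<otimes>\<^sub>\<star> Ws) (?Y v w)"
  \<comment> \<open>By \<open>HH_twist\<close>, the inverse of R^F taken in the twisted Hopf algebra
    is the one in \<open>HH K H\<close>.\<close>
  have eq: "con_sum K HF RF As Vs Ws Oms DV DW X = tsum ?T X (\<lambda>v w. ?t v w \<oplus>\<^bsub>?T\<^esub> ?a v w)"
    by (simp add: con_sum_def Let_def tsum_def HH_twist hV)
  have Y: "?Y v w \<in> carrier ?S" if "v \<in> carrier V" "w \<in> carrier W" for v w
    using that by (intro HH.tsum_closed[OF V_WO.abelian_T]) simp_all
  have t: "?t v w \<in> carrier ?T" and a: "?a v w \<in> carrier ?T" if "v \<in> carrier V" "w \<in> carrier W" for v w
    using that Y by (simp_all add: star_tau_closed[OF V_star star_map_one_forms W_star V Om_bimodule W] star_assoc_closed[OF V_star W_star star_map_one_forms V W Om_bimodule])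
  have sum: "?t v w \<oplus>\<^bsub>?T\<^esub> ?a v w \<in> carrier ?T" if "v \<in> carrier V" "w \<in> carrier W" for v w
    using that by (intro T.T.a_closed t a)
  show "con_sum K HF RF As Vs Ws Oms DV DW X \<in> carrier ?T"
    unfolding eq by (rule VW.tsum_closed[OF T.abelian_T X]) (simp add: sum)
  note DF_sum = DF_klinear[OF bim_H_module[OF tensor_bims(1)] bim_H_module[OF bim_btensor[OF tensor_bims(1) Om_bimodule]]
      con_sum_klinear[OF V W Om_bimodule qW Om_qcomm Om_qcomm_left diff_klinear diff_hact P Q]]
  let ?D = "DF K H F u_VW u_VWO (con_sum K H R A V W Om P Q)"
  have pair: "psi_VWO (?t v w \<oplus>\<^bsub>?T\<^esub> ?a v w) = ?D (star_ptens V W v w)"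
    if [simp]: "v \<in> carrier V" "w \<in> carrier W" for v w
  proof -
    have "psi_VWO (?t v w) = u_tau (psi (V \<otimes>\<^sub>A Om) W psi_VO (\<lambda>w. w) (DV v \<boxtimes>\<^bsub>(Vs \<otimes>\<^sub>\<star> Oms) \<otimes>\<^sub>\<star> Ws\<^esub> w))"
      by (rule tau_star[OF V Om_bimodule W qW Om_qcomm_left V_star W_star star_map_one_forms]) simp
    also have "\<dots> = u_tau (star_ptens (V \<otimes>\<^sub>A Om) W (DF K H F V (V \<otimes>\<^sub>A Om) P v) w)"
      by (simp add: psi_ptens[OF VO_star W_star tensor_bims(2) W])
    finally have 1: "psi_VWO (?t v w) = u_tau (star_ptens (V \<otimes>\<^sub>A Om) W (DF K H F V (V \<otimes>\<^sub>A Om) P v) w)" .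
    have "psi_VWO (?a v w) = assoc V W Om (psi V u_WO (\<lambda>v. v) psi_WO (?Y v w))"
      by (rule psi_assoc[OF V_star W_star star_map_one_forms V W Om_bimodule Y]) simp_all
    also have "psi V u_WO (\<lambda>v. v) psi_WO (?Y v w)
      = tsum u_V_WO ?RFb (\<lambda>x y. psi V u_WO (\<lambda>v. v) psi_WO (hact V x v \<boxtimes>\<^bsub>?S\<^esub> adj_act HF Ws (Ws \<otimes>\<^sub>\<star> Oms) y DW w))"
      by (rule psi_tsum[OF V_star WO_star V tensor_bims(3) HH.tensor_product_axioms]) simp_all
    also have "\<dots> = tsum u_V_WO ?RFb (\<lambda>x y. star_ptens V u_WO (hact V x v) (DF K H F W u_WO (adj_act H W u_WO y Q) w))"
      by (rule HH.tsum_cong) (simp_all add: psi_ptens[OF V_star WO_star V tensor_bims(3)])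
    finally have 2: "psi_VWO (?a v w) = assoc V W Om (tsum u_V_WO ?RFb (\<lambda>x y. star_ptens V u_WO (hact V x v)
        (DF K H F W u_WO (adj_act H W u_WO y Q) w)))" .
    have "psi_VWO (?t v w \<oplus>\<^bsub>?T\<^esub> ?a v w) = psi_VWO (?t v w) \<oplus>\<^bsub>u_VWO\<^esub> psi_VWO (?a v w)"
      using psi_additive[OF VW_star star_map_one_forms tensor_bims(1) Om_bimodule] t a unfolding additive_map_def by simp
    then show ?thesis
      unfolding 1 2 by (simp add: DF_con_sum_star_ptens[OF V W Om_bimodule qW Om_qcomm Om_qcomm_left diff_klinear diff_hact P Q])
  qed
  have "psi_VWO (con_sum K HF RF As Vs Ws Oms DV DW X) = tsum u_VWO X (\<lambda>v w. psi_VWO (?t v w \<oplus>\<^bsub>?T\<^esub> ?a v w))"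
    unfolding eq by (rule psi_tsum[OF VW_star star_map_one_forms tensor_bims(1) Om_bimodule VW.tensor_product_axioms X]) (simp add: sum)
  also have "\<dots> = tsum u_VWO X (\<lambda>v w. ?D (star_ptens V W v w))"
    by (rule VW.tsum_cong[OF X]) (simp add: pair)
  also have "\<dots> = ?D (psi_VW X)"
    unfolding psi_def
    by (rule VW.tsum_hom[symmetric, OF module_abelian module_abelian klinear_additive[where K = K]])
      (simp_all add: DF_sum X tensor_bims Om_bimodule)
  finally show "psi_VWO (con_sum K HF RF As Vs Ws Oms DV DW X) = ?D (psi_VW X)" .
qed

end

end

theorem theorem4p5:
  fixes K :: "('k, 'r) ring_scheme"
    and H :: "('k, 'h) hopf"
    and R F :: "('h, 'h) tens"
    and A :: "('k, 'e, 'h) hmod"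
    and E :: "('k, 'e, 'h) calc"
    and V :: "('k, 'v, 'h, 'e) hbimod"
    and W :: "('k, 'w, 'h, 'e) hbimod"
    and nablaV :: "'v \<Rightarrow> ('v, 'e) tens"
    and nablaW :: "'w \<Rightarrow> ('w, 'e) tens"
  defines "HF \<equiv> twist_hopf K H F"
    and "RF \<equiv> twist_R K H F R"
    and "As \<equiv> twist_alg K H F A"
    and "Vs \<equiv> twist_bimod K H F A V"
    and "Ws \<equiv> twist_bimod K H F A W"
    and "Om \<equiv> one_forms E"
    and "Oms \<equiv> one_forms (twist_alg K H F E)"
    and "VW \<equiv> btensor H A V W"
  assumes "cring K"
    and "quasitriangular K H R"
    and "twist K H F"
    and "H_module_algebra K H A"
    and "H_module_bimodule K H A V" and "quasi_commutative K H R A V"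
    and "H_module_bimodule K H A W" and "quasi_commutative K H R A W"
    and "differential_calculus K A E" and "H_covariant K H A E"
    and "graded_quasi_commutative K H R E"
    and "nablaV \<in> Con K H A E V" and "nablaW \<in> Con K H A E W"
  shows "\<forall>X \<in> carrier (btensor HF As Vs Ws).
     (phi3 K H F A V W Om Oms \<circ>
        con_sum K HF RF As Vs Ws Oms (DF_con K H F A E V nablaV) (DF_con K H F A E W nablaW)) X
   = (DF K H F VW (btensor H A VW Om) (con_sum K H R A V W Om nablaV nablaW)
        \<circ> phi K H F A V W) X"
proof
  fix X assume X: "X \<in> carrier (btensor HF As Vs Ws)"
  interpret twisted_calculus K H A R F E
    using assms(9-21) by unfold_locales (simp_all add: quasitriangular_def)
  note P = \<open>nablaV \<in> Con K H A E V\<close>[unfolded Con_connection] and Q = \<open>nablaW \<in> Con K H A E W\<close>[unfolded Con_connection]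
  note ctx = \<open>H_module_bimodule K H A V\<close> \<open>H_module_bimodule K H A W\<close> \<open>quasi_commutative K H R A W\<close> P Q
  show "(phi3 K H F A V W Om Oms \<circ>
        con_sum K HF RF As Vs Ws Oms (DF_con K H F A E V nablaV) (DF_con K H F A E W nablaW)) X
   = (DF K H F VW (btensor H A VW Om) (con_sum K H R A V W Om nablaV nablaW) \<circ> phi K H F A V W) X"
    using psi_con_sum[OF ctx, of X] phi3_psi[OF ctx] X
    by (simp add: phi_psi HF_def RF_def As_def Vs_def Ws_def Om_def Oms_def VW_def)
qed

end
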